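(* Let $S$ be a Damek--Ricci space, let $\mathfrak b$ be the family of all half balls in $S$, let $\mathcal N^{\mathfrak b}$ be the associated uncentred Hardy--Littlewood maximal operator, and let $\Phi(t):=t\,\log(2+t)$ for $t\ge 0$. Then the following hold. (i) There exists a positive constant $C$ such that $$\big|\{x\in S:\ \mathcal N^{\mathfrak b}f(x)>\alpha\}\big|\ \le\ C\int_S \Phi\big(|f|/\alpha\big)\,d\mu$$ for every $\alpha>0$ and every measurable function $f$ on $S$ for which the right-hand side is finite. (ii) $\mathcal N^{\mathfrak b}$ is bounded on $L^p(S)$ for every $p\in(1,\infty]$. (iii) Statement (i) is optimal in the following sense: if $\Psi$ is a Young function such that $\lim_{t\to+\infty}\Psi(t)/\Phi(t)=0$, then there is no positive constant $C$ such that $$\big|\{x\in S:\ \mathcal N^{\mathfrak b}f(x)>\alpha\}\big|\ \le\ C\int_S \Psi\big(|f|/\alpha\big)\,d\mu$$ for every $\alpha>0$ and every measurable function $f$ on $S$ for which the right-hand side is finite. In particular, $\mathcal N^{\mathfrak b}$ is not of weak type $(1,1)$.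
   Context: Damek--Ricci spaces. Let $\mathfrak n\neq\{0\}$ be a finite-dimensional real Lie algebra with a scalar product $\langle\cdot,\cdot\rangle$, which is an orthogonal direct sum $\mathfrak n=\mathfrak v\oplus\mathfrak z$ with $[\mathfrak v,\mathfrak v]\subseteq\mathfrak z$ and $[\mathfrak v,\mathfrak z]=0=[\mathfrak z,\mathfrak z]$ (one of $\mathfrak v,\mathfrak z$ is allowed to be $\{0\}$). For $Z\in\mathfrak z$ define the linear map $J_Z$ on $\mathfrak v$ by $\langle J_ZX,X'\rangle=\langle Z,[X,X']\rangle$ for all $X,X'\in\mathfrak v$. Assume $\mathfrak n$ is $H$-type, i.e. $J_Z^2=-|Z|^2 I$ for all $Z\in\mathfrak z$. Put $p:=\dim\mathfrak v$, $q:=\dim\mathfrak z$, $\nu:=p/2+q$. Let $\mathfrak s:=\mathfrak n\oplus\mathbb R H$ with Lie bracket extended by $[H,X]=\tfrac12X$ for $X\in\mathfrak v$, $[H,Z]=Z$ for $Z\in\mathfrak z$, and with the inner product extending that of $\mathfrak n$ for which $H$ is a unit vector orthogonal to $\mathfrak n$; write $(X,Z,t)$ for $X+Z+tH\in\mathfrak s$, so $|(X,Z,t)|^2=|X|^2+|Z|^2+t^2$. The Damek--Ricci space $S=NA$ is the connected, simply connected Lie group with Lie algebra $\mathfrak s$. In the coordinates $(X,Z,s)\leftrightarrow\exp(X+Z)\exp((\log s)H)$, with $X\in\mathfrak v$, $Z\in\mathfrak z$, $s>0$, the group law is $(X,Z,s)(X',Z',s')=(X+\sqrt s\,X',\,Z+sZ'+\tfrac{\sqrt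 s}{2}[X,X'],\,ss')$, and the identity is $e=(0,0,1)$. $S$ carries the left-invariant Riemannian metric which agrees with the given inner product on $\mathfrak s=T_eS$; $d$ is its Riemannian distance and $\mu$ is its Riemannian measure, which is the left Haar measure $d\mu(X,Z,s)=s^{-\nu-1}\,dX\,dZ\,ds$. Write $|E|:=\mu(E)$, and $L^p(S)=L^p(S,\mu)$. Half balls. For a unit vector $v\in\mathfrak s$ let $\gamma_v$ be the unit speed geodesic in $S$ with $\gamma_v(0)=e$ and $\dot\gamma_v(0)=v$. Put $T(e):=\{\gamma_v(\tau):\ v=(X,Z,t)\in\mathfrak s,\ |v|=1,\ t<0,\ \tau>0\}$. For $R>0$ let $B_R(e)$ be the open ball with centre $e$ and radius $R$ for $d$, let $b_R(e):=B_R(e)\cap T(e)$, and for $x\in S$ let $b_R(x):=x\cdot b_R(e)$ (left translate). The sets $b_R(x)$ are called half balls; $\mathfrak b:=\{b_R(x):x\in S,\ R>0\}$. Maximal operator. For a family $\mathfrak F$ of measurable subsets of $S$ of positive finite measure, $\mathcal N^{\mathfrak F}f(x):=\sup\big\{\tfrac1{|F|}\int_F|f|\,d\mu:\ F\in\mathfrak F,\ x\in F\big\}$. A Young function is a convex, nondecreasing function $\Psi:[0,\infty)\to[0,\infty)$ with $\Psi(0)=0$, not identically zero. *)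

theory Defs
  imports "HOL-Analysis.Analysis" "HOL-Probability.Essential_Supremum"
begin

section \<open>Riemannian metrics on an open subset of a Euclidean space\<close>

text \<open>A metric \<open>g\<close> assigns to a point \<open>x\<close> a bilinear form \<open>g x\<close>; tangent spaces of an open
  subset \<open>S\<close> of \<open>'a\<close> are identified with \<open>'a\<close>.\<close>

text \<open>The length takes values in \<open>ennreal\<close>: a \<open>valid_path\<close> has a continuous derivative off a finite
  set, but this derivative need not be integrable, and then the length is \<open>\<infinity>\<close>.\<close>

definition riem_length ::
  "('a::euclidean_space \<Rightarrow> 'a \<Rightarrow> 'a \<Rightarrow> real) \<Rightarrow> (real \<Rightarrow> 'a) \<Rightarrow> ennreal" where
  "riem_length g \<gamma> =
     (\<integral>\<^sup>+\<tau>\<in>{0..1}. ennreal (sqrt (g (\<gamma> \<tau>) (vector_derivative \<gamma> (at \<tau>)) (vector_derivative \<gamma> (at \<tau>))))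
        \<partial>lborel)"

definition riem_dist ::
  "'a::euclidean_space set \<Rightarrow> ('a \<Rightarrow> 'a \<Rightarrow> 'a \<Rightarrow> real) \<Rightarrow> 'a \<Rightarrow> 'a \<Rightarrow> ennreal" where
  "riem_dist S g x y =
     (INF \<gamma>\<in>{\<gamma>. valid_path \<gamma> \<and> path_image \<gamma> \<subseteq> S \<and> pathstart \<gamma> = x \<and> pathfinish \<gamma> = y}. riem_length g \<gamma>)"

text \<open>The Levi-Civita connection: \<open>christoffel g x u v\<close> is \<open>\<nabla>\<^sub>U V\<close> at \<open>x\<close> for the constant vector
  fields \<open>U = u\<close> and \<open>V = v\<close>, given by the Koszul formula (constant fields commute).\<close>

definition christoffel ::
  "('a::euclidean_space \<Rightarrow> 'a \<Rightarrow> 'a \<Rightarrow> real) \<Rightarrow> 'a \<Rightarrow> 'a \<Rightarrow> 'a \<Rightarrow> 'a" where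
  "christoffel g x u v =
     (THE c. \<forall>w. 2 * g x c w =
        frechet_derivative (\<lambda>y. g y v w) (at x) u
      + frechet_derivative (\<lambda>y. g y u w) (at x) v
      - frechet_derivative (\<lambda>y. g y u v) (at x) w)"

definition geodesic_from ::
  "'a::euclidean_space set \<Rightarrow> ('a \<Rightarrow> 'a \<Rightarrow> 'a \<Rightarrow> real) \<Rightarrow> 'a \<Rightarrow> 'a \<Rightarrow> (real \<Rightarrow> 'a) \<Rightarrow> bool" where
  "geodesic_from S g x v \<gamma> \<longleftrightarrow>
     \<gamma> 0 = x \<and>
     (\<exists>\<gamma>'. \<gamma>' 0 = v \<and>
        (\<forall>\<tau>. \<gamma> \<tau> \<in> S \<and>
             (\<gamma> has_vector_derivative \<gamma>' \<tau>) (at \<tau>) \<and>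
             (\<gamma>' has_vector_derivative - christoffel g (\<gamma> \<tau>) (\<gamma>' \<tau>) (\<gamma>' \<tau>)) (at \<tau>)))"


section \<open>Damek--Ricci spaces\<close>

text \<open>The Lie algebra \<open>\<nn>\<close> is the type \<open>'n\<close>, with the inner product of its type class. It is not \<open>{0}\<close>
  because Euclidean spaces have positive dimension; \<open>V\<close> or \<open>Z\<close> may be \<open>{0}\<close>.\<close>

locale two_step_algebra =
  fixes V Z :: "'n::euclidean_space set" and br :: "'n \<Rightarrow> 'n \<Rightarrow> 'n"
  assumes br_bilinear: "bilinear br"
    and br_alternating: "br x x = 0"
    and br_jacobi: "br x (br y z) + br y (br z x) + br z (br x y) = 0"
    and subspace_V: "subspace V"
    and subspace_Z: "subspace Z"
    and V_orthogonal_Z: "x \<in> V \<Longrightarrow> z \<in> Z \<Longrightarrow> inner x z = 0"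
    and V_plus_Z: "\<exists>x\<in>V. \<exists>z\<in>Z. w = x + z"
    and br_V_V: "x \<in> V \<Longrightarrow> x' \<in> V \<Longrightarrow> br x x' \<in> Z"
    and br_V_Z: "x \<in> V \<Longrightarrow> z \<in> Z \<Longrightarrow> br x z = 0"
    and br_Z_Z: "z \<in> Z \<Longrightarrow> z' \<in> Z \<Longrightarrow> br z z' = 0"
begin

definition J :: "'n \<Rightarrow> 'n \<Rightarrow> 'n" where
  "J z x = (THE y. y \<in> V \<and> (\<forall>x'\<in>V. inner y x' = inner z (br x x')))"

end

locale damek_ricci = two_step_algebra V Z br
  for V Z :: "'n::euclidean_space set" and br :: "'n \<Rightarrow> 'n \<Rightarrow> 'n" +
  assumes H_type: "z \<in> Z \<Longrightarrow> x \<in> V \<Longrightarrow> J z (J z x) = - (norm z)\<^sup>2 *\<^sub>R x"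
begin

definition nu :: real where
  "nu = real (dim V) / 2 + real (dim Z)"

definition V_part :: "'n \<Rightarrow> 'n" where
  "V_part w = (THE x. x \<in> V \<and> w - x \<in> Z)"

definition Z_part :: "'n \<Rightarrow> 'n" where
  "Z_part w = w - V_part w"

text \<open>The group is given in the coordinates \<open>(X + Z, s) \<leftrightarrow> exp (X + Z) exp ((log s) H)\<close>. They identify
  the tangent space at the identity \<open>(0, 1)\<close> with \<open>'n \<times> real\<close>, the vector \<open>X + Z + t H\<close> being
  \<open>(X + Z, t)\<close>, and its inner product with the product inner product.\<close>

definition S :: "('n \<times> real) set" where
  "S = {(w, s). s > 0}"

definition e :: "'n \<times> real" where
  "e = (0, 1)"

definition mult :: "'n \<times> real \<Rightarrow> 'n \<times> real \<Rightarrow> 'n \<times> real" where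
  "mult = (\<lambda>(w, s) (w', s').
     ((V_part w + sqrt s *\<^sub>R V_part w')
       + (Z_part w + s *\<^sub>R Z_part w' + (sqrt s / 2) *\<^sub>R br (V_part w) (V_part w')),
      s * s'))"

definition left_diff :: "'n \<times> real \<Rightarrow> 'n \<times> real \<Rightarrow> 'n \<times> real" where
  "left_diff x = frechet_derivative (mult x) (at e)"

definition metric :: "'n \<times> real \<Rightarrow> 'n \<times> real \<Rightarrow> 'n \<times> real \<Rightarrow> real" where
  "metric x u v = inner (inv (left_diff x) u) (inv (left_diff x) v)"

definition mu :: "('n \<times> real) measure" where
  "mu = density (lebesgue_on S) (\<lambda>(w, s). ennreal (s powr (- nu - 1)))"

definition open_ball_e :: "real \<Rightarrow> ('n \<times> real) set" where
  "open_ball_e R = {y \<in> S. riem_dist S metric e y < ennreal R}"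

definition T_e :: "('n \<times> real) set" where
  "T_e = {\<gamma> \<tau> | \<gamma> v \<tau>. geodesic_from S metric e v \<gamma> \<and> norm v = 1 \<and> snd v < 0 \<and> \<tau> > 0}"

definition half_ball :: "'n \<times> real \<Rightarrow> real \<Rightarrow> ('n \<times> real) set" where
  "half_ball x R = mult x ` (open_ball_e R \<inter> T_e)"

definition half_balls :: "('n \<times> real) set set" where
  "half_balls = {half_ball x R | x R. x \<in> S \<and> R > 0}"

end


section \<open>Maximal operators, Young functions, \<open>L\<^sup>p\<close> norms\<close>

definition maximal_op :: "'a measure \<Rightarrow> 'a set set \<Rightarrow> ('a \<Rightarrow> real) \<Rightarrow> 'a \<Rightarrow> ennreal" where
  "maximal_op M \<F> f x =
     (SUP F\<in>{F\<in>\<F>. x \<in> F}. (\<integral>\<^sup>+y\<in>F. ennreal \<bar>f y\<bar> \<partial>M) / emeasure M F)"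

text \<open>Only the restriction of \<open>\<Psi>\<close> to \<open>{0..}\<close> matters.\<close>

definition young_function :: "(real \<Rightarrow> real) \<Rightarrow> bool" where
  "young_function \<Psi> \<longleftrightarrow>
     convex_on {0..} \<Psi> \<and> mono_on {0..} \<Psi> \<and> \<Psi> ` {0..} \<subseteq> {0..} \<and> \<Psi> 0 = 0 \<and> (\<exists>t\<ge>0. \<Psi> t \<noteq> 0)"

definition Phi :: "real \<Rightarrow> real" where
  "Phi t = t * ln (2 + t)"

text \<open>Powers with exponent \<open>a > 0\<close>.\<close>

definition ennreal_powr :: "ennreal \<Rightarrow> real \<Rightarrow> ennreal" where
  "ennreal_powr x a = (if x = \<infinity> then \<infinity> else ennreal (enn2real x powr a))"

definition Lp_norm :: "'a measure \<Rightarrow> ennreal \<Rightarrow> ('a \<Rightarrow> ennreal) \<Rightarrow> ennreal" where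
  "Lp_norm M p f =
     (if p = \<infinity> then esssup M f
      else ennreal_powr (\<integral>\<^sup>+x. ennreal_powr (f x) (enn2real p) \<partial>M) (1 / enn2real p))"

definition bounded_on_Lp :: "'a measure \<Rightarrow> ennreal \<Rightarrow> (('a \<Rightarrow> real) \<Rightarrow> 'a \<Rightarrow> ennreal) \<Rightarrow> bool" where
  "bounded_on_Lp M p N \<longleftrightarrow>
     (\<exists>C>0. \<forall>f\<in>borel_measurable M. Lp_norm M p (\<lambda>x. ennreal \<bar>f x\<bar>) < \<infinity> \<longrightarrow>
        N f \<in> borel_measurable M \<and>
        Lp_norm M p (N f) \<le> ennreal C * Lp_norm M p (\<lambda>x. ennreal \<bar>f x\<bar>))"

definition weak_type_1_1 :: "'a measure \<Rightarrow> (('a \<Rightarrow> real) \<Rightarrow> 'a \<Rightarrow> ennreal) \<Rightarrow> bool" where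
  "weak_type_1_1 M N \<longleftrightarrow>
     (\<exists>C>0. \<forall>\<alpha>>0. \<forall>f\<in>borel_measurable M. (\<integral>\<^sup>+x. ennreal \<bar>f x\<bar> \<partial>M) < \<infinity> \<longrightarrow>
        emeasure M {x \<in> space M. N f x > ennreal \<alpha>} \<le> ennreal (C / \<alpha>) * (\<integral>\<^sup>+x. ennreal \<bar>f x\<bar> \<partial>M))"

end

theory Submission imports Defs
begin

text \<open>Write a point as \<open>(w, s)\<close>, with \<open>w\<close> in the nilpotent factor \<open>N\<close> and height \<open>s > 0\<close>.

The geodesics from the identity can be integrated explicitly, since a central momentum, a \<open>V\<close>-valued
momentum and the energy are conserved (\<open>geodesic_unique\<close>). Along a geodesic with
initial velocity \<open>v\<close> the function \<open>cap\<close> equals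
\<open>1 + 2 t s sinh \<tau>\<close>, where \<open>t\<close> is the \<open>H\<close>-component of \<open>v\<close>. So the
points reached by descending geodesics are exactly those with \<open>cap < 1\<close> (\<open>T_e_eq\<close>). Likewise the
hyperbolic cosine \<open>c\<close> of the distance to the identity is a rational function of the height and of the two norms;
its gradient satisfies \<open>|grad c|\<^sup>2 = c\<^sup>2 - 1\<close>, which bounds the distance from below, while
the explicit geodesics bound it from above (\<open>half_ball_e_eq\<close>).

From the resulting inequalities, a half ball of radius \<open>R \<le> 2\<close> at the identity is comparable with a
box of side \<open>R\<close>, and these obey the usual Vitali covering argument: the part of the maximal operator over
small half balls is of weak type (1,1) (\<open>small_half_balls_weak_type\<close>). A half ball of radius
\<open>R \<ge> 2\<close> is contained in a bounded subset of \<open>N\<close> times the interval from \<open>exp (-R)\<close> to 1.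
Its measure is comparable with \<open>exp (\<nu>R)\<close> because of the mass at its bottom. This growth rules out
doubling, but the average over the translate centred at \<open>(w0, s0)\<close> is dominated by an average over a ball
of \<open>N\<close> of radius governed by \<open>s0\<close>, of the function whose value at \<open>w\<close> is
\<open>sup h\<^sup>\<nu> \<integral>\<^bsub>r>h\<^esub> f (w, r) r\<^sup>-\<^sup>\<nu>\<^sup>-\<^sup>1 dr\<close>
over all dyadic \<open>h\<close> below the height of the point considered (\<open>large_half_ball_base\<close>). Both
operators are of weak type (1,1): the one on \<open>N\<close> because its balls are doubling, the vertical one because rays
are nested. Composing two operators of weak type costs one logarithm, and this gives the \<open>L log L\<close>
estimate (\<open>large_half_balls_LlogL\<close>, \<open>LlogL_estimate\<close>).

The bounds on \<open>L\<^sup>p\<close> follow by truncating the function at half the level and integrating over the levels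
(\<open>strong_type\<close>); for \<open>p = \<infinity>\<close> they are immediate.

For the sharpness, put a large multiple of an indicator on a fixed set \<open>E\<close>. Large half balls of the same
radius \<open>R\<close>, centred at the points \<open>(0, 4 * 2 ^ j)\<close>, contain \<open>E\<close> for a number of \<open>j\<close> proportional to
\<open>R\<close>, and each contains a bottom layer of measure comparable with \<open>exp (\<nu>R)\<close>; these layers are disjoint.
So the superlevel set is larger than the weak type bound by a factor \<open>R\<close>, which is the logarithm of the
height of the function (\<open>superlevel_lower_bound\<close>, \<open>LlogL_sharp\<close>).\<close>

section \<open>Vitali selection and translation-invariant measures\<close>

text \<open>Greedy selection: keep an index of largest size \<open>r\<close>, discard all that meet it (they are engulfed
by the enlarged set), and repeat with the rest.\<close>

lemma finite_vitali_selection: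
  fixes F F' :: "'i \<Rightarrow> 'a set" and r :: "'i \<Rightarrow> real"
  assumes "finite I"
    and engulf: "\<And>i j. i \<in> I \<Longrightarrow> j \<in> I \<Longrightarrow> F i \<inter> F j \<noteq> {} \<Longrightarrow> r j \<le> r i \<Longrightarrow> F j \<subseteq> F' i"
  shows "\<exists>K\<subseteq>I. disjoint_family_on F K \<and> (\<Union>i\<in>I. F i) \<subseteq> (\<Union>i\<in>K. F' i)"
  using assms
proof (induction "card I" arbitrary: I rule: less_induct)
  case less
  show ?case
  proof (cases "I = {}")
    case True
    then show ?thesis by (auto simp: disjoint_family_on_def)
  next
    case False
    obtain i where i: "i \<in> I" "\<And>j. j \<in> I \<Longrightarrow> r j \<le> r i"
    proof -
      have "Max (r ` I) \<in> r ` I" using less.prems False by (intro Max_in) auto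
      then obtain i where "i \<in> I" "r i = Max (r ` I)" by auto
      with less.prems that show ?thesis by auto
    qed
    define I1 where "I1 = {j\<in>I - {i}. F i \<inter> F j = {}}"
    have "card I1 < card I"
      using i less.prems by (intro psubset_card_mono) (auto simp: I1_def)
    moreover have "finite I1" "I1 \<subseteq> I" using less.prems by (auto simp: I1_def)
    ultimately obtain K where K: "K \<subseteq> I1" "disjoint_family_on F K" "(\<Union>i\<in>I1. F i) \<subseteq> (\<Union>i\<in>K. F' i)"
      using less.hyps[of I1] less.prems by (metis subset_iff)
    have "insert i K \<subseteq> I" using K i \<open>I1 \<subseteq> I\<close> by auto
    moreover have "disjoint_family_on F (insert i K)"
      using K unfolding disjoint_family_on_def I1_def by blast
    moreover have "F j \<subseteq> (\<Union>i\<in>insert i K. F' i)" if "j \<in> I" for j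
    proof (cases "j \<in> I1")
      case True
      with K show ?thesis by blast
    next
      case False
      then have "F i \<inter> F j \<noteq> {} \<or> F j = {}" using that by (auto simp: I1_def)
      then show ?thesis using less.prems(2)[of i j] i that by auto
    qed
    ultimately show ?thesis by (intro exI[of _ "insert i K"]) blast
  qed
qed

text \<open>For finitely many sets, select a disjoint subfamily whose enlargements cover; disjointness lets
the integrals of \<open>g\<close> add up. By the Lindelof property the whole union is an increasing limit of finite
unions. The hypothesis is a covering statement for an arbitrary indexed family, so that it serves for half
balls, for balls of the nilpotent factor and for rays.\<close>

lemma vitali_weak_type:
  fixes F F' :: "'i \<Rightarrow> 'a::second_countable_topology set" and r :: "'i \<Rightarrow> real"
  assumes "\<And>i. i \<in> I \<Longrightarrow> open (F i)"
    and meas: "\<And>i. i \<in> I \<Longrightarrow> F i \<in> sets M" "\<And>i. i \<in> I \<Longrightarrow> F' i \<in> sets M"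
    and engulf: "\<And>i j. i \<in> I \<Longrightarrow> j \<in> I \<Longrightarrow> F i \<inter> F j \<noteq> {} \<Longrightarrow> r j \<le> r i \<Longrightarrow> F j \<subseteq> F' i"
    and doubling: "\<And>i. i \<in> I \<Longrightarrow> emeasure M (F' i) \<le> K * emeasure M (F i)"
    and g: "g \<in> borel_measurable M"
    and large: "\<And>i. i \<in> I \<Longrightarrow> a * emeasure M (F i) \<le> (\<integral>\<^sup>+x\<in>F i. g x \<partial>M)"
  shows "a * emeasure M (\<Union>i\<in>I. F i) \<le> K * (\<integral>\<^sup>+x. g x \<partial>M)"
proof -
  have fin: "a * emeasure M (\<Union>i\<in>L. F i) \<le> K * (\<integral>\<^sup>+x. g x \<partial>M)" if L: "finite L" "L \<subseteq> I" for L
  proof -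
    obtain Q where Q: "Q \<subseteq> L" "disjoint_family_on F Q" "(\<Union>i\<in>L. F i) \<subseteq> (\<Union>i\<in>Q. F' i)"
      using finite_vitali_selection[of L F r F'] engulf L by (metis subset_iff)
    have Qf: "finite Q" "Q \<subseteq> I" using Q L finite_subset by auto
    have "emeasure M (\<Union>i\<in>L. F i) \<le> emeasure M (\<Union>i\<in>Q. F' i)"
      using Q Qf meas by (intro emeasure_mono sets.finite_UN) auto
    also have "\<dots> \<le> (\<Sum>i\<in>Q. emeasure M (F' i))"
      using Qf meas by (intro emeasure_subadditive_finite) auto
    also have "\<dots> \<le> (\<Sum>i\<in>Q. K * emeasure M (F i))"
      using Qf doubling by (intro sum_mono) auto
    finally have "a * emeasure M (\<Union>i\<in>L. F i) \<le> a * (\<Sum>i\<in>Q. K * emeasure M (F i))"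
      by (rule mult_left_mono) simp
    also have "\<dots> = K * (\<Sum>i\<in>Q. a * emeasure M (F i))"
      by (simp add: sum_distrib_left mult_ac)
    also have "\<dots> \<le> K * (\<Sum>i\<in>Q. (\<integral>\<^sup>+x\<in>F i. g x \<partial>M))"
      using large Qf by (intro mult_left_mono sum_mono) auto
    also have "(\<Sum>i\<in>Q. (\<integral>\<^sup>+x\<in>F i. g x \<partial>M)) = (\<integral>\<^sup>+x. (\<Sum>i\<in>Q. g x * indicator (F i) x) \<partial>M)"
      using g meas Qf by (intro nn_integral_sum[symmetric]) auto
    also have "\<dots> \<le> (\<integral>\<^sup>+x. g x \<partial>M)"
    proof (rule nn_integral_mono)
      fix x
      show "(\<Sum>i\<in>Q. g x * indicator (F i) x) \<le> g x"
      proof (cases "\<exists>i\<in>Q. x \<in> F i")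
        case True
        then obtain i where i: "i \<in> Q" "x \<in> F i" by auto
        have "(\<Sum>j\<in>Q. g x * indicator (F j) x) = (\<Sum>j\<in>{i}. g x * indicator (F j) x)"
          using i Q(2) Qf by (intro sum.mono_neutral_right) (auto simp: disjoint_family_on_def indicator_def)
        then show ?thesis using i by simp
      next
        case False
        then show ?thesis by (simp add: indicator_def)
      qed
    qed
    finally show ?thesis by (simp add: mult_left_mono)
  qed
  (* Countably many sets suffice by the Lindelof property; enumerate their indices. *)
  obtain \<F> where \<F>: "\<F> \<subseteq> F ` I" "countable \<F>" "\<Union>\<F> = \<Union>(F ` I)"
    using Lindelof[of "F ` I"] assms(1) by blast
  have "\<exists>I0. countable I0 \<and> I0 \<subseteq> I \<and> \<F> = F ` I0"
    using \<F>(1,2) countable_subset_image[of \<F> F I] by simp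
  then obtain I0 where I0: "I0 \<subseteq> I" "countable I0" "\<F> = F ` I0"
    by (elim exE conjE) (rule that)
  show ?thesis
  proof (cases "I0 = {}")
    case True
    with \<F> I0 have e: "(\<Union>i\<in>I. F i) = {}" by auto
    show ?thesis unfolding e by simp
  next
    case False
    define f where "f = from_nat_into I0"
    have f: "range f = I0" unfolding f_def by (rule range_from_nat_into[OF False I0(2)])
    have inc: "incseq (\<lambda>n. \<Union>i\<in>f ` {..n}. F i)" unfolding incseq_def by fastforce
    have U: "(\<Union>n. \<Union>i\<in>f ` {..n}. F i) = (\<Union>i\<in>I. F i)"
    proof -
      have "(\<Union>n. \<Union>i\<in>f ` {..n}. F i) = (\<Union>i\<in>range f. F i)" by auto
      then show ?thesis using f \<F> I0 by simp
    qed
    have "F (f n) \<in> sets M" for n using meas f I0 by blast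
    then have "range (\<lambda>n. \<Union>i\<in>f ` {..n}. F i) \<subseteq> sets M"
      by (auto intro!: sets.finite_UN)
    then have "emeasure M (\<Union>i\<in>I. F i) = (SUP n. emeasure M (\<Union>i\<in>f ` {..n}. F i))"
      using SUP_emeasure_incseq[OF _ inc] unfolding U by simp
    then have "a * emeasure M (\<Union>i\<in>I. F i) = (SUP n. a * emeasure M (\<Union>i\<in>f ` {..n}. F i))"
      by (simp add: SUP_mult_left_ennreal)
    also have "\<dots> \<le> K * (\<integral>\<^sup>+x. g x \<partial>M)"
      using f I0 by (intro SUP_least fin) auto
    finally show ?thesis .
  qed
qed

text \<open>Uniqueness of Haar measure on a vector space: by Fubini, substitute \<open>y\<close> by \<open>y - x\<close>, then \<open>x\<close> by
\<open>x + y\<close>, then \<open>y\<close> by \<open>y - x\<close> in the integral of \<open>1\<^sub>A(x) 1\<^sub>B(y)\<close>, using the invariance of one measure at each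
step. This route to the behaviour of Lebesgue measure under linear maps avoids determinants, which are tied
to coordinates, whereas \<open>V\<close> and \<open>Z\<close> are arbitrary subspaces.\<close>

lemma translation_invariant_measure_unique:
  fixes M :: "'a::euclidean_space measure"
  assumes sets_M: "sets M = sets borel" and sf: "sigma_finite_measure M"
    and inv: "\<And>a. distr M borel (\<lambda>x. x + a) = M"
    and A[measurable]: "A \<in> sets borel" and B[measurable]: "B \<in> sets borel"
  shows "emeasure M A * emeasure lborel B = emeasure lborel A * emeasure M (uminus ` B)"
proof -
  note sets_M[measurable_cong]
  interpret M: sigma_finite_measure M by fact
  interpret P: pair_sigma_finite M lborel by unfold_locales
  have mB: "uminus ` B = uminus -` B" by (auto simp: image_iff) (metis minus_minus)
  have "emeasure M A * emeasure lborel B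
      = (\<integral>\<^sup>+x. (\<integral>\<^sup>+y. indicator A x * indicator B y \<partial>lborel) \<partial>M)"
    by (simp add: nn_integral_cmult nn_integral_multc sets_M)
  also have "\<dots> = (\<integral>\<^sup>+x. (\<integral>\<^sup>+y. indicator A x * indicator B (- x + y) \<partial>lborel) \<partial>M)"
  proof (rule nn_integral_cong)
    fix x
    show "(\<integral>\<^sup>+y. indicator A x * indicator B y \<partial>lborel) = (\<integral>\<^sup>+y. indicator A x * indicator B (- x + y) \<partial>lborel)"
      by (subst lborel_distr_plus[of "-x", symmetric], subst nn_integral_distr) auto
  qed
  also have "\<dots> = (\<integral>\<^sup>+y. (\<integral>\<^sup>+x. indicator A x * indicator B (- x + y) \<partial>M) \<partial>lborel)"
    by (rule P.Fubini'[symmetric]) measurable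
  also have "\<dots> = (\<integral>\<^sup>+y. (\<integral>\<^sup>+x. indicator A (x + y) * indicator B (- x) \<partial>M) \<partial>lborel)"
  proof (rule nn_integral_cong)
    fix y
    show "(\<integral>\<^sup>+x. indicator A x * indicator B (- x + y) \<partial>M) = (\<integral>\<^sup>+x. indicator A (x + y) * indicator B (- x) \<partial>M)"
      by (subst inv[of y, symmetric], subst nn_integral_distr) auto
  qed
  also have "\<dots> = (\<integral>\<^sup>+x. (\<integral>\<^sup>+y. indicator A (x + y) * indicator B (- x) \<partial>lborel) \<partial>M)"
    by (rule P.Fubini') measurable
  also have "\<dots> = (\<integral>\<^sup>+x. (\<integral>\<^sup>+y. indicator A y * indicator B (- x) \<partial>lborel) \<partial>M)"
  proof (rule nn_integral_cong)
    fix x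
    show "(\<integral>\<^sup>+y. indicator A (x + y) * indicator B (- x) \<partial>lborel) = (\<integral>\<^sup>+y. indicator A y * indicator B (- x) \<partial>lborel)"
      by (subst (2) lborel_distr_plus[of x, symmetric], subst nn_integral_distr) auto
  qed
  also have "\<dots> = emeasure lborel A * (\<integral>\<^sup>+x. indicator B (- x) \<partial>M)"
    by (simp add: nn_integral_cmult nn_integral_multc sets_M)
  also have "(\<integral>\<^sup>+x. indicator B (- x) \<partial>M) = emeasure M (uminus ` B)"
  proof -
    have "uminus -` B \<in> sets borel" using measurable_sets_borel[of "uminus :: 'a \<Rightarrow> 'a" borel B] by simp
    moreover have "indicator B (- x) = (indicator (uminus -` B) x :: ennreal)" for x :: 'a
      by (simp add: indicator_def)
    ultimately show ?thesis unfolding mB by (simp add: sets_M)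
  qed
  finally show ?thesis .
qed

section \<open>Lebesgue measure under linear maps\<close>

lemma emeasure_unit_ball:
  obtains l where "emeasure lborel (ball (0::'a::euclidean_space) 1) = ennreal l" "l > 0"
proof
  show "emeasure lborel (ball (0::'a) 1) = ennreal (measure lborel (ball (0::'a) 1))"
    by (rule emeasure_eq_ennreal_measure) (use emeasure_lborel_ball_finite[of "0::'a" 1] in auto)
  show "measure lborel (ball (0::'a) 1) > 0" by (simp add: content_ball_pos)
qed

lemma emeasure_lborel_open_pos:
  fixes U :: "'a::euclidean_space set"
  assumes "open U" "U \<noteq> {}"
  shows "emeasure lborel U > 0"
proof -
  obtain x e where e: "e > 0" "ball x e \<subseteq> U" using assms by (metis ex_in_conv openE)
  have "0 < emeasure lborel (ball x e)"
    using content_ball_pos[OF e(1), of x] measure_def[of lborel "ball x e"]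
    by (metis enn2real_0 less_irrefl zero_less_iff_neq_zero)
  also have "\<dots> \<le> emeasure lborel U" using e assms by (intro emeasure_mono) auto
  finally show ?thesis .
qed

lemma linear_injective_image_borel:
  fixes L :: "'a::euclidean_space \<Rightarrow> 'a"
  assumes L: "linear L" "inj L" and A: "A \<in> sets borel"
  shows "L ` A \<in> sets borel"
proof -
  obtain L' where L': "linear L'" "L' \<circ> L = id" "L \<circ> L' = id"
    using linear_injective_isomorphism[OF L] by (metis comp_def eq_id_iff)
  then have "L ` A = L' -` A" by (auto simp: image_iff fun_eq_iff) metis
  moreover have "L' \<in> borel_measurable borel"
    using L'(1) by (intro borel_measurable_continuous_onI linear_continuous_on) (simp add: linear_linear)
  ultimately show ?thesis using measurable_sets_borel[of L' borel A] A by simp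
qed

text \<open>The measure \<open>A \<mapsto> vol (L A)\<close> is translation invariant, hence a multiple of Lebesgue measure.\<close>

lemma linear_image_lborel_scale:
  fixes L :: "'a::euclidean_space \<Rightarrow> 'a"
  assumes L: "linear L" "inj L"
  shows "\<exists>c>0. \<forall>A\<in>sets borel. emeasure lborel (L ` A) = ennreal c * emeasure lborel A"
proof -
  obtain L' where L': "linear L'" "L' \<circ> L = id" "L \<circ> L' = id"
    using linear_injective_isomorphism[OF L] by (metis comp_def eq_id_iff)
  have LL: "L (L' x) = x" "L' (L x) = x" for x using L' by (auto simp: fun_eq_iff)
  have m[measurable]: "L' \<in> borel_measurable borel" "L \<in> borel_measurable borel"
    using L'(1) L(1) by (auto intro!: borel_measurable_continuous_onI linear_continuous_on simp: linear_linear)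
  define M where "M = distr lborel borel L'"
  have im: "L ` A = L' -` A" for A using LL by (auto simp: image_iff) metis
  have M: "emeasure M A = emeasure lborel (L ` A)" if "A \<in> sets borel" for A
    using that unfolding M_def im by (subst emeasure_distr) auto
  have opn: "open (L ` U)" if "open U" for U
  proof -
    have "surj L" using LL(1) by (metis surjI)
    with that L(1) show ?thesis by (intro open_surjective_linear_image)
  qed
  have fin: "emeasure M (ball 0 r) < \<infinity>" for r
  proof -
    have "bounded (L ` ball 0 r)" using L by (intro bounded_linear_image) (auto simp: linear_linear)
    then show ?thesis using emeasure_bounded_finite by (simp add: M)
  qed
  have inv: "distr M borel (\<lambda>x. x + a) = M" for a
  proof -
    have "distr M borel (\<lambda>x. x + a) = distr lborel borel (\<lambda>x. L' (L a + x))"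
      unfolding M_def using L' by (subst distr_distr) (auto simp: comp_def LL linear_add add.commute)
    also have "\<dots> = distr (distr lborel borel ((+) (L a))) borel L'"
      by (subst distr_distr) (auto simp: comp_def)
    finally show ?thesis by (simp add: M_def lborel_distr_plus)
  qed
  have sf: "sigma_finite_measure M"
  proof
    show "\<exists>A. countable A \<and> A \<subseteq> sets M \<and> \<Union> A = space M \<and> (\<forall>a\<in>A. emeasure M a \<noteq> \<infinity>)"
    proof (intro exI conjI ballI)
      show "countable (range (\<lambda>n::nat. ball (0::'a) (real n)))" by simp
      show "\<Union> (range (\<lambda>n::nat. ball (0::'a) (real n))) = space M"
        by (auto simp: M_def reals_Archimedean2)
    next
      fix a assume "a \<in> range (\<lambda>n::nat. ball (0::'a) (real n))"
      then show "emeasure M a \<noteq> \<infinity>" using fin by (metis imageE less_irrefl)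
    qed (auto simp: M_def)
  qed
  have b: "uminus ` ball (0::'a) 1 = ball 0 1"
  proof -
    have "x \<in> uminus ` ball 0 1" if "x \<in> ball 0 1" for x :: 'a
      using that by (intro image_eqI[of _ _ "-x"]) auto
    then show ?thesis by auto
  qed
  define m where "m = measure M (ball 0 1)"
  define l where "l = measure lborel (ball (0::'a) 1)"
  have m: "emeasure M (ball 0 1) = ennreal m" unfolding m_def
    by (rule emeasure_eq_ennreal_measure) (use fin[of 1] in auto)
  have l: "emeasure lborel (ball (0::'a) 1) = ennreal l" unfolding l_def
    by (rule emeasure_eq_ennreal_measure) (use emeasure_lborel_ball_finite[of "0::'a" 1] in auto)
  have "emeasure M (ball 0 1) > 0"
    using opn[of "ball 0 1"] by (simp add: M emeasure_lborel_open_pos)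
  then have m0: "m > 0" unfolding m by simp
  have l0: "l > 0" unfolding l_def by (simp add: content_ball_pos)
  have "emeasure lborel (L ` A) = ennreal (m / l) * emeasure lborel A" if A: "A \<in> sets borel" for A
  proof -
    have "emeasure M A * ennreal l = emeasure lborel A * ennreal m"
      using translation_invariant_measure_unique[OF _ sf inv A, of "ball 0 1"] m l b by (simp add: M_def)
    then have "emeasure M A * ennreal l * ennreal (1/l) = emeasure lborel A * ennreal m * ennreal (1/l)" by simp
    then have "emeasure M A = emeasure lborel A * ennreal (m / l)"
      using l0 m0 by (simp add: mult.assoc ennreal_mult[symmetric])
    then show ?thesis by (simp add: M A mult.commute)
  qed
  then show ?thesis using m0 l0 by (intro exI[of _ "m/l"]) auto
qed

text \<open>The scale factor is 1 because the unit ball is mapped to itself.\<close>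

lemma isometry_image_lborel:
  fixes L :: "'a::euclidean_space \<Rightarrow> 'a"
  assumes L: "linear L" "\<And>x. norm (L x) = norm x" and A: "A \<in> sets borel"
  shows "emeasure lborel (L ` A) = emeasure lborel A"
proof -
  have inj: "inj L" using L by (simp add: linear_inj_iff_eq_0) (metis norm_eq_zero)
  then obtain c where c: "c > 0" "\<And>A. A \<in> sets borel \<Longrightarrow> emeasure lborel (L ` A) = ennreal c * emeasure lborel A"
    using linear_image_lborel_scale[OF L(1)] by metis
  have "surj L" using L(1) inj using linear_injective_imp_surjective by blast
  then have "L ` ball 0 1 = ball 0 1"
  proof -
    have "x \<in> L ` ball 0 1" if "x \<in> ball 0 1" for x
    proof -
      obtain y where "x = L y" using \<open>surj L\<close> by (metis surjD)
      then show ?thesis using L(2) that by auto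
    qed
    then show ?thesis using L(2) by auto
  qed
  with c(2)[of "ball 0 1"] have "emeasure lborel (ball (0::'a) 1) = ennreal c * emeasure lborel (ball (0::'a) 1)" by simp
  moreover obtain l where "emeasure lborel (ball (0::'a) 1) = ennreal l" "l > 0"
    by (rule emeasure_unit_ball)
  ultimately have "c = 1" using c(1) by (simp add: ennreal_mult[symmetric])
  then show ?thesis using c(2)[OF A] by simp
qed

text \<open>The isometry \<open>R\<close> conjugates the shear \<open>1 + N\<close> to its inverse \<open>1 - N\<close>, so the scale factor \<open>c\<close>
satisfies \<open>c\<^sup>2 = 1\<close>.\<close>

lemma shear_image_lborel:
  fixes N R :: "'a::euclidean_space \<Rightarrow> 'a"
  assumes N: "linear N" "\<And>x. N (N x) = 0"
    and R: "linear R" "\<And>x. norm (R x) = norm x" "\<And>x. R (N x) = - N (R x)"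
    and A: "A \<in> sets borel"
  shows "emeasure lborel ((\<lambda>x. x + N x) ` A) = emeasure lborel A"
proof -
  let ?L = "\<lambda>x. x + N x"
  have lin: "linear ?L" using N by (intro linear_compose_add linear_ident)
  have inj: "inj ?L"
  proof (subst linear_inj_iff_eq_0[OF lin], intro allI impI)
    fix x assume e: "x + N x = 0"
    then have "N (x + N x) = 0" using N linear_0 by metis
    then have "N x = 0" using N by (simp add: linear_add)
    with e show "x = 0" by simp
  qed
  obtain c where c: "c > 0" "\<And>A. A \<in> sets borel \<Longrightarrow> emeasure lborel (?L ` A) = ennreal c * emeasure lborel A"
    using linear_image_lborel_scale[OF lin inj] by metis
  have Rinj: "inj R" using R by (simp add: linear_inj_iff_eq_0) (metis norm_eq_zero)
  (* Shearing, reflecting and shearing again is the reflection. *)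
  have eq: "R x + R (N x) + N (R x + R (N x)) = R x" for x
  proof -
    have "N (R (N x)) = - R (N (N x))" using R(3) by simp
    then show ?thesis using N R by (simp add: linear_add linear_0 linear_diff linear_neg)
  qed
  let ?B = "ball (0::'a) 1"
  have "?L ` (R ` (?L ` ?B)) = R ` ?B"
    unfolding image_image linear_add[OF R(1)] by (simp only: eq)
  moreover have "?L ` ?B \<in> sets borel" by (rule linear_injective_image_borel[OF lin inj]) simp
  moreover have "R ` (?L ` ?B) \<in> sets borel"
    by (rule linear_injective_image_borel[OF R(1) Rinj]) fact
  ultimately have "ennreal c * (ennreal c * emeasure lborel ?B) = emeasure lborel ?B"
    using c(2) isometry_image_lborel[OF R(1,2)] by (metis borel_open open_ball)
  moreover obtain l where "emeasure lborel ?B = ennreal l" "l > 0"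
    by (rule emeasure_unit_ball)
  ultimately have "c * c = 1" using c(1) by (simp add: ennreal_mult[symmetric])
  then have "c = 1" using c(1) by (simp add: square_eq_1_iff)
  then show ?thesis using c(2)[OF A] by simp
qed

text \<open>The isometry that carries the orthonormal basis \<open>B\<close> to the standard basis conjugates \<open>L\<close> to a
coordinatewise scaling.\<close>

lemma diagonal_image_lborel:
  fixes L :: "'a::euclidean_space \<Rightarrow> 'a" and B :: "'a set"
  assumes L: "linear L" and B: "pairwise orthogonal B" "\<And>b. b \<in> B \<Longrightarrow> norm b = 1" "span B = UNIV"
    and r: "\<And>b. b \<in> B \<Longrightarrow> L b = r b *\<^sub>R b" "\<And>b. b \<in> B \<Longrightarrow> r b > 0"
    and A: "A \<in> sets borel"
  shows "emeasure lborel (L ` A) = ennreal (\<Prod>b\<in>B. r b) * emeasure lborel A"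
proof -
  have indB: "independent B" using B by (intro pairwise_orthogonal_independent) force+
  then have finB: "finite B" by (rule independent_imp_finite)
  have "card B = DIM('a)" using indB B(3) by (metis dim_UNIV dim_span basis_card_eq_dim dim_eq_card_independent)
  then have "\<exists>f. bij_betw f B (Basis :: 'a set)" using finB by (intro finite_same_card_bij) auto
  then obtain f :: "'a \<Rightarrow> 'a" where f: "bij_betw f B Basis" by blast
  define U where "U x = (\<Sum>b\<in>B. (x \<bullet> b) *\<^sub>R f b)" for x
  have linU: "linear U" unfolding U_def
    by (intro linearI) (simp_all add: inner_add_left scaleR_add_left sum.distrib scaleR_sum_right)
  have bb: "b \<bullet> b' = (if b = b' then 1 else 0)" if "b \<in> B" "b' \<in> B" for b b'
    using B that by (auto simp: pairwise_def orthogonal_def norm_eq_1)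
  have ff: "f b \<bullet> f b' = (if b = b' then 1 else 0)" if "b \<in> B" "b' \<in> B" for b b'
  proof -
    have "f b \<in> Basis" "f b' \<in> Basis" "f b = f b' \<longleftrightarrow> b = b'"
      using f that by (auto simp: bij_betw_def inj_on_def)
    then show ?thesis by (simp add: inner_Basis)
  qed
  have exp: "x = (\<Sum>b\<in>B. (x \<bullet> b) *\<^sub>R b)" for x
  proof -
    have "x \<in> span B" using B by simp
    then obtain q where q: "x = (\<Sum>b\<in>B. q b *\<^sub>R b)" by (auto simp: span_finite[OF finB])
    have "x \<bullet> b = q b" if "b \<in> B" for b
      unfolding q using that finB by (simp add: inner_sum_left bb if_distrib cong: if_cong)
    then show ?thesis using q by simp
  qed
  have isoU: "norm (U x) = norm x" for x
  proof -
    have "U x \<bullet> U x = (\<Sum>b\<in>B. (x \<bullet> b) * (x \<bullet> b))"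
      unfolding U_def using finB by (simp add: inner_sum_left inner_sum_right ff if_distrib cong: if_cong)
    also have "\<dots> = x \<bullet> (\<Sum>b\<in>B. (x \<bullet> b) *\<^sub>R b)" by (simp add: inner_sum_right)
    finally show ?thesis using exp[of x] by (simp add: norm_eq)
  qed
  define c where "c j = r (the_inv_into B f j)" for j
  have cf: "c (f b) = r b" if "b \<in> B" for b
    using f that by (simp add: c_def the_inv_into_f_f bij_betw_def)
  define D where "D x = 0 + (\<Sum>j\<in>Basis. (c j * (x \<bullet> j)) *\<^sub>R j)" for x
  have cpos: "c j > 0" if "j \<in> Basis" for j
    using cf r(2) f that by (metis bij_betw_imp_surj_on imageE)
  have DU: "U (L x) = D (U x)" for x
  proof -
    have "L x = (\<Sum>b\<in>B. (x \<bullet> b) *\<^sub>R L b)"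
      by (subst exp[of x]) (simp add: linear_sum[OF L] linear_scale[OF L])
    then have 1: "U (L x) = (\<Sum>b\<in>B. (x \<bullet> b * r b) *\<^sub>R U b)"
      using r by (simp add: linear_sum[OF linU] linear_scale[OF linU])
    have 2: "U b = f b" if "b \<in> B" for b
      unfolding U_def using that finB
      by (simp add: bb if_distrib[of "\<lambda>t. t *\<^sub>R _"] cong: if_cong)
    have 3: "U x \<bullet> f b = x \<bullet> b" if "b \<in> B" for b
      unfolding U_def using that finB by (simp add: inner_sum_left ff if_distrib cong: if_cong)
    have "D (U x) = (\<Sum>b\<in>B. (c (f b) * (U x \<bullet> f b)) *\<^sub>R f b)"
      unfolding D_def using f by (simp add: sum.reindex_bij_betw[OF f, symmetric])
    also have "\<dots> = (\<Sum>b\<in>B. (x \<bullet> b * r b) *\<^sub>R U b)"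
      by (intro sum.cong refl) (simp add: cf 3 2 mult.commute)
    finally show ?thesis using 1 by simp
  qed
  have injL: "inj L"
  proof (subst linear_inj_iff_eq_0[OF L], intro allI impI)
    fix x assume "L x = 0"
    then have D0: "D (U x) = 0" using DU[of x] linU by (simp add: linear_0)
    have "c j * (U x \<bullet> j) = 0" if "j \<in> Basis" for j
    proof -
      have "D (U x) \<bullet> j = c j * (U x \<bullet> j)" unfolding D_def using that by simp
      then show ?thesis using D0 by simp
    qed
    then have "U x \<bullet> j = 0" if "j \<in> Basis" for j using cpos[OF that] that by fastforce
    then have "U x = 0" using euclidean_all_zero_iff[of "U x"] by blast
    then show "x = 0" using isoU[of x] by (metis norm_eq_zero)
  qed
  have injU: "inj U" using isoU linU by (simp add: linear_inj_iff_eq_0) (metis norm_eq_zero)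
  have measD[measurable]: "D \<in> borel_measurable borel" unfolding D_def by measurable
  have injD: "inj D"
  proof (rule injI)
    fix x y assume "D x = D y"
    moreover have "D x \<bullet> j = c j * (x \<bullet> j)" if "j \<in> Basis" for x j using that by (simp add: D_def)
    ultimately have "c j * (x \<bullet> j) = c j * (y \<bullet> j)" if "j \<in> Basis" for j using that by metis
    then have "x \<bullet> j = y \<bullet> j" if "j \<in> Basis" for j using cpos[OF that] that by fastforce
    then show "x = y" by (rule euclidean_eqI)
  qed
  have "linear D" unfolding D_def
    by (intro linearI) (simp_all add: inner_add_left algebra_simps sum.distrib scaleR_sum_right)
  have D: "emeasure lborel (D ` E) = ennreal (\<Prod>b\<in>B. r b) * emeasure lborel E" if E: "E \<in> sets borel" for E
  proof -
    have DE: "D ` E \<in> sets borel" by (rule linear_injective_image_borel[OF \<open>linear D\<close> injD E])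
    have "lborel = density (distr lborel borel D) (\<lambda>_. (\<Prod>j\<in>Basis. \<bar>c j\<bar>))"
      unfolding D_def using cpos by (intro lborel_affine_euclidean) force
    then have "emeasure lborel (D ` E) = emeasure (density (distr lborel borel D) (\<lambda>_. (\<Prod>j\<in>Basis. \<bar>c j\<bar>))) (D ` E)"
      by simp
    also have "\<dots> = ennreal (\<Prod>j\<in>Basis. \<bar>c j\<bar>) * emeasure lborel (D -` (D ` E))"
      using DE by (simp add: emeasure_density emeasure_distr nn_integral_cmult)
    also have "D -` (D ` E) = E" using injD by (rule inj_vimage_image_eq)
    also have "(\<Prod>j\<in>Basis. \<bar>c j\<bar>) = (\<Prod>b\<in>B. r b)"
      using cf r(2) by (subst prod.reindex_bij_betw[OF f, symmetric]) (auto intro!: prod.cong simp: less_imp_le)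
    finally show ?thesis .
  qed
  have "emeasure lborel (L ` A) = emeasure lborel (U ` (L ` A))"
    using linear_injective_image_borel[OF L injL A] by (intro isometry_image_lborel[symmetric] linU isoU)
  also have "U ` (L ` A) = D ` (U ` A)" by (simp add: image_image DU)
  also have "emeasure lborel \<dots> = ennreal (\<Prod>b\<in>B. r b) * emeasure lborel (U ` A)"
    by (rule D) (rule linear_injective_image_borel[OF linU injU A])
  also have "emeasure lborel (U ` A) = emeasure lborel A"
    by (rule isometry_image_lborel[OF linU isoU A])
  finally show ?thesis .
qed

section \<open>H-type algebra and the left-invariant metric\<close>

context two_step_algebra
begin

lemma br_zero [simp]: "br 0 x = 0" "br x 0 = 0"
  using br_bilinear by (simp_all add: bilinear_lzero bilinear_rzero)

lemma br_antisym: "br y x = - br x y"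
proof -
  have "br (x + y) (x + y) = (br x x + br x y) + (br y x + br y y)"
    by (simp only: bilinear_ladd[OF br_bilinear] bilinear_radd[OF br_bilinear] ac_simps)
  then show ?thesis by (simp add: br_alternating eq_neg_iff_add_eq_0 add.commute)
qed

lemma br_center: 
  assumes "z \<in> Z" shows "br w z = 0" "br z w = 0"
proof -
  obtain x z' where w: "x \<in> V" "z' \<in> Z" "w = x + z'" using V_plus_Z by blast
  show "br w z = 0" using w assms br_V_Z br_Z_Z by (simp add: bilinear_ladd[OF br_bilinear])
  then show "br z w = 0" using br_antisym[of z w] by simp
qed

text \<open>The definition by description denotes an existing map; this makes it linear in both arguments.\<close>

lemma J_eq_adjoint: "J z x = adjoint (br x) z"
proof -
  have lin: "linear (br x)" using br_bilinear by (simp add: bilinear_def)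
  have ip: "adjoint (br x) z \<bullet> w = z \<bullet> br x w" for w
    using adjoint_works[OF lin, of w z] by (simp add: inner_commute)
  obtain v c where vc: "v \<in> V" "c \<in> Z" "adjoint (br x) z = v + c" using V_plus_Z by blast
  have "(v + c) \<bullet> c = 0" using ip[of c] br_center[OF vc(2)] vc by simp
  then have "c \<bullet> c = 0" using V_orthogonal_Z[OF vc(1,2)] by (simp add: inner_add_left)
  then have inV: "adjoint (br x) z \<in> V" using vc by simp
  show ?thesis unfolding J_def
  proof (rule the_equality)
    show "adjoint (br x) z \<in> V \<and> (\<forall>x'\<in>V. adjoint (br x) z \<bullet> x' = z \<bullet> br x x')" using inV ip by simp
    fix y assume y: "y \<in> V \<and> (\<forall>x'\<in>V. y \<bullet> x' = z \<bullet> br x x')"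
    let ?d = "y - adjoint (br x) z"
    have "?d \<in> V" using y inV subspace_V by (simp add: subspace_diff)
    then have "?d \<bullet> ?d = 0" using y ip by (simp add: inner_diff_left)
    then show "y = adjoint (br x) z" by simp
  qed
qed

lemma inner_J: "J z x \<bullet> w = z \<bullet> br x w"
proof -
  have lin: "linear (br x)" using br_bilinear by (simp add: bilinear_def)
  show ?thesis
    using adjoint_works[OF lin, of w z] by (simp add: inner_commute J_eq_adjoint)
qed

lemma J_add_left: "J (z + z') x = J z x + J z' x"
  by (rule vector_eq_rdot[THEN iffD1]) (simp add: inner_J inner_add_left)

lemma J_scale_left: "J (a *\<^sub>R z) x = a *\<^sub>R J z x"
  by (rule vector_eq_rdot[THEN iffD1]) (simp add: inner_J)

lemma J_add_right: "J z (x + x') = J z x + J z x'"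
  by (rule vector_eq_rdot[THEN iffD1])
    (simp add: inner_J inner_add_left bilinear_ladd[OF br_bilinear] inner_add_right)

lemma J_scale_right: "J z (a *\<^sub>R x) = a *\<^sub>R J z x"
  by (rule vector_eq_rdot[THEN iffD1]) (simp add: inner_J bilinear_lmul[OF br_bilinear])

lemma J_zero [simp]: "J 0 x = 0" "J z 0 = 0"
  using J_scale_left[of 0 0 x] J_scale_right[of z 0 0] by simp_all

lemma J_diff_right: "J z (x - y) = J z x - J z y"
  using J_add_right[of z "x - y" y] by simp

lemma bounded_linear_J: "bounded_linear (J z)"
  by (rule linear_conv_bounded_linear[THEN iffD1], rule linearI) (simp_all add: J_add_right J_scale_right)

lemma J_skew: "J z x \<bullet> y = - (x \<bullet> J z y)"
  using br_antisym[of x y] by (simp add: inner_J inner_commute[of x])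

lemma J_skew_self [simp]: "J z x \<bullet> x = 0" "x \<bullet> J z x = 0"
  by (simp_all add: inner_J br_alternating inner_commute[of x])

lemma J_in_V: "J z x \<in> V"
proof -
  obtain v c where vc: "v \<in> V" "c \<in> Z" "J z x = v + c" using V_plus_Z by blast
  have "(v + c) \<bullet> c = 0" using inner_J[of z x c] br_center[OF vc(2)] vc by simp
  then have "c \<bullet> c = 0" using V_orthogonal_Z[OF vc(1,2)] by (simp add: inner_add_left)
  then show ?thesis using vc by simp
qed

lemma bounded_bilinear_br: "bounded_bilinear br"
  using br_bilinear by (simp add: bilinear_conv_bounded_bilinear)

end

context damek_ricci
begin

lemma V_Z_disjoint: "x \<in> V \<Longrightarrow> x \<in> Z \<Longrightarrow> x = 0"
  using V_orthogonal_Z[of x x] by simp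

text \<open>\<open>V\<close> and \<open>Z\<close> are orthogonal and span, so the decomposition is unique.\<close>

lemma V_part_eqI:
  assumes "x \<in> V" "w - x \<in> Z" shows "V_part w = x"
  unfolding V_part_def
proof (rule the_equality)
  fix y assume y: "y \<in> V \<and> w - y \<in> Z"
  have "(w - x) - (w - y) \<in> Z" using subspace_diff[OF subspace_Z assms(2)] y by blast
  then have "y - x \<in> Z" by simp
  moreover have "y - x \<in> V" using assms y subspace_V by (simp add: subspace_diff)
  ultimately show "y = x" using V_Z_disjoint[of "y - x"] by simp
qed (use assms in auto)

lemma V_part_in_V [simp]: "V_part w \<in> V" and Z_part_in_Z [simp]: "Z_part w \<in> Z"
proof -
  obtain x z where w: "x \<in> V" "z \<in> Z" "w = x + z" using V_plus_Z by blast
  have "V_part w = x" using w by (intro V_part_eqI) auto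
  with w show "V_part w \<in> V" "Z_part w \<in> Z" by (simp_all add: Z_part_def)
qed

lemma V_Z_decomp: "V_part w + Z_part w = w"
  by (simp add: Z_part_def)

lemma V_part_sum: "x \<in> V \<Longrightarrow> z \<in> Z \<Longrightarrow> V_part (x + z) = x"
  by (rule V_part_eqI) auto

lemma Z_part_sum: "x \<in> V \<Longrightarrow> z \<in> Z \<Longrightarrow> Z_part (x + z) = z"
  by (simp add: Z_part_def V_part_sum)

lemma V_part_id: "x \<in> V \<Longrightarrow> V_part x = x" "x \<in> V \<Longrightarrow> Z_part x = 0"
  using V_part_sum[of x 0] subspace_Z by (auto simp: subspace_0 Z_part_def)

lemma Z_part_id: "z \<in> Z \<Longrightarrow> Z_part z = z" "z \<in> Z \<Longrightarrow> V_part z = 0"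
  using V_part_sum[of 0 z] subspace_V by (auto simp: subspace_0 Z_part_def)

lemma part_part [simp]: "V_part (V_part w) = V_part w" "Z_part (V_part w) = 0"
  "Z_part (Z_part w) = Z_part w" "V_part (Z_part w) = 0"
  by (simp_all add: V_part_id Z_part_id)

lemma V_part_add: "V_part (u + v) = V_part u + V_part v"
proof (rule V_part_eqI)
  show "V_part u + V_part v \<in> V" using subspace_V by (simp add: subspace_add)
  have "Z_part u + Z_part v \<in> Z" using subspace_Z by (simp add: subspace_add)
  then show "u + v - (V_part u + V_part v) \<in> Z" by (simp add: Z_part_def algebra_simps)
qed

lemma V_part_scale: "V_part (a *\<^sub>R u) = a *\<^sub>R V_part u"
proof (rule V_part_eqI)
  show "a *\<^sub>R V_part u \<in> V" using subspace_V by (simp add: subspace_scale)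
  have "a *\<^sub>R Z_part u \<in> Z" using subspace_Z by (simp add: subspace_scale)
  then show "a *\<^sub>R u - a *\<^sub>R V_part u \<in> Z" by (simp add: Z_part_def algebra_simps)
qed

lemma Z_part_add: "Z_part (u + v) = Z_part u + Z_part v"
  by (simp add: Z_part_def V_part_add)

lemma Z_part_scale: "Z_part (a *\<^sub>R u) = a *\<^sub>R Z_part u"
  by (simp add: Z_part_def V_part_scale algebra_simps)

lemma linear_V_part: "linear V_part" and linear_Z_part: "linear Z_part"
  by (auto intro!: linearI simp: V_part_add V_part_scale Z_part_add Z_part_scale)

lemma bounded_linear_V_part: "bounded_linear V_part" and bounded_linear_Z_part: "bounded_linear Z_part"
  using linear_V_part linear_Z_part by (simp_all add: linear_conv_bounded_linear)

lemma part_zero [simp]: "V_part 0 = 0" "Z_part 0 = 0"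
  using linear_V_part linear_Z_part by (simp_all add: linear_0)

lemma part_neg: "V_part (- u) = - V_part u" "Z_part (- u) = - Z_part u"
  using linear_V_part linear_Z_part by (simp_all add: linear_neg)

lemma part_diff: "V_part (u - v) = V_part u - V_part v" "Z_part (u - v) = Z_part u - Z_part v"
  using linear_V_part linear_Z_part by (simp_all add: linear_diff)

lemmas part_linear = V_part_add Z_part_add V_part_scale Z_part_scale part_neg part_diff

lemma inner_V_Z [simp]: "V_part u \<bullet> Z_part v = 0" "Z_part u \<bullet> V_part v = 0"
  using V_orthogonal_Z by (simp_all add: inner_commute)

lemma inner_parts: "u \<bullet> v = V_part u \<bullet> V_part v + Z_part u \<bullet> Z_part v"
proof -
  have "u \<bullet> v = (V_part u + Z_part u) \<bullet> (V_part v + Z_part v)" by (simp add: V_Z_decomp)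
  then show ?thesis by (simp add: inner_add_left inner_add_right)
qed

lemma norm_parts: "(norm u)\<^sup>2 = (norm (V_part u))\<^sup>2 + (norm (Z_part u))\<^sup>2"
  by (simp add: power2_norm_eq_inner inner_parts[of u u])

lemma norm_part_le: "norm (V_part u) \<le> norm u" "norm (Z_part u) \<le> norm u"
  by (rule power2_le_imp_le; simp add: norm_parts[of u])+

lemma br_parts: "br (V_part u) (V_part v) = br u v"
proof -
  have "br u v = br (V_part u + Z_part u) (V_part v + Z_part v)" by (simp add: V_Z_decomp)
  then show ?thesis
    by (simp add: bilinear_ladd[OF br_bilinear] bilinear_radd[OF br_bilinear] br_center)
qed

lemma br_in_Z [simp]: "br u v \<in> Z"
  using br_V_V[of "V_part u" "V_part v"] by (simp add: br_parts)

lemma part_br [simp]: "V_part (br u v) = 0" "Z_part (br u v) = br u v"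
  by (simp_all add: Z_part_id)

lemma part_J [simp]: "V_part (J z x) = J z x" "Z_part (J z x) = 0"
  by (simp_all add: V_part_id J_in_V)

text \<open>The H-type identity \<open>J\<^sub>z\<^sup>2 = - |z|\<^sup>2\<close> together with skewness makes \<open>J\<^sub>z\<close> a multiple of an
isometry.\<close>

lemma inner_JJ: "z \<in> Z \<Longrightarrow> x \<in> V \<Longrightarrow> J z x \<bullet> J z y = (norm z)\<^sup>2 * (x \<bullet> y)"
  using J_skew[of z "J z x" y] by (simp add: H_type inner_commute)

lemma norm_J: "z \<in> Z \<Longrightarrow> x \<in> V \<Longrightarrow> norm (J z x) = norm z * norm x"
  by (rule power2_eq_imp_eq)
    (simp_all add: power2_norm_eq_inner[of "J z x"] inner_JJ power_mult_distrib power2_norm_eq_inner[of x])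

text \<open>Polarisation of \<open>norm_J\<close> in \<open>z\<close>.\<close>

lemma inner_JJ_polar:
  assumes "z \<in> Z" "z' \<in> Z" "x \<in> V"
  shows "J z x \<bullet> J z' x = (z \<bullet> z') * (norm x)\<^sup>2"
proof -
  have "z + z' \<in> Z" using assms subspace_Z by (simp add: subspace_add)
  then have "J (z + z') x \<bullet> J (z + z') x = (norm (z + z'))\<^sup>2 * (x \<bullet> x)"
    using assms by (rule_tac inner_JJ)
  then show ?thesis
    using inner_JJ[OF assms(1,3), of x] inner_JJ[OF assms(2,3), of x]
    by (simp add: J_add_left inner_add_left inner_add_right inner_commute power2_norm_eq_inner algebra_simps)
qed

text \<open>Test against \<open>z'\<close> in \<open>Z\<close> and use the polarised identity.\<close>

lemma br_J:
  assumes "z \<in> Z" "x \<in> V"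
  shows "br x (J z x) = (norm x)\<^sup>2 *\<^sub>R z"
proof (rule vector_eq_ldot[THEN iffD1], intro allI)
  fix w
  have "w \<bullet> br x (J z x) = Z_part w \<bullet> br x (J z x)" by (simp add: inner_parts[of w])
  also have "\<dots> = J (Z_part w) x \<bullet> J z x" by (simp add: inner_J)
  also have "\<dots> = (Z_part w \<bullet> z) * (norm x)\<^sup>2" using assms by (simp add: inner_JJ_polar)
  also have "Z_part w \<bullet> z = w \<bullet> z" using assms by (simp add: inner_parts[of w] Z_part_id)
  finally show "w \<bullet> br x (J z x) = w \<bullet> ((norm x)\<^sup>2 *\<^sub>R z)" by (simp add: mult.commute)
qed

text \<open>The bracket has norm at most 1: test it against itself and use \<open>norm_J\<close>.\<close>

lemma norm_br_le: "norm (br u v) \<le> norm (V_part u) * norm (V_part v)"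
proof -
  let ?b = "br u v"
  have "(norm ?b)\<^sup>2 = J ?b (V_part u) \<bullet> V_part v"
    by (simp add: inner_J br_parts power2_norm_eq_inner)
  also have "\<dots> \<le> norm (J ?b (V_part u)) * norm (V_part v)" by (rule norm_cauchy_schwarz)
  also have "\<dots> = norm ?b * (norm (V_part u) * norm (V_part v))" by (simp add: norm_J)
  finally show ?thesis
    by (cases "norm ?b = 0") (simp_all add: power2_eq_square)
qed

lemma mult_eq: "mult (w, s) (w', s') =
   (w + sqrt s *\<^sub>R V_part w' + s *\<^sub>R Z_part w' + (sqrt s / 2) *\<^sub>R br w w', s * s')"
proof -
  have "w = V_part w + Z_part w" by (simp add: V_Z_decomp)
  then show ?thesis by (simp add: mult_def br_parts)
qed

lemma left_diff_eq: "left_diff (w, s) (u, t) =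
   (sqrt s *\<^sub>R V_part u + s *\<^sub>R Z_part u + (sqrt s / 2) *\<^sub>R br w u, s * t)"
proof -
  let ?D = "\<lambda>p. (sqrt s *\<^sub>R V_part (fst p) + s *\<^sub>R Z_part (fst p) + (sqrt s / 2) *\<^sub>R br w (fst p), s * snd p)"
  have "linear ?D"
    by (rule linearI) (simp_all add: part_linear bilinear_radd[OF br_bilinear] bilinear_rmul[OF br_bilinear] algebra_simps)
  then have "(?D has_derivative ?D) (at e)"
    by (intro bounded_linear_imp_has_derivative) (simp add: linear_conv_bounded_linear)
  then have "((\<lambda>p. (w, 0) + ?D p) has_derivative ?D) (at e)"
    using has_derivative_add[OF has_derivative_const[of "(w, 0)"], of ?D ?D] by simp
  moreover have "(\<lambda>p. (w, 0) + ?D p) = mult (w, s)" by (auto simp: mult_eq fun_eq_iff)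
  ultimately have "(mult (w, s) has_derivative ?D) (at e)" by metis
  then have "left_diff (w, s) = ?D"
    unfolding left_diff_def by (rule frechet_derivative_at[symmetric])
  then show ?thesis by simp
qed

lemma inv_left_diff_eq:
  assumes "s > 0"
  shows "inv (left_diff (w, s)) (u, t) =
    ((1 / sqrt s) *\<^sub>R V_part u + (1 / s) *\<^sub>R (Z_part u - (1/2) *\<^sub>R br w u), t / s)"
proof -
  let ?I = "\<lambda>p. ((1 / sqrt s) *\<^sub>R V_part (fst p) + (1 / s) *\<^sub>R (Z_part (fst p) - (1/2) *\<^sub>R br w (fst p)), snd p / s)"
  have b1: "br w (V_part u) = br w u" for u by (metis br_parts part_part(1))
  have b2: "br w (Z_part u) = 0" for u by (simp add: br_center)
  have b3: "br w (br w u) = 0" for u by (simp add: br_center)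
  note lin = part_linear bilinear_radd[OF br_bilinear] bilinear_rmul[OF br_bilinear] bilinear_rsub[OF br_bilinear]
  have "inv (left_diff (w, s)) = ?I"
  proof (rule inv_equality)
    fix p show "?I (left_diff (w, s) p) = p"
      using assms by (cases p) (simp add: left_diff_eq lin b1 b2 b3 V_Z_decomp)
    show "left_diff (w, s) (?I p) = p"
      using assms by (cases p) (simp add: left_diff_eq lin b1 b2 b3 V_Z_decomp)
  qed
  then show ?thesis by simp
qed

lemma metric_eq:
  assumes "s > 0"
  shows "metric (w, s) (u, a) (v, b) =
    (V_part u \<bullet> V_part v) / s
    + ((Z_part u - (1/2) *\<^sub>R br w u) \<bullet> (Z_part v - (1/2) *\<^sub>R br w v)) / s\<^sup>2 + a * b / s\<^sup>2"
proof -
  define a' b' where "a' = Z_part u - (1/2) *\<^sub>R br w u" and "b' = Z_part v - (1/2) *\<^sub>R br w v"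
  have "a' \<in> Z" "b' \<in> Z" unfolding a'_def b'_def
    using subspace_Z by (auto intro!: subspace_diff subspace_scale)
  then have "V_part u \<bullet> b' = 0" "a' \<bullet> V_part v = 0"
    using V_orthogonal_Z[of "V_part u" b'] V_orthogonal_Z[of "V_part v" a'] inner_commute[of a'] by simp_all
  then show ?thesis
    using assms unfolding metric_def inv_left_diff_eq[OF assms] a'_def[symmetric] b'_def[symmetric] inner_Pair
    by (simp add: inner_add_left inner_add_right power2_eq_square)
qed

lemma mem_S [simp]: "(w, s) \<in> S \<longleftrightarrow> s > 0"
  by (simp add: S_def)

lemma open_S: "open S"
proof -
  have "S = UNIV \<times> {0<..}" by (auto simp: S_def)
  moreover have "open (UNIV \<times> {0::real<..} :: ('n \<times> real) set)" by (intro open_Times) auto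
  ultimately show ?thesis by simp
qed

end

section \<open>The geodesic equation\<close>

context damek_ricci
begin

lemmas br_lin = bilinear_ladd[OF br_bilinear] bilinear_radd[OF br_bilinear]
  bilinear_lmul[OF br_bilinear] bilinear_rmul[OF br_bilinear]
  bilinear_lsub[OF br_bilinear] bilinear_rsub[OF br_bilinear]
  bilinear_lneg[OF br_bilinear] bilinear_rneg[OF br_bilinear]

lemma br_V_right [simp]: "br w (V_part u) = br w u" and br_V_left [simp]: "br (V_part w) u = br w u"
  by (metis br_parts part_part(1))+

lemma br_Z_right [simp]: "br w (Z_part u) = 0" "br (Z_part u) w = 0" "br w (br u v) = 0" "br (br u v) w = 0"
  by (simp_all add: br_center)

text \<open>The \<open>Z\<close>-part of the left-invariant velocity, before division by the height.\<close>

definition vert :: "'n \<Rightarrow> 'n \<Rightarrow> 'n" where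
  "vert w u = Z_part u - (1/2) *\<^sub>R br w u"

text \<open>The second derivative of a geodesic through \<open>(w, s)\<close> with velocity \<open>(u, a)\<close>, found by solving
the Koszul identity.\<close>

definition geodesic_acc :: "'n \<times> real \<Rightarrow> 'n \<times> real \<Rightarrow> 'n \<times> real" where
  "geodesic_acc = (\<lambda>(w, s) (u, a).
     let \<zeta> = (1 / s\<^sup>2) *\<^sub>R vert w u; x = (a / s) *\<^sub>R V_part u + s *\<^sub>R J \<zeta> (V_part u)
     in (x + (1/2) *\<^sub>R br w x + (2 * s * a) *\<^sub>R \<zeta>,
         a\<^sup>2 / s - (norm (V_part u))\<^sup>2 / 2 - s ^ 3 * (norm \<zeta>)\<^sup>2))"

lemma vert_in_Z [simp]: "vert w u \<in> Z"
  unfolding vert_def using subspace_Z by (intro subspace_diff subspace_scale) auto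

lemma metric_vert:
  assumes "s > 0"
  shows "metric (w, s) (u, a) (v, b) = (V_part u \<bullet> V_part v) / s + (vert w u \<bullet> vert w v) / s\<^sup>2 + a * b / s\<^sup>2"
  unfolding vert_def by (rule metric_eq[OF assms])

text \<open>Only \<open>h\<close>, through the bracket, and \<open>k\<close>, through the powers of the height, occur in the
derivative: the metric is invariant under central translations.\<close>

lemma metric_has_derivative:
  assumes "s > 0"
  shows "((\<lambda>y. metric y (u, a) (v, b)) has_derivative
     (\<lambda>(h, k). - (V_part u \<bullet> V_part v) * k / s\<^sup>2
        - ((br h u \<bullet> vert w v) + (vert w u \<bullet> br h v)) / (2 * s\<^sup>2)
        - 2 * k * (vert w u \<bullet> vert w v) / s ^ 3 - 2 * k * (a * b) / s ^ 3)) (at (w, s))"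
proof (rule has_derivative_transform_within_open[OF _ open_S])
  have b: "((\<lambda>y. vert (fst y) u) has_derivative (\<lambda>h. - (1/2) *\<^sub>R br (fst h) u)) (at (w, s))" for u
    unfolding vert_def
    by (auto intro!: derivative_eq_intros bounded_linear.has_derivative[OF bounded_bilinear.bounded_linear_left[OF bounded_bilinear_br]])
  have i: "((\<lambda>y. vert (fst y) u \<bullet> vert (fst y) v) has_derivative
      (\<lambda>h. vert w u \<bullet> (- (1/2) *\<^sub>R br (fst h) v) + (- (1/2) *\<^sub>R br (fst h) u) \<bullet> vert w v)) (at (w, s))"
    using has_derivative_inner[OF b[of u] b[of v]] by simp
  have gen: "((\<lambda>y. c / snd y + F y / (snd y)\<^sup>2 + a * b / (snd y)\<^sup>2) has_derivative
     (\<lambda>h. - c * snd h / s\<^sup>2 + F' h / s\<^sup>2 - 2 * snd h * F (w, s) / s ^ 3 - 2 * snd h * (a * b) / s ^ 3)) (at (w, s))"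
    if F: "(F has_derivative F') (at (w, s))" for F F' c
  proof -
    have s: "snd (w, s) \<noteq> 0" "(snd (w, s))\<^sup>2 \<noteq> 0" using assms by simp_all
    have d: "(snd has_derivative snd) (at (w, s))"
      by (rule bounded_linear_imp_has_derivative[OF bounded_linear_snd])
    have p: "((\<lambda>y. (snd y)\<^sup>2) has_derivative (\<lambda>h. 2 * s * snd h)) (at (w, s))"
      by (auto intro!: derivative_eq_intros d)
    show ?thesis
      by (rule has_derivative_eq_rhs[OF has_derivative_add[OF has_derivative_add[OF
            has_derivative_divide[OF has_derivative_const d s(1)]
            has_derivative_divide[OF F p s(2)]] has_derivative_divide[OF has_derivative_const p s(2)]]])
        (use assms in \<open>auto simp: fun_eq_iff power2_eq_square power3_eq_cube divide_simps algebra_simps\<close>)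
  qed
  show "((\<lambda>y. (V_part u \<bullet> V_part v) / snd y + (vert (fst y) u \<bullet> vert (fst y) v) / (snd y)\<^sup>2 + a * b / (snd y)\<^sup>2) has_derivative
     (\<lambda>(h, k). - (V_part u \<bullet> V_part v) * k / s\<^sup>2
        - ((br h u \<bullet> vert w v) + (vert w u \<bullet> br h v)) / (2 * s\<^sup>2)
        - 2 * k * (vert w u \<bullet> vert w v) / s ^ 3 - 2 * k * (a * b) / s ^ 3)) (at (w, s))"
    by (rule has_derivative_eq_rhs[OF gen[OF i]]) (auto simp: fun_eq_iff add_divide_distrib diff_divide_distrib)
  show "(w, s) \<in> S" using assms by simp
  show "\<And>x. x \<in> S \<Longrightarrow> (V_part u \<bullet> V_part v) / snd x + (vert (fst x) u \<bullet> vert (fst x) v) / (snd x)\<^sup>2 + a * b / (snd x)\<^sup>2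
      = metric x (u, a) (v, b)"
    by (auto simp: metric_vert S_def)
qed

lemma vert_geodesic_acc:
  assumes "s > 0"
  shows "vert w (fst (geodesic_acc (w, s) (u, a))) = (2 * a / s) *\<^sub>R vert w u"
    and "V_part (fst (geodesic_acc (w, s) (u, a))) = (a / s) *\<^sub>R V_part u + (1 / s) *\<^sub>R J (vert w u) (V_part u)"
    and "snd (geodesic_acc (w, s) (u, a)) = a\<^sup>2 / s - (norm (V_part u))\<^sup>2 / 2 - (norm (vert w u))\<^sup>2 / s"
proof -
  have v: "V_part (vert w u) = 0" "Z_part (vert w u) = vert w u" by (simp_all add: Z_part_id)
  have c: "br w (vert w u) = 0" by (simp add: br_center)
  show "V_part (fst (geodesic_acc (w, s) (u, a))) = (a / s) *\<^sub>R V_part u + (1 / s) *\<^sub>R J (vert w u) (V_part u)"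
    using assms by (simp add: geodesic_acc_def Let_def part_linear v J_scale_left power2_eq_square)
  show "vert w (fst (geodesic_acc (w, s) (u, a))) = (2 * a / s) *\<^sub>R vert w u"
    unfolding vert_def[of w "fst _"]
    using assms by (simp add: geodesic_acc_def Let_def part_linear v br_lin c power2_eq_square)
  show "snd (geodesic_acc (w, s) (u, a)) = a\<^sup>2 / s - (norm (V_part u))\<^sup>2 / 2 - (norm (vert w u))\<^sup>2 / s"
    using assms by (simp add: geodesic_acc_def Let_def power2_eq_square power3_eq_cube field_simps)
qed

text \<open>The proposed vector satisfies the Koszul identity tested against every \<open>d\<close>; it is the only one,
because the metric is positive definite.\<close>

lemma christoffel_eq:
  assumes s: "s > 0"
  shows "christoffel metric (w, s) (u, a) (u, a) = - geodesic_acc (w, s) (u, a)"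
proof -
  let ?rhs = "\<lambda>d. frechet_derivative (\<lambda>y. metric y (u, a) d) (at (w, s)) (u, a)
      + frechet_derivative (\<lambda>y. metric y (u, a) d) (at (w, s)) (u, a)
      - frechet_derivative (\<lambda>y. metric y (u, a) (u, a)) (at (w, s)) d"
  have fd: "frechet_derivative (\<lambda>y. metric y (u, a) (v, b)) (at (w, s)) =
     (\<lambda>(h, k). - (V_part u \<bullet> V_part v) * k / s\<^sup>2
        - ((br h u \<bullet> vert w v) + (vert w u \<bullet> br h v)) / (2 * s\<^sup>2)
        - 2 * k * (vert w u \<bullet> vert w v) / s ^ 3 - 2 * k * (a * b) / s ^ 3)" for v b
    using frechet_derivative_at[OF metric_has_derivative[OF s]] by metis
  have koszul: "2 * metric (w, s) (- geodesic_acc (w, s) (u, a)) d = ?rhs d" for d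
  proof -
    obtain h k where d: "d = (h, k)" by fastforce
    obtain c b where c: "geodesic_acc (w, s) (u, a) = (c, b)" by fastforce
    note A = vert_geodesic_acc[OF s, of w u a, unfolded c, simplified]
    have neg: "vert w (- c) = - vert w c" by (simp add: vert_def part_neg br_lin)
    have Jh: "J (vert w u) (V_part u) \<bullet> V_part h = vert w u \<bullet> br u h" by (simp add: inner_J)
    have hu: "br h u = - br u h" by (rule br_antisym)
    have lhs: "metric (w, s) (- geodesic_acc (w, s) (u, a)) d =
       - ((a / s) * (V_part u \<bullet> V_part h) + (1 / s) * (vert w u \<bullet> br u h)) / s
       - (2 * a / s) * (vert w u \<bullet> vert w h) / s\<^sup>2
       - (a\<^sup>2 / s - (V_part u \<bullet> V_part u) / 2 - (vert w u \<bullet> vert w u) / s) * k / s\<^sup>2"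
      unfolding c d by (simp add: metric_vert[OF s] neg A part_neg inner_diff_left inner_add_left Jh power2_norm_eq_inner
        add_divide_distrib diff_divide_distrib algebra_simps)
    have r: "?rhs d = 2 * (- (V_part u \<bullet> V_part h) * a / s\<^sup>2 - (vert w u \<bullet> br u h) / (2 * s\<^sup>2)
        - 2 * a * (vert w u \<bullet> vert w h) / s ^ 3 - 2 * a * (a * k) / s ^ 3)
      - (- (V_part u \<bullet> V_part u) * k / s\<^sup>2
        - ((vert w u \<bullet> - br u h) + (vert w u \<bullet> - br u h)) / (2 * s\<^sup>2)
        - 2 * k * (vert w u \<bullet> vert w u) / s ^ 3 - 2 * k * (a * a) / s ^ 3)"
      unfolding d fd by (simp add: br_alternating hu inner_commute)
    show ?thesis unfolding lhs r using s
      by (simp add: field_simps power2_eq_square power3_eq_cube)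
  qed
  show ?thesis unfolding christoffel_def
  proof (rule the_equality)
    show "\<forall>d. 2 * metric (w, s) (- geodesic_acc (w, s) (u, a)) d = ?rhs d" using koszul by blast
    fix c assume "\<forall>d. 2 * metric (w, s) c d = ?rhs d"
    then have eq: "metric (w, s) c d = metric (w, s) (- geodesic_acc (w, s) (u, a)) d" for d using koszul[of d] by (metis mult_cancel_left zero_neq_numeral)
    (* The difference of two solutions has zero length, so it vanishes component by component. *)
    define f where "f = c + geodesic_acc (w, s) (u, a)"
    obtain c1 c2 a1 a2 where ca: "c = (c1, c2)" "geodesic_acc (w, s) (u, a) = (a1, a2)" by fastforce
    have f: "f = (c1 + a1, c2 + a2)" by (simp add: f_def ca)
    have va: "vert w (x + y) = vert w x + vert w y" "vert w (- x) = - vert w x" for x y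
      by (simp_all add: vert_def part_linear br_lin algebra_simps)
    have "metric (w, s) f f = 0"
    proof -
      have "metric (w, s) f f = metric (w, s) c f + metric (w, s) (geodesic_acc (w, s) (u, a)) f"
        unfolding f ca by (simp add: metric_vert[OF s] va(1) V_part_add inner_add_left distrib_right add_divide_distrib)
      moreover have "metric (w, s) (- geodesic_acc (w, s) (u, a)) f = - metric (w, s) (geodesic_acc (w, s) (u, a)) f"
        unfolding f ca by (simp add: metric_vert[OF s] va(2) part_neg)
      ultimately show ?thesis using eq[of f] by simp
    qed
    then have "(norm (V_part (c1 + a1)))\<^sup>2 / s + (norm (vert w (c1 + a1)))\<^sup>2 / s\<^sup>2 + (c2 + a2)\<^sup>2 / s\<^sup>2 = 0"
      unfolding f by (simp add: metric_vert[OF s] power2_norm_eq_inner power2_eq_square[of "c2 + a2"])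
    moreover have "(norm (V_part (c1 + a1)))\<^sup>2 / s \<ge> 0" "(norm (vert w (c1 + a1)))\<^sup>2 / s\<^sup>2 \<ge> 0" "(c2 + a2)\<^sup>2 / s\<^sup>2 \<ge> 0"
      using s by simp_all
    ultimately have 0: "(norm (V_part (c1 + a1)))\<^sup>2 / s = 0" "(norm (vert w (c1 + a1)))\<^sup>2 / s\<^sup>2 = 0" "(c2 + a2)\<^sup>2 / s\<^sup>2 = 0"
      by linarith+
    then have V0: "V_part (c1 + a1) = 0" "vert w (c1 + a1) = 0" "c2 + a2 = 0" using s by simp_all
    have "br w (c1 + a1) = br w (V_part (c1 + a1))" by simp
    then have "br w (c1 + a1) = 0" by (simp only: V0 br_zero)
    with V0(2) have "Z_part (c1 + a1) = 0" by (simp add: vert_def)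
    with V0(1) have "c1 + a1 = 0" using V_Z_decomp[of "c1 + a1"] by simp
    with V0(3) show "c = - geodesic_acc (w, s) (u, a)" unfolding ca by (simp add: eq_neg_iff_add_eq_0)
  qed
qed

lemma geodesic_from_iff:
  "geodesic_from S metric e v \<gamma> \<longleftrightarrow>
     \<gamma> 0 = e \<and>
     (\<exists>\<gamma>'. \<gamma>' 0 = v \<and>
        (\<forall>\<tau>. \<gamma> \<tau> \<in> S \<and>
             (\<gamma> has_vector_derivative \<gamma>' \<tau>) (at \<tau>) \<and>
             (\<gamma>' has_vector_derivative geodesic_acc (\<gamma> \<tau>) (\<gamma>' \<tau>)) (at \<tau>)))"
proof -
  have "christoffel metric x u u = - geodesic_acc x u" if "x \<in> S" for x u
    using that christoffel_eq[of "snd x" "fst x" "fst u" "snd u"] by (cases x) simp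
  then show ?thesis unfolding geodesic_from_def by (metis (no_types, lifting) minus_minus)
qed

end

section \<open>Explicit geodesics\<close>

text \<open>Factor the operator: \<open>(d' + d) exp (-\<tau>)\<close> is constant, hence zero, and then \<open>d exp \<tau>\<close> is
constant.\<close>

lemma hyperbolic_ode_unique:
  fixes d d' :: "real \<Rightarrow> real"
  assumes d: "\<And>\<tau>. (d has_field_derivative d' \<tau>) (at \<tau>)"
    and d': "\<And>\<tau>. (d' has_field_derivative d \<tau>) (at \<tau>)"
    and "d 0 = 0" "d' 0 = 0"
  shows "d \<tau> = 0"
proof -
  have "\<forall>\<tau>. ((\<lambda>\<tau>. (d' \<tau> + d \<tau>) * exp (- \<tau>)) has_field_derivative 0) (at \<tau>)"
    by (auto intro!: derivative_eq_intros d d' simp: algebra_simps)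
  from DERIV_isconst_all[OF this, of _ 0] have "d' \<tau> + d \<tau> = 0" for \<tau>
    using assms(3,4) by simp
  then have 1: "d' \<tau> = - d \<tau>" for \<tau> by (simp add: eq_neg_iff_add_eq_0)
  have "\<forall>\<tau>. ((\<lambda>\<tau>. d \<tau> * exp \<tau>) has_field_derivative 0) (at \<tau>)"
    by (auto intro!: derivative_eq_intros d simp: 1)
  from DERIV_isconst_all[OF this, of _ 0] show ?thesis
    using assms(3) by simp
qed

lemma has_vector_derivative_zero_imp_const:
  fixes f :: "real \<Rightarrow> 'a::real_normed_vector"
  assumes "\<And>\<tau>. (f has_vector_derivative 0) (at \<tau>)"
  shows "f \<tau> = f 0"
proof -
  obtain c where "\<And>x. f x = c"
    using has_vector_derivative_zero_constant[of UNIV f] assms by auto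
  then show ?thesis by simp
qed

context damek_ricci
begin

text \<open>The reciprocal of the height along the geodesic with initial velocity \<open>v\<close>. It satisfies \<open>y'' = y
+ B - 1\<close> with \<open>y(0) = 1\<close> and \<open>y'(0) = - t\<close>.\<close>

definition inv_height :: "'n \<times> real \<Rightarrow> real \<Rightarrow> real" where
  "inv_height v \<tau> = (let t = snd v; B = (1 + t\<^sup>2 + (norm (Z_part (fst v)))\<^sup>2) / 2 in 1 - B + B * cosh \<tau> - t * sinh \<tau>)"

definition inv_height' :: "'n \<times> real \<Rightarrow> real \<Rightarrow> real" where
  "inv_height' v \<tau> = (let t = snd v; B = (1 + t\<^sup>2 + (norm (Z_part (fst v)))\<^sup>2) / 2 in B * sinh \<tau> - t * cosh \<tau>)"

definition geo :: "'n \<times> real \<Rightarrow> real \<Rightarrow> 'n \<times> real" where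
  "geo v \<tau> = (let x = V_part (fst v); z = Z_part (fst v); t = snd v; y = inv_height v \<tau> in
     (((sinh \<tau> - t * (cosh \<tau> - 1)) / y) *\<^sub>R x + ((cosh \<tau> - 1) / y) *\<^sub>R J z x + (sinh \<tau> / y) *\<^sub>R z, 1 / y))"

text \<open>The derivative of the \<open>V\<close>-part of \<open>geo\<close>; the momentum equation is \<open>X' = s (x + J\<^sub>z X)\<close>.\<close>

definition geo_V_deriv :: "'n \<times> real \<Rightarrow> real \<Rightarrow> 'n" where
  "geo_V_deriv v \<tau> = (1 / inv_height v \<tau>) *\<^sub>R (V_part (fst v) + J (Z_part (fst v)) (V_part (fst (geo v \<tau>))))"

definition geo' :: "'n \<times> real \<Rightarrow> real \<Rightarrow> 'n \<times> real" where
  "geo' v \<tau> = (geo_V_deriv v \<tau> + (1 / (inv_height v \<tau>)\<^sup>2) *\<^sub>R Z_part (fst v) + (1/2) *\<^sub>R br (fst (geo v \<tau>)) (geo_V_deriv v \<tau>),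
     - inv_height' v \<tau> / (inv_height v \<tau>)\<^sup>2)"

context
  fixes v :: "'n \<times> real"
  assumes unit: "norm v = 1"
begin

private definition "x0 = V_part (fst v)"
private definition "z0 = Z_part (fst v)"
private definition "t0 = snd v"
private definition "B = (1 + t0\<^sup>2 + (norm z0)\<^sup>2) / 2"

private lemma unit_eq: "(norm x0)\<^sup>2 = 1 - t0\<^sup>2 - (norm z0)\<^sup>2"
proof -
  have "(norm v)\<^sup>2 = (norm (fst v))\<^sup>2 + t0\<^sup>2" by (simp add: norm_prod_def t0_def)
  then show ?thesis using unit norm_parts[of "fst v"] by (simp add: x0_def z0_def)
qed

private lemma inv_height_B: "inv_height v \<tau> = 1 - B + B * cosh \<tau> - t0 * sinh \<tau>"
  by (simp add: inv_height_def Let_def B_def t0_def z0_def)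

private lemma inv_height'_B: "inv_height' v \<tau> = B * sinh \<tau> - t0 * cosh \<tau>"
  by (simp add: inv_height'_def Let_def B_def t0_def z0_def)

private lemma sinh_sq: "(sinh \<tau>)\<^sup>2 = (cosh \<tau>)\<^sup>2 - (1::real)"
  by (simp add: cosh_square_eq)

lemma inv_height_pos: "inv_height v \<tau> > 0"
proof -
  have t1: "t0\<^sup>2 \<le> 1" using unit_eq zero_le_power2[of "norm x0"] zero_le_power2[of "norm z0"] by linarith
  let ?c = "cosh (\<tau>/2)" and ?s = "sinh (\<tau>/2)"
  have c2: "cosh \<tau> = ?c\<^sup>2 + ?s\<^sup>2" "sinh \<tau> = 2 * ?s * ?c"
    using cosh_double[of "\<tau>/2"] sinh_double[of "\<tau>/2"] by simp_all
  have cs: "?c\<^sup>2 = 1 + ?s\<^sup>2" by (simp add: cosh_square_eq)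
  have "inv_height v \<tau> = (?c - t0 * ?s)\<^sup>2 + (norm z0)\<^sup>2 * ?s\<^sup>2"
    unfolding inv_height_B c2 B_def power2_diff power_mult_distrib cs by (simp add: field_simps)
  moreover have "?c - t0 * ?s \<noteq> 0"
  proof
    assume "?c - t0 * ?s = 0"
    then have "?c\<^sup>2 = t0\<^sup>2 * ?s\<^sup>2" by (simp add: power_mult_distrib)
    moreover have "t0\<^sup>2 * ?s\<^sup>2 \<le> 1 * ?s\<^sup>2" using t1 by (intro mult_right_mono) auto
    ultimately show False using cs by linarith
  qed
  ultimately show ?thesis by (simp add: add_pos_nonneg)
qed

lemma inv_height_derivs [derivative_intros]:
  "(inv_height v has_field_derivative inv_height' v \<tau>) (at \<tau>)"
  "(inv_height' v has_field_derivative inv_height v \<tau> + B - 1) (at \<tau>)"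
  unfolding inv_height_B[abs_def] inv_height'_B[abs_def] by (auto intro!: derivative_eq_intros)

private lemma inv_height_quadratic: "(inv_height v \<tau>)\<^sup>2 = (norm x0)\<^sup>2 * inv_height v \<tau> + (norm z0)\<^sup>2 + (inv_height' v \<tau>)\<^sup>2"
proof -
  have z: "(norm z0)\<^sup>2 = 2 * B - 1 - t0\<^sup>2" by (simp add: B_def field_simps)
  have x: "(norm x0)\<^sup>2 = 2 - 2 * B" using unit_eq z by simp
  show ?thesis
    unfolding x z inv_height_B inv_height'_B using sinh_sq[of \<tau>] by algebra
qed

private definition "ga \<tau> = (sinh \<tau> - t0 * (cosh \<tau> - 1)) / inv_height v \<tau>"
private definition "gb \<tau> = (cosh \<tau> - 1) / inv_height v \<tau>"
private definition "gz \<tau> = sinh \<tau> / inv_height v \<tau>"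

private lemma geo_eq: "geo v \<tau> = (ga \<tau> *\<^sub>R x0 + gb \<tau> *\<^sub>R J z0 x0 + gz \<tau> *\<^sub>R z0, 1 / inv_height v \<tau>)"
  by (simp add: geo_def Let_def ga_def gb_def gz_def x0_def z0_def t0_def)

private lemma V_geo: "V_part (fst (geo v \<tau>)) = ga \<tau> *\<^sub>R x0 + gb \<tau> *\<^sub>R J z0 x0"
  by (simp add: geo_eq part_linear) (simp add: x0_def z0_def)

private lemma x0_V [simp]: "x0 \<in> V" and z0_Z [simp]: "z0 \<in> Z"
  by (simp_all add: x0_def z0_def)

private lemma geo_V_deriv_eq: "geo_V_deriv v \<tau> = (1 / inv_height v \<tau>) *\<^sub>R ((1 - (norm z0)\<^sup>2 * gb \<tau>) *\<^sub>R x0 + ga \<tau> *\<^sub>R J z0 x0)"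
  unfolding geo_V_deriv_def V_geo
  by (simp add: J_add_right J_scale_right H_type x0_def[symmetric] z0_def[symmetric] algebra_simps)

private lemma z0_sq: "(norm z0)\<^sup>2 = 2 * B - 1 - t0\<^sup>2" by (simp add: B_def field_simps)

private lemma gab: "(ga \<tau>)\<^sup>2 + (norm z0)\<^sup>2 * (gb \<tau>)\<^sup>2 = 2 * gb \<tau>"
proof -
  let ?y = "inv_height v \<tau>"
  have "(sinh \<tau> - t0 * (cosh \<tau> - 1))\<^sup>2 + (norm z0)\<^sup>2 * (cosh \<tau> - 1)\<^sup>2 = 2 * (cosh \<tau> - 1) * ?y"
    unfolding z0_sq inv_height_B using sinh_sq[of \<tau>] by algebra
  moreover have "(ga \<tau>)\<^sup>2 + (norm z0)\<^sup>2 * (gb \<tau>)\<^sup>2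
      = ((sinh \<tau> - t0 * (cosh \<tau> - 1))\<^sup>2 + (norm z0)\<^sup>2 * (cosh \<tau> - 1)\<^sup>2) / ?y\<^sup>2"
    by (simp add: ga_def gb_def power_divide add_divide_distrib)
  ultimately show ?thesis using inv_height_pos[of \<tau>]
    by (simp add: gb_def power2_eq_square)
qed

private lemma ga_deriv: "(ga has_field_derivative (1 - (norm z0)\<^sup>2 * gb \<tau>) / inv_height v \<tau>) (at \<tau>)"
proof -
  have n: "inv_height v \<tau> \<noteq> 0" using inv_height_pos[of \<tau>] by simp
  have "(cosh \<tau> - t0 * sinh \<tau>) * inv_height v \<tau> - (sinh \<tau> - t0 * (cosh \<tau> - 1)) * inv_height' v \<tau> = inv_height v \<tau> - (norm z0)\<^sup>2 * (cosh \<tau> - 1)"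
    unfolding z0_sq inv_height_B inv_height'_B using sinh_sq[of \<tau>] by algebra
  then have eq: "((cosh \<tau> - t0 * sinh \<tau>) * inv_height v \<tau> - (sinh \<tau> - t0 * (cosh \<tau> - 1)) * inv_height' v \<tau>) / (inv_height v \<tau> * inv_height v \<tau>)
      = (1 - (norm z0)\<^sup>2 * gb \<tau>) / inv_height v \<tau>"
    using n by (simp add: gb_def field_simps)
  show ?thesis unfolding ga_def[abs_def] eq[symmetric]
    using n by (auto intro!: derivative_eq_intros)
qed

private lemma gb_deriv: "(gb has_field_derivative ga \<tau> / inv_height v \<tau>) (at \<tau>)"
proof -
  have n: "inv_height v \<tau> \<noteq> 0" using inv_height_pos[of \<tau>] by simp
  have "sinh \<tau> * inv_height v \<tau> - (cosh \<tau> - 1) * inv_height' v \<tau> = sinh \<tau> - t0 * (cosh \<tau> - 1)"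
    unfolding inv_height_B inv_height'_B using sinh_sq[of \<tau>] by algebra
  then have eq: "(sinh \<tau> * inv_height v \<tau> - (cosh \<tau> - 1) * inv_height' v \<tau>) / (inv_height v \<tau> * inv_height v \<tau>) = ga \<tau> / inv_height v \<tau>"
    using n by (simp add: ga_def field_simps)
  show ?thesis unfolding gb_def[abs_def] eq[symmetric]
    using n by (auto intro!: derivative_eq_intros)
qed

private lemma gz_deriv: "(gz has_field_derivative 1 / (inv_height v \<tau>)\<^sup>2 + gb \<tau> * (norm x0)\<^sup>2 / (2 * inv_height v \<tau>)) (at \<tau>)"
proof -
  have n: "inv_height v \<tau> \<noteq> 0" using inv_height_pos[of \<tau>] by simp
  have "2 * (cosh \<tau> * inv_height v \<tau> - sinh \<tau> * inv_height' v \<tau>) = 2 + (cosh \<tau> - 1) * (norm x0)\<^sup>2"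
    unfolding unit_eq unfolding z0_sq inv_height_B inv_height'_B using sinh_sq[of \<tau>] by algebra
  then have "cosh \<tau> * inv_height v \<tau> - sinh \<tau> * inv_height' v \<tau> = 1 + (cosh \<tau> - 1) * (norm x0)\<^sup>2 / 2" by simp
  then have eq: "(cosh \<tau> * inv_height v \<tau> - sinh \<tau> * inv_height' v \<tau>) / (inv_height v \<tau> * inv_height v \<tau>)
     = 1 / (inv_height v \<tau>)\<^sup>2 + gb \<tau> * (norm x0)\<^sup>2 / (2 * inv_height v \<tau>)"
    by (simp add: gb_def add_divide_distrib power2_eq_square)
  show ?thesis unfolding gz_def[abs_def] eq[symmetric]
    using n by (auto intro!: derivative_eq_intros)
qed

private lemma br_geo_geo_V_deriv: "br (fst (geo v \<tau>)) (geo_V_deriv v \<tau>) = (gb \<tau> * (norm x0)\<^sup>2 / inv_height v \<tau>) *\<^sub>R z0"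
proof -
  let ?k = "(norm z0)\<^sup>2"
  have "br (fst (geo v \<tau>)) (geo_V_deriv v \<tau>) = br (ga \<tau> *\<^sub>R x0 + gb \<tau> *\<^sub>R J z0 x0) (geo_V_deriv v \<tau>)"
    by (simp only: V_geo[symmetric] br_V_left)
  also have "\<dots> = (1 / inv_height v \<tau>) *\<^sub>R (ga \<tau> * ga \<tau> - gb \<tau> * (1 - ?k * gb \<tau>)) *\<^sub>R br x0 (J z0 x0)"
    unfolding geo_V_deriv_eq br_lin br_antisym[of x0 "J z0 x0"]
    by (simp add: br_alternating algebra_simps)
  also have "ga \<tau> * ga \<tau> - gb \<tau> * (1 - ?k * gb \<tau>) = gb \<tau>"
    using gab[of \<tau>] by (simp add: power2_eq_square algebra_simps)
  finally show ?thesis by (simp add: br_J)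
qed

private lemma norm_geo_V_deriv: "(norm (geo_V_deriv v \<tau>))\<^sup>2 = (norm x0)\<^sup>2 / (inv_height v \<tau>)\<^sup>2"
proof -
  let ?k = "(norm z0)\<^sup>2" and ?p = "(1 - (norm z0)\<^sup>2 * gb \<tau>) *\<^sub>R x0 + ga \<tau> *\<^sub>R J z0 x0"
  have "(norm ?p)\<^sup>2 = ((1 - ?k * gb \<tau>)\<^sup>2 + (ga \<tau>)\<^sup>2 * ?k) * (norm x0)\<^sup>2"
    unfolding power2_norm_eq_inner[of ?p]
    by (simp add: inner_add_left inner_add_right inner_JJ dot_square_norm[of x0] power2_eq_square algebra_simps)
  also have "(1 - ?k * gb \<tau>)\<^sup>2 + (ga \<tau>)\<^sup>2 * ?k = 1"
    using gab[of \<tau>] by algebra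
  finally show ?thesis unfolding geo_V_deriv_eq by (simp add: power_mult_distrib power_divide)
qed

text \<open>The bracket term in the velocity is the one that makes \<open>vert\<close> equal to \<open>z / y\<^sup>2\<close>.\<close>

lemma geo_has_derivative: "(geo v has_vector_derivative geo' v \<tau>) (at \<tau>)"
proof -
  have n: "inv_height v \<tau> \<noteq> 0" using inv_height_pos[of \<tau>] by simp
  have 1: "((\<lambda>\<tau>. 1 / inv_height v \<tau>) has_field_derivative - inv_height' v \<tau> / (inv_height v \<tau>)\<^sup>2) (at \<tau>)"
    using n by (auto intro!: derivative_eq_intros simp: power2_eq_square)
  have 2: "((\<lambda>\<tau>. ga \<tau> *\<^sub>R x0 + gb \<tau> *\<^sub>R J z0 x0 + gz \<tau> *\<^sub>R z0) has_vector_derivative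
     ((1 - (norm z0)\<^sup>2 * gb \<tau>) / inv_height v \<tau>) *\<^sub>R x0 + (ga \<tau> / inv_height v \<tau>) *\<^sub>R J z0 x0
     + (1 / (inv_height v \<tau>)\<^sup>2 + gb \<tau> * (norm x0)\<^sup>2 / (2 * inv_height v \<tau>)) *\<^sub>R z0) (at \<tau>)"
    by (auto intro!: derivative_eq_intros has_vector_derivative_scaleR[THEN has_vector_derivative_eq_rhs] ga_deriv gb_deriv gz_deriv)
  have "geo' v \<tau> = (((1 - (norm z0)\<^sup>2 * gb \<tau>) / inv_height v \<tau>) *\<^sub>R x0 + (ga \<tau> / inv_height v \<tau>) *\<^sub>R J z0 x0
     + (1 / (inv_height v \<tau>)\<^sup>2 + gb \<tau> * (norm x0)\<^sup>2 / (2 * inv_height v \<tau>)) *\<^sub>R z0, - inv_height' v \<tau> / (inv_height v \<tau>)\<^sup>2)"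
    unfolding geo'_def br_geo_geo_V_deriv unfolding geo_V_deriv_eq z0_def[symmetric] by (simp add: scaleR_add_right scaleR_add_left add.assoc)
  then show ?thesis unfolding geo_eq[abs_def]
    using has_vector_derivative_Pair[OF 2 1[unfolded has_real_derivative_iff_has_vector_derivative]] by simp
qed

lemma geo_V_deriv_V [simp]: "geo_V_deriv v \<tau> \<in> V"
  unfolding geo_V_deriv_def using subspace_V J_in_V by (intro subspace_scale subspace_add) auto

private lemma V_geo': "V_part (fst (geo' v \<tau>)) = geo_V_deriv v \<tau>"
  and vert_geo': "vert (fst (geo v \<tau>)) (fst (geo' v \<tau>)) = (1 / (inv_height v \<tau>)\<^sup>2) *\<^sub>R z0"
proof -
  show "V_part (fst (geo' v \<tau>)) = geo_V_deriv v \<tau>" unfolding geo'_def by (simp add: part_linear V_part_id)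
  show "vert (fst (geo v \<tau>)) (fst (geo' v \<tau>)) = (1 / (inv_height v \<tau>)\<^sup>2) *\<^sub>R z0"
    unfolding geo'_def vert_def by (simp add: part_linear V_part_id br_lin z0_def)
qed

lemma geo_in_S: "geo v \<tau> \<in> S"
  using inv_height_pos[of \<tau>] by (simp add: geo_eq)

text \<open>Unit speed: this is the first integral \<open>y\<^sup>2 = |x|\<^sup>2 y + |z|\<^sup>2 + y'\<^sup>2\<close> divided by \<open>y\<^sup>2\<close>.\<close>

lemma metric_geo': "metric (geo v \<tau>) (geo' v \<tau>) (geo' v \<tau>) = 1"
proof -
  have y: "inv_height v \<tau> > 0" by (rule inv_height_pos)
  have "metric (geo v \<tau>) (geo' v \<tau>) (geo' v \<tau>)
     = (norm (geo_V_deriv v \<tau>))\<^sup>2 * inv_height v \<tau> + (norm z0)\<^sup>2 / (inv_height v \<tau>)\<^sup>2 + (inv_height' v \<tau>)\<^sup>2 / (inv_height v \<tau>)\<^sup>2"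
  proof -
    have g: "geo v \<tau> = (fst (geo v \<tau>), 1 / inv_height v \<tau>)" "geo' v \<tau> = (fst (geo' v \<tau>), - inv_height' v \<tau> / (inv_height v \<tau>)\<^sup>2)"
      by (simp_all add: geo_eq geo'_def)
    have "metric (geo v \<tau>) (geo' v \<tau>) (geo' v \<tau>)
       = (geo_V_deriv v \<tau> \<bullet> geo_V_deriv v \<tau>) / (1 / inv_height v \<tau>)
         + (((1 / (inv_height v \<tau>)\<^sup>2) *\<^sub>R z0) \<bullet> ((1 / (inv_height v \<tau>)\<^sup>2) *\<^sub>R z0)) / (1 / inv_height v \<tau>)\<^sup>2
         + (- inv_height' v \<tau> / (inv_height v \<tau>)\<^sup>2) * (- inv_height' v \<tau> / (inv_height v \<tau>)\<^sup>2) / (1 / inv_height v \<tau>)\<^sup>2"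
      using y metric_vert[of "1 / inv_height v \<tau>" "fst (geo v \<tau>)" "fst (geo' v \<tau>)" "- inv_height' v \<tau> / (inv_height v \<tau>)\<^sup>2" "fst (geo' v \<tau>)" "- inv_height' v \<tau> / (inv_height v \<tau>)\<^sup>2"]
      unfolding V_geo' vert_geo' by (simp only: g[symmetric] zero_less_divide_1_iff)
    then show ?thesis using y
      by (simp add: dot_square_norm power_divide power_mult_distrib) (simp add: power2_eq_square power4_eq_xxxx divide_simps)
  qed
  also have "\<dots> = ((norm x0)\<^sup>2 * inv_height v \<tau> + (norm z0)\<^sup>2 + (inv_height' v \<tau>)\<^sup>2) / (inv_height v \<tau>)\<^sup>2"
    using y unfolding norm_geo_V_deriv by (simp add: add_divide_distrib)
  also have "\<dots> = 1" unfolding inv_height_quadratic[of \<tau>, symmetric] using y by simp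
  finally show ?thesis .
qed

lemma geo'_has_derivative: "(geo' v has_vector_derivative geodesic_acc (geo v \<tau>) (geo' v \<tau>)) (at \<tau>)"
proof -
  let ?y = "inv_height v \<tau>" and ?y' = "inv_height' v \<tau>" and ?u = "geo_V_deriv v \<tau>" and ?w = "fst (geo v \<tau>)"
  have n: "?y \<noteq> 0" using inv_height_pos[of \<tau>] by simp
  have 1: "((\<lambda>\<tau>. 1 / inv_height v \<tau>) has_real_derivative - ?y' / ?y\<^sup>2) (at \<tau>)"
    using n by (auto intro!: derivative_eq_intros simp: power2_eq_square)
  have dw: "((\<lambda>\<tau>. fst (geo v \<tau>)) has_vector_derivative fst (geo' v \<tau>)) (at \<tau>)"
    by (rule bounded_linear.has_vector_derivative[OF bounded_linear_fst geo_has_derivative])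
  have dX: "((\<lambda>\<tau>. x0 + J z0 (V_part (fst (geo v \<tau>)))) has_vector_derivative J z0 ?u) (at \<tau>)"
    using bounded_linear.has_vector_derivative[OF bounded_linear_J[of z0]
      bounded_linear.has_vector_derivative[OF bounded_linear_V_part dw]]
    by (auto intro!: derivative_eq_intros simp: V_geo')
  define x2 where "x2 = (- ?y' / ?y) *\<^sub>R ?u + (1 / ?y) *\<^sub>R J z0 ?u"
  have du: "(geo_V_deriv v has_vector_derivative x2) (at \<tau>)"
  proof -
    have "((\<lambda>\<tau>. (1 / inv_height v \<tau>) *\<^sub>R (x0 + J z0 (V_part (fst (geo v \<tau>))))) has_vector_derivative
       (1 / ?y) *\<^sub>R J z0 ?u + (- ?y' / ?y\<^sup>2) *\<^sub>R (x0 + J z0 (V_part (fst (geo v \<tau>))))) (at \<tau>)"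
      by (rule has_vector_derivative_scaleR[OF 1 dX])
    moreover have geo_V_deriv: "geo_V_deriv v = (\<lambda>\<tau>. (1 / inv_height v \<tau>) *\<^sub>R (x0 + J z0 (V_part (fst (geo v \<tau>)))))"
      by (simp add: geo_V_deriv_def fun_eq_iff x0_def z0_def)
    moreover have "(- ?y' / ?y\<^sup>2) *\<^sub>R (x0 + J z0 (V_part (fst (geo v \<tau>)))) = (- ?y' / ?y) *\<^sub>R ?u"
    proof -
      have "?u = (1 / ?y) *\<^sub>R (x0 + J z0 (V_part (fst (geo v \<tau>))))" by (simp only: geo_V_deriv)
      then show ?thesis by (simp add: power2_eq_square)
    qed
    ultimately show ?thesis by (simp only: x2_def add.commute)
  qed
  have db: "((\<lambda>\<tau>. br (fst (geo v \<tau>)) (geo_V_deriv v \<tau>)) has_vector_derivative br ?w x2) (at \<tau>)"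
  proof -
    have "br (fst (geo' v \<tau>)) ?u = br (V_part (fst (geo' v \<tau>))) ?u" by simp
    then have "br (fst (geo' v \<tau>)) ?u = 0" unfolding V_geo' by (simp add: br_alternating)
    then show ?thesis
      using bounded_bilinear.has_vector_derivative[OF bounded_bilinear_br dw du] by simp
  qed
  have d2: "((\<lambda>\<tau>. 1 / (inv_height v \<tau>)\<^sup>2) has_real_derivative - 2 * ?y' / ?y ^ 3) (at \<tau>)"
    using n by (auto intro!: derivative_eq_intros simp: power2_eq_square power3_eq_cube field_simps)
  have d1: "((\<lambda>\<tau>. geo_V_deriv v \<tau> + (1 / (inv_height v \<tau>)\<^sup>2) *\<^sub>R z0 + (1/2) *\<^sub>R br (fst (geo v \<tau>)) (geo_V_deriv v \<tau>)) has_vector_derivative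
     x2 + (- 2 * ?y' / ?y ^ 3) *\<^sub>R z0 + (1/2) *\<^sub>R br ?w x2) (at \<tau>)"
  proof -
    have A: "((\<lambda>\<tau>. (1 / (inv_height v \<tau>)\<^sup>2) *\<^sub>R z0) has_vector_derivative (- 2 * ?y' / ?y ^ 3) *\<^sub>R z0) (at \<tau>)"
      using has_vector_derivative_scaleR[OF d2 has_vector_derivative_const[of z0]] by simp
    show ?thesis
      by (rule has_vector_derivative_add[OF has_vector_derivative_add[OF du A]
        bounded_linear.has_vector_derivative[OF bounded_linear_scaleR_right[of "1/2"] db]])
  qed
  have ds: "((\<lambda>\<tau>. - inv_height' v \<tau> / (inv_height v \<tau>)\<^sup>2) has_real_derivative - (?y + B - 1) / ?y\<^sup>2 + 2 * ?y'\<^sup>2 / ?y ^ 3) (at \<tau>)"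
    using n by (auto intro!: derivative_eq_intros simp: power2_eq_square power3_eq_cube field_simps)
  have "geodesic_acc (geo v \<tau>) (geo' v \<tau>) = (x2 + (- 2 * ?y' / ?y ^ 3) *\<^sub>R z0 + (1/2) *\<^sub>R br ?w x2,
      - (?y + B - 1) / ?y\<^sup>2 + 2 * ?y'\<^sup>2 / ?y ^ 3)"
  proof -
    have g: "geo v \<tau> = (?w, 1 / ?y)" "geo' v \<tau> = (fst (geo' v \<tau>), - ?y' / ?y\<^sup>2)"
      by (simp_all add: geo_eq geo'_def)
    have z: "(1 / (1 / ?y)\<^sup>2) *\<^sub>R vert ?w (fst (geo' v \<tau>)) = z0"
      unfolding vert_geo' using n by (simp add: power_divide)
    have x: "(- ?y' / ?y\<^sup>2 / (1 / ?y)) *\<^sub>R ?u + (1 / ?y) *\<^sub>R J z0 ?u = x2"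
      unfolding x2_def using n by (simp add: power2_eq_square)
    have key: "2 * (?y + B - 1) * ?y = ?y'\<^sup>2 + ?y\<^sup>2 + (norm z0)\<^sup>2"
      unfolding z0_sq inv_height_B inv_height'_B using sinh_sq[of \<tau>] by algebra
    have "(- ?y' / ?y\<^sup>2)\<^sup>2 / (1 / ?y) - (norm ?u)\<^sup>2 / 2 - (1 / ?y) ^ 3 * (norm z0)\<^sup>2
        = - (?y + B - 1) / ?y\<^sup>2 + 2 * ?y'\<^sup>2 / ?y ^ 3"
    proof -
      have x0: "(norm x0)\<^sup>2 = (?y\<^sup>2 - (norm z0)\<^sup>2 - ?y'\<^sup>2) / ?y" using inv_height_quadratic[of \<tau>] n by (simp add: field_simps)
      have b: "B = (?y'\<^sup>2 + ?y\<^sup>2 + (norm z0)\<^sup>2) / (2 * ?y) + 1 - ?y" using key n by (simp add: field_simps)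
      show ?thesis unfolding norm_geo_V_deriv x0 unfolding b using n
        by (simp add: field_simps power2_eq_square power3_eq_cube)
    qed
    moreover have "2 * (1 / ?y) * (- ?y' / ?y\<^sup>2) = - 2 * ?y' / ?y ^ 3"
      using n by (simp add: power2_eq_square power3_eq_cube)
    ultimately have "geodesic_acc (?w, 1 / ?y) (fst (geo' v \<tau>), - ?y' / ?y\<^sup>2) =
      (x2 + (1/2) *\<^sub>R br ?w x2 + (- 2 * ?y' / ?y ^ 3) *\<^sub>R z0, - (?y + B - 1) / ?y\<^sup>2 + 2 * ?y'\<^sup>2 / ?y ^ 3)"
      unfolding geodesic_acc_def Let_def prod.case z V_geo' x by (simp only:)
    then have "geodesic_acc (geo v \<tau>) (geo' v \<tau>) =
      (x2 + (1/2) *\<^sub>R br ?w x2 + (- 2 * ?y' / ?y ^ 3) *\<^sub>R z0, - (?y + B - 1) / ?y\<^sup>2 + 2 * ?y'\<^sup>2 / ?y ^ 3)"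
      by (simp only: g[symmetric])
    then show ?thesis by (simp only: add.assoc add.commute[of "(1/2) *\<^sub>R br ?w x2"])
  qed
  then show ?thesis unfolding geo'_def[abs_def] z0_def[symmetric]
    using has_vector_derivative_Pair[OF d1 ds[unfolded has_real_derivative_iff_has_vector_derivative]] by (simp add: geo'_def z0_def)
qed

lemma geo_0: "geo v 0 = e" "geo' v 0 = v"
proof -
  have y: "inv_height v 0 = 1" "inv_height' v 0 = - t0" by (simp_all add: inv_height_B inv_height'_B)
  show 1: "geo v 0 = e" by (simp add: geo_def y e_def)
  have "geo_V_deriv v 0 = x0" by (simp add: geo_V_deriv_def y 1 x0_def e_def)
  then show "geo' v 0 = v" by (simp add: geo'_def y 1 e_def x0_def V_Z_decomp t0_def)
qed

lemma geodesic_geo: "geodesic_from S metric e v (geo v)"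
  unfolding geodesic_from_iff using geo_0 geo_in_S geo_has_derivative geo'_has_derivative by blast

text \<open>The geodesic equation is integrable. The quotient of \<open>vert\<close> by the square of the height is
constant, equal to \<open>z\<close>; so is \<open>X'/s - J\<^sub>z X\<close>, equal to \<open>x\<close>; and so is the speed. With these, the reciprocal
of the height satisfies the linear equation of \<open>inv_height\<close>. Once the height is known, the \<open>V\<close>-part satisfies
a linear equation with skew coefficients, so the difference of two solutions has constant norm, and the
\<open>Z\<close>-part is an integral of known functions. Solving by conservation laws keeps the argument global in time.\<close>

lemma geodesic_unique:
  assumes geod: "geodesic_from S metric e v \<gamma>"
  shows "\<gamma> \<tau> = geo v \<tau>"
proof -
  obtain \<gamma>' where g0: "\<gamma> 0 = e" "\<gamma>' 0 = v" and inS: "\<And>\<tau>. \<gamma> \<tau> \<in> S"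
    and d1: "\<And>\<tau>. (\<gamma> has_vector_derivative \<gamma>' \<tau>) (at \<tau>)"
    and d2: "\<And>\<tau>. (\<gamma>' has_vector_derivative geodesic_acc (\<gamma> \<tau>) (\<gamma>' \<tau>)) (at \<tau>)"
    using geod unfolding geodesic_from_iff by blast
  define w s w' a where "w \<tau> = fst (\<gamma> \<tau>)" and "s \<tau> = snd (\<gamma> \<tau>)"
    and "w' \<tau> = fst (\<gamma>' \<tau>)" and "a \<tau> = snd (\<gamma>' \<tau>)" for \<tau>
  define u where "u \<tau> = V_part (w' \<tau>)" for \<tau>
  define q where "q \<tau> = vert (w \<tau>) (w' \<tau>)" for \<tau>
  define w2 where "w2 \<tau> = fst (geodesic_acc (\<gamma> \<tau>) (\<gamma>' \<tau>))" for \<tau>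
  let ?k = "(norm z0)\<^sup>2"
  have s: "s \<tau> > 0" for \<tau> using inS[of \<tau>] by (simp add: S_def s_def split: prod.splits)
  have s0: "s \<tau> \<noteq> 0" for \<tau> using s[of \<tau>] by simp
  have gp: "\<gamma> \<tau> = (w \<tau>, s \<tau>)" "\<gamma>' \<tau> = (w' \<tau>, a \<tau>)" for \<tau> by (simp_all add: w_def s_def w'_def a_def)
  have init: "w 0 = 0" "s 0 = 1" "w' 0 = fst v" "a 0 = t0" "u 0 = x0" "q 0 = z0"
    using g0 by (simp_all add: w_def s_def w'_def a_def u_def q_def vert_def e_def t0_def x0_def z0_def)
  have dw: "(w has_vector_derivative w' \<tau>) (at \<tau>)" for \<tau>
    unfolding w_def[abs_def] w'_def by (rule bounded_linear.has_vector_derivative[OF bounded_linear_fst d1])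
  have ds: "(s has_real_derivative a \<tau>) (at \<tau>)" for \<tau>
    unfolding s_def[abs_def] a_def has_real_derivative_iff_has_vector_derivative
    by (rule bounded_linear.has_vector_derivative[OF bounded_linear_snd d1])
  have dw': "(w' has_vector_derivative w2 \<tau>) (at \<tau>)" for \<tau>
    unfolding w'_def[abs_def] w2_def by (rule bounded_linear.has_vector_derivative[OF bounded_linear_fst d2])
  have geodesic_acc: "vert (w \<tau>) (w2 \<tau>) = (2 * a \<tau> / s \<tau>) *\<^sub>R q \<tau>"
    "V_part (w2 \<tau>) = (a \<tau> / s \<tau>) *\<^sub>R u \<tau> + (1 / s \<tau>) *\<^sub>R J (q \<tau>) (u \<tau>)"
    "snd (geodesic_acc (\<gamma> \<tau>) (\<gamma>' \<tau>)) = (a \<tau>)\<^sup>2 / s \<tau> - (norm (u \<tau>))\<^sup>2 / 2 - (norm (q \<tau>))\<^sup>2 / s \<tau>" for \<tau>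
    using vert_geodesic_acc[OF s[of \<tau>], of "w \<tau>" "w' \<tau>" "a \<tau>"] by (simp_all add: w2_def u_def q_def gp)
  have da: "(a has_real_derivative (a \<tau>)\<^sup>2 / s \<tau> - (norm (u \<tau>))\<^sup>2 / 2 - (norm (q \<tau>))\<^sup>2 / s \<tau>) (at \<tau>)" for \<tau>
    unfolding a_def[abs_def] has_real_derivative_iff_has_vector_derivative
    using bounded_linear.has_vector_derivative[OF bounded_linear_snd d2[of \<tau>]] geodesic_acc(3)[of \<tau>] by (simp add: a_def)
  have dVw: "((\<lambda>\<tau>. V_part (w \<tau>)) has_vector_derivative u \<tau>) (at \<tau>)" for \<tau>
    unfolding u_def by (rule bounded_linear.has_vector_derivative[OF bounded_linear_V_part dw])
  have dq: "(q has_vector_derivative (2 * a \<tau> / s \<tau>) *\<^sub>R q \<tau>) (at \<tau>)" for \<tau>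
  proof -
    have "((\<lambda>\<tau>. Z_part (w' \<tau>) - (1/2) *\<^sub>R br (w \<tau>) (w' \<tau>)) has_vector_derivative
       Z_part (w2 \<tau>) - (1/2) *\<^sub>R (br (w \<tau>) (w2 \<tau>) + br (w' \<tau>) (w' \<tau>))) (at \<tau>)"
      by (intro has_vector_derivative_diff bounded_linear.has_vector_derivative[OF bounded_linear_Z_part]
          bounded_linear.has_vector_derivative[OF bounded_linear_scaleR_right]
          bounded_bilinear.has_vector_derivative[OF bounded_bilinear_br] dw dw')
    then show ?thesis using geodesic_acc(1)[of \<tau>] unfolding q_def[abs_def] vert_def by (simp add: br_alternating)
  qed
  have q: "q \<tau> = (s \<tau>)\<^sup>2 *\<^sub>R z0" for \<tau>
  proof -
    have "((\<lambda>\<tau>. (1 / (s \<tau>)\<^sup>2) *\<^sub>R q \<tau>) has_vector_derivative 0) (at \<tau>)" for \<tau>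
    proof -
      have A: "((\<lambda>\<tau>. 1 / (s \<tau>)\<^sup>2) has_real_derivative - 2 * a \<tau> / s \<tau> ^ 3) (at \<tau>)"
        using s0 by (auto intro!: derivative_eq_intros ds simp: power2_eq_square power3_eq_cube field_simps)
      have "((\<lambda>\<tau>. (1 / (s \<tau>)\<^sup>2) *\<^sub>R q \<tau>) has_vector_derivative
         (1 / (s \<tau>)\<^sup>2) *\<^sub>R (2 * a \<tau> / s \<tau>) *\<^sub>R q \<tau> + (- 2 * a \<tau> / s \<tau> ^ 3) *\<^sub>R q \<tau>) (at \<tau>)"
        by (rule has_vector_derivative_scaleR[OF A dq])
      moreover have "(1 / (s \<tau>)\<^sup>2) *\<^sub>R (2 * a \<tau> / s \<tau>) *\<^sub>R q \<tau> + (- 2 * a \<tau> / s \<tau> ^ 3) *\<^sub>R q \<tau> = 0"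
        by (simp add: power2_eq_square power3_eq_cube mult.assoc)
      ultimately show ?thesis by (simp only:)
    qed
    from has_vector_derivative_zero_imp_const[OF this, of \<tau>]
    have "(1 / (s \<tau>)\<^sup>2) *\<^sub>R q \<tau> = z0" by (simp add: init)
    then have "(s \<tau>)\<^sup>2 *\<^sub>R ((1 / (s \<tau>)\<^sup>2) *\<^sub>R q \<tau>) = (s \<tau>)\<^sup>2 *\<^sub>R z0" by simp
    then show ?thesis using s0 by simp
  qed
  have nq: "(norm (q \<tau>))\<^sup>2 = s \<tau> ^ 4 * ?k" for \<tau>
    unfolding q by (simp add: power_mult_distrib)
  have du: "(u has_vector_derivative (a \<tau> / s \<tau>) *\<^sub>R u \<tau> + s \<tau> *\<^sub>R J z0 (u \<tau>)) (at \<tau>)" for \<tau>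
  proof -
    have "V_part (w2 \<tau>) = (a \<tau> / s \<tau>) *\<^sub>R u \<tau> + s \<tau> *\<^sub>R J z0 (u \<tau>)"
      unfolding geodesic_acc(2) q J_scale_left using s0 by (simp add: power2_eq_square)
    then show ?thesis
      using bounded_linear.has_vector_derivative[OF bounded_linear_V_part dw'[of \<tau>]] by (simp add: u_def[abs_def])
  qed
  have d_inv: "((\<lambda>\<tau>. 1 / s \<tau>) has_real_derivative - a \<tau> / (s \<tau>)\<^sup>2) (at \<tau>)" for \<tau>
    using s0 by (auto intro!: derivative_eq_intros ds simp: power2_eq_square)
  have u: "u \<tau> = s \<tau> *\<^sub>R (x0 + J z0 (V_part (w \<tau>)))" for \<tau>
  proof -
    have "((\<lambda>\<tau>. (1 / s \<tau>) *\<^sub>R u \<tau> - J z0 (V_part (w \<tau>))) has_vector_derivative 0) (at \<tau>)" for \<tau>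
    proof -
      have "((\<lambda>\<tau>. (1 / s \<tau>) *\<^sub>R u \<tau> - J z0 (V_part (w \<tau>))) has_vector_derivative
        ((1 / s \<tau>) *\<^sub>R ((a \<tau> / s \<tau>) *\<^sub>R u \<tau> + s \<tau> *\<^sub>R J z0 (u \<tau>)) + (- a \<tau> / (s \<tau>)\<^sup>2) *\<^sub>R u \<tau>) - J z0 (u \<tau>)) (at \<tau>)"
        by (intro has_vector_derivative_diff has_vector_derivative_scaleR d_inv du
          bounded_linear.has_vector_derivative[OF bounded_linear_J] dVw)
      then show ?thesis using s0 by (simp add: scaleR_add_right power2_eq_square)
    qed
    from has_vector_derivative_zero_imp_const[OF this, of \<tau>]
    have "(1 / s \<tau>) *\<^sub>R u \<tau> = x0 + J z0 (V_part (w \<tau>))" by (simp add: init diff_eq_eq)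
    then have "s \<tau> *\<^sub>R ((1 / s \<tau>) *\<^sub>R u \<tau>) = s \<tau> *\<^sub>R (x0 + J z0 (V_part (w \<tau>)))" by simp
    then show ?thesis using s0 by simp
  qed
  define n where "n \<tau> = (norm (u \<tau>))\<^sup>2" for \<tau>
  have dn: "(n has_real_derivative 2 * a \<tau> / s \<tau> * n \<tau>) (at \<tau>)" for \<tau>
  proof -
    have "((\<lambda>\<tau>. u \<tau> \<bullet> u \<tau>) has_vector_derivative
      u \<tau> \<bullet> ((a \<tau> / s \<tau>) *\<^sub>R u \<tau> + s \<tau> *\<^sub>R J z0 (u \<tau>)) + ((a \<tau> / s \<tau>) *\<^sub>R u \<tau> + s \<tau> *\<^sub>R J z0 (u \<tau>)) \<bullet> u \<tau>) (at \<tau>)"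
      by (rule bounded_bilinear.has_vector_derivative[OF bounded_bilinear_inner du du])
    then show ?thesis unfolding n_def[abs_def] power2_norm_eq_inner has_real_derivative_iff_has_vector_derivative
      by (simp add: inner_add_left inner_add_right mult.assoc)
  qed
  have n: "n \<tau> = s \<tau> * (1 - (s \<tau>)\<^sup>2 * ?k - (a \<tau>)\<^sup>2 / (s \<tau>)\<^sup>2)" for \<tau>
  proof -
    have "((\<lambda>\<tau>. n \<tau> / s \<tau> + (s \<tau>)\<^sup>2 * ?k + (a \<tau>)\<^sup>2 / (s \<tau>)\<^sup>2) has_real_derivative 0) (at \<tau>)" for \<tau>
      using s0[of \<tau>]
      by (auto intro!: derivative_eq_intros ds da dn simp: nq n_def[symmetric])
        (simp add: divide_simps eval_nat_numeral algebra_simps)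
    then have "n \<tau> / s \<tau> + (s \<tau>)\<^sup>2 * ?k + (a \<tau>)\<^sup>2 / (s \<tau>)\<^sup>2 = n 0 / s 0 + (s 0)\<^sup>2 * ?k + (a 0)\<^sup>2 / (s 0)\<^sup>2"
      using DERIV_isconst_all by blast
    also have "\<dots> = 1" using unit_eq by (simp add: init n_def)
    finally have "n \<tau> / s \<tau> = 1 - (s \<tau>)\<^sup>2 * ?k - (a \<tau>)\<^sup>2 / (s \<tau>)\<^sup>2" by simp
    then show ?thesis using s0[of \<tau>] by (simp add: field_simps)
  qed
  have da': "(a has_real_derivative 3 * (a \<tau>)\<^sup>2 / (2 * s \<tau>) - s \<tau> ^ 3 * ?k / 2 - s \<tau> / 2) (at \<tau>)" for \<tau>
  proof (rule DERIV_cong[OF da])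
    have "(a \<tau>)\<^sup>2 / s \<tau> - n \<tau> / 2 - s \<tau> ^ 4 * ?k / s \<tau> = 3 * (a \<tau>)\<^sup>2 / (2 * s \<tau>) - s \<tau> ^ 3 * ?k / 2 - s \<tau> / 2"
      unfolding n using s0[of \<tau>]
      by (simp add: divide_simps eval_nat_numeral algebra_simps)
    then show "(a \<tau>)\<^sup>2 / s \<tau> - (norm (u \<tau>))\<^sup>2 / 2 - (norm (q \<tau>))\<^sup>2 / s \<tau> = 3 * (a \<tau>)\<^sup>2 / (2 * s \<tau>) - s \<tau> ^ 3 * ?k / 2 - s \<tau> / 2"
      by (simp only: nq n_def)
  qed
  have F: "(a \<tau>)\<^sup>2 / (2 * s \<tau> ^ 3) + s \<tau> * ?k / 2 - 1 / (2 * s \<tau>) = B - 1" for \<tau>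
  proof -
    have "((\<lambda>\<tau>. (a \<tau>)\<^sup>2 / (2 * s \<tau> ^ 3) + s \<tau> * ?k / 2 - 1 / (2 * s \<tau>)) has_real_derivative 0) (at \<tau>)" for \<tau>
      using s0[of \<tau>]
      by (auto intro!: derivative_eq_intros ds da')
        (simp add: divide_simps eval_nat_numeral algebra_simps)
    then have "(a \<tau>)\<^sup>2 / (2 * s \<tau> ^ 3) + s \<tau> * ?k / 2 - 1 / (2 * s \<tau>) = (a 0)\<^sup>2 / (2 * s 0 ^ 3) + s 0 * ?k / 2 - 1 / (2 * s 0)"
      using DERIV_isconst_all by blast
    then show ?thesis by (simp add: init B_def field_simps)
  qed
  have dp: "((\<lambda>\<tau>. - a \<tau> / (s \<tau>)\<^sup>2) has_real_derivative 1 / s \<tau> + (B - 1)) (at \<tau>)" for \<tau>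
    unfolding F[of \<tau>, symmetric] using s0[of \<tau>]
    by (auto intro!: derivative_eq_intros ds da')
      (simp add: divide_simps eval_nat_numeral algebra_simps)
  have y: "1 / s \<tau> = inv_height v \<tau>" for \<tau>
  proof -
    have "1 / s \<tau> - inv_height v \<tau> = 0"
    proof (rule hyperbolic_ode_unique[where d = "\<lambda>\<tau>. 1 / s \<tau> - inv_height v \<tau>" and d' = "\<lambda>\<tau>. - a \<tau> / (s \<tau>)\<^sup>2 - inv_height' v \<tau>"])
      show "((\<lambda>\<tau>. 1 / s \<tau> - inv_height v \<tau>) has_real_derivative - a \<tau> / (s \<tau>)\<^sup>2 - inv_height' v \<tau>) (at \<tau>)" for \<tau>
        by (rule DERIV_diff[OF d_inv inv_height_derivs(1)])
      show "((\<lambda>\<tau>. - a \<tau> / (s \<tau>)\<^sup>2 - inv_height' v \<tau>) has_real_derivative 1 / s \<tau> - inv_height v \<tau>) (at \<tau>)" for \<tau>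
        using DERIV_diff[OF dp inv_height_derivs(2), of \<tau>] by simp
    qed (simp_all add: init inv_height_B inv_height'_B)
    then show ?thesis by simp
  qed
  have sy: "s \<tau> = 1 / inv_height v \<tau>" for \<tau> by (simp add: y[symmetric])
  define d where "d \<tau> = V_part (w \<tau>) - V_part (fst (geo v \<tau>))" for \<tau>
  have dgw: "((\<lambda>\<tau>. fst (geo v \<tau>)) has_vector_derivative fst (geo' v \<tau>)) (at \<tau>)" for \<tau>
    by (rule bounded_linear.has_vector_derivative[OF bounded_linear_fst geo_has_derivative])
  have dgV: "((\<lambda>\<tau>. V_part (fst (geo v \<tau>))) has_vector_derivative geo_V_deriv v \<tau>) (at \<tau>)" for \<tau>
    using bounded_linear.has_vector_derivative[OF bounded_linear_V_part dgw[of \<tau>]] by (simp add: V_geo')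
  have ug: "u \<tau> - geo_V_deriv v \<tau> = s \<tau> *\<^sub>R J z0 (d \<tau>)" for \<tau>
    unfolding u geo_V_deriv_def d_def J_diff_right sy by (simp add: x0_def z0_def scaleR_add_right scaleR_diff_right)
  have dd: "(d has_vector_derivative s \<tau> *\<^sub>R J z0 (d \<tau>)) (at \<tau>)" for \<tau>
    unfolding ug[symmetric] unfolding d_def[abs_def] by (rule has_vector_derivative_diff[OF dVw dgV])
  have "((\<lambda>\<tau>. d \<tau> \<bullet> d \<tau>) has_vector_derivative 0) (at \<tau>)" for \<tau>
    using bounded_bilinear.has_vector_derivative[OF bounded_bilinear_inner dd dd, of \<tau>] by simp
  from has_vector_derivative_zero_imp_const[OF this]
  have d0: "d \<tau> = 0" for \<tau> using geo_0(1) by (simp add: d_def init e_def)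
  have Vw: "V_part (w \<tau>) = V_part (fst (geo v \<tau>))" and uu: "u \<tau> = geo_V_deriv v \<tau>" for \<tau>
    using d0[of \<tau>] ug[of \<tau>] by (simp_all add: d_def)
  have "((\<lambda>\<tau>. Z_part (w \<tau>) - Z_part (fst (geo v \<tau>))) has_vector_derivative 0) (at \<tau>)" for \<tau>
  proof -
    have "Z_part (w' \<tau>) = q \<tau> + (1/2) *\<^sub>R br (V_part (w \<tau>)) (u \<tau>)"
      by (simp add: q_def vert_def u_def)
    moreover have "Z_part (fst (geo' v \<tau>)) = (1 / (inv_height v \<tau>)\<^sup>2) *\<^sub>R z0 + (1/2) *\<^sub>R br (V_part (fst (geo v \<tau>))) (geo_V_deriv v \<tau>)"
      unfolding geo'_def by (simp add: part_linear V_part_id z0_def)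
    ultimately have "Z_part (w' \<tau>) - Z_part (fst (geo' v \<tau>)) = 0"
      by (simp only: q Vw uu sy) (simp add: power_divide)
    then show ?thesis
      using has_vector_derivative_diff[OF bounded_linear.has_vector_derivative[OF bounded_linear_Z_part dw[of \<tau>]]
        bounded_linear.has_vector_derivative[OF bounded_linear_Z_part dgw[of \<tau>]]] by simp
  qed
  from has_vector_derivative_zero_imp_const[OF this, of \<tau>]
  have Zw: "Z_part (w \<tau>) = Z_part (fst (geo v \<tau>))" using geo_0(1) by (simp add: init e_def)
  have "w \<tau> = V_part (w \<tau>) + Z_part (w \<tau>)" by (simp only: V_Z_decomp)
  also have "\<dots> = fst (geo v \<tau>)" by (simp only: Vw Zw V_Z_decomp)
  finally have "w \<tau> = fst (geo v \<tau>)" .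
  moreover have "s \<tau> = snd (geo v \<tau>)" by (simp add: sy geo_eq)
  ultimately show ?thesis by (simp add: gp prod_eq_iff)
qed

lemma cap_geo:
  "(snd (geo v \<tau>) + (norm (V_part (fst (geo v \<tau>))))\<^sup>2 / 4)\<^sup>2 + (norm (Z_part (fst (geo v \<tau>))))\<^sup>2
     = 1 + 2 * snd v * sinh \<tau> * snd (geo v \<tau>)"
  and cosh_geo: "(1 + snd (geo v \<tau>) + (norm (V_part (fst (geo v \<tau>))))\<^sup>2 / 4)\<^sup>2 + (norm (Z_part (fst (geo v \<tau>))))\<^sup>2
     = 2 * snd (geo v \<tau>) * (1 + cosh \<tau>)"
proof -
  let ?y = "inv_height v \<tau>" and ?c = "cosh \<tau>" and ?s = "sinh \<tau>"
  have y: "?y > 0" by (rule inv_height_pos)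
  have x: "(norm x0)\<^sup>2 = 2 - 2 * B" using unit_eq by (simp add: B_def field_simps)
  have "(norm (V_part (fst (geo v \<tau>))))\<^sup>2 = ((ga \<tau>)\<^sup>2 + (norm z0)\<^sup>2 * (gb \<tau>)\<^sup>2) * (norm x0)\<^sup>2"
    unfolding V_geo power2_norm_eq_inner[of "_ + _"]
    by (simp add: inner_add_left inner_add_right inner_JJ dot_square_norm[of x0] power2_eq_square algebra_simps)
  then have V: "(norm (V_part (fst (geo v \<tau>))))\<^sup>2 = 4 * ((?c - 1) * (1 - B) / ?y)"
    unfolding gab x using y by (simp add: gb_def field_simps)
  have "Z_part (fst (geo v \<tau>)) = gz \<tau> *\<^sub>R z0"
    by (simp add: geo_eq part_linear z0_def V_part_id x0_def)
  then have Z: "(norm (Z_part (fst (geo v \<tau>))))\<^sup>2 = ?s\<^sup>2 * (norm z0)\<^sup>2 / ?y\<^sup>2"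
    by (simp add: gz_def power_mult_distrib power_divide)
  have s: "snd (geo v \<tau>) = 1 / ?y" by (simp add: geo_eq)
  have 1: "1 / ?y + 4 * ((?c - 1) * (1 - B) / ?y) / 4 = (1 + (?c - 1) * (1 - B)) / ?y" by (simp add: add_divide_distrib)
  have 2: "1 + 1 / ?y + 4 * ((?c - 1) * (1 - B) / ?y) / 4 = (?y + (1 + (?c - 1) * (1 - B))) / ?y" using y by (simp add: add_divide_distrib)
  have e1: "(1 + (?c - 1) * (1 - B))\<^sup>2 + ?s\<^sup>2 * (norm z0)\<^sup>2 = ?y\<^sup>2 + 2 * t0 * ?s * ?y"
    unfolding z0_sq inv_height_B using sinh_sq[of \<tau>] by algebra
  show "(snd (geo v \<tau>) + (norm (V_part (fst (geo v \<tau>))))\<^sup>2 / 4)\<^sup>2 + (norm (Z_part (fst (geo v \<tau>))))\<^sup>2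
     = 1 + 2 * snd v * sinh \<tau> * snd (geo v \<tau>)"
    unfolding s V Z 1 power_divide add_divide_distrib[symmetric] e1 t0_def[symmetric]
    using y by (simp add: add_divide_distrib power2_eq_square)
  have e2: "(?y + (1 + (?c - 1) * (1 - B)))\<^sup>2 + ?s\<^sup>2 * (norm z0)\<^sup>2 = 2 * (1 + ?c) * ?y"
    unfolding z0_sq inv_height_B using sinh_sq[of \<tau>] by algebra
  show "(1 + snd (geo v \<tau>) + (norm (V_part (fst (geo v \<tau>))))\<^sup>2 / 4)\<^sup>2 + (norm (Z_part (fst (geo v \<tau>))))\<^sup>2
     = 2 * snd (geo v \<tau>) * (1 + cosh \<tau>)"
    unfolding s V Z 2 power_divide add_divide_distrib[symmetric] e2
    using y by (simp add: add_divide_distrib power2_eq_square)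
qed

end

end

section \<open>The region swept by descending geodesics\<close>

context damek_ricci
begin

text \<open>The geodesic inversion at the identity sends a point of height \<open>s\<close> to one of height \<open>s / cap\<close>;
so \<open>cap < 1\<close> says that the reflected point lies higher.\<close>

definition cap :: "'n \<times> real \<Rightarrow> real" where
  "cap p = (snd p + (norm (V_part (fst p)))\<^sup>2 / 4)\<^sup>2 + (norm (Z_part (fst p)))\<^sup>2"

text \<open>The denominator of the Cayley transform, which maps \<open>S\<close> to the unit ball.\<close>

definition cayley_denominator :: "'n \<times> real \<Rightarrow> real" where
  "cayley_denominator p = (1 + snd p + (norm (V_part (fst p)))\<^sup>2 / 4)\<^sup>2 + (norm (Z_part (fst p)))\<^sup>2"

lemma cayley_denominator_cap: "cayley_denominator p = 1 + 2 * (snd p + (norm (V_part (fst p)))\<^sup>2 / 4) + cap p"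
  by (simp add: cayley_denominator_def cap_def power2_eq_square algebra_simps)

lemma cap_geo': "norm v = 1 \<Longrightarrow> cap (geo v \<tau>) = 1 + 2 * snd v * sinh \<tau> * snd (geo v \<tau>)"
  unfolding cap_def by (rule cap_geo)

lemma cayley_denominator_geo: "norm v = 1 \<Longrightarrow> cayley_denominator (geo v \<tau>) = 2 * snd (geo v \<tau>) * (1 + cosh \<tau>)"
  unfolding cayley_denominator_def by (rule cosh_geo)

text \<open>Invert the exponential map. The time is read off from \<open>cayley_denominator\<close>, the \<open>H\<close>-component of the
velocity from \<open>cap\<close>, its \<open>Z\<close>-part from the \<open>Z\<close>-part of the point, and its \<open>V\<close>-part by inverting the operator
\<open>1 + a + J\<^sub>Z\<close>, whose inverse is \<open>1 + a - J\<^sub>Z\<close> divided by \<open>cayley_denominator\<close>.\<close>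

lemma geo_surj:
  assumes s: "s > 0" and h: "cap (w, s) < 1"
  obtains v \<tau> where "norm v = 1" "snd v < 0" "\<tau> > 0" "geo v \<tau> = (w, s)" "cayley_denominator (w, s) = 2 * s * (1 + cosh \<tau>)"
proof -
  let ?X = "V_part w" and ?Z = "Z_part w"
  define n where "n = (norm ?X)\<^sup>2"
  define m where "m = (norm ?Z)\<^sup>2"
  define H where "H = cap (w, s)"
  define a where "a = s + n / 4"
  define P where "P = cayley_denominator (w, s)"
  have n0: "n \<ge> 0" and m0: "m \<ge> 0" by (simp_all add: n_def m_def)
  have H: "H = a\<^sup>2 + m" by (simp add: H_def cap_def a_def n_def m_def)
  have P1: "P = 1 + 2 * a + H" by (simp add: P_def cayley_denominator_cap H_def a_def n_def)
  have P2: "P = (1 + a)\<^sup>2 + m" unfolding P1 H by (simp add: power2_eq_square algebra_simps)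
  have a0: "a > 0" using s n0 by (simp add: a_def)
  have H0: "H \<ge> 0" using m0 by (simp add: H)
  have H1: "H < 1" using h by (simp add: H_def)
  have P0: "P > 0" using a0 H0 by (simp add: P1)
  have na: "n = 4 * (a - s)" by (simp add: a_def)
  (* The right side is positive, so the point is not the identity and the time is positive. *)
  have PP: "P * (P - 4 * s) = P * n + (H - 1)\<^sup>2 + 4 * m"
    unfolding na P1 H by (simp add: power2_eq_square algebra_simps)
  moreover have "P * n + (H - 1)\<^sup>2 + 4 * m > 0"
    using P0 n0 m0 H1 by (intro add_pos_nonneg add_nonneg_pos) auto
  ultimately have P4: "P > 4 * s" using P0 by (metis diff_gt_0_iff_gt zero_less_mult_pos)
  define c where "c = P / (2 * s) - 1"
  define \<tau> where "\<tau> = arcosh c"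
  have c1: "c > 1" using P4 s by (simp add: c_def field_simps)
  have ct: "cosh \<tau> = c" using c1 by (simp add: \<tau>_def)
  have t0: "\<tau> > 0" using c1 by (simp add: \<tau>_def)
  define \<sigma> where "\<sigma> = sinh \<tau>"
  have \<sigma>0: "\<sigma> > 0" using t0 by (simp add: \<sigma>_def)
  have \<sigma>2: "\<sigma>\<^sup>2 = c\<^sup>2 - 1" unfolding \<sigma>_def ct[symmetric] by (simp add: cosh_square_eq)
  have \<sigma>3: "4 * s\<^sup>2 * \<sigma>\<^sup>2 = P * (P - 4 * s)"
    unfolding \<sigma>2 c_def using s by (simp add: field_simps power2_eq_square)
  (* From cap = 1 + 2 t s sinh T; z and x come from solving the formula of geo for the velocity. *)
  define t where "t = (H - 1) / (2 * s * \<sigma>)"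
  define z where "z = (1 / (s * \<sigma>)) *\<^sub>R ?Z"
  define x where "x = (1 / (2 * s * \<sigma>)) *\<^sub>R ((1 + a) *\<^sub>R ?X - J ?Z ?X)"
  define v where "v = (x + z, t)"
  have zZ: "z \<in> Z" unfolding z_def using subspace_Z by (simp add: subspace_scale)
  have xV: "x \<in> V" unfolding x_def using subspace_V J_in_V by (intro subspace_scale subspace_diff) auto
  have Vv: "V_part (fst v) = x" "Z_part (fst v) = z" "snd v = t" by (simp_all add: v_def V_part_sum Z_part_sum xV zZ)
  have nz: "(norm z)\<^sup>2 = m / (s\<^sup>2 * \<sigma>\<^sup>2)"
    by (simp add: z_def m_def power_mult_distrib power_divide)
  have nx: "(norm x)\<^sup>2 = P * n / (4 * s\<^sup>2 * \<sigma>\<^sup>2)"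
  proof -
    let ?p = "(1 + a) *\<^sub>R ?X - J ?Z ?X"
    have "(norm ?p)\<^sup>2 = ((1 + a)\<^sup>2 + m) * n"
      unfolding power2_norm_eq_inner[of ?p]
      by (simp add: inner_diff_left inner_diff_right inner_JJ dot_square_norm[of ?X] m_def n_def power2_eq_square algebra_simps)
    then show ?thesis by (simp add: x_def P2 power_mult_distrib power_divide)
  qed
  have "(norm v)\<^sup>2 = (norm x)\<^sup>2 + (norm z)\<^sup>2 + t\<^sup>2"
    using norm_parts[of "fst v"] unfolding Vv by (simp add: norm_prod_def v_def)
  also have "\<dots> = (P * n + 4 * m + (H - 1)\<^sup>2) / (4 * s\<^sup>2 * \<sigma>\<^sup>2)"
    unfolding nx nz t_def power_divide power_mult_distrib using s \<sigma>0 by (simp add: field_simps)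
  also have "\<dots> = 1"
  proof -
    have "P * n + 4 * m + (H - 1)\<^sup>2 = 4 * s\<^sup>2 * \<sigma>\<^sup>2" unfolding \<sigma>3 PP by simp
    moreover have "4 * s\<^sup>2 * \<sigma>\<^sup>2 \<noteq> 0" using s \<sigma>0 by simp
    ultimately show ?thesis by simp
  qed
  finally have nv2: "(norm v)\<^sup>2 = 1\<^sup>2" by simp
  have nv: "norm v = 1" by (rule power2_eq_imp_eq[OF nv2]) auto
  have tneg: "t < 0" using H1 s \<sigma>0 by (simp add: t_def divide_neg_pos)
  have tk: "(t\<^sup>2 + (norm z)\<^sup>2) * (P - 4 * s) = P - 4 * a"
  proof -
    have "t\<^sup>2 + (norm z)\<^sup>2 = ((H - 1)\<^sup>2 + 4 * m) / (4 * s\<^sup>2 * \<sigma>\<^sup>2)"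
      unfolding nz t_def power_divide power_mult_distrib using s \<sigma>0 by (simp add: field_simps)
    also have "(H - 1)\<^sup>2 + 4 * m = P * (P - 4 * a)"
      unfolding P1 H by (simp add: power2_eq_square algebra_simps)
    finally have "t\<^sup>2 + (norm z)\<^sup>2 = (P - 4 * a) / (P - 4 * s)" unfolding \<sigma>3 using P0 by simp
    then show ?thesis using P4 by simp
  qed
  have y: "inv_height v \<tau> = 1 / s"
  proof -
    have "inv_height v \<tau> = 1 + (1 + t\<^sup>2 + (norm z)\<^sup>2) / 2 * (c - 1) - t * \<sigma>"
      unfolding inv_height_def Let_def Vv ct \<sigma>_def by (simp add: field_simps)
    also have "t * \<sigma> = (H - 1) / (2 * s)" using \<sigma>0 by (simp add: t_def)
    also have "c - 1 = (P - 4 * s) / (2 * s)" using s by (simp add: c_def field_simps)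
    also have "(1 + t\<^sup>2 + (norm z)\<^sup>2) / 2 * ((P - 4 * s) / (2 * s)) = (P - 4 * s + (t\<^sup>2 + (norm z)\<^sup>2) * (P - 4 * s)) / (4 * s)"
      using s by (simp add: field_simps)
    also have "1 + (P - 4 * s + (t\<^sup>2 + (norm z)\<^sup>2) * (P - 4 * s)) / (4 * s) - (H - 1) / (2 * s) = 1 / s"
      unfolding tk unfolding P1 using s by (simp add: field_simps)
    finally show ?thesis .
  qed
  have r: "(c - 1) / \<sigma>\<^sup>2 = 2 * s / P"
  proof -
    have "\<sigma>\<^sup>2 = (c - 1) * (c + 1)" unfolding \<sigma>2 by (simp add: power2_eq_square algebra_simps)
    moreover have "c + 1 = P / (2 * s)" by (simp add: c_def)
    ultimately show ?thesis using c1 by simp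
  qed
  have JJ: "J z x = (1 / (2 * s\<^sup>2 * \<sigma>\<^sup>2)) *\<^sub>R ((1 + a) *\<^sub>R J ?Z ?X + m *\<^sub>R ?X)"
    unfolding z_def x_def J_scale_left J_scale_right J_diff_right
    by (simp add: H_type m_def power2_eq_square scaleR_add_right mult_ac)
  have "(s * (\<sigma> - t * (c - 1))) *\<^sub>R x + (s * (c - 1)) *\<^sub>R J z x = ?X"
  proof -
    have r': "(c - 1) = 2 * s / P * \<sigma>\<^sup>2" using r \<sigma>0 by (metis nonzero_eq_divide_eq power_not_zero less_irrefl)
    have f1: "s * (\<sigma> - t * (c - 1)) * (1 / (2 * s * \<sigma>)) = (1 + a) / P"
    proof -
      have "t * (c - 1) = (H - 1) * \<sigma> / P"
        unfolding r' t_def using s \<sigma>0 by (simp add: power2_eq_square)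
      moreover have "\<sigma> - (H - 1) * \<sigma> / P = \<sigma> * ((P - (H - 1)) / P)"
        using P0 by (simp add: field_simps)
      ultimately have "\<sigma> - t * (c - 1) = \<sigma> * ((P - (H - 1)) / P)" by (simp only:)
      then have "s * (\<sigma> - t * (c - 1)) * (1 / (2 * s * \<sigma>)) = (P - (H - 1)) / (2 * P)"
        using s \<sigma>0 by simp
      also have "P - (H - 1) = 2 * (1 + a)" by (simp add: P1)
      also have "2 * (1 + a) / (2 * P) = (1 + a) / P" by (rule mult_divide_mult_cancel_left) simp
      finally show ?thesis .
    qed
    have f2: "s * (c - 1) * (1 / (2 * s\<^sup>2 * \<sigma>\<^sup>2)) = 1 / P"
      unfolding r' using s \<sigma>0 by (simp add: power2_eq_square)
    have gen: "p *\<^sub>R (q *\<^sub>R A - B) + r *\<^sub>R (q *\<^sub>R B + k *\<^sub>R A) = (p * q + r * k) *\<^sub>R A"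
      if "p = r * q" for p q r k :: real and A B :: 'n
      by (simp add: that scaleR_diff_right scaleR_add_right scaleR_add_left)
    have "(s * (\<sigma> - t * (c - 1))) *\<^sub>R x + (s * (c - 1)) *\<^sub>R J z x
      = (s * (\<sigma> - t * (c - 1)) * (1 / (2 * s * \<sigma>))) *\<^sub>R ((1 + a) *\<^sub>R ?X - J ?Z ?X)
        + (s * (c - 1) * (1 / (2 * s\<^sup>2 * \<sigma>\<^sup>2))) *\<^sub>R ((1 + a) *\<^sub>R J ?Z ?X + m *\<^sub>R ?X)"
      unfolding JJ by (simp add: x_def)
    also have "\<dots> = ((1 + a) / P * (1 + a) + 1 / P * m) *\<^sub>R ?X"
      unfolding f1 f2 by (rule gen) simp
    also have "(1 + a) / P * (1 + a) + 1 / P * m = 1"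
    proof -
      have "(1 + a) / P * (1 + a) + 1 / P * m = ((1 + a)\<^sup>2 + m) / P"
        by (simp add: add_divide_distrib[of "_ * _"] power2_eq_square)
      then show ?thesis unfolding P2[symmetric] using P0 by simp
    qed
    finally show ?thesis by (simp only: scaleR_one)
  qed
  note VX = this
  have ZZ: "(s * \<sigma>) *\<^sub>R z = ?Z"
  proof -
    have "s * \<sigma> * (1 / (s * \<sigma>)) = 1" using s \<sigma>0 by simp
    then show ?thesis unfolding z_def scaleR_scaleR by (simp only: scaleR_one)
  qed
  have q: "q / (1 / s) = s * q" for q by simp
  have "geo v \<tau> = (?X + ?Z, 1 / (1 / s))"
    unfolding geo_def Let_def Vv y ct \<sigma>_def[symmetric] q by (simp only: VX ZZ)
  then have "geo v \<tau> = (w, s)" by (simp add: V_Z_decomp)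
  moreover have "cayley_denominator (w, s) = 2 * s * (1 + cosh \<tau>)"
    unfolding ct c_def using s by (simp add: P_def[symmetric] field_simps)
  ultimately show ?thesis using that nv tneg t0 Vv(3) by metis
qed

text \<open>Along a geodesic \<open>cap - 1\<close> has the sign of the \<open>H\<close>-component of the initial velocity.\<close>

lemma T_e_eq: "T_e = {p \<in> S. cap p < 1}"
proof (intro set_eqI iffI)
  fix p assume "p \<in> T_e"
  then obtain \<gamma> v \<tau> where g: "geodesic_from S metric e v \<gamma>" "norm v = 1" "snd v < 0" "\<tau> > 0" "p = \<gamma> \<tau>"
    unfolding T_e_def by blast
  then have p: "p = geo v \<tau>" using geodesic_unique by metis
  have "p \<in> S" unfolding p using g(2) by (rule geo_in_S)
  moreover from this have "snd p > 0" by (cases p) simp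
  moreover have "snd v * (sinh \<tau> * snd p) < 0"
    using g(3,4) \<open>snd p > 0\<close> by (intro mult_neg_pos mult_pos_pos) auto
  ultimately show "p \<in> {p \<in> S. cap p < 1}" using cap_geo'[OF g(2), of \<tau>] by (simp add: p mult.assoc)
next
  fix p assume p: "p \<in> {p \<in> S. cap p < 1}"
  then obtain w s where ws: "p = (w, s)" "s > 0" "cap (w, s) < 1" by (cases p) auto
  obtain v \<tau> where "norm v = 1" "snd v < 0" "\<tau> > 0" "geo v \<tau> = (w, s)"
    using geo_surj[OF ws(2,3)] by metis
  then have "geo v \<tau> \<in> T_e" unfolding T_e_def using geodesic_geo[of v] by blast
  then show "p \<in> T_e" using \<open>geo v \<tau> = (w, s)\<close> ws(1) by simp
qed

end

section \<open>Distance from the identity\<close>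

text \<open>Bridges the gauge integral of the fundamental theorem of calculus and the nonnegative Lebesgue
integral that defines length; \<open>h\<close> may be nonmeasurable, and \<open>N\<close> holds the break points of a piecewise smooth
path.\<close>

lemma has_integral_le_nn_integral:
  fixes f h :: "real \<Rightarrow> real"
  assumes f: "(f has_integral I) {0..1}" and le: "\<And>x. x \<in> {0..1} - N \<Longrightarrow> f x \<le> h x" and N: "finite N"
  shows "ennreal I \<le> (\<integral>\<^sup>+x\<in>{0..1}. ennreal (h x) \<partial>lborel)"
proof (cases "(\<integral>\<^sup>+x\<in>{0..1}. ennreal (h x) \<partial>lborel) = \<infinity>")
  case False
  define g where "g x = (if x \<in> {0..1} - N then f x else 0)" for x :: real
  have sp: "negligible N" using N by (rule negligible_finite)
  have "(g has_integral I) {0..1}"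
    by (rule has_integral_spike[OF sp _ f]) (simp add: g_def)
  then have gU: "(g has_integral I) UNIV"
    by (rule has_integral_on_superset) (auto simp: g_def)
  then have "g \<in> borel_measurable (lebesgue_on UNIV)"
    using integrable_imp_measurable_weak[of UNIV g] by (simp add: has_integral_integrable)
  then have gm: "g \<in> borel_measurable lebesgue" by simp
  have pm: "(\<lambda>x. max 0 (g x)) \<in> borel_measurable lebesgue" using gm by (intro borel_measurable_max) auto
  have le2: "(\<integral>\<^sup>+x. ennreal (max 0 (g x)) \<partial>lebesgue) \<le> (\<integral>\<^sup>+x\<in>{0..1}. ennreal (h x) \<partial>lborel)"
    unfolding nn_integral_completion
  proof (rule nn_integral_mono)
    fix x
    show "ennreal (max 0 (g x)) \<le> ennreal (h x) * indicator {0..1} x"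
    proof (cases "x \<in> {0..1} - N")
      case True
      then have "g x \<le> h x" using le by (simp add: g_def)
      then have "ennreal (max 0 (g x)) \<le> ennreal (max 0 (h x))" by (intro ennreal_leI) simp
      then show ?thesis using True by (simp add: ennreal_max_0)
    next
      case False
      then have "g x = 0" unfolding g_def by (rule if_not_P)
      then show ?thesis by simp
    qed
  qed
  have "integrable lebesgue (\<lambda>x. max 0 (g x))"
  proof (rule integrableI_nonneg[OF pm])
    show "(\<integral>\<^sup>+x. ennreal (max 0 (g x)) \<partial>lebesgue) < \<infinity>"
      using le2 False by (metis less_top infinity_ennreal_def order_le_less_trans)
  qed simp
  then have pi: "((\<lambda>x. max 0 (g x)) has_integral (integral\<^sup>L lebesgue (\<lambda>x. max 0 (g x)))) UNIV"
    by (rule has_integral_integral_lebesgue)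
  have "I \<le> integral\<^sup>L lebesgue (\<lambda>x. max 0 (g x))"
    by (rule has_integral_le[OF gU pi]) simp
  then have "ennreal I \<le> ennreal (integral\<^sup>L lebesgue (\<lambda>x. max 0 (g x)))" by (rule ennreal_leI)
  also have "\<dots> = (\<integral>\<^sup>+x. ennreal (max 0 (g x)) \<partial>lebesgue)"
    by (rule nn_integral_eq_integral[symmetric]) (use \<open>integrable lebesgue _\<close> in auto)
  finally show ?thesis using le2 by (rule order_trans)
qed simp

text \<open>A function whose gradient has length at most 1 grows by at most the length of the path.\<close>

lemma riem_length_ge:
  fixes f :: "'a::euclidean_space \<Rightarrow> real"
  assumes \<gamma>: "valid_path \<gamma>" "path_image \<gamma> \<subseteq> U"
    and f: "\<And>x. x \<in> U \<Longrightarrow> (f has_derivative f' x) (at x)"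
    and le: "\<And>x u. x \<in> U \<Longrightarrow> f' x u \<le> sqrt (g x u u)"
  shows "ennreal (f (pathfinish \<gamma>) - f (pathstart \<gamma>)) \<le> riem_length g \<gamma>"
proof -
  obtain N where N: "finite N" "continuous_on {0..1} \<gamma>" "\<gamma> C1_differentiable_on ({0..1} - N)"
    using \<gamma>(1) by (auto simp: valid_path_def piecewise_C1_differentiable_on_def)
  have im: "\<gamma> t \<in> U" if "t \<in> {0..1}" for t using \<gamma>(2) that by (auto simp: path_image_def)
  have d: "(f \<circ> \<gamma> has_vector_derivative f' (\<gamma> t) (vector_derivative \<gamma> (at t))) (at t)" if t: "t \<in> {0..1} - N" for t
  proof -
    have "\<gamma> differentiable at t" using N(3) t by (simp add: C1_differentiable_on_eq)
    then have "(\<gamma> has_vector_derivative vector_derivative \<gamma> (at t)) (at t)"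
      by (simp add: vector_derivative_works)
    then show ?thesis
      by (rule vector_derivative_diff_chain_within) (use f[OF im] t in \<open>auto intro: has_derivative_at_withinI\<close>)
  qed
  have "continuous_on U f" using f by (meson continuous_at_imp_continuous_on has_derivative_continuous)
  then have c: "continuous_on {0..1} (f \<circ> \<gamma>)"
    using N(2) im by (intro continuous_on_compose) (auto elim: continuous_on_subset)
  have "((\<lambda>t. f' (\<gamma> t) (vector_derivative \<gamma> (at t))) has_integral (f \<circ> \<gamma>) 1 - (f \<circ> \<gamma>) 0) {0..1}"
    by (rule fundamental_theorem_of_calculus_interior_strong[OF N(1) _ d c]) auto
  from has_integral_le_nn_integral[OF this, of N] show ?thesis
    using le im N(1) unfolding riem_length_def by (auto simp: pathstart_def pathfinish_def)
qed

context damek_ricci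
begin

text \<open>The hyperbolic cosine of the distance to the identity, as \<open>cosh_dist_geo\<close> shows along geodesics.\<close>

definition cosh_dist :: "'n \<times> real \<Rightarrow> real" where
  "cosh_dist p = cayley_denominator p / (2 * snd p) - 1"

lemma cosh_dist_ge_1:
  assumes "s > 0" shows "cosh_dist (w, s) \<ge> 1"
proof -
  define n where "n = (norm (V_part w))\<^sup>2"
  define m where "m = (norm (Z_part w))\<^sup>2"
  have "cayley_denominator (w, s) - 4 * s = (1 - s)\<^sup>2 + n * (1 + s) / 2 + n\<^sup>2 / 16 + m"
  proof -
    have "cayley_denominator (w, s) = (1 + s + n / 4)\<^sup>2 + m" by (simp add: cayley_denominator_def n_def m_def)
    then show ?thesis by (simp add: power2_eq_square field_simps)
  qed
  also have "\<dots> \<ge> 0" using assms by (simp add: n_def m_def)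
  finally show ?thesis using assms by (simp add: cosh_dist_def field_simps)
qed

lemma cosh_dist_geo: "norm v = 1 \<Longrightarrow> cosh_dist (geo v \<tau>) = cosh \<tau>"
proof -
  assume v: "norm v = 1"
  have "snd (geo v \<tau>) > 0" using geo_in_S[OF v, of \<tau>] by (cases "geo v \<tau>") simp
  then show ?thesis by (simp add: cosh_dist_def cayley_denominator_geo[OF v])
qed

text \<open>Cauchy--Schwarz in the left-invariant frame: the gradient \<open>G\<close> has squared length exactly \<open>c\<^sup>2 -
1\<close>, by the H-type identity.\<close>

lemma cosh_dist_gradient:
  assumes s: "s > 0"
  obtains D where "(cosh_dist has_derivative D) (at (w, s))"
    "\<And>u. \<bar>D u\<bar> \<le> sqrt ((cosh_dist (w, s))\<^sup>2 - 1) * sqrt (metric (w, s) u u)"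
proof -
  define X where "X = V_part w"
  define Y where "Y = Z_part w"
  define n where "n = (norm X)\<^sup>2"
  define m where "m = (norm Y)\<^sup>2"
  define a where "a = s + n / 4"
  define P where "P = (1 + a)\<^sup>2 + m"
  have P: "cayley_denominator (w, s) = P" by (simp add: cayley_denominator_def P_def a_def n_def m_def X_def Y_def add.assoc)
  define D where "D = (\<lambda>(u, k). (2 * (1 + a) * (k + (X \<bullet> V_part u) / 2) + 2 * (Y \<bullet> Z_part u)) / (2 * s) - P * k / (2 * s\<^sup>2))"
  have "(cosh_dist has_derivative D) (at (w, s))"
  proof -
    have dV: "((\<lambda>p. V_part (fst p)) has_derivative (\<lambda>h. V_part (fst h))) (at (w, s))"
      by (rule bounded_linear_imp_has_derivative) (rule bounded_linear_compose[OF bounded_linear_V_part bounded_linear_fst])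
    have dZ: "((\<lambda>p. Z_part (fst p)) has_derivative (\<lambda>h. Z_part (fst h))) (at (w, s))"
      by (rule bounded_linear_imp_has_derivative) (rule bounded_linear_compose[OF bounded_linear_Z_part bounded_linear_fst])
    have dn: "((\<lambda>p. (norm (V_part (fst p)))\<^sup>2) has_derivative (\<lambda>h. 2 * (X \<bullet> V_part (fst h)))) (at (w, s))"
      unfolding power2_norm_eq_inner by (rule has_derivative_eq_rhs[OF has_derivative_inner[OF dV dV]])
        (auto simp: fun_eq_iff X_def inner_commute)
    have dm: "((\<lambda>p. (norm (Z_part (fst p)))\<^sup>2) has_derivative (\<lambda>h. 2 * (Y \<bullet> Z_part (fst h)))) (at (w, s))"
      unfolding power2_norm_eq_inner by (rule has_derivative_eq_rhs[OF has_derivative_inner[OF dZ dZ]])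
        (auto simp: fun_eq_iff Y_def inner_commute)
    have ds: "(snd has_derivative snd) (at (w, s))"
      by (rule bounded_linear_imp_has_derivative[OF bounded_linear_snd])
    have da: "((\<lambda>p. 1 + snd p + (norm (V_part (fst p)))\<^sup>2 / 4) has_derivative (\<lambda>h. snd h + (X \<bullet> V_part (fst h)) / 2)) (at (w, s))"
      by (rule has_derivative_eq_rhs[OF has_derivative_add[OF has_derivative_add[OF has_derivative_const ds]
        bounded_linear.has_derivative[OF bounded_linear_divide dn]]]) (auto simp: fun_eq_iff)
    have dP: "(cayley_denominator has_derivative (\<lambda>h. 2 * (1 + a) * (snd h + (X \<bullet> V_part (fst h)) / 2) + 2 * (Y \<bullet> Z_part (fst h)))) (at (w, s))"
      unfolding cayley_denominator_def[abs_def]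
      by (rule has_derivative_eq_rhs[OF has_derivative_add[OF has_derivative_power[OF da, of 2] dm]])
        (auto simp: fun_eq_iff a_def n_def X_def algebra_simps)
    have d2: "((\<lambda>p. 2 * snd p) has_derivative (\<lambda>h. 2 * snd h)) (at (w, s))"
      by (rule bounded_linear.has_derivative[OF bounded_linear_mult_right ds])
    have "2 * snd (w, s) \<noteq> 0" using s by simp
    from has_derivative_diff[OF has_derivative_divide[OF dP d2 this] has_derivative_const[of 1]]
    show ?thesis unfolding cosh_dist_def[abs_def]
    proof (rule has_derivative_eq_rhs)
      define Q where "Q h = 2 * (1 + a) * (snd h + (X \<bullet> V_part (fst h)) / 2) + 2 * (Y \<bullet> Z_part (fst h))" for h :: "'n \<times> real"
      have "- P * (inverse (2 * s) * (2 * k) * inverse (2 * s)) + q / (2 * s) = q / (2 * s) - P * k / (2 * s\<^sup>2)" for q k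
        using s by (simp add: field_simps power2_eq_square)
      then show "(\<lambda>h. - cayley_denominator (w, s) * (inverse (2 * snd (w, s)) * (2 * snd h) * inverse (2 * snd (w, s)))
         + (2 * (1 + a) * (snd h + (X \<bullet> V_part (fst h)) / 2) + 2 * (Y \<bullet> Z_part (fst h))) / (2 * snd (w, s)) - 0) = D"
        unfolding D_def P by (auto simp: fun_eq_iff)
    qed
  qed
  moreover have "\<bar>D u\<bar> \<le> sqrt ((cosh_dist (w, s))\<^sup>2 - 1) * sqrt (metric (w, s) u u)" for u
  proof -
    obtain h k where u: "u = (h, k)" by fastforce
    (* G and U are the gradient and the tangent vector in an orthonormal left-invariant frame. *)
    define G where "G = ((1 / (2 * sqrt s)) *\<^sub>R ((1 + a) *\<^sub>R X + J Y X), Y, 1 + a - P / (2 * s))"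
    define U where "U = ((1 / sqrt s) *\<^sub>R V_part h, (1 / s) *\<^sub>R vert w h, k / s)"
    have YZ: "Y \<in> Z" and XV: "X \<in> V" by (simp_all add: X_def Y_def)
    have yz: "Y \<bullet> Z_part h = Y \<bullet> vert w h + (J Y X \<bullet> V_part h) / 2"
      by (simp add: vert_def inner_diff_right inner_J X_def)
    have "D u = (1 / (2 * s)) * ((1 + a) * (X \<bullet> V_part h) + J Y X \<bullet> V_part h) + (Y \<bullet> vert w h) / s
        + (1 + a - P / (2 * s)) * (k / s)"
      unfolding D_def u prod.case yz using s by (simp add: field_simps power2_eq_square)
    moreover have "G \<bullet> U = (1 / (2 * sqrt s)) * (1 / sqrt s) * ((1 + a) * (X \<bullet> V_part h) + J Y X \<bullet> V_part h)
        + (Y \<bullet> vert w h) / s + (1 + a - P / (2 * s)) * (k / s)"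
      unfolding G_def U_def inner_Pair inner_scaleR_left inner_scaleR_right inner_add_left by simp
    moreover have "(1 / (2 * sqrt s)) * (1 / sqrt s) = 1 / (2 * s)" using s by simp
    ultimately have DG: "D u = G \<bullet> U" by (simp only:)
    have "U \<bullet> U = metric (w, s) u u"
      unfolding u U_def inner_Pair metric_vert[OF s] using s by (simp add: power2_eq_square)
    then have nU: "norm U = sqrt (metric (w, s) u u)" by (simp add: norm_eq_sqrt_inner)
    have "((1 + a) *\<^sub>R X + J Y X) \<bullet> ((1 + a) *\<^sub>R X + J Y X) = P * n"
      using YZ XV by (simp add: P_def inner_add_left inner_add_right inner_JJ dot_square_norm[of X] m_def n_def power2_eq_square algebra_simps)
    then have "G \<bullet> G = P * n / (4 * s) + m + (1 + a - P / (2 * s))\<^sup>2"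
      unfolding G_def inner_Pair using s by (simp add: dot_square_norm[of Y] m_def power2_eq_square)
    also have "n = 4 * (a - s)" by (simp add: a_def)
    also have "P * (4 * (a - s)) / (4 * s) + m + (1 + a - P / (2 * s))\<^sup>2 = (P / (2 * s) - 1)\<^sup>2 - 1"
    proof -
      have m: "m = P - (1 + a)\<^sup>2" by (simp add: P_def)
      show ?thesis unfolding m using s by (simp add: field_simps power2_eq_square)
    qed
    finally have nG: "norm G = sqrt ((cosh_dist (w, s))\<^sup>2 - 1)"
      by (simp add: norm_eq_sqrt_inner cosh_dist_def P)
    show ?thesis unfolding DG nU[symmetric] nG[symmetric] by (rule Cauchy_Schwarz_ineq2)
  qed
  ultimately show ?thesis by (rule that)
qed

text \<open>The inverse hyperbolic cosine of \<open>cosh_dist\<close> has gradient of length at most 1 but is not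
differentiable at the identity. Adding a small constant to \<open>cosh_dist\<close> removes the singularity and changes
the value at the identity by little.\<close>

lemma cosh_dist_less_if_dist_less:
  assumes y: "y \<in> S" and d: "riem_dist S metric e y < ennreal R"
  shows "cosh_dist y < cosh R"
proof -
  obtain \<gamma> where \<gamma>: "valid_path \<gamma>" "path_image \<gamma> \<subseteq> S" "pathstart \<gamma> = e" "pathfinish \<gamma> = y"
    and l: "riem_length metric \<gamma> < ennreal R"
    using d unfolding riem_dist_def by (auto simp: INF_less_iff)
  define L where "L = enn2real (riem_length metric \<gamma>)"
  have L: "riem_length metric \<gamma> = ennreal L" "L \<ge> 0"
    using l by (auto simp: L_def less_top intro!: ennreal_enn2real[symmetric] elim: order_less_trans)
  then have LR: "L < R" using l by (simp add: ennreal_less_iff)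
  have cy: "cosh_dist y \<ge> 1" using cosh_dist_ge_1 y by (cases y) auto
  have ce: "cosh_dist e = 1" by (simp add: cosh_dist_def cayley_denominator_def e_def)
  have "arcosh (cosh_dist y) \<le> L + \<delta>" if \<delta>: "\<delta> > 0" for \<delta>
  proof -
    (* This choice makes arcosh (1 + \<epsilon>) equal to \<delta>. *)
    define \<epsilon> where "\<epsilon> = cosh \<delta> - 1"
    have \<epsilon>: "\<epsilon> > 0" using cosh_real_strict_mono[of 0 \<delta>] \<delta> by (simp add: \<epsilon>_def)
    have "\<exists>D. ((\<lambda>p. arcosh (cosh_dist p + \<epsilon>)) has_derivative D) (at x) \<and> (\<forall>u. D u \<le> sqrt (metric x u u))" if x: "x \<in> S" for x
    proof -
      obtain w s where ws: "x = (w, s)" "s > 0" using x by (cases x) auto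
      obtain D where D: "(cosh_dist has_derivative D) (at x)"
        "\<And>u. \<bar>D u\<bar> \<le> sqrt ((cosh_dist x)\<^sup>2 - 1) * sqrt (metric x u u)"
        using cosh_dist_gradient[OF ws(2)] ws(1) by metis
      have c1: "cosh_dist x \<ge> 1" using cosh_dist_ge_1 ws by simp
      let ?r = "sqrt ((cosh_dist x + \<epsilon>)\<^sup>2 - 1)"
      have "1\<^sup>2 < (cosh_dist x + \<epsilon>)\<^sup>2" using c1 \<epsilon> by (intro power_strict_mono) auto
      then have r: "?r > 0" by simp
      have le: "sqrt ((cosh_dist x)\<^sup>2 - 1) \<le> ?r" using c1 \<epsilon> by (intro real_sqrt_le_mono diff_mono power_mono) auto
      have "(arcosh has_derivative (\<lambda>h. h * (1 / ?r))) (at (cosh_dist x + \<epsilon>))"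
        by (rule has_derivative_eq_rhs[OF arcosh_real_has_field_derivative[of "cosh_dist x + \<epsilon>" UNIV, unfolded has_field_derivative_def]])
          (use c1 \<epsilon> in \<open>auto simp: fun_eq_iff\<close>)
      from has_derivative_compose[OF has_derivative_add[OF D(1) has_derivative_const[of \<epsilon>]] this]
      have "((\<lambda>p. arcosh (cosh_dist p + \<epsilon>)) has_derivative (\<lambda>u. (D u + 0) * (1 / ?r))) (at x)" .
      moreover have "(D u + 0) * (1 / ?r) \<le> sqrt (metric x u u)" for u
      proof -
        have g0: "metric x u u \<ge> 0" by (simp add: metric_def)
        have "D u \<le> sqrt ((cosh_dist x)\<^sup>2 - 1) * sqrt (metric x u u)" using D(2)[of u] by simp
        also have "\<dots> \<le> ?r * sqrt (metric x u u)" using le g0 by (intro mult_right_mono) auto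
        finally show ?thesis using r by (simp add: divide_le_eq mult.commute)
      qed
      ultimately show ?thesis by blast
    qed
    then obtain D where D: "\<And>x. x \<in> S \<Longrightarrow> ((\<lambda>p. arcosh (cosh_dist p + \<epsilon>)) has_derivative D x) (at x)"
      "\<And>x u. x \<in> S \<Longrightarrow> D x u \<le> sqrt (metric x u u)" by metis
    have "ennreal (arcosh (cosh_dist y + \<epsilon>) - arcosh (cosh_dist e + \<epsilon>)) \<le> ennreal L"
      using riem_length_ge[OF \<gamma>(1,2), where f = "\<lambda>p. arcosh (cosh_dist p + \<epsilon>)" and f' = D and g = metric, OF D] \<gamma>(3,4) L(1)
      by simp
    then have "arcosh (cosh_dist y + \<epsilon>) - arcosh (1 + \<epsilon>) \<le> L" using L(2) by (simp add: ennreal_le_iff ce)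
    moreover have "arcosh (1 + \<epsilon>) = \<delta>" using \<delta> by (simp add: \<epsilon>_def arcosh_cosh_real)
    moreover have "arcosh (cosh_dist y) \<le> arcosh (cosh_dist y + \<epsilon>)" using cy \<epsilon> by (rule_tac less_imp_le, rule_tac arcosh_real_strict_mono) auto
    ultimately show ?thesis by simp
  qed
  then have "arcosh (cosh_dist y) \<le> L" by (rule field_le_epsilon)
  then have "cosh (arcosh (cosh_dist y)) < cosh R" using LR cy
    by (intro cosh_real_strict_mono) auto
  then show ?thesis using cy by simp
qed

text \<open>The geodesic itself is an admissible path of length \<open>\<tau>\<close>.\<close>

lemma dist_geo_le:
  assumes v: "norm v = 1" and \<tau>: "\<tau> > 0"
  shows "riem_dist S metric e (geo v \<tau>) \<le> ennreal \<tau>"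
proof -
  define \<gamma> where "\<gamma> t = geo v (\<tau> * t)" for t
  have d: "(\<gamma> has_vector_derivative \<tau> *\<^sub>R geo' v (\<tau> * t)) (at t)" for t
  proof -
    have "((\<lambda>x. \<tau> * x) has_real_derivative \<tau>) (at t)" by (auto intro!: derivative_eq_intros)
    then have "((\<lambda>x. \<tau> * x) has_vector_derivative \<tau>) (at t)"
      by (simp only: has_real_derivative_iff_has_vector_derivative)
    from vector_diff_chain_at[OF this geo_has_derivative[OF v]] show ?thesis
      by (simp add: \<gamma>_def[abs_def] comp_def)
  qed
  have c0: "continuous_on UNIV (geo' v)"
    by (intro continuous_at_imp_continuous_on ballI has_vector_derivative_continuous[OF geo'_has_derivative[OF v]])
  have c: "continuous_on {0..1} (\<lambda>t. \<tau> *\<^sub>R geo' v (\<tau> * t))"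
    by (rule continuous_on_scaleR[OF continuous_on_const continuous_on_compose2[OF c0]])
      (auto intro: continuous_on_mult_left continuous_on_id)
  have "\<gamma> C1_differentiable_on {0..1}"
    unfolding C1_differentiable_on_def by (rule exI, intro conjI ballI, rule d, rule c)
  then have vp: "valid_path \<gamma>" unfolding valid_path_def by (rule C1_differentiable_imp_piecewise)
  have "riem_length metric \<gamma> = (\<integral>\<^sup>+t\<in>{0..1::real}. ennreal \<tau> \<partial>lborel)"
    unfolding riem_length_def
  proof (rule nn_integral_cong)
    fix t :: real
    have "vector_derivative \<gamma> (at t) = \<tau> *\<^sub>R geo' v (\<tau> * t)" by (rule vector_derivative_at[OF d])
    moreover have "metric x (\<tau> *\<^sub>R u) (\<tau> *\<^sub>R u) = \<tau>\<^sup>2 * metric x u u" if x: "x \<in> S" for x u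
    proof -
      obtain w s h k where ws: "x = (w, s)" "s > 0" "u = (h, k)" using x by (cases x; cases u) auto
      have "vert w (\<tau> *\<^sub>R h) = \<tau> *\<^sub>R vert w h" by (simp add: vert_def part_linear br_lin scaleR_diff_right)
      then show ?thesis unfolding ws(1,3) scaleR_Pair metric_vert[OF ws(2)]
        by (simp add: part_linear power2_eq_square distrib_left mult_ac)
    qed
    ultimately show "ennreal (sqrt (metric (\<gamma> t) (vector_derivative \<gamma> (at t)) (vector_derivative \<gamma> (at t)))) * indicator {0..1} t
      = ennreal \<tau> * indicator {0..1} t"
      using geo_in_S[OF v] metric_geo'[OF v] \<tau> by (simp add: \<gamma>_def real_sqrt_mult)
  qed
  also have "\<dots> = ennreal \<tau>" by (simp add: nn_integral_cmult)
  finally have l: "riem_length metric \<gamma> = ennreal \<tau>" .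
  show ?thesis unfolding riem_dist_def l[symmetric]
    by (rule INF_lower) (use vp geo_in_S[OF v] geo_0[OF v] in \<open>auto simp: path_image_def pathstart_def pathfinish_def \<gamma>_def\<close>)
qed

lemma half_ball_e_eq:
  "open_ball_e R \<inter> T_e = {p \<in> S. cap p < 1 \<and> cosh_dist p < cosh R}" if R: "R > 0"
proof (intro set_eqI iffI)
  fix p assume "p \<in> open_ball_e R \<inter> T_e"
  then show "p \<in> {p \<in> S. cap p < 1 \<and> cosh_dist p < cosh R}"
    using cosh_dist_less_if_dist_less[of p R] by (auto simp: open_ball_e_def T_e_eq)
next
  fix p assume p: "p \<in> {p \<in> S. cap p < 1 \<and> cosh_dist p < cosh R}"
  then obtain w s where ws: "p = (w, s)" "s > 0" "cap (w, s) < 1" by (cases p) auto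
  obtain v \<tau> where v: "norm v = 1" "\<tau> > 0" "geo v \<tau> = p"
    using geo_surj[OF ws(2,3)] ws(1) by metis
  have "cosh \<tau> < cosh R" using p cosh_dist_geo[OF v(1), of \<tau>] v(3) by simp
  then have "\<tau> < R" using v(2) R by (simp add: cosh_real_nonneg_less_iff)
  then have "riem_dist S metric e p < ennreal R"
    using dist_geo_le[OF v(1,2)] v(2,3) by (metis ennreal_lessI R le_less_trans)
  then show "p \<in> open_ball_e R \<inter> T_e" using p by (simp add: open_ball_e_def T_e_eq)
qed

end

section \<open>The left Haar measure\<close>

context damek_ricci
begin

text \<open>The density of the measure in the height variable.\<close>

definition rho :: "real \<Rightarrow> ennreal" where
  "rho s = ennreal (s powr (- nu - 1)) * indicator {0<..} s"

lemma rho_measurable [measurable]: "rho \<in> borel_measurable borel"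
  unfolding rho_def[abs_def] by measurable

lemma space_mu [simp]: "space mu = S"
  by (simp add: mu_def space_restrict_space)

lemma sets_mu: "sets mu = sets (lebesgue_on S)"
  by (simp add: mu_def)

lemma S_borel [measurable]: "S \<in> sets borel"
  using open_S by simp

lemma borel_imp_sets_mu: "A \<in> sets borel \<Longrightarrow> A \<subseteq> S \<Longrightarrow> A \<in> sets mu"
  unfolding sets_mu by (subst sets_restrict_space_iff) auto

text \<open>The integrand is only Lebesgue measurable, so the completed measure has to be used.\<close>

lemma nn_integral_mu_lborel:
  assumes f: "f \<in> borel_measurable mu"
  shows "(\<integral>\<^sup>+p. f p \<partial>mu) = (\<integral>\<^sup>+p. rho (snd p) * f p * indicator S p \<partial>lborel)"
proof -
  have w: "(\<lambda>(w :: 'n, s). ennreal (s powr (- nu - 1))) \<in> borel_measurable (lebesgue_on S)"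
  proof (rule measurable_restrict_space1)
    have "(\<lambda>(w :: 'n, s). ennreal (s powr (- nu - 1))) \<in> borel_measurable borel"
      unfolding borel_prod[symmetric] by measurable
    then have "(\<lambda>(w :: 'n, s). ennreal (s powr (- nu - 1))) \<in> borel_measurable lborel" by simp
    then show "(\<lambda>(w :: 'n, s). ennreal (s powr (- nu - 1))) \<in> borel_measurable lebesgue"
      by (rule measurable_completion)
  qed
  have f': "f \<in> borel_measurable (lebesgue_on S)" using f by (simp add: measurable_cong_sets[OF sets_mu refl])
  have "(\<integral>\<^sup>+p. f p \<partial>mu) = (\<integral>\<^sup>+p. (case p of (w, s) \<Rightarrow> ennreal (s powr (- nu - 1))) * f p \<partial>lebesgue_on S)"
    unfolding mu_def by (rule nn_integral_density[OF w f'])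
  also have "\<dots> = (\<integral>\<^sup>+p. (case p of (w, s) \<Rightarrow> ennreal (s powr (- nu - 1))) * f p * indicator S p \<partial>lebesgue)"
    by (rule nn_integral_restrict_space) simp
  also have "\<dots> = (\<integral>\<^sup>+p. (case p of (w, s) \<Rightarrow> ennreal (s powr (- nu - 1))) * f p * indicator S p \<partial>lborel)"
    by (rule nn_integral_completion)
  also have "\<dots> = (\<integral>\<^sup>+p. rho (snd p) * f p * indicator S p \<partial>lborel)"
    by (rule nn_integral_cong) (auto simp: rho_def indicator_def)
  finally show ?thesis .
qed

lemma borel_measurable_mu: "f \<in> borel_measurable borel \<Longrightarrow> f \<in> borel_measurable mu"
proof -
  assume f: "f \<in> borel_measurable borel"
  have "f \<in> borel_measurable lborel" using f by simp
  then have "f \<in> borel_measurable lebesgue" by (rule measurable_completion)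
  then have "f \<in> borel_measurable (lebesgue_on S)" by (rule measurable_restrict_space1)
  then show ?thesis by (simp add: measurable_cong_sets[OF sets_mu refl])
qed

lemma nn_integral_mu:
  fixes f :: "'n \<times> real \<Rightarrow> ennreal"
  assumes f [measurable]: "f \<in> borel_measurable borel"
  shows "(\<integral>\<^sup>+p. f p \<partial>mu) = (\<integral>\<^sup>+s. rho s * (\<integral>\<^sup>+w. f (w, s) \<partial>lborel) \<partial>lborel)"
    and "(\<integral>\<^sup>+p. f p \<partial>mu) = (\<integral>\<^sup>+w. (\<integral>\<^sup>+s. rho s * f (w, s) \<partial>lborel) \<partial>lborel)"
proof -
  have f'[measurable]: "f \<in> borel_measurable (lborel \<Otimes>\<^sub>M lborel)"
    by (simp add: lborel_prod)
  have *: "(\<lambda>p :: 'n \<times> real. rho (snd p) * f p) \<in> borel_measurable (lborel \<Otimes>\<^sub>M lborel)" by measurable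
  have "(\<integral>\<^sup>+p. f p \<partial>mu) = (\<integral>\<^sup>+p. rho (snd p) * f p * indicator S p \<partial>lborel)"
    by (rule nn_integral_mu_lborel[OF borel_measurable_mu[OF f]])
  also have "\<dots> = (\<integral>\<^sup>+p. rho (snd p) * f p \<partial>(lborel \<Otimes>\<^sub>M lborel))"
    unfolding lborel_prod by (rule nn_integral_cong) (auto simp: rho_def S_def indicator_def)
  finally have 1: "(\<integral>\<^sup>+p. f p \<partial>mu) = (\<integral>\<^sup>+p. rho (snd p) * f p \<partial>(lborel \<Otimes>\<^sub>M lborel))" .
  show "(\<integral>\<^sup>+p. f p \<partial>mu) = (\<integral>\<^sup>+s. rho s * (\<integral>\<^sup>+w. f (w, s) \<partial>lborel) \<partial>lborel)"
    unfolding 1 lborel_pair.nn_integral_snd[OF *, symmetric] by (intro nn_integral_cong) (simp add: nn_integral_cmult)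
  show "(\<integral>\<^sup>+p. f p \<partial>mu) = (\<integral>\<^sup>+w. (\<integral>\<^sup>+s. rho s * f (w, s) \<partial>lborel) \<partial>lborel)"
    unfolding 1 using lborel.nn_integral_fst[OF *] by simp
qed

lemma emeasure_mu:
  assumes A [measurable]: "A \<in> sets borel" and "A \<subseteq> S"
  shows "emeasure mu A = (\<integral>\<^sup>+s. rho s * emeasure lborel {w. (w, s) \<in> A} \<partial>lborel)"
proof -
  have sl: "{w. (w, s) \<in> A} \<in> sets borel" for s
  proof -
    have "A \<in> sets (borel \<Otimes>\<^sub>M borel)" unfolding borel_prod by (rule A)
    from sets_Pair2[OF this, of s] show ?thesis by (simp add: vimage_def)
  qed
  have "emeasure mu A = (\<integral>\<^sup>+p. indicator A p \<partial>mu)"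
    using borel_imp_sets_mu[OF assms] by simp
  also have "\<dots> = (\<integral>\<^sup>+s. rho s * (\<integral>\<^sup>+w. indicator A (w, s) \<partial>lborel) \<partial>lborel)"
    by (rule nn_integral_mu) measurable
  also have "\<dots> = (\<integral>\<^sup>+s. rho s * emeasure lborel {w. (w, s) \<in> A} \<partial>lborel)"
  proof (rule nn_integral_cong)
    fix s :: real
    have "(indicator A (w, s) :: ennreal) = indicator {w. (w, s) \<in> A} w" for w by (simp add: indicator_def)
    then show "rho s * (\<integral>\<^sup>+w. indicator A (w, s) \<partial>lborel) = rho s * emeasure lborel {w. (w, s) \<in> A}"
      using sl by simp
  qed
  finally show ?thesis .
qed

text \<open>The dilation of the nilpotent factor by which an element of height \<open>s\<close> acts.\<close>

definition dil :: "real \<Rightarrow> 'n \<Rightarrow> 'n" where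
  "dil s w = sqrt s *\<^sub>R V_part w + s *\<^sub>R Z_part w"

text \<open>The action of \<open>(w0, s)\<close> on the nilpotent factor.\<close>

definition aff :: "'n \<Rightarrow> real \<Rightarrow> 'n \<Rightarrow> 'n" where
  "aff w0 s w = fst (mult (w0, s) (w, 1))"

lemma aff_eq: "aff w0 s w = w0 + dil s w + (sqrt s / 2) *\<^sub>R br w0 w"
  by (simp add: aff_def mult_eq dil_def add.assoc)

lemma mult_aff: "mult (w0, s0) (w, s) = (aff w0 s0 w, s0 * s)"
  by (simp add: aff_def mult_eq)

lemma orthonormal_basis_V_Z:
  obtains A B where "A \<subseteq> V" "B \<subseteq> Z" "finite A" "finite B" "card A = dim V" "card B = dim Z"
    "pairwise orthogonal (A \<union> B)" "\<And>b. b \<in> A \<union> B \<Longrightarrow> norm b = 1" "A \<inter> B = {}" "span (A \<union> B) = UNIV"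
proof -
  obtain A where A: "A \<subseteq> V" "pairwise orthogonal A" "\<And>x. x \<in> A \<Longrightarrow> norm x = 1" "independent A" "card A = dim V" "span A = V"
    using orthonormal_basis_subspace[OF subspace_V] by metis
  obtain B where B: "B \<subseteq> Z" "pairwise orthogonal B" "\<And>x. x \<in> B \<Longrightarrow> norm x = 1" "independent B" "card B = dim Z" "span B = Z"
    using orthonormal_basis_subspace[OF subspace_Z] by metis
  show ?thesis
  proof (rule that)
    show "A \<inter> B = {}"
    proof (rule equals0I)
      fix x assume x: "x \<in> A \<inter> B"
      then have "x = 0" using A(1) B(1) V_Z_disjoint by blast
      moreover have "norm x = 1" using x A(3) by blast
      ultimately show False by simp
    qed
    show "pairwise orthogonal (A \<union> B)"
      using A(1,2) B(1,2) V_orthogonal_Z unfolding pairwise_def orthogonal_def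
      by (metis Un_iff inner_commute subsetD)
    show "span (A \<union> B) = UNIV"
    proof -
      have "w \<in> span (A \<union> B)" for w :: 'n
      proof -
        have "V_part w \<in> span (A \<union> B)" "Z_part w \<in> span (A \<union> B)"
          using A(6) B(6) span_mono[of A "A \<union> B"] span_mono[of B "A \<union> B"] V_part_in_V[of w] Z_part_in_Z[of w] by blast+
        then have "V_part w + Z_part w \<in> span (A \<union> B)" by (rule span_add)
        then show ?thesis by (simp add: V_Z_decomp)
      qed
      then show ?thesis by blast
    qed
  qed (use A B in \<open>auto intro: independent_imp_finite\<close>)
qed

text \<open>Here \<open>n\<close> is not the zero space.\<close>

lemma nu_pos: "nu > 0"
proof -
  have "dim V \<noteq> 0 \<or> dim Z \<noteq> 0"
  proof (rule ccontr)
    assume "\<not> (dim V \<noteq> 0 \<or> dim Z \<noteq> 0)"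
    then have "V \<subseteq> {0}" "Z \<subseteq> {0}" by (simp_all add: dim_eq_0)
    then have "w = 0" for w :: 'n using V_plus_Z[of w] by (metis add.right_neutral singletonD subsetD)
    moreover obtain b :: 'n where "b \<in> Basis" using nonempty_Basis by blast
    ultimately show False using nonzero_Basis by blast
  qed
  then have "dim V > 0 \<or> dim Z > 0" by (simp only: neq0_conv)
  then have "real (dim V) > 0 \<or> real (dim Z) > 0" by (simp only: of_nat_0_less_iff)
  then show ?thesis unfolding nu_def by (elim disjE) linarith+
qed

text \<open>The factor \<open>s\<^sup>\<nu>\<close> is the product of \<open>sqrt s\<close> over a basis of \<open>V\<close> and of \<open>s\<close> over a basis of \<open>Z\<close>.\<close>

lemma emeasure_dil:
  assumes s: "s > 0" and E: "E \<in> sets borel"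
  shows "emeasure lborel (dil s ` E) = ennreal (s powr nu) * emeasure lborel E"
proof -
  obtain A B where AB: "A \<subseteq> V" "B \<subseteq> Z" "finite A" "finite B" "card A = dim V" "card B = dim Z"
    "pairwise orthogonal (A \<union> B)" "\<And>b. b \<in> A \<union> B \<Longrightarrow> norm b = 1" "A \<inter> B = {}" "span (A \<union> B) = UNIV"
    by (rule orthonormal_basis_V_Z) blast
  define r where "r b = (if b \<in> A then sqrt s else s)" for b
  have "emeasure lborel (dil s ` E) = ennreal (\<Prod>b\<in>A \<union> B. r b) * emeasure lborel E"
  proof (rule diagonal_image_lborel[OF _ AB(7,8,10) _ _ E])
    show "linear (dil s)" unfolding dil_def by (rule linearI) (simp_all add: part_linear algebra_simps)
    show "r b > 0" for b using s by (simp add: r_def)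
    fix b assume "b \<in> A \<union> B"
    then show "dil s b = r b *\<^sub>R b"
      using AB(1,2,9) by (auto simp: dil_def r_def V_part_id Z_part_id subset_iff)
  qed
  also have "(\<Prod>b\<in>A \<union> B. r b) = (\<Prod>b\<in>A. r b) * (\<Prod>b\<in>B. r b)"
    using AB by (intro prod.union_disjoint) auto
  also have "(\<Prod>b\<in>A. r b) = sqrt s ^ dim V" using AB(5) by (simp add: r_def)
  also have "(\<Prod>b\<in>B. r b) = (\<Prod>b\<in>B. s)" using AB(9) by (intro prod.cong) (auto simp: r_def)
  also have "\<dots> = s ^ dim Z" using AB(6) by simp
  also have "sqrt s ^ dim V * s ^ dim Z = s powr nu"
    using s by (simp add: nu_def powr_add powr_realpow powr_half_sqrt[symmetric] powr_powr powr_power)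
  finally show ?thesis .
qed

text \<open>A translation, a shear by half the bracket, and a dilation. The isometry that changes the sign
of the \<open>Z\<close>-part conjugates the shear to its inverse.\<close>

lemma emeasure_aff:
  assumes s: "s > 0" and E: "E \<in> sets borel"
  shows "emeasure lborel (aff w0 s ` E) = ennreal (s powr nu) * emeasure lborel E"
proof -
  define N where "N w = (1/2) *\<^sub>R br w0 w" for w
  have linN: "linear N" unfolding N_def by (rule linearI) (simp_all add: br_lin algebra_simps)
  have lind: "linear (dil s)" unfolding dil_def by (rule linearI) (simp_all add: part_linear algebra_simps)
  have injd: "inj (dil s)"
  proof (subst linear_inj_iff_eq_0[OF lind], intro allI impI)
    fix x assume 0: "dil s x = 0"
    have "V_part (dil s x) = sqrt s *\<^sub>R V_part x" "Z_part (dil s x) = s *\<^sub>R Z_part x" by (simp_all add: dil_def part_linear)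
    then have "V_part x = 0" "Z_part x = 0" using s unfolding 0 by auto
    then show "x = 0" using V_Z_decomp[of x] by simp
  qed
  have dE: "dil s ` E \<in> sets borel" by (rule linear_injective_image_borel[OF lind injd E])
  have "aff w0 s ` E = (+) w0 ` ((\<lambda>y. y + N y) ` (dil s ` E))"
    by (simp add: image_image aff_eq N_def dil_def br_lin add.assoc)
  also have "emeasure lborel \<dots> = emeasure lborel ((\<lambda>y. y + N y) ` (dil s ` E))"
  proof -
    have inj: "inj (\<lambda>y. y + N y)"
    proof (rule injI)
      fix x y assume e: "x + N x = y + N y"
      then have "N (x + N x) = N (y + N y)" by simp
      then have "N x = N y" unfolding N_def by (simp add: br_lin)
      with e show "x = y" by simp
    qed
    have lin: "linear (\<lambda>y. y + N y)" by (intro linear_compose_add linear_ident linN)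
    let ?A = "(\<lambda>y. y + N y) ` (dil s ` E)"
    have "?A \<in> sets borel" by (rule linear_injective_image_borel[OF lin inj dE])
    moreover have "(+) w0 ` B = (+) (- w0) -` B" for B :: "'n set"
    proof (intro set_eqI iffI)
      fix y assume "y \<in> (+) (- w0) -` B"
      then show "y \<in> (+) w0 ` B" by (intro image_eqI[of _ _ "- w0 + y"]) auto
    qed auto
    moreover have "emeasure lborel ?A = emeasure (distr lborel borel ((+) (- w0))) ?A"
      by (simp only: lborel_distr_plus)
    ultimately show ?thesis by (simp add: emeasure_distr)
  qed
  also have "\<dots> = emeasure lborel (dil s ` E)"
  proof (rule shear_image_lborel[OF linN _ _ _ _ dE])
    show "N (N x) = 0" for x by (simp add: N_def br_lin)
    show "linear (\<lambda>x. V_part x - Z_part x)" by (rule linearI) (simp_all add: part_linear algebra_simps)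
    show "norm (V_part x - Z_part x) = norm x" for x
      by (rule power2_eq_imp_eq) (simp_all add: norm_parts[of x] norm_parts[of "V_part x - Z_part x"] part_linear)
    show "V_part (N x) - Z_part (N x) = - N (V_part x - Z_part x)" for x
      by (simp add: N_def part_linear br_lin)
  qed
  also have "\<dots> = ennreal (s powr nu) * emeasure lborel E" by (rule emeasure_dil[OF s E])
  finally show ?thesis .
qed

lemma mult_assoc:
  assumes "s > 0" "s' > 0"
  shows "mult (mult (w, s) (w', s')) (w'', s'') = mult (w, s) (mult (w', s') (w'', s''))"
  using assms
  by (simp add: mult_eq part_linear br_lin real_sqrt_mult scaleR_add_right add_ac mult_ac)

definition inverse_elt :: "'n \<times> real \<Rightarrow> 'n \<times> real" where
  "inverse_elt p = (- dil (1 / snd p) (fst p), 1 / snd p)"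

lemma mult_inverse:
  assumes "s > 0"
  shows "mult (w, s) (inverse_elt (w, s)) = e" "mult (inverse_elt (w, s)) (w, s) = e"
proof -
  have V: "w - V_part w = Z_part w" by (simp add: Z_part_def)
  show "mult (w, s) (inverse_elt (w, s)) = e"
    using assms V by (simp add: inverse_elt_def mult_eq dil_def e_def part_linear br_lin br_alternating real_sqrt_divide)
  show "mult (inverse_elt (w, s)) (w, s) = e"
    using assms by (simp add: inverse_elt_def mult_eq dil_def e_def part_linear br_lin br_alternating real_sqrt_divide)
qed

lemma mult_e: "mult e p = p"
  by (cases p) (simp add: e_def mult_eq V_Z_decomp)

lemma mult_in_S: "x \<in> S \<Longrightarrow> y \<in> S \<Longrightarrow> mult x y \<in> S"
  by (cases x; cases y) (simp add: mult_eq)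

lemma inverse_in_S: "x \<in> S \<Longrightarrow> inverse_elt x \<in> S"
  by (cases x) (simp add: inverse_elt_def)

lemma mult_inverse_cancel:
  assumes "x \<in> S" "p \<in> S"
  shows "mult x (mult (inverse_elt x) p) = p" "mult (inverse_elt x) (mult x p) = p"
proof -
  obtain w s where x: "x = (w, s)" "s > 0" using assms by (cases x) auto
  obtain w' s' where p: "p = (w', s')" "s' > 0" using assms by (cases p) auto
  have i: "inverse_elt x = (fst (inverse_elt x), 1 / s)" by (simp add: x inverse_elt_def)
  show "mult x (mult (inverse_elt x) p) = p"
    using mult_assoc[of s "1/s" w "fst (inverse_elt x)" w' s'] x p i mult_inverse[OF x(2), of w] mult_e by simp
  show "mult (inverse_elt x) (mult x p) = p"
    using mult_assoc[of "1/s" s "fst (inverse_elt x)" w w' s'] x p i mult_inverse[OF x(2), of w] mult_e by simp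
qed

lemma continuous_mult: "continuous_on UNIV (mult x)"
proof -
  obtain w s where x: "x = (w, s)" by fastforce
  have "mult x = (\<lambda>p. (w + sqrt s *\<^sub>R V_part (fst p) + s *\<^sub>R Z_part (fst p) + (sqrt s / 2) *\<^sub>R br w (fst p), s * snd p))"
    by (auto simp: x mult_eq)
  moreover have "continuous_on UNIV (\<lambda>p. (w + sqrt s *\<^sub>R V_part (fst p) + s *\<^sub>R Z_part (fst p) + (sqrt s / 2) *\<^sub>R br w (fst p), s * snd p))"
    by (intro continuous_intros bounded_linear.continuous_on[OF bounded_linear_V_part]
      bounded_linear.continuous_on[OF bounded_linear_Z_part]
      bounded_linear.continuous_on[OF bounded_bilinear.bounded_linear_right[OF bounded_bilinear_br]])
  ultimately show ?thesis by simp
qed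

lemma mult_image_vimage:
  assumes "x \<in> S" "A \<subseteq> S"
  shows "mult x ` A = mult (inverse_elt x) -` A \<inter> S"
proof (intro set_eqI iffI)
  fix p assume "p \<in> mult x ` A"
  then obtain a where "a \<in> A" "p = mult x a" by blast
  then show "p \<in> mult (inverse_elt x) -` A \<inter> S"
    using assms mult_inverse_cancel(2)[of x a] mult_in_S[of x a] by auto
next
  fix p assume "p \<in> mult (inverse_elt x) -` A \<inter> S"
  then show "p \<in> mult x ` A"
    using assms mult_inverse_cancel(1)[of x p] by (intro image_eqI[of _ _ "mult (inverse_elt x) p"]) auto
qed

lemma mult_image_borel:
  assumes "x \<in> S" "A \<subseteq> S" "A \<in> sets borel" shows "mult x ` A \<in> sets borel"
proof -
  have "mult (inverse_elt x) \<in> borel_measurable borel"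
    by (rule borel_measurable_continuous_onI[OF continuous_mult])
  from measurable_sets_borel[OF this assms(3)] show ?thesis
    unfolding mult_image_vimage[OF assms(1,2)] by auto
qed

lemma open_mult_image:
  assumes "x \<in> S" "A \<subseteq> S" "open A" shows "open (mult x ` A)"
  unfolding mult_image_vimage[OF assms(1,2)]
  by (intro open_Int open_vimage[OF assms(3) continuous_mult] open_S)

text \<open>On horizontal slices left translation acts by \<open>aff\<close>, with factor \<open>s0\<^sup>\<nu>\<close>; rescaling the height
cancels it against \<open>rho\<close>.\<close>

lemma emeasure_mult_image:
  assumes x: "x \<in> S" and A: "A \<subseteq> S" "A \<in> sets borel"
  shows "emeasure mu (mult x ` A) = emeasure mu A"
proof -
  obtain w0 s0 where ws: "x = (w0, s0)" "s0 > 0" using x by (cases x) auto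
  have sl: "{w. (w, s) \<in> A} \<in> sets borel" for s
  proof -
    have "A \<in> sets (borel \<Otimes>\<^sub>M borel)" unfolding borel_prod by (rule A(2))
    from sets_Pair2[OF this, of s] show ?thesis by (simp add: vimage_def)
  qed
  have slice: "{w. (w, s) \<in> mult x ` A} = aff w0 s0 ` {w. (w, s / s0) \<in> A}" for s
    using ws(2) by (force simp: ws(1) mult_aff image_iff field_simps)
  define F where "F s = rho s * emeasure lborel {w. (w, s) \<in> mult x ` A}" for s
  have mF: "F \<in> borel_measurable borel"
  proof -
    have [measurable]: "mult x ` A \<in> sets (lborel \<Otimes>\<^sub>M lborel)"
      unfolding lborel_prod using mult_image_borel[OF x A] by simp
    have "(\<lambda>s. \<integral>\<^sup>+w. indicator (mult x ` A) (w, s) \<partial>lborel) \<in> borel_measurable lborel" by measurable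
    moreover have "(\<integral>\<^sup>+w. indicator (mult x ` A) (w, s) \<partial>lborel) = emeasure lborel {w. (w, s) \<in> mult x ` A}" for s
    proof -
      have "{w. (w, s) \<in> mult x ` A} \<in> sets borel"
      proof -
        have "mult x ` A \<in> sets (borel \<Otimes>\<^sub>M borel)" unfolding borel_prod by (rule mult_image_borel[OF x A])
        from sets_Pair2[OF this, of s] show ?thesis by (simp add: vimage_def)
      qed
      moreover have "(indicator (mult x ` A) (w, s) :: ennreal) = indicator {w. (w, s) \<in> mult x ` A} w" for w by (simp add: indicator_def)
      ultimately show ?thesis by simp
    qed
    ultimately show ?thesis unfolding F_def by simp
  qed
  have "emeasure mu (mult x ` A) = (\<integral>\<^sup>+s. F s \<partial>lborel)"
    unfolding F_def
  proof (rule emeasure_mu[OF mult_image_borel[OF x A]])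
    show "mult x ` A \<subseteq> S" using mult_in_S[OF x] A(1) by blast
  qed
  also have "\<dots> = ennreal \<bar>s0\<bar> * (\<integral>\<^sup>+s. F (0 + s0 * s) \<partial>lborel)"
    using ws(2) mF by (intro nn_integral_real_affine) auto
  also have "\<dots> = (\<integral>\<^sup>+s. ennreal s0 * F (0 + s0 * s) \<partial>lborel)"
    using ws(2) mF by (subst nn_integral_cmult) auto
  also have "\<dots> = (\<integral>\<^sup>+s. rho s * emeasure lborel {w. (w, s) \<in> A} \<partial>lborel)"
  proof (rule nn_integral_cong)
    fix s :: real
    have "F (0 + s0 * s) = rho (s0 * s) * (ennreal (s0 powr nu) * emeasure lborel {w. (w, s) \<in> A})"
      unfolding F_def slice using ws(2) sl by (simp add: emeasure_aff)
    moreover have "ennreal s0 * (rho (s0 * s) * ennreal (s0 powr nu)) = rho s"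
    proof (cases "s > 0")
      case True
      have "s0 * ((s0 * s) powr (- nu - 1) * s0 powr nu) = s powr (- nu - 1) * (s0 powr 1 * s0 powr (- nu - 1) * s0 powr nu)"
        using ws(2) True by (simp add: powr_mult)
      also have "s0 powr 1 * s0 powr (- nu - 1) * s0 powr nu = 1"
        using ws(2) by (simp only: powr_add[symmetric]) simp
      finally show ?thesis using True ws(2) by (simp add: rho_def ennreal_mult[symmetric])
    next
      case False
      then show ?thesis using ws(2) by (simp add: rho_def zero_less_mult_iff)
    qed
    ultimately show "ennreal s0 * F (0 + s0 * s) = rho s * emeasure lborel {w. (w, s) \<in> A}"
      by (metis mult.assoc)
  qed
  also have "\<dots> = emeasure mu A" by (rule emeasure_mu[OF A(2,1), symmetric])
  finally show ?thesis .
qed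

end

section \<open>Size and shape of half balls\<close>

context damek_ricci
begin

text \<open>The half ball at the identity in closed form.\<close>

definition base_half_ball :: "real \<Rightarrow> ('n \<times> real) set" where
  "base_half_ball R = {p \<in> S. cap p < 1 \<and> cosh_dist p < cosh R}"

lemma half_ball_eq: "R > 0 \<Longrightarrow> half_ball x R = mult x ` base_half_ball R"
  by (simp add: half_ball_def half_ball_e_eq base_half_ball_def)

lemma base_half_ball_subset_S: "base_half_ball R \<subseteq> S"
  by (auto simp: base_half_ball_def)

lemma base_half_ball_iff:
  "(w, s) \<in> base_half_ball R \<longleftrightarrow> s > 0 \<and> (s + (norm (V_part w))\<^sup>2 / 4)\<^sup>2 + (norm (Z_part w))\<^sup>2 < 1 \<and>
     1 + 2 * (s + (norm (V_part w))\<^sup>2 / 4) + ((s + (norm (V_part w))\<^sup>2 / 4)\<^sup>2 + (norm (Z_part w))\<^sup>2) < 2 * s * (1 + cosh R)"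
proof (cases "s > 0")
  case True
  then have "cosh_dist (w, s) < cosh R \<longleftrightarrow> cayley_denominator (w, s) < 2 * s * (1 + cosh R)"
    by (simp add: cosh_dist_def field_simps)
  then show ?thesis using True by (simp add: base_half_ball_def cayley_denominator_cap) (simp add: cap_def)
qed (simp add: base_half_ball_def)

lemma continuous_V_part [continuous_intros]: "continuous_on A f \<Longrightarrow> continuous_on A (\<lambda>x. V_part (f x))"
  and continuous_Z_part [continuous_intros]: "continuous_on A f \<Longrightarrow> continuous_on A (\<lambda>x. Z_part (f x))"
  by (rule bounded_linear.continuous_on[OF bounded_linear_V_part], assumption)
    (rule bounded_linear.continuous_on[OF bounded_linear_Z_part], assumption)

lemma open_base_half_ball: "open (base_half_ball R)"
proof -
  let ?n = "\<lambda>p :: 'n \<times> real. snd p + (norm (V_part (fst p)))\<^sup>2 / 4" and ?m = "\<lambda>p :: 'n \<times> real. (norm (Z_part (fst p)))\<^sup>2"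
  have "base_half_ball R = {p. 0 < snd p} \<inter> {p. (?n p)\<^sup>2 + ?m p < 1} \<inter> {p. 1 + 2 * ?n p + ((?n p)\<^sup>2 + ?m p) < 2 * snd p * (1 + cosh R)}"
    by (auto simp: base_half_ball_iff)
  moreover have "open \<dots>"
    by (intro open_Int open_Collect_less continuous_intros) auto
  ultimately show ?thesis by simp
qed

lemma open_half_ball: "x \<in> S \<Longrightarrow> R > 0 \<Longrightarrow> open (half_ball x R)"
  by (simp add: half_ball_eq open_mult_image base_half_ball_subset_S open_base_half_ball)

lemma half_ball_subset_S: "x \<in> S \<Longrightarrow> R > 0 \<Longrightarrow> half_ball x R \<subseteq> S"
  using mult_in_S[of x] subsetD[OF base_half_ball_subset_S] by (simp add: half_ball_eq image_subset_iff)

lemma emeasure_half_ball: "x \<in> S \<Longrightarrow> R > 0 \<Longrightarrow> emeasure mu (half_ball x R) = emeasure mu (base_half_ball R)"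
  by (simp add: half_ball_eq emeasure_mult_image base_half_ball_subset_S open_base_half_ball)

definition Nbox :: "real \<Rightarrow> 'n set" where
  "Nbox a = {w. norm (V_part w) < a \<and> norm (Z_part w) < a}"

lemma open_Nbox: "open (Nbox a)"
  unfolding Nbox_def Collect_conj_eq by (intro open_Int open_Collect_less continuous_intros)

lemma Nbox_borel [measurable, simp]: "Nbox a \<in> sets borel"
  by (simp add: open_Nbox)

definition Nbox1_volume :: real where
  "Nbox1_volume = measure lborel (Nbox 1)"

lemma Nbox1_volume: "emeasure lborel (Nbox 1) = ennreal Nbox1_volume" "Nbox1_volume > 0"
proof -
  have "Nbox 1 \<subseteq> ball 0 2"
  proof
    fix w assume "w \<in> Nbox 1"
    then have "norm (V_part w + Z_part w) < 2" using norm_triangle_ineq[of "V_part w" "Z_part w"] by (auto simp: Nbox_def)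
    then show "w \<in> ball 0 2" by (simp add: V_Z_decomp)
  qed
  then have "bounded (Nbox 1)" using bounded_ball bounded_subset by blast
  then show 1: "emeasure lborel (Nbox 1) = ennreal Nbox1_volume"
    unfolding Nbox1_volume_def using emeasure_bounded_finite[of "Nbox 1"] by (intro emeasure_eq_ennreal_measure) auto
  have "0 \<in> Nbox 1" by (simp add: Nbox_def)
  then have "emeasure lborel (Nbox 1) > 0" by (intro emeasure_lborel_open_pos open_Nbox) auto
  then show "Nbox1_volume > 0" unfolding 1 by simp
qed

lemma emeasure_Nbox:
  assumes a: "a > 0" shows "emeasure lborel (Nbox a) = ennreal (a ^ DIM('n) * Nbox1_volume)"
proof -
  have "Nbox a = (*\<^sub>R) a ` Nbox 1"
  proof (intro set_eqI iffI)
    fix w assume "w \<in> Nbox a"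
    then show "w \<in> (*\<^sub>R) a ` Nbox 1" using a
      by (intro image_eqI[of _ _ "(1 / a) *\<^sub>R w"]) (auto simp: Nbox_def part_linear)
  next
    fix w assume "w \<in> (*\<^sub>R) a ` Nbox 1"
    then show "w \<in> Nbox a" using a by (auto simp: Nbox_def part_linear)
  qed
  also have "emeasure lborel \<dots> = ennreal (\<Prod>b\<in>(Basis :: 'n set). a) * emeasure lborel (Nbox 1)"
  proof (rule diagonal_image_lborel)
    show "linear ((*\<^sub>R) a :: 'n \<Rightarrow> 'n)" by (rule linearI) (simp_all add: scaleR_add_right)
    show "pairwise orthogonal (Basis :: 'n set)" by (auto simp: pairwise_def orthogonal_def inner_not_same_Basis)
  qed (use a in auto)
  finally show ?thesis using a Nbox1_volume by (simp add: ennreal_mult)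
qed

lemma emeasure_mu_product:
  assumes A: "A \<in> sets borel" and I: "I \<in> sets borel" "I \<subseteq> {0<..}"
  shows "emeasure mu (A \<times> I) = (\<integral>\<^sup>+s. rho s * indicator I s \<partial>lborel) * emeasure lborel A"
proof -
  have "A \<times> I \<in> sets borel" unfolding borel_prod[symmetric] using A I by simp
  then have "emeasure mu (A \<times> I) = (\<integral>\<^sup>+s. rho s * emeasure lborel {w. (w, s) \<in> A \<times> I} \<partial>lborel)"
    using I by (intro emeasure_mu) (auto simp: S_def)
  also have "\<dots> = (\<integral>\<^sup>+s. (rho s * indicator I s) * emeasure lborel A \<partial>lborel)"
    by (rule nn_integral_cong) (auto simp: indicator_def)
  also have "\<dots> = (\<integral>\<^sup>+s. rho s * indicator I s \<partial>lborel) * emeasure lborel A"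
    using I(1) by (intro nn_integral_multc) auto
  finally show ?thesis .
qed

lemma rho_interval_ge:
  assumes "0 \<le> lo" "lo < hi"
  shows "ennreal ((hi - lo) * hi powr (- nu - 1)) \<le> (\<integral>\<^sup>+s. rho s * indicator {lo<..<hi} s \<partial>lborel)"
proof -
  have "ennreal ((hi - lo) * hi powr (- nu - 1)) = (\<integral>\<^sup>+s. ennreal (hi powr (- nu - 1)) * indicator {lo<..<hi} s \<partial>lborel)"
    using assms by (subst nn_integral_cmult) (simp_all add: ennreal_mult[symmetric] mult.commute)
  also have "\<dots> \<le> (\<integral>\<^sup>+s. rho s * indicator {lo<..<hi} s \<partial>lborel)"
  proof (rule nn_integral_mono)
    fix s :: real
    show "ennreal (hi powr (- nu - 1)) * indicator {lo<..<hi} s \<le> rho s * indicator {lo<..<hi} s"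
    proof (cases "s \<in> {lo<..<hi}")
      case True
      then have "hi powr (- nu - 1) \<le> s powr (- nu - 1)"
        using assms nu_pos by (intro powr_mono2') auto
      then show ?thesis using True assms by (simp add: rho_def ennreal_leI)
    qed simp
  qed
  finally show ?thesis .
qed

lemma rho_interval_le:
  assumes "0 < lo" "lo < hi"
  shows "(\<integral>\<^sup>+s. rho s * indicator {lo<..<hi} s \<partial>lborel) \<le> ennreal ((hi - lo) * lo powr (- nu - 1))"
proof -
  have "(\<integral>\<^sup>+s. rho s * indicator {lo<..<hi} s \<partial>lborel) \<le> (\<integral>\<^sup>+s. ennreal (lo powr (- nu - 1)) * indicator {lo<..<hi} s \<partial>lborel)"
  proof (rule nn_integral_mono)
    fix s :: real
    show "rho s * indicator {lo<..<hi} s \<le> ennreal (lo powr (- nu - 1)) * indicator {lo<..<hi} s"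
    proof (cases "s \<in> {lo<..<hi}")
      case True
      then have "s powr (- nu - 1) \<le> lo powr (- nu - 1)"
        using assms nu_pos by (intro powr_mono2') auto
      then show ?thesis using True assms by (simp add: rho_def ennreal_leI)
    qed simp
  qed
  also have "\<dots> = ennreal ((hi - lo) * lo powr (- nu - 1))"
    using assms by (subst nn_integral_cmult) (simp_all add: ennreal_mult[symmetric] mult.commute)
  finally show ?thesis .
qed

text \<open>The measure of a ray is comparable with the density at its end point times that point, so mass
concentrates at the bottom.\<close>

lemma rho_tail:
  assumes h: "h > 0"
  shows "(\<integral>\<^sup>+s. rho s * indicator {h<..} s \<partial>lborel) = ennreal (h powr (- nu) / nu)"
proof -
  have "(\<integral>\<^sup>+s. rho s * indicator {h<..} s \<partial>lborel) = (\<integral>\<^sup>+s. ennreal (s powr (- nu - 1)) * indicator {h..} s \<partial>lborel)"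
  proof (rule nn_integral_cong_AE)
    have "AE s in lborel. s \<noteq> h" by (rule AE_lborel_singleton)
    then show "AE s in lborel. rho s * indicator {h<..} s = ennreal (s powr (- nu - 1)) * indicator {h..} s"
      by eventually_elim (use h in \<open>auto simp: rho_def indicator_def\<close>)
  qed
  also have "\<dots> = ennreal (0 - (- (h powr (- nu)) / nu))"
  proof (rule nn_integral_FTC_atLeast)
    show "(\<lambda>s. s powr (- nu - 1)) \<in> borel_measurable borel" by measurable
    show "((\<lambda>s. - (s powr (- nu)) / nu) has_real_derivative s powr (- nu - 1)) (at s)" if "h \<le> s" for s
      using that h nu_pos by (auto intro!: derivative_eq_intros)
    show "((\<lambda>s. - (s powr (- nu)) / nu) \<longlongrightarrow> 0) at_top"
    proof -
      have "((\<lambda>s :: real. s powr (- nu)) \<longlongrightarrow> 0) at_top"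
        using nu_pos by (intro tendsto_neg_powr filterlim_ident) auto
      from tendsto_divide[OF tendsto_minus[OF this] tendsto_const[of nu]] nu_pos show ?thesis by simp
    qed
  qed auto
  finally show ?thesis by simp
qed

lemma cosh_minus_1_le: "R \<ge> 0 \<Longrightarrow> 2 * (cosh R - 1) \<le> R\<^sup>2 * exp R" for R :: real
proof -
  assume R: "R \<ge> 0"
  have "1 - R \<le> exp (- R)" using exp_ge_add_one_self[of "- R"] by simp
  then have "(1 - R) * exp R \<le> exp (- R) * exp R" by (intro mult_right_mono) auto
  then have 1: "exp R - 1 \<le> R * exp R" by (simp add: exp_minus algebra_simps)
  have e: "exp R * exp (- R) = 1" by (simp add: exp_minus)
  have "2 * (cosh R - 1) = exp (- R) * (exp R - 1)\<^sup>2"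
    unfolding cosh_def using e by (simp add: power2_eq_square algebra_simps)
  also have "\<dots> \<le> exp (- R) * (R * exp R)\<^sup>2"
    using 1 R by (intro mult_left_mono power_mono) auto
  also have "\<dots> = R\<^sup>2 * exp R * (exp R * exp (- R))" by (simp only: power2_eq_square mult_ac)
  finally show ?thesis by (simp only: e)
qed

lemma cosh_minus_1_ge: "0 \<le> R \<Longrightarrow> R\<^sup>2 * exp (- R) \<le> 2 * (cosh R - 1)" for R :: real
proof -
  assume R: "R \<ge> 0"
  have 1: "R \<le> exp R - 1" using exp_ge_add_one_self[of R] by linarith
  have e: "exp R * exp (- R) = 1" by (simp add: exp_minus)
  have "exp (- R) * R\<^sup>2 \<le> exp (- R) * (exp R - 1)\<^sup>2"
    using 1 R by (intro mult_left_mono power_mono) auto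
  also have "\<dots> = 2 * (cosh R - 1)"
    unfolding cosh_def using e by (simp add: power2_eq_square algebra_simps)
  finally show ?thesis by (simp add: mult.commute)
qed

lemma exp_2_bounds: "exp 2 \<le> (9 :: real)" "exp 2 \<ge> (6 :: real)"
proof -
  have e: "exp 2 = exp 1 * (exp 1 :: real)" by (simp add: exp_add[symmetric])
  have "exp 1 * exp 1 \<le> 3 * (3 :: real)" using exp_le by (intro mult_mono) auto
  then show "exp 2 \<le> (9 :: real)" unfolding e by simp
  have "1 + 1 + 1 / 2 \<le> exp (1::real)" using exp_lower_Taylor_quadratic[of 1] by simp
  then have "(5/2) * (5/2) \<le> exp 1 * (exp 1 :: real)" by (intro mult_mono) auto
  then show "exp 2 \<ge> (6 :: real)" unfolding e by simp
qed

text \<open>Below the unit sphere of \<open>cap\<close> the height and the norms are bounded, and \<open>cosh_dist\<close> at height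
\<open>s\<close> is at least \<open>cosh (ln s)\<close>.\<close>

lemma base_half_ball_crude:
  assumes "(w, s) \<in> base_half_ball R" "R > 0"
  shows "w \<in> Nbox 2" "exp (- R) < s" "s < 1"
proof -
  define n where "n = (norm (V_part w))\<^sup>2"
  define m where "m = (norm (Z_part w))\<^sup>2"
  have b: "s > 0" "(s + n / 4)\<^sup>2 + m < 1" "1 + 2 * (s + n / 4) + ((s + n / 4)\<^sup>2 + m) < 2 * s * (1 + cosh R)"
    using assms(1) by (simp_all add: base_half_ball_iff n_def m_def)
  have nm: "n \<ge> 0" "m \<ge> 0" by (simp_all add: n_def m_def)
  have "(s + n / 4)\<^sup>2 < 1\<^sup>2" using b nm by simp
  then have a1: "s + n / 4 < 1" by (rule power2_less_imp_less) simp
  then show "s < 1" using nm by simp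
  have "n < 2\<^sup>2" using a1 b by simp
  then have "norm (V_part w) < 2" unfolding n_def by (rule power2_less_imp_less) simp
  moreover have "m < 1\<^sup>2" using b(2) zero_le_power2[of "s + n / 4"] unfolding one_power2 by linarith
  then have "norm (Z_part w) < 1" unfolding m_def by (rule power2_less_imp_less) simp
  ultimately show "w \<in> Nbox 2" by (simp add: Nbox_def)
  have "s\<^sup>2 \<le> (s + n / 4)\<^sup>2" using b nm by (intro power_mono) auto
  moreover define A where "A = (s + n / 4)\<^sup>2"
  moreover have "1 + 2 * s + n / 2 + A + m < 2 * s + 2 * s * cosh R"
    using b(3) unfolding A_def[symmetric] by (simp add: distrib_left)
  ultimately have "1 + s\<^sup>2 < 2 * s * cosh R" using nm by linarith
  also have "\<dots> = s * exp R + s * exp (- R)" by (simp add: cosh_def distrib_left)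
  finally have "1 + s\<^sup>2 < s * exp R + s * exp (- R)" .
  moreover have "(exp R - s) * (s - exp (- R)) = s * exp R + s * exp (- R) - s\<^sup>2 - exp R * exp (- R)"
    by (simp add: algebra_simps power2_eq_square)
  moreover have "exp R * exp (- R) = 1" by (simp add: exp_minus)
  ultimately have "(exp R - s) * (s - exp (- R)) > 0" by simp
  moreover have "exp R > 1" using assms(2) by simp
  then have "exp R - s > 0" using \<open>s < 1\<close> by linarith
  ultimately show "exp (- R) < s" by (simp add: zero_less_mult_iff)
qed

text \<open>Boxes around the identity of independent horizontal size \<open>a\<close> and logarithmic height \<open>b\<close>; they
are easy to multiply and to invert.\<close>

definition Ebox :: "real \<Rightarrow> real \<Rightarrow> ('n \<times> real) set" where
  "Ebox a b = Nbox a \<times> {exp (- b)<..<exp b}"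

text \<open>By completing squares, \<open>cosh_dist < cosh R\<close> bounds \<open>(1 - s)\<^sup>2 + |X|\<^sup>2/2 + |Z|\<^sup>2\<close> by a multiple
of \<open>R\<^sup>2\<close>.\<close>

lemma base_half_ball_small:
  assumes "R > 0" "R \<le> 2" shows "base_half_ball R \<subseteq> Ebox (5 * R) R"
proof
  fix p assume p: "p \<in> base_half_ball R"
  obtain w s where ws: "p = (w, s)" by fastforce
  define n where "n = (norm (V_part w))\<^sup>2"
  define m where "m = (norm (Z_part w))\<^sup>2"
  have b: "s > 0" "(s + n / 4)\<^sup>2 + m < 1" "1 + 2 * (s + n / 4) + ((s + n / 4)\<^sup>2 + m) < 2 * s * (1 + cosh R)"
    using p by (simp_all add: ws base_half_ball_iff n_def m_def)
  have c: "exp (- R) < s" "s < 1" using base_half_ball_crude[of w s R] p ws assms by auto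
  have nm: "n \<ge> 0" "m \<ge> 0" by (simp_all add: n_def m_def)
  have "(1 - s)\<^sup>2 + n / 2 + s * n / 2 + n\<^sup>2 / 16 + m = 1 + 2 * (s + n / 4) + ((s + n / 4)\<^sup>2 + m) - 4 * s"
    by (simp add: power2_eq_square field_simps)
  also have "\<dots> < s * (2 * (cosh R - 1))" using b(3) by (simp add: algebra_simps)
  also have "\<dots> \<le> 1 * (2 * (cosh R - 1))" using c cosh_real_ge_1[of R] by (intro mult_right_mono) auto
  also have "\<dots> \<le> R\<^sup>2 * exp R" using cosh_minus_1_le[of R] assms by simp
  also have "\<dots> \<le> R\<^sup>2 * 9"
  proof (rule mult_left_mono)
    have "exp R \<le> exp 2" using assms by simp
    then show "exp R \<le> 9" using exp_2_bounds by linarith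
  qed simp
  (* The constant 9 bounds exp 2. *)
  finally have *: "(1 - s)\<^sup>2 + n / 2 + s * n / 2 + n\<^sup>2 / 16 + m < 9 * R\<^sup>2" by simp
  have "s * n \<ge> 0" using b nm by simp
  then have "n < 25 * R\<^sup>2" "m < 25 * R\<^sup>2"
    using * nm zero_le_power2[of "1 - s"] zero_le_power2[of n] zero_le_power2[of R] by linarith+
  then have "n < (5 * R)\<^sup>2" "m < (5 * R)\<^sup>2" by (simp_all add: power_mult_distrib)
  then have "norm (V_part w) < 5 * R" "norm (Z_part w) < 5 * R"
    unfolding n_def m_def using assms by (auto intro: power2_less_imp_less)
  moreover have "s < exp R"
  proof -
    have "1 \<le> exp R" using assms by simp
    then show ?thesis using c by linarith
  qed
  ultimately show "p \<in> Ebox (5 * R) R" using c by (simp add: ws Ebox_def Nbox_def)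
qed

text \<open>The box sits at a distance of order \<open>R\<close> below the identity, small enough to stay within distance
\<open>R\<close>, but low enough that the horizontal extent does not lift it out of \<open>cap < 1\<close>; hence the asymmetric
interval.\<close>

lemma small_box_subset_base_half_ball:
  assumes R: "R > 0" "R \<le> 2"
  shows "Nbox (R / 32) \<times> {1 - R / 8<..<1 - R / 16} \<subseteq> base_half_ball R"
proof
  fix p assume p: "p \<in> Nbox (R / 32) \<times> {1 - R / 8<..<1 - R / 16}"
  obtain w s where ws: "p = (w, s)" by fastforce
  define n where "n = (norm (V_part w))\<^sup>2"
  define m where "m = (norm (Z_part w))\<^sup>2"
  have nm: "n \<ge> 0" "m \<ge> 0" by (simp_all add: n_def m_def)
  have s: "1 - R / 8 < s" "s < 1 - R / 16" using p ws by auto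
  have "n \<le> (R / 32)\<^sup>2" "m \<le> (R / 32)\<^sup>2"
    unfolding n_def m_def using p ws by (auto simp: Nbox_def intro!: power_mono)
  then have nR: "n \<le> R\<^sup>2 / 1024" "m \<le> R\<^sup>2 / 1024" by (simp_all add: power_divide)
  have RR: "R\<^sup>2 \<le> 2 * R" using R by (simp add: power2_eq_square)
  have s34: "s > 3 / 4" using s R by simp
  have a: "s + n / 4 \<le> 1 - R / 32" using s nR RR R by linarith
  have a0: "s + n / 4 \<ge> 0" using s34 nm by linarith
  have "(s + n / 4)\<^sup>2 \<le> s + n / 4"
    using mult_left_le[of "s + n / 4" "s + n / 4"] a a0 R by (simp add: power2_eq_square)
  then have b2: "(s + n / 4)\<^sup>2 + m < 1" using a nR RR R by linarith
  have n1: "n\<^sup>2 \<le> n"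
  proof -
    have "n \<le> 1" using nR RR R by linarith
    then show ?thesis using mult_left_le[of n n] nm by (simp add: power2_eq_square)
  qed
  have sn: "s * n \<le> n" using mult_right_mono[of s 1 n] s R nm by simp
  have "(1 - s)\<^sup>2 \<le> (R / 8)\<^sup>2" using s R by (intro power_mono) auto
  then have s2: "(1 - s)\<^sup>2 \<le> R\<^sup>2 / 64" by (simp add: power_divide)
  have "1 + 2 * (s + n / 4) + ((s + n / 4)\<^sup>2 + m) - 4 * s = (1 - s)\<^sup>2 + n / 2 + s * n / 2 + n\<^sup>2 / 16 + m"
    by (simp add: power2_eq_square field_simps)
  also have "\<dots> < R\<^sup>2 / 12"
  proof -
    have "R\<^sup>2 > 0" using R by simp
    then show ?thesis using s2 nR sn n1 by linarith
  qed
  also have "\<dots> = 3 / 4 * (R\<^sup>2 * (1 / 9))" by simp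
  also have "\<dots> \<le> s * (R\<^sup>2 * exp (- R))"
  proof (rule mult_mono)
    have "exp R \<le> exp 2" using R by simp
    then have "exp R \<le> 9" using exp_2_bounds by linarith
    then have "1 / 9 \<le> exp (- R)" by (simp add: exp_minus field_simps)
    then show "R\<^sup>2 * (1 / 9) \<le> R\<^sup>2 * exp (- R)" by (rule mult_left_mono) simp
  qed (use s34 in auto)
  also have "\<dots> \<le> s * (2 * (cosh R - 1))"
    using cosh_minus_1_ge[of R] R s34 by (intro mult_left_mono) auto
  finally have "1 + 2 * (s + n / 4) + ((s + n / 4)\<^sup>2 + m) < 2 * s * (1 + cosh R)" by (simp add: algebra_simps)
  then show "p \<in> base_half_ball R" using b2 s34 unfolding ws base_half_ball_iff n_def m_def by simp
qed

text \<open>For large \<open>R\<close> the box reaches down to a fixed multiple of the lowest height \<open>exp (-R)\<close>, and this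
bottom part carries a fixed proportion of the measure of the half ball.\<close>

lemma large_box_subset_base_half_ball:
  assumes R: "R > 0"
  shows "Nbox (1/2) \<times> {5/2 * exp (- R)<..<1/2} \<subseteq> base_half_ball R"
proof
  fix p assume p: "p \<in> Nbox (1/2) \<times> {5/2 * exp (- R)<..<1/2}"
  obtain w s where ws: "p = (w, s)" by fastforce
  define n where "n = (norm (V_part w))\<^sup>2"
  define m where "m = (norm (Z_part w))\<^sup>2"
  have nm: "n \<ge> 0" "m \<ge> 0" by (simp_all add: n_def m_def)
  have s: "5/2 * exp (- R) < s" "s < 1/2" using p ws by auto
  have s0: "s > 0" using s(1) exp_gt_zero[of "- R"] by linarith
  have "n \<le> (1/2)\<^sup>2" "m \<le> (1/2)\<^sup>2"
    unfolding n_def m_def using p ws by (auto simp: Nbox_def intro!: power_mono)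
  then have nm4: "n \<le> 1/4" "m \<le> 1/4" by (simp_all add: power_divide)
  have a: "0 \<le> s + n / 4" "s + n / 4 \<le> 3/4" using s s0 nm nm4 by linarith+
  then have "(s + n / 4)\<^sup>2 \<le> (3/4)\<^sup>2" by (intro power_mono) auto
  then have b2: "(s + n / 4)\<^sup>2 + m < 1" using nm4 by (simp add: power_divide)
  have "5/2 * (exp (- R) * exp R) < s * exp R" using s(1) by (simp add: mult.assoc[symmetric])
  then have "5/2 < s * exp R" by (simp add: exp_minus)
  also have "\<dots> \<le> 2 * s * cosh R" using s0 by (simp add: cosh_def distrib_left)
  finally have "5/2 < 2 * s * cosh R" .
  then have "1 + 2 * (s + n / 4) + ((s + n / 4)\<^sup>2 + m) < 2 * s * (1 + cosh R)"
    using b2 nm4 by (simp add: distrib_left)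
  then show "p \<in> base_half_ball R" using b2 s0 unfolding ws base_half_ball_iff n_def m_def by simp
qed

lemma Ebox_mult:
  assumes p: "p \<in> Ebox a b" and q: "q \<in> Ebox a' b'" and b: "b \<ge> 0"
  shows "mult p q \<in> Ebox (a + exp b * a' + exp b * a * a') (b + b')"
proof -
  obtain w s where ws: "p = (w, s)" by fastforce
  obtain w' s' where ws': "q = (w', s')" by fastforce
  have 1: "norm (V_part w) < a" "norm (Z_part w) < a" "exp (- b) < s" "s < exp b"
    using p by (auto simp: ws Ebox_def Nbox_def)
  have 2: "norm (V_part w') < a'" "norm (Z_part w') < a'" "exp (- b') < s'" "s' < exp b'"
    using q by (auto simp: ws' Ebox_def Nbox_def)
  have a0: "a > 0" "a' > 0" using 1(1) 2(1) norm_ge_zero le_less_trans by blast+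
  have s0: "s > 0" "s' > 0" using 1(3) 2(3) exp_gt_zero less_trans by blast+
  have "sqrt s \<le> exp b"
  proof -
    have "s \<le> exp b * exp b" using 1(4) b mult_left_mono[of 1 "exp b" "exp b"] by (simp add: less_imp_le order_less_le_trans)
    then show ?thesis by (simp add: real_le_lsqrt power2_eq_square)
  qed
  then have ss: "0 \<le> sqrt s" "sqrt s \<le> exp b" using s0 by auto
  have "norm (V_part (fst (mult p q))) = norm (V_part w + sqrt s *\<^sub>R V_part w')"
    by (simp add: ws ws' mult_eq part_linear)
  also have "\<dots> \<le> norm (V_part w) + sqrt s * norm (V_part w')" using norm_triangle_ineq[of "V_part w" "sqrt s *\<^sub>R V_part w'"] ss by simp
  also have "\<dots> < a + exp b * a'" using 1 2 ss a0 by (intro add_less_le_mono mult_mono) auto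
  also have "\<dots> \<le> a + exp b * a' + exp b * a * a'" using a0 by simp
  finally have V: "norm (V_part (fst (mult p q))) < a + exp b * a' + exp b * a * a'" .
  have "norm (Z_part (fst (mult p q))) = norm (Z_part w + s *\<^sub>R Z_part w' + (sqrt s / 2) *\<^sub>R br w w')"
    by (simp add: ws ws' mult_eq part_linear)
  also have "\<dots> \<le> norm (Z_part w) + norm (s *\<^sub>R Z_part w') + norm ((sqrt s / 2) *\<^sub>R br w w')"
    by (intro norm_triangle_le add_right_mono norm_triangle_ineq)
  also have "\<dots> = norm (Z_part w) + s * norm (Z_part w') + (sqrt s / 2) * norm (br w w')" using s0 by simp
  also have "\<dots> < a + exp b * a' + exp b * (a * a')"
  proof (intro add_less_le_mono)
    show "s * norm (Z_part w') \<le> exp b * a'" using 1 2 s0 by (intro mult_mono) auto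
    have "norm (br w w') \<le> norm (V_part w) * norm (V_part w')" by (rule norm_br_le)
    also have "\<dots> \<le> a * a'" using 1 2 a0 by (intro mult_mono) auto
    finally have bb: "norm (br w w') \<le> a * a'" .
    have hh: "sqrt s / 2 \<le> exp b" using ss by linarith
    show "sqrt s / 2 * norm (br w w') \<le> exp b * (a * a')" by (rule mult_mono[OF hh bb]) simp_all
  qed (use 1 in simp)
  finally have Z: "norm (Z_part (fst (mult p q))) < a + exp b * a' + exp b * a * a'" by (simp add: mult.assoc)
  have "exp (- b) * exp (- b') < s * s'" "s * s' < exp b * exp b'"
    using 1 2 s0 by (intro mult_strict_mono; simp)+
  then have "exp (- (b + b')) < snd (mult p q)" "snd (mult p q) < exp (b + b')"
    by (simp_all add: ws ws' mult_eq exp_add[symmetric])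
  with V Z show ?thesis unfolding Ebox_def Nbox_def by (cases "mult p q") simp
qed

lemma Ebox_inverse:
  assumes p: "p \<in> Ebox a b" and b: "b \<ge> 0"
  shows "inverse_elt p \<in> Ebox (exp b * a) b"
proof -
  obtain w s where ws: "p = (w, s)" by fastforce
  have 1: "norm (V_part w) < a" "norm (Z_part w) < a" "exp (- b) < s" "s < exp b"
    using p by (auto simp: ws Ebox_def Nbox_def)
  have a0: "a > 0" using 1(1) norm_ge_zero le_less_trans by blast
  have s0: "s > 0" using 1(3) exp_gt_zero less_trans by blast
  have i: "1 / s < exp b" "exp (- b) < 1 / s"
    using 1 s0 by (simp_all add: exp_minus field_simps)
  have "1 / s \<le> exp b * exp b"
  proof -
    have "exp b * 1 \<le> exp b * exp b" using b by (intro mult_left_mono) auto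
    then show ?thesis using i by linarith
  qed
  then have ss: "0 \<le> sqrt (1 / s)" "sqrt (1 / s) \<le> exp b" using s0 by (auto simp: real_le_lsqrt power2_eq_square)
  have e: "inverse_elt p = (- (sqrt (1 / s) *\<^sub>R V_part w + (1 / s) *\<^sub>R Z_part w), 1 / s)"
    by (simp add: ws inverse_elt_def dil_def)
  have "norm (V_part (fst (inverse_elt p))) = sqrt (1 / s) * norm (V_part w)"
    unfolding e using ss by (simp add: part_linear)
  also have "\<dots> < exp b * a" using ss 1 a0 s0 by (intro mult_le_less_imp_less) auto
  finally have V: "norm (V_part (fst (inverse_elt p))) < exp b * a" .
  have "norm (Z_part (fst (inverse_elt p))) = (1 / s) * norm (Z_part w)"
    unfolding e using s0 by (simp add: part_linear)
  also have "\<dots> < exp b * a" using i 1 a0 s0 by (intro mult_strict_mono) auto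
  finally have "norm (Z_part (fst (inverse_elt p))) < exp b * a" .
  with V i show ?thesis unfolding Ebox_def Nbox_def by (cases "inverse_elt p") (simp add: e)
qed

lemma Ebox_mono: "a \<le> a' \<Longrightarrow> b \<le> b' \<Longrightarrow> Ebox a b \<subseteq> Ebox a' b'"
proof
  fix p assume a: "a \<le> a'" and b: "b \<le> b'" and p: "p \<in> Ebox a b"
  obtain w s where ws: "p = (w, s)" by fastforce
  have 1: "norm (V_part w) < a" "norm (Z_part w) < a" "exp (- b) < s" "s < exp b"
    using p by (simp_all add: ws Ebox_def Nbox_def)
  have "exp (- b') \<le> exp (- b)" "exp b \<le> exp b'" using b by simp_all
  then have "exp (- b') < s" "s < exp b'" using 1 by linarith+
  then show "p \<in> Ebox a' b'" using 1 a unfolding ws Ebox_def Nbox_def by simp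
qed

lemma Ebox_in_S: "Ebox a b \<subseteq> S"
proof
  fix p assume p: "p \<in> Ebox a b"
  obtain w s where ws: "p = (w, s)" by fastforce
  have "exp (- b) < s" using p by (simp add: ws Ebox_def)
  then have "0 < s" using exp_gt_zero[of "- b"] by linarith
  then show "p \<in> S" by (simp add: ws)
qed

lemma open_Ebox: "open (Ebox a b)"
  unfolding Ebox_def by (intro open_Times open_Nbox) auto

text \<open>If two half balls of radius at most \<open>R\<close> meet, the second lies in the left translate by the
centre of the first of the set of products \<open>p q\<^sup>-\<^sup>1 r\<close>.\<close>

lemma small_engulf:
  assumes R: "0 < R" "R \<le> 2" and p: "p \<in> base_half_ball R" and q: "q \<in> base_half_ball R" and r: "r \<in> base_half_ball R"
  shows "mult (mult p (inverse_elt q)) r \<in> Ebox (10000000 * R) (3 * R)"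
proof -
  have E: "p \<in> Ebox (5 * R) R" "q \<in> Ebox (5 * R) R" "r \<in> Ebox (5 * R) R"
    using subsetD[OF base_half_ball_small[OF R]] p q r by simp_all
  have e1: "1 \<le> exp R" "exp R \<le> 9"
  proof -
    have "exp R \<le> exp 2" using R by simp
    then show "exp R \<le> 9" using exp_2_bounds by linarith
  qed (use R in simp)
  (* The numbers below are crude: exp R is at most 9, and each product adds the three terms of Ebox_mult. *)
  have "inverse_elt q \<in> Ebox (exp R * (5 * R)) R" using E(2) R by (intro Ebox_inverse) auto
  then have "inverse_elt q \<in> Ebox (45 * R) R" using Ebox_mono[of "exp R * (5 * R)" "45 * R" R R] e1 R by auto
  then have "mult p (inverse_elt q) \<in> Ebox (5 * R + exp R * (45 * R) + exp R * (5 * R) * (45 * R)) (R + R)"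
    using E(1) R by (intro Ebox_mult) auto
  moreover have "5 * R + exp R * (45 * R) + exp R * (5 * R) * (45 * R) \<le> 5000 * R"
  proof -
    have "exp R * (45 * R) \<le> 9 * (45 * R)" using e1 R by (intro mult_right_mono) auto
    moreover have "exp R * (5 * R) * (45 * R) \<le> 9 * (5 * 2) * (45 * R)" using e1 R by (intro mult_mono) auto
    ultimately show ?thesis using R by linarith
  qed
  ultimately have pq: "mult p (inverse_elt q) \<in> Ebox (5000 * R) (2 * R)"
    using Ebox_mono[of _ "5000 * R" "R + R" "2 * R"] by fastforce
  have e2: "exp (2 * R) \<le> 81"
  proof -
    have "exp (2 * R) = exp R * exp R" by (simp add: exp_add[symmetric])
    also have "\<dots> \<le> 9 * 9" using e1 by (intro mult_mono) auto
    finally show ?thesis by simp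
  qed
  have "mult (mult p (inverse_elt q)) r \<in> Ebox (5000 * R + exp (2 * R) * (5 * R) + exp (2 * R) * (5000 * R) * (5 * R)) (2 * R + R)"
    using pq E(3) R by (intro Ebox_mult) auto
  moreover have "5000 * R + exp (2 * R) * (5 * R) + exp (2 * R) * (5000 * R) * (5 * R) \<le> 10000000 * R"
  proof -
    have "exp (2 * R) * (5 * R) \<le> 81 * (5 * R)" using e2 R by (intro mult_right_mono) auto
    moreover have "exp (2 * R) * (5000 * R) * (5 * R) \<le> 81 * (5000 * 2) * (5 * R)" using e2 R by (intro mult_mono) auto
    ultimately show ?thesis using R by linarith
  qed
  ultimately show ?thesis
    using Ebox_mono[of _ "10000000 * R" "2 * R + R" "3 * R"] by fastforce
qed

end

section \<open>Weak type for small half balls and for balls of the nilpotent factor\<close>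

text \<open>Fubini on the region under the graph.\<close>

lemma nn_integral_layer_cake:
  fixes f :: "'a \<Rightarrow> ennreal" and w :: "real \<Rightarrow> ennreal"
  assumes M: "sigma_finite_measure M" and f[measurable]: "f \<in> borel_measurable M"
    and w[measurable]: "w \<in> borel_measurable borel"
  shows "(\<integral>\<^sup>+x. (\<integral>\<^sup>+b. w b * indicator {b. ennreal b < f x} b \<partial>lborel) \<partial>M)
       = (\<integral>\<^sup>+b. w b * emeasure M {x\<in>space M. f x > ennreal b} \<partial>lborel)"
proof -
  interpret M: sigma_finite_measure M by fact
  interpret P: pair_sigma_finite M lborel by unfold_locales
  have eq: "indicator {b. ennreal b < f x} b = (if ennreal b < f x then 1 else 0 :: ennreal)" for x b
    by (simp add: indicator_def)
  have "(\<integral>\<^sup>+x. (\<integral>\<^sup>+b. w b * indicator {b. ennreal b < f x} b \<partial>lborel) \<partial>M)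
      = (\<integral>\<^sup>+b. (\<integral>\<^sup>+x. w b * indicator {b. ennreal b < f x} b \<partial>M) \<partial>lborel)"
    unfolding eq by (rule P.Fubini'[symmetric]) measurable
  also have "\<dots> = (\<integral>\<^sup>+b. w b * emeasure M {x\<in>space M. f x > ennreal b} \<partial>lborel)"
  proof (rule nn_integral_cong)
    fix b :: real
    have "(\<integral>\<^sup>+x. w b * indicator {b. ennreal b < f x} b \<partial>M) = (\<integral>\<^sup>+x. w b * indicator {x\<in>space M. f x > ennreal b} x \<partial>M)"
      by (rule nn_integral_cong) (simp add: indicator_def)
    also have "\<dots> = w b * emeasure M {x\<in>space M. f x > ennreal b}"
      by (rule nn_integral_cmult_indicator) measurable
    finally show "(\<integral>\<^sup>+x. w b * indicator {b. ennreal b < f x} b \<partial>M) = w b * emeasure M {x\<in>space M. f x > ennreal b}" .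
  qed
  finally show ?thesis .
qed

lemma nn_integral_inverse_Icc:
  assumes "0 < a" "a \<le> b"
  shows "(\<integral>\<^sup>+x. ennreal (1 / x) * indicator {a..b} x \<partial>lborel) = ennreal (ln (b / a))"
proof -
  have "(\<integral>\<^sup>+x. ennreal (1 / x) * indicator {a..b} x \<partial>lborel) = ennreal (ln b - ln a)"
    using assms by (intro nn_integral_FTC_Icc) (auto intro!: derivative_eq_intros)
  then show ?thesis using assms by (simp add: ln_div)
qed

context damek_ricci
begin

lemma mult_assoc_S: "x \<in> S \<Longrightarrow> y \<in> S \<Longrightarrow> mult (mult x y) z = mult x (mult y z)"
proof -
  assume a: "x \<in> S" "y \<in> S"
  obtain w s where x: "x = (w, s)" "s > 0" using a(1) by (cases x) auto
  obtain w' s' where y: "y = (w', s')" "s' > 0" using a(2) by (cases y) auto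
  show ?thesis using mult_assoc[OF x(2) y(2)] by (cases z) (simp add: x y)
qed

text \<open>Cancellation: \<open>y = x p q\<^sup>-\<^sup>1\<close>.\<close>

lemma translate_quotient:
  assumes S: "x \<in> S" "y \<in> S" "p \<in> S" "q \<in> S" "r \<in> S" and eq: "mult x p = mult y q"
  shows "mult y r = mult x (mult (mult p (inverse_elt q)) r)"
proof -
  have i: "inverse_elt q \<in> S" using S(4) by (rule inverse_in_S)
  have "mult x (mult (mult p (inverse_elt q)) r) = mult (mult x p) (mult (inverse_elt q) r)"
    using S i by (simp add: mult_assoc_S mult_in_S)
  also have "\<dots> = mult y (mult q (mult (inverse_elt q) r))" using S by (simp add: eq mult_assoc_S)
  also have "\<dots> = mult y r" using S mult_inverse_cancel(1)[of q r] by simp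
  finally show ?thesis by simp
qed

lemma base_half_ball_mono: "0 < R \<Longrightarrow> R \<le> R' \<Longrightarrow> base_half_ball R \<subseteq> base_half_ball R'"
proof -
  assume "0 < R" "R \<le> R'"
  then have "cosh R \<le> cosh R'" by (simp add: cosh_real_nonneg_le_iff)
  then show ?thesis unfolding base_half_ball_def by auto
qed

lemma emeasure_base_half_ball_small_ge:
  assumes R: "0 < R" "R \<le> 2"
  shows "ennreal ((1/32) ^ DIM('n) * Nbox1_volume / 16 * R ^ Suc DIM('n)) \<le> emeasure mu (base_half_ball R)"
proof -
  let ?I = "{1 - R / 8<..<1 - R / 16}"
  have I0: "?I \<subseteq> {0<..}" using R by auto
  have "1 powr (- nu - 1) \<le> (1 - R / 16) powr (- nu - 1)"
    using R nu_pos by (intro powr_mono2') auto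
  then have "R / 16 * 1 \<le> (1 - R / 16 - (1 - R / 8)) * (1 - R / 16) powr (- nu - 1)"
    using R by (intro mult_mono) auto
  then have "ennreal (R / 16) \<le> ennreal ((1 - R / 16 - (1 - R / 8)) * (1 - R / 16) powr (- nu - 1))"
    by (intro ennreal_leI) simp
  also have "\<dots> \<le> (\<integral>\<^sup>+s. rho s * indicator ?I s \<partial>lborel)"
    using R by (intro rho_interval_ge) auto
  finally have "ennreal (R / 16) * emeasure lborel (Nbox (R / 32)) \<le> emeasure mu (Nbox (R / 32) \<times> ?I)"
    using I0 by (subst emeasure_mu_product) (auto intro: mult_right_mono)
  also have "\<dots> \<le> emeasure mu (base_half_ball R)"
    by (intro emeasure_mono small_box_subset_base_half_ball R borel_imp_sets_mu base_half_ball_subset_S) (simp add: open_base_half_ball)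
  finally have "ennreal (R / 16) * ennreal ((R / 32) ^ DIM('n) * Nbox1_volume) \<le> emeasure mu (base_half_ball R)"
    using R by (simp add: emeasure_Nbox)
  moreover have "ennreal (R / 16) * ennreal ((R / 32) ^ DIM('n) * Nbox1_volume) = ennreal ((1/32) ^ DIM('n) * Nbox1_volume / 16 * R ^ Suc DIM('n))"
    using R Nbox1_volume(2) by (simp add: ennreal_mult[symmetric] power_divide mult_ac)
  ultimately show ?thesis by simp
qed

lemma emeasure_Ebox_le:
  assumes R: "0 < R" "R \<le> 2"
  shows "emeasure mu (Ebox (10000000 * R) (3 * R))
    \<le> ennreal (6 * exp 6 * exp (6 * (nu + 1)) * (10000000 ^ DIM('n) * Nbox1_volume) * R ^ Suc DIM('n))"
proof -
  let ?I = "{exp (- (3 * R))<..<exp (3 * R)}"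
  have I0: "?I \<subseteq> {0<..}" by (auto intro: order_less_trans[OF exp_gt_zero])
  have e1: "1 - 3 * R \<le> exp (- (3 * R))" using exp_ge_add_one_self[of "- (3 * R)"] by simp
  then have "(1 - 3 * R) * exp (3 * R) \<le> exp (- (3 * R)) * exp (3 * R)" by (intro mult_right_mono) auto
  then have e2: "exp (3 * R) - 1 \<le> 3 * R * exp (3 * R)" by (simp add: exp_minus algebra_simps)
  have e6: "exp (3 * R) \<le> exp 6" using R by simp
  have "1 \<le> exp (6::real)" by simp
  have "exp (3 * R) - exp (- (3 * R)) \<le> 3 * R * exp 6 + 3 * R * exp 6"
  proof -
    have "3 * R * exp (3 * R) \<le> 3 * R * exp 6" using R e6 by (intro mult_left_mono) auto
    moreover have "3 * R * 1 \<le> 3 * R * exp 6" using R by (intro mult_left_mono) auto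
    ultimately show ?thesis using e1 e2 by linarith
  qed
  moreover have "exp (- (3 * R)) powr (- nu - 1) \<le> exp (6 * (nu + 1))"
  proof -
    have "exp (- (3 * R)) powr (- nu - 1) = exp (3 * R * (nu + 1))" by (simp add: powr_def algebra_simps)
    also have "\<dots> \<le> exp (6 * (nu + 1))"
    proof -
      have "3 * R * (nu + 1) \<le> 6 * (nu + 1)" using R nu_pos by (intro mult_right_mono) auto
      then show ?thesis by (simp only: exp_le_cancel_iff)
    qed
    finally show ?thesis .
  qed
  ultimately have b: "(exp (3 * R) - exp (- (3 * R))) * exp (- (3 * R)) powr (- nu - 1) \<le> (6 * R * exp 6) * exp (6 * (nu + 1))"
    using R by (intro mult_mono) auto
  have "emeasure mu (Ebox (10000000 * R) (3 * R)) = (\<integral>\<^sup>+s. rho s * indicator ?I s \<partial>lborel) * ennreal ((10000000 * R) ^ DIM('n) * Nbox1_volume)"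
    unfolding Ebox_def using I0 R by (subst emeasure_mu_product) (auto simp: emeasure_Nbox)
  also have "\<dots> \<le> ennreal ((exp (3 * R) - exp (- (3 * R))) * exp (- (3 * R)) powr (- nu - 1)) * ennreal ((10000000 * R) ^ DIM('n) * Nbox1_volume)"
    using R by (intro mult_right_mono rho_interval_le) auto
  also have "\<dots> \<le> ennreal ((6 * R * exp 6) * exp (6 * (nu + 1))) * ennreal ((10000000 * R) ^ DIM('n) * Nbox1_volume)"
    using b by (intro mult_right_mono ennreal_leI) auto
  also have "\<dots> = ennreal (6 * exp 6 * exp (6 * (nu + 1)) * (10000000 ^ DIM('n) * Nbox1_volume) * R ^ Suc DIM('n))"
    using R Nbox1_volume(2) by (simp add: ennreal_mult[symmetric] power_mult_distrib mult_ac)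
  finally show ?thesis .
qed

text \<open>Boxes of size \<open>R\<close> have measure comparable with \<open>R\<close> to the dimension of the group, as long as \<open>R\<close>
is bounded; with \<open>small_engulf\<close> the Vitali argument applies.\<close>

lemma small_half_balls_weak_type:
  "\<exists>C>0. \<forall>g\<in>borel_measurable mu. \<forall>a::real. a > 0 \<longrightarrow>
     ennreal a * emeasure mu (\<Union>(x, R)\<in>{(x, R). x \<in> S \<and> 0 < R \<and> R \<le> 2 \<and>
        ennreal a * emeasure mu (half_ball x R) \<le> (\<integral>\<^sup>+y\<in>half_ball x R. g y \<partial>mu)}. half_ball x R)
     \<le> ennreal C * (\<integral>\<^sup>+y. g y \<partial>mu)"
proof -
  define c1 where "c1 = (1/32) ^ DIM('n) * Nbox1_volume / 16"
  define c2 where "c2 = 6 * exp 6 * exp (6 * (nu + 1)) * (10000000 ^ DIM('n) * Nbox1_volume)"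
  have c: "c1 > 0" "c2 > 0" using Nbox1_volume(2) by (simp_all add: c1_def c2_def)
  show ?thesis
  proof (intro exI conjI ballI allI impI)
    show "c2 / c1 > 0" using c by simp
    fix g :: "'n \<times> real \<Rightarrow> ennreal" and a :: real
    assume g: "g \<in> borel_measurable mu" and a: "a > 0"
    define I where "I = {(x, R). x \<in> S \<and> 0 < R \<and> R \<le> 2 \<and>
        ennreal a * emeasure mu (half_ball x R) \<le> (\<integral>\<^sup>+y\<in>half_ball x R. g y \<partial>mu)}"
    have I: "fst i \<in> S" "0 < snd i" "snd i \<le> 2" if "i \<in> I" for i using that by (auto simp: I_def)
    have "ennreal a * emeasure mu (\<Union>i\<in>I. half_ball (fst i) (snd i)) \<le> ennreal (c2 / c1) * (\<integral>\<^sup>+y. g y \<partial>mu)"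
    proof (rule vitali_weak_type[where r = snd and F' = "\<lambda>i. mult (fst i) ` Ebox (10000000 * snd i) (3 * snd i)"])
      fix i assume i: "i \<in> I"
      note ii = I[OF i]
      show "open (half_ball (fst i) (snd i))" using ii by (intro open_half_ball) auto
      then show "half_ball (fst i) (snd i) \<in> sets mu"
        using ii by (intro borel_imp_sets_mu half_ball_subset_S) auto
      have "open (mult (fst i) ` Ebox (10000000 * snd i) (3 * snd i))"
        using ii by (intro open_mult_image Ebox_in_S open_Ebox)
      then show "mult (fst i) ` Ebox (10000000 * snd i) (3 * snd i) \<in> sets mu"
        by (intro borel_imp_sets_mu image_subsetI mult_in_S[OF ii(1)] subsetD[OF Ebox_in_S]) (simp_all only: borel_open)
      show "emeasure mu (mult (fst i) ` Ebox (10000000 * snd i) (3 * snd i)) \<le> ennreal (c2 / c1) * emeasure mu (half_ball (fst i) (snd i))"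
      proof -
        have "emeasure mu (mult (fst i) ` Ebox (10000000 * snd i) (3 * snd i)) = emeasure mu (Ebox (10000000 * snd i) (3 * snd i))"
          using ii by (intro emeasure_mult_image Ebox_in_S) (simp_all add: open_Ebox)
        also have "\<dots> \<le> ennreal (c2 * snd i ^ Suc DIM('n))"
          unfolding c2_def by (rule emeasure_Ebox_le[OF ii(2,3)])
        also have "\<dots> = ennreal (c2 / c1) * ennreal (c1 * snd i ^ Suc DIM('n))"
          using c ii by (simp add: ennreal_mult[symmetric])
        also have "\<dots> \<le> ennreal (c2 / c1) * emeasure mu (base_half_ball (snd i))"
          unfolding c1_def by (intro mult_left_mono emeasure_base_half_ball_small_ge[OF ii(2,3)]) simp
        finally show ?thesis using ii by (simp add: emeasure_half_ball)
      qed
      show "ennreal a * emeasure mu (half_ball (fst i) (snd i)) \<le> (\<integral>\<^sup>+y\<in>half_ball (fst i) (snd i). g y \<partial>mu)"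
        using i by (auto simp: I_def)
    next
      fix i j assume i: "i \<in> I" and j: "j \<in> I" and ne: "half_ball (fst i) (snd i) \<inter> half_ball (fst j) (snd j) \<noteq> {}"
        and r: "snd j \<le> snd i"
      note ii = I[OF i] and jj = I[OF j]
      obtain p q where pq: "p \<in> base_half_ball (snd i)" "q \<in> base_half_ball (snd j)" "mult (fst i) p = mult (fst j) q"
      proof -
        obtain y where y: "y \<in> mult (fst i) ` base_half_ball (snd i)" "y \<in> mult (fst j) ` base_half_ball (snd j)"
          using ne unfolding half_ball_eq[OF ii(2)] half_ball_eq[OF jj(2)] by blast
        obtain p where "y = mult (fst i) p" "p \<in> base_half_ball (snd i)" using y(1) by (rule imageE)
        moreover obtain q where "y = mult (fst j) q" "q \<in> base_half_ball (snd j)" using y(2) by (rule imageE)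
        ultimately show ?thesis using that by simp
      qed
      have sub: "base_half_ball (snd j) \<subseteq> base_half_ball (snd i)" using base_half_ball_mono r jj by simp
      show "half_ball (fst j) (snd j) \<subseteq> mult (fst i) ` Ebox (10000000 * snd i) (3 * snd i)"
      proof
        fix y assume "y \<in> half_ball (fst j) (snd j)"
        then obtain r where r: "r \<in> base_half_ball (snd j)" "y = mult (fst j) r" using jj by (auto simp: half_ball_eq)
        have "y = mult (fst i) (mult (mult p (inverse_elt q)) r)"
          unfolding r(2) using ii jj pq r(1) subsetD[OF base_half_ball_subset_S] by (intro translate_quotient) auto
        moreover have "mult (mult p (inverse_elt q)) r \<in> Ebox (10000000 * snd i) (3 * snd i)"
          using ii pq(1) subsetD[OF sub pq(2)] subsetD[OF sub r(1)] by (intro small_engulf) auto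
        ultimately show "y \<in> mult (fst i) ` Ebox (10000000 * snd i) (3 * snd i)" by blast
      qed
    qed (rule g)
    moreover have "(\<Union>(x, R)\<in>I. half_ball x R) = (\<Union>i\<in>I. half_ball (fst i) (snd i))" by (simp add: case_prod_beta)
    ultimately show "ennreal a * emeasure mu (\<Union>(x, R)\<in>{(x, R). x \<in> S \<and> 0 < R \<and> R \<le> 2 \<and>
        ennreal a * emeasure mu (half_ball x R) \<le> (\<integral>\<^sup>+y\<in>half_ball x R. g y \<partial>mu)}. half_ball x R)
      \<le> ennreal (c2 / c1) * (\<integral>\<^sup>+y. g y \<partial>mu)" unfolding I_def[symmetric] by simp
  qed
qed

text \<open>A ball of the nilpotent factor, of homogeneous radius about \<open>sqrt s\<close>; it is the shadow of the
large half balls centred at \<open>(w0, s)\<close>, since it contains their projections.\<close>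

definition Nball :: "'n \<Rightarrow> real \<Rightarrow> 'n set" where
  "Nball w0 s = aff w0 s ` Nbox 2"

lemma Nbox_mult:
  assumes u: "u \<in> Nbox a" and v: "v \<in> Nbox b" and s: "0 < s" "s \<le> 1"
  shows "fst (mult (u, s) (v, t)) \<in> Nbox (a + b + a * b)"
proof -
  have 1: "norm (V_part u) < a" "norm (Z_part u) < a" "norm (V_part v) < b" "norm (Z_part v) < b"
    using u v by (auto simp: Nbox_def)
  have a0: "a > 0" "b > 0" using 1(1,3) norm_ge_zero le_less_trans by blast+
  have ss: "0 \<le> sqrt s" "sqrt s \<le> 1" using s by auto
  have "norm (V_part (fst (mult (u, s) (v, t)))) = norm (V_part u + sqrt s *\<^sub>R V_part v)"
    by (simp add: mult_eq part_linear)
  also have "\<dots> \<le> norm (V_part u) + sqrt s * norm (V_part v)" using norm_triangle_ineq[of "V_part u" "sqrt s *\<^sub>R V_part v"] ss by simp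
  also have "\<dots> \<le> norm (V_part u) + 1 * norm (V_part v)" using ss by (intro add_left_mono mult_right_mono) auto
  also have "\<dots> < a + b" using 1 by simp
  also have "\<dots> \<le> a + b + a * b" using a0 by simp
  finally have V: "norm (V_part (fst (mult (u, s) (v, t)))) < a + b + a * b" .
  have "norm (Z_part (fst (mult (u, s) (v, t)))) = norm (Z_part u + s *\<^sub>R Z_part v + (sqrt s / 2) *\<^sub>R br u v)"
    by (simp add: mult_eq part_linear)
  also have "\<dots> \<le> norm (Z_part u) + norm (s *\<^sub>R Z_part v) + norm ((sqrt s / 2) *\<^sub>R br u v)"
    by (intro norm_triangle_le add_right_mono norm_triangle_ineq)
  also have "\<dots> = norm (Z_part u) + s * norm (Z_part v) + (sqrt s / 2) * norm (br u v)" using s by simp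
  also have "\<dots> < a + b + a * b"
  proof (intro add_less_le_mono)
    show "norm (Z_part u) < a" by (rule 1)
    have "s * norm (Z_part v) \<le> 1 * norm (Z_part v)" using s by (intro mult_right_mono) auto
    then show "s * norm (Z_part v) \<le> b" using 1 by simp
    have "norm (br u v) \<le> norm (V_part u) * norm (V_part v)" by (rule norm_br_le)
    also have "\<dots> \<le> a * b" using 1 a0 by (intro mult_mono) auto
    finally have bb: "norm (br u v) \<le> a * b" .
    have hh: "sqrt s / 2 \<le> 1" using ss by linarith
    have "sqrt s / 2 * norm (br u v) \<le> 1 * (a * b)" by (rule mult_mono[OF hh bb]) simp_all
    then show "sqrt s / 2 * norm (br u v) \<le> a * b" by simp
  qed
  finally show ?thesis using V by (simp add: Nbox_def)
qed

lemma aff_continuous: "continuous_on UNIV (aff w0 s)"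
  unfolding aff_eq[abs_def] dil_def
  by (intro continuous_intros bounded_linear.continuous_on[OF bounded_bilinear.bounded_linear_right[OF bounded_bilinear_br]])

lemma aff_inverse:
  assumes "s > 0"
  shows "aff (fst (inverse_elt (w0, s))) (1 / s) (aff w0 s w) = w" "aff w0 s (aff (fst (inverse_elt (w0, s))) (1 / s) w) = w"
proof -
  obtain j where j: "inverse_elt (w0, s) = (j, 1 / s)" by (simp add: inverse_elt_def)
  have "mult (inverse_elt (w0, s)) (mult (w0, s) (w, 1)) = (w, 1)" using assms by (intro mult_inverse_cancel) auto
  then show "aff (fst (inverse_elt (w0, s))) (1 / s) (aff w0 s w) = w"
    unfolding j by (simp add: mult_aff)
  have "mult (w0, s) (mult (inverse_elt (w0, s)) (w, 1)) = (w, 1)" using assms by (intro mult_inverse_cancel) auto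
  then show "aff w0 s (aff (fst (inverse_elt (w0, s))) (1 / s) w) = w"
    unfolding j by (simp add: mult_aff)
qed

lemma open_aff_image:
  assumes "s > 0" "open A" shows "open (aff w0 s ` A)"
proof -
  have "aff w0 s ` A = aff (fst (inverse_elt (w0, s))) (1 / s) -` A"
  proof (intro set_eqI iffI)
    fix y assume "y \<in> aff (fst (inverse_elt (w0, s))) (1 / s) -` A"
    then show "y \<in> aff w0 s ` A" using aff_inverse(2)[OF assms(1), of w0 y]
      by (intro image_eqI[of _ _ "aff (fst (inverse_elt (w0, s))) (1 / s) y"]) auto
  qed (auto simp: aff_inverse(1)[OF assms(1)])
  then show ?thesis using open_vimage[OF assms(2) aff_continuous] by simp
qed

text \<open>As for half balls, the smaller ball consists of points with quotient form \<open>k k'\<^sup>-\<^sup>1 k''\<close>; the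
constant 26 is \<open>8 + 2 + 8 * 2\<close> with 8 coming from \<open>2 + 2 + 2 * 2\<close>.\<close>

lemma Nball_engulf:
  assumes s: "0 < s'" "s' \<le> s" and ne: "Nball w0 s \<inter> Nball w1 s' \<noteq> {}"
  shows "Nball w1 s' \<subseteq> aff w0 s ` Nbox 26"
proof
  fix y assume "y \<in> Nball w1 s'"
  then obtain k'' where k'': "k'' \<in> Nbox 2" "y = aff w1 s' k''" by (auto simp: Nball_def)
  obtain k k' where k: "k \<in> Nbox 2" "k' \<in> Nbox 2" "aff w0 s k = aff w1 s' k'"
    using ne unfolding Nball_def by blast
  define t where "t = s / s'"
  have t: "t \<ge> 1" "t > 0" "s' * t = s" using s by (simp_all add: t_def)
  have "mult (w0, s) (k, 1) = mult (w1, s') (k', t)" using k t by (simp add: mult_aff)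
  then have eq: "mult (w1, s') (k'', 1) = mult (w0, s) (mult (mult (k, 1) (inverse_elt (k', t))) (k'', 1))"
    using s t by (intro translate_quotient) auto
  define i where "i = fst (inverse_elt (k', t))"
  have ie: "inverse_elt (k', t) = (i, 1 / t)" by (simp add: i_def inverse_elt_def)
  have t1: "0 \<le> sqrt (1 / t)" "sqrt (1 / t) \<le> 1" "1 / t \<le> 1" using t by auto
  have "i \<in> Nbox 2"
  proof -
    have "V_part i = - (sqrt (1 / t) *\<^sub>R V_part k')" "Z_part i = - ((1 / t) *\<^sub>R Z_part k')"
      by (simp_all add: i_def inverse_elt_def dil_def part_linear)
    then have "norm (V_part i) = sqrt (1 / t) * norm (V_part k')" "norm (Z_part i) = (1 / t) * norm (Z_part k')"
      using t by simp_all
    moreover have "sqrt (1 / t) * norm (V_part k') \<le> 1 * norm (V_part k')" "(1 / t) * norm (Z_part k') \<le> 1 * norm (Z_part k')"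
      using t1 by (intro mult_right_mono; simp)+
    ultimately show ?thesis using k(2) by (auto simp: Nbox_def)
  qed
  then have 1: "fst (mult (k, 1) (inverse_elt (k', t))) \<in> Nbox 8"
    unfolding ie using Nbox_mult[OF k(1), of i 2 1] by simp
  have 2: "snd (mult (k, 1) (inverse_elt (k', t))) = 1 / t" by (simp add: ie mult_eq)
  have "mult (k, 1) (inverse_elt (k', t)) = (fst (mult (k, 1) (inverse_elt (k', t))), 1 / t)"
    by (simp add: prod_eq_iff 2)
  then have "fst (mult (mult (k, 1) (inverse_elt (k', t))) (k'', 1)) \<in> Nbox (8 + 2 + 8 * 2)"
    using Nbox_mult[OF 1 k''(1), of "1 / t" 1] t t1 by simp
  then have "fst (mult (mult (k, 1) (inverse_elt (k', t))) (k'', 1)) \<in> Nbox 26" by simp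
  moreover have "y = aff w0 s (fst (mult (mult (k, 1) (inverse_elt (k', t))) (k'', 1)))"
  proof -
    obtain a b where ab: "mult (mult (k, 1) (inverse_elt (k', t))) (k'', 1) = (a, b)" by fastforce
    have "(aff w1 s' k'', s' * 1) = (aff w0 s a, s * b)" using eq unfolding ab mult_aff .
    then have "aff w1 s' k'' = aff w0 s a" by (rule Pair_inject)
    then show ?thesis using k''(2) ab by (simp only: fst_conv)
  qed
  ultimately show "y \<in> aff w0 s ` Nbox 26" by blast
qed

lemma emeasure_Nball: "s > 0 \<Longrightarrow> emeasure lborel (Nball w0 s) = ennreal (s powr nu * (2 ^ DIM('n) * Nbox1_volume))"
  unfolding Nball_def using Nbox1_volume(2) by (simp add: emeasure_aff emeasure_Nbox ennreal_mult)

lemma open_Nball: "s > 0 \<Longrightarrow> open (Nball w0 s)"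
  unfolding Nball_def by (intro open_aff_image open_Nbox)

lemma Nball_weak_type:
  assumes g: "g \<in> borel_measurable lborel"
  shows "a * emeasure lborel (\<Union>(w0, s)\<in>{(w0, s). 0 < s \<and> a * emeasure lborel (Nball w0 s) \<le> (\<integral>\<^sup>+y\<in>Nball w0 s. g y \<partial>lborel)}. Nball w0 s)
     \<le> ennreal (13 ^ DIM('n)) * (\<integral>\<^sup>+y. g y \<partial>lborel)"
proof -
  define I where "I = {(w0, s). 0 < s \<and> a * emeasure lborel (Nball w0 s) \<le> (\<integral>\<^sup>+y\<in>Nball w0 s. g y \<partial>lborel)}"
  have "a * emeasure lborel (\<Union>i\<in>I. Nball (fst i) (snd i)) \<le> ennreal (13 ^ DIM('n)) * (\<integral>\<^sup>+y. g y \<partial>lborel)"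
  proof (rule vitali_weak_type[where r = snd and F' = "\<lambda>i. aff (fst i) (snd i) ` Nbox 26"])
    fix i assume i: "i \<in> I"
    then have s: "snd i > 0" by (auto simp: I_def)
    show "open (Nball (fst i) (snd i))" using s by (rule open_Nball)
    then show "Nball (fst i) (snd i) \<in> sets lborel" by simp
    show "aff (fst i) (snd i) ` Nbox 26 \<in> sets lborel" using open_aff_image[OF s open_Nbox] by simp
    have "(26::real) ^ DIM('n) = 13 ^ DIM('n) * 2 ^ DIM('n)" by (simp add: power_mult_distrib[symmetric])
    then show "emeasure lborel (aff (fst i) (snd i) ` Nbox 26) \<le> ennreal (13 ^ DIM('n)) * emeasure lborel (Nball (fst i) (snd i))"
      using s Nbox1_volume(2) by (simp add: emeasure_Nball emeasure_aff emeasure_Nbox ennreal_mult[symmetric] mult_ac)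
    show "a * emeasure lborel (Nball (fst i) (snd i)) \<le> (\<integral>\<^sup>+y\<in>Nball (fst i) (snd i). g y \<partial>lborel)"
      using i by (auto simp: I_def)
  next
    fix i j assume "i \<in> I" "j \<in> I" "Nball (fst i) (snd i) \<inter> Nball (fst j) (snd j) \<noteq> {}" "snd j \<le> snd i"
    then show "Nball (fst j) (snd j) \<subseteq> aff (fst i) (snd i) ` Nbox 26"
      by (intro Nball_engulf) (auto simp: I_def)
  qed (rule g)
  moreover have "(\<Union>(x, R)\<in>I. Nball x R) = (\<Union>i\<in>I. Nball (fst i) (snd i))" by (simp add: case_prod_beta)
  ultimately show ?thesis unfolding I_def[symmetric] by simp
qed

end

section \<open>A maximal operator on the vertical half line\<close>

text \<open>The length of the interval of levels between \<open>b0\<close> and \<open>x\<close>; stated as an inequality, it also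
covers infinite \<open>x\<close>.\<close>

lemma ennreal_diff_le_layer:
  fixes x :: ennreal
  assumes b: "b0 \<ge> 0"
  shows "x - ennreal b0 \<le> (\<integral>\<^sup>+b. indicator {b0..} b * indicator {b. ennreal b < x} b \<partial>lborel)"
proof (cases x)
  case (real r)
  have "x - ennreal b0 = ennreal (r - b0)" using real b by (simp add: ennreal_minus)
  also have "\<dots> \<le> emeasure lborel {b0..<r}"
    by (cases "b0 \<le> r") (simp_all add: ennreal_neg)
  also have "\<dots> = (\<integral>\<^sup>+b. indicator {b0..<r} b \<partial>lborel)" by simp
  also have "\<dots> \<le> (\<integral>\<^sup>+b. indicator {b0..} b * indicator {b. ennreal b < x} b \<partial>lborel)"
    using real b by (intro nn_integral_mono) (auto simp: indicator_def ennreal_less_iff)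
  finally show ?thesis .
next
  case top
  have "ennreal (real n) \<le> (\<integral>\<^sup>+b. indicator {b0..} b * indicator {b. ennreal b < x} b \<partial>lborel)" for n :: nat
  proof -
    have "ennreal (real n) = (\<integral>\<^sup>+b. indicator {b0..<b0 + real n} b \<partial>lborel)" by simp
    also have "\<dots> \<le> (\<integral>\<^sup>+b. indicator {b0..} b * indicator {b. ennreal b < x} b \<partial>lborel)"
      using top by (intro nn_integral_mono) (auto simp: indicator_def)
    finally show ?thesis .
  qed
  then have "(\<integral>\<^sup>+b. indicator {b0..} b * indicator {b. ennreal b < x} b \<partial>lborel) = \<infinity>"
    by (metis ennreal_of_nat_eq_real_of_nat ennreal_Ex_less_of_nat infinity_ennreal_def leD top.not_eq_extremum)
  then show ?thesis by simp
qed

lemma ln_max_le: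
  fixes A t :: real
  assumes A: "A \<ge> 1" and t: "t \<ge> 0"
  shows "ln (max 1 (A * t)) \<le> (1 + ln A / ln 2) * ln (2 + t)"
proof -
  have "max 1 (A * t) \<le> A * (2 + t)"
  proof -
    have "1 * 1 \<le> A * (2 + t)" using A t by (intro mult_mono) auto
    moreover have "A * t \<le> A * (2 + t)" using A by (intro mult_left_mono) auto
    ultimately show ?thesis by simp
  qed
  then have "ln (max 1 (A * t)) \<le> ln (A * (2 + t))" using A t by (subst ln_le_cancel_iff) auto
  also have "\<dots> = ln A + ln (2 + t)" using A t by (simp add: ln_mult)
  also have "ln A \<le> ln A / ln 2 * ln (2 + t)"
  proof -
    have "ln A / ln 2 * ln 2 \<le> ln A / ln 2 * ln (2 + t)"
      using A t by (intro mult_left_mono) auto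
    then show ?thesis by simp
  qed
  finally show ?thesis by (simp add: distrib_right)
qed

context damek_ricci
begin

text \<open>Vertical marginal of the measure, on the height alone.\<close>

definition mrho :: "real measure" where
  "mrho = density lborel rho"

lemma sets_mrho [simp, measurable_cong]: "sets mrho = sets borel" and space_mrho [simp]: "space mrho = UNIV"
  by (simp_all add: mrho_def)

lemma nn_integral_mrho: "f \<in> borel_measurable borel \<Longrightarrow> (\<integral>\<^sup>+s. f s \<partial>mrho) = (\<integral>\<^sup>+s. rho s * f s \<partial>lborel)"
  unfolding mrho_def by (rule nn_integral_density) auto

lemma sigma_finite_mrho: "sigma_finite_measure mrho"
proof -
  have "rho s \<noteq> \<infinity>" for s by (simp add: rho_def indicator_def)
  then show ?thesis unfolding mrho_def
    by (subst sigma_finite_measure.sigma_finite_iff_density_finite[OF sigma_finite_lborel]) auto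
qed

lemma emeasure_mrho_ray: "h > 0 \<Longrightarrow> emeasure mrho {h<..} = ennreal (h powr (- nu) / nu)"
  unfolding mrho_def by (subst emeasure_density) (simp_all add: rho_tail)

definition tail_integral :: "(real \<Rightarrow> ennreal) \<Rightarrow> int \<Rightarrow> ennreal" where
  "tail_integral f k = (\<integral>\<^sup>+r. rho r * f r * indicator {2 powr real_of_int k<..} r \<partial>lborel)"

text \<open>Up to the factor \<open>\<nu>\<close> this is the supremum of the averages over the dyadic rays that contain \<open>s\<close>.
Dyadic end points keep it measurable as a countable supremum.\<close>

definition vmax :: "(real \<Rightarrow> ennreal) \<Rightarrow> real \<Rightarrow> ennreal" where
  "vmax f s = (SUP k::int. ennreal ((2 powr real_of_int k) powr nu) * tail_integral f k * indicator {2 powr real_of_int k<..} s)"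

lemma vmax_measurable [measurable]: "vmax f \<in> borel_measurable borel"
  unfolding vmax_def[abs_def] by measurable

lemma vmax_ge: "2 powr real_of_int k < s \<Longrightarrow> ennreal ((2 powr real_of_int k) powr nu) * tail_integral f k \<le> vmax f s"
  unfolding vmax_def by (rule SUP_upper2[of k]) auto

text \<open>Superlevel sets are unions of rays, and of two rays one contains the other: the covering
argument works with no enlargement at all.\<close>

lemma vmax_weak_type:
  assumes f [measurable]: "f \<in> borel_measurable borel" and b: "b > 0"
  shows "ennreal (b * nu) * emeasure mrho {s. vmax f s > ennreal b} \<le> (\<integral>\<^sup>+s. f s \<partial>mrho)"
proof -
  define K where "K = {k::int. ennreal b < ennreal ((2 powr real_of_int k) powr nu) * tail_integral f k}"
  have "{s. vmax f s > ennreal b} = (\<Union>k\<in>K. {2 powr real_of_int k<..})"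
    unfolding vmax_def less_SUP_iff K_def by (auto simp: indicator_def split: if_splits)
  moreover have "ennreal (b * nu) * emeasure mrho (\<Union>k\<in>K. {2 powr real_of_int k<..}) \<le> 1 * (\<integral>\<^sup>+s. f s \<partial>mrho)"
  (* Lower rays are larger, so the size of a ray is minus its exponent. *)
  proof (rule vitali_weak_type[where r = "\<lambda>k. - real_of_int k" and F' = "\<lambda>k. {2 powr real_of_int k<..}"])
    fix k assume k: "k \<in> K"
    let ?h = "2 powr real_of_int k"
    have h: "?h > 0" by simp
    have "ennreal (b * nu) * emeasure mrho {?h<..} = ennreal (?h powr (- nu)) * ennreal b"
      using nu_pos b by (simp add: emeasure_mrho_ray ennreal_mult[symmetric] mult.commute)
    also have "\<dots> \<le> ennreal (?h powr (- nu)) * (ennreal (?h powr nu) * tail_integral f k)"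
      using k by (intro mult_left_mono) (auto simp: K_def)
    also have "\<dots> = ennreal (?h powr (- nu) * ?h powr nu) * tail_integral f k" by (simp add: ennreal_mult mult.assoc)
    also have "?h powr (- nu) * ?h powr nu = 1" using h by (simp only: powr_add[symmetric]) simp
    also have "ennreal 1 * tail_integral f k = (\<integral>\<^sup>+s\<in>{?h<..}. f s \<partial>mrho)"
      by (subst nn_integral_mrho) (simp_all add: tail_integral_def mult.assoc)
    finally show "ennreal (b * nu) * emeasure mrho {?h<..} \<le> (\<integral>\<^sup>+s\<in>{?h<..}. f s \<partial>mrho)" .
  next
    fix i j :: int assume "- real_of_int j \<le> - real_of_int i"
    then have "2 powr real_of_int i \<le> (2 powr real_of_int j :: real)" by simp
    then show "{2 powr real_of_int j<..} \<subseteq> {2 powr real_of_int i<..}" by auto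
  qed auto
  ultimately show ?thesis by simp
qed

text \<open>Values of \<open>f\<close> up to \<open>\<nu> b / 2\<close> contribute at most \<open>b / 2\<close> to each average.\<close>

lemma vmax_truncate:
  assumes f [measurable]: "f \<in> borel_measurable borel" and b: "b > 0"
  shows "vmax (\<lambda>s. ennreal (f s)) s \<le> vmax (\<lambda>s. ennreal (f s) * indicator {s. f s > nu * b / 2} s) s + ennreal (b / 2)"
  unfolding vmax_def[of "\<lambda>s. ennreal (f s)"]
proof (rule SUP_least)
  fix k :: int
  let ?h = "2 powr real_of_int k" and ?f = "\<lambda>s. ennreal (f s) * indicator {s. f s > nu * b / 2} s"
  have h: "?h > 0" by simp
  show "ennreal (?h powr nu) * tail_integral (\<lambda>s. ennreal (f s)) k * indicator {?h<..} s \<le> vmax ?f s + ennreal (b / 2)"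
  proof (cases "?h < s")
    case True
    have "tail_integral (\<lambda>s. ennreal (f s)) k \<le> (\<integral>\<^sup>+r. rho r * ?f r * indicator {?h<..} r + ennreal (nu * b / 2) * (rho r * indicator {?h<..} r) \<partial>lborel)"
      unfolding tail_integral_def
    proof (rule nn_integral_mono)
      fix r :: real
      have "ennreal (f r) \<le> ?f r + ennreal (nu * b / 2)"
        by (cases "f r > nu * b / 2") (auto simp: ennreal_leI)
      then have "rho r * ennreal (f r) \<le> rho r * (?f r + ennreal (nu * b / 2))" by (intro mult_left_mono) auto
      then show "rho r * ennreal (f r) * indicator {?h<..} r
        \<le> rho r * ?f r * indicator {?h<..} r + ennreal (nu * b / 2) * (rho r * indicator {?h<..} r)"
        by (cases "?h < r") (auto simp: distrib_left mult.commute)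
    qed
    also have "\<dots> = tail_integral ?f k + ennreal (nu * b / 2) * ennreal (?h powr (- nu) / nu)"
      by (subst nn_integral_add) (auto simp: tail_integral_def nn_integral_cmult rho_tail)
    finally have "ennreal (?h powr nu) * tail_integral (\<lambda>s. ennreal (f s)) k
        \<le> ennreal (?h powr nu) * (tail_integral ?f k + ennreal (nu * b / 2) * ennreal (?h powr (- nu) / nu))"
      by (rule mult_left_mono) simp
    also have "\<dots> = ennreal (?h powr nu) * tail_integral ?f k + ennreal (?h powr nu * (nu * b / 2 * (?h powr (- nu) / nu)))"
    proof -
      have "ennreal (?h powr nu) * (ennreal (nu * b / 2) * ennreal (?h powr (- nu) / nu)) = ennreal (?h powr nu * (nu * b / 2 * (?h powr (- nu) / nu)))"
      proof -
        have "ennreal A * (ennreal B * ennreal C) = ennreal (A * (B * C))" if "A \<ge> 0" "B \<ge> 0" "C \<ge> 0" for A B C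
          using that by (simp add: ennreal_mult)
        then show ?thesis using nu_pos b by simp
      qed
      then show ?thesis by (simp only: distrib_left)
    qed
    also have "?h powr nu * (nu * b / 2 * (?h powr (- nu) / nu)) = (?h powr nu * ?h powr (- nu)) * (b / 2)"
      using nu_pos by simp
    also have "?h powr nu * ?h powr (- nu) = 1" using h by (simp only: powr_add[symmetric]) simp
    also have "ennreal (?h powr nu) * tail_integral ?f k + ennreal (1 * (b / 2)) \<le> vmax ?f s + ennreal (b / 2)"
      using vmax_ge[OF True, of ?f] by (simp add: add_right_mono)
    finally show ?thesis using True by simp
  qed simp
qed

text \<open>The weak type bound for the truncated function, integrated over the levels above \<open>b0\<close>; the
integral of \<open>1 / b\<close> over the levels up to a multiple of \<open>f s\<close> produces the logarithm.\<close>

lemma vmax_LlogL: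
  assumes f [measurable]: "f \<in> borel_measurable borel" and f0: "\<And>s. f s \<ge> 0" and b0: "b0 > 0"
  shows "(\<integral>\<^sup>+s. (vmax (\<lambda>s. ennreal (f s)) s - ennreal b0) \<partial>mrho)
     \<le> (\<integral>\<^sup>+s. ennreal (2 / nu * f s * ln (max 1 (2 / (nu * b0) * f s))) \<partial>mrho)"
proof -
  interpret m: sigma_finite_measure mrho by (rule sigma_finite_mrho)
  interpret P: pair_sigma_finite mrho lborel by unfold_locales
  let ?G = "vmax (\<lambda>s. ennreal (f s))"
  define w where "w b = ennreal (2 / (nu * b)) * indicator {b0..} b" for b :: real
  have [measurable]: "w \<in> borel_measurable borel" unfolding w_def[abs_def] by measurable
  have "(\<integral>\<^sup>+s. (?G s - ennreal b0) \<partial>mrho) \<le> (\<integral>\<^sup>+s. (\<integral>\<^sup>+b. indicator {b0..} b * indicator {b. ennreal b < ?G s} b \<partial>lborel) \<partial>mrho)"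
    using b0 by (intro nn_integral_mono ennreal_diff_le_layer) auto
  also have "\<dots> = (\<integral>\<^sup>+b. indicator {b0..} b * emeasure mrho {s \<in> space mrho. ?G s > ennreal b} \<partial>lborel)"
    by (rule nn_integral_layer_cake[OF sigma_finite_mrho]) measurable
  also have "\<dots> \<le> (\<integral>\<^sup>+b. w b * (\<integral>\<^sup>+s. ennreal (f s) * (if f s > nu * b / 2 then 1 else 0) \<partial>mrho) \<partial>lborel)"
  proof (rule nn_integral_mono)
    fix b :: real
    show "indicator {b0..} b * emeasure mrho {s \<in> space mrho. ?G s > ennreal b}
      \<le> w b * (\<integral>\<^sup>+s. ennreal (f s) * (if f s > nu * b / 2 then 1 else 0) \<partial>mrho)"
    proof (cases "b \<ge> b0")
      case True
      then have b: "b > 0" using b0 by simp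
      let ?f = "\<lambda>s. ennreal (f s) * indicator {s. f s > nu * b / 2} s"
      have "{s \<in> space mrho. ?G s > ennreal b} \<subseteq> {s. vmax ?f s > ennreal (b / 2)}"
      proof
        fix s assume "s \<in> {s \<in> space mrho. ?G s > ennreal b}"
        then have "ennreal b < vmax ?f s + ennreal (b / 2)"
          using vmax_truncate[OF f b, of s] by (simp add: less_le_trans)
        moreover have "ennreal b = ennreal (b / 2) + ennreal (b / 2)" using b by (simp add: ennreal_plus[symmetric] del: ennreal_plus)
        ultimately have "ennreal (b / 2) + ennreal (b / 2) < vmax ?f s + ennreal (b / 2)" by simp
        then have "ennreal (b / 2) < vmax ?f s" by (meson add_right_mono leD not_le_imp_less)
        then show "s \<in> {s. vmax ?f s > ennreal (b / 2)}" by simp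
      qed
      then have "emeasure mrho {s \<in> space mrho. ?G s > ennreal b} \<le> emeasure mrho {s. vmax ?f s > ennreal (b / 2)}"
        by (intro emeasure_mono) auto
      also have "\<dots> = ennreal (2 / (nu * b)) * (ennreal (b / 2 * nu) * emeasure mrho {s. vmax ?f s > ennreal (b / 2)})"
      proof -
        have "ennreal (2 / (nu * b)) * ennreal (b / 2 * nu) = 1" using b nu_pos by (simp add: ennreal_mult[symmetric])
        then show ?thesis by (simp only: mult.assoc[symmetric] mult_1_left)
      qed
      also have "\<dots> \<le> ennreal (2 / (nu * b)) * (\<integral>\<^sup>+s. ?f s \<partial>mrho)"
        using b by (intro mult_left_mono vmax_weak_type) auto
      also have "(\<integral>\<^sup>+s. ?f s \<partial>mrho) = (\<integral>\<^sup>+s. ennreal (f s) * (if f s > nu * b / 2 then 1 else 0) \<partial>mrho)"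
        by (rule nn_integral_cong) (simp add: indicator_def)
      finally show ?thesis using True by (simp add: w_def)
    qed simp
  qed
  also have "\<dots> = (\<integral>\<^sup>+b. (\<integral>\<^sup>+s. w b * (ennreal (f s) * (if f s > nu * b / 2 then 1 else 0)) \<partial>mrho) \<partial>lborel)"
    by (intro nn_integral_cong nn_integral_cmult[symmetric]) measurable
  also have "\<dots> = (\<integral>\<^sup>+s. (\<integral>\<^sup>+b. w b * (ennreal (f s) * (if f s > nu * b / 2 then 1 else 0)) \<partial>lborel) \<partial>mrho)"
    by (rule P.Fubini') measurable
  also have "\<dots> \<le> (\<integral>\<^sup>+s. ennreal (2 / nu * f s * ln (max 1 (2 / (nu * b0) * f s))) \<partial>mrho)"
  proof (rule nn_integral_mono)
    fix s :: real
    let ?B = "2 * f s / nu"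
    have "(\<integral>\<^sup>+b. w b * (ennreal (f s) * (if f s > nu * b / 2 then 1 else 0)) \<partial>lborel)
       \<le> (\<integral>\<^sup>+b. ennreal (2 / nu * f s) * (ennreal (1 / b) * indicator {b0..?B} b) \<partial>lborel)"
    proof (rule nn_integral_mono)
      fix b :: real
      show "w b * (ennreal (f s) * (if f s > nu * b / 2 then 1 else 0)) \<le> ennreal (2 / nu * f s) * (ennreal (1 / b) * indicator {b0..?B} b)"
      proof (cases "b \<ge> b0 \<and> f s > nu * b / 2")
        case True
        then have "b \<le> ?B" "b > 0" using nu_pos b0 by (auto simp: field_simps)
        moreover have "2 / (nu * b) * f s = 2 / nu * f s * (1 / b)" by simp
        ultimately show ?thesis using True nu_pos f0[of s] by (simp add: w_def ennreal_mult[symmetric])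
      next
        case False
        then show ?thesis by (auto simp: w_def)
      qed
    qed
    also have "\<dots> = ennreal (2 / nu * f s) * (\<integral>\<^sup>+b. ennreal (1 / b) * indicator {b0..?B} b \<partial>lborel)"
      by (rule nn_integral_cmult) measurable
    also have "\<dots> \<le> ennreal (2 / nu * f s) * ennreal (ln (max 1 (2 / (nu * b0) * f s)))"
    proof (intro mult_left_mono)
      show "(\<integral>\<^sup>+b. ennreal (1 / b) * indicator {b0..?B} b \<partial>lborel) \<le> ennreal (ln (max 1 (2 / (nu * b0) * f s)))"
      proof (cases "b0 \<le> ?B")
        case True
        then have "(\<integral>\<^sup>+b. ennreal (1 / b) * indicator {b0..?B} b \<partial>lborel) = ennreal (ln (?B / b0))"
          using b0 by (intro nn_integral_inverse_Icc) auto
        also have "?B / b0 = 2 / (nu * b0) * f s" by simp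
        also have "ennreal (ln (2 / (nu * b0) * f s)) \<le> ennreal (ln (max 1 (2 / (nu * b0) * f s)))"
        proof (intro ennreal_leI)
          have "0 < ?B" using True b0 by linarith
          then have "0 < ?B / b0" using b0 by (rule divide_pos_pos)
          also have "?B / b0 = 2 / (nu * b0) * f s" by simp
          finally have "0 < 2 / (nu * b0) * f s" .
          then show "ln (2 / (nu * b0) * f s) \<le> ln (max 1 (2 / (nu * b0) * f s))" by (subst ln_le_cancel_iff) auto
        qed
        finally show ?thesis .
      next
        case False
        then have "{b0..?B} = {}" by simp
        then show ?thesis by simp
      qed
    qed simp
    also have "\<dots> = ennreal (2 / nu * f s * ln (max 1 (2 / (nu * b0) * f s)))"
      using nu_pos f0[of s] by (intro ennreal_mult[symmetric]) auto
    finally show "(\<integral>\<^sup>+b. w b * (ennreal (f s) * (if f s > nu * b / 2 then 1 else 0)) \<partial>lborel)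
       \<le> ennreal (2 / nu * f s * ln (max 1 (2 / (nu * b0) * f s)))" .
  qed
  finally show ?thesis .
qed

end

section \<open>Large half balls\<close>

context damek_ricci
begin

text \<open>The lower bound is already attained by the bottom layer, of heights between \<open>5/2 exp (-R)\<close> and
\<open>3 exp (-R)\<close>.\<close>

lemma emeasure_base_half_ball_large_ge:
  assumes R: "R \<ge> 2"
  shows "ennreal (1/2 * 3 powr (- nu - 1) * ((1/2) ^ DIM('n) * Nbox1_volume) * exp (nu * R)) \<le> emeasure mu (base_half_ball R)"
proof -
  let ?I = "{5/2 * exp (- R)<..<3 * exp (- R)}"
  have "exp (- R) * 6 \<le> exp (- R) * exp R"
  proof (rule mult_left_mono)
    have "exp 2 \<le> exp R" using R by simp
    then show "6 \<le> exp R" using exp_2_bounds by linarith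
  qed simp
  then have e6: "3 * exp (- R) \<le> 1/2" by (simp add: exp_minus)
  have I0: "?I \<subseteq> {0<..}"
  proof
    fix x assume "x \<in> ?I"
    then have "5/2 * exp (- R) < x" by simp
    moreover have "5/2 * exp (- R) > 0" by simp
    ultimately have "0 < x" by linarith
    then show "x \<in> {0<..}" by simp
  qed
  have p: "(3 * exp (- R) - 5/2 * exp (- R)) * (3 * exp (- R)) powr (- nu - 1) = 1/2 * 3 powr (- nu - 1) * exp (nu * R)"
  proof -
    have "(3 * exp (- R)) powr (- nu - 1) = 3 powr (- nu - 1) * exp (- R) powr (- nu - 1)" by (rule powr_mult)
    also have "exp (- R) powr (- nu - 1) = exp (R * (nu + 1))" by (simp add: powr_def algebra_simps)
    finally have "(3 * exp (- R) - 5/2 * exp (- R)) * (3 * exp (- R)) powr (- nu - 1)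
        = 1/2 * 3 powr (- nu - 1) * (exp (- R) * exp (R * (nu + 1)))" by simp
    also have "exp (- R) * exp (R * (nu + 1)) = exp (nu * R)" by (simp add: exp_add[symmetric] algebra_simps)
    finally show ?thesis .
  qed
  have "ennreal (1/2 * 3 powr (- nu - 1) * exp (nu * R)) \<le> (\<integral>\<^sup>+s. rho s * indicator ?I s \<partial>lborel)"
    unfolding p[symmetric] by (intro rho_interval_ge) auto
  then have "ennreal (1/2 * 3 powr (- nu - 1) * exp (nu * R)) * emeasure lborel (Nbox (1/2)) \<le> emeasure mu (Nbox (1/2) \<times> ?I)"
    using I0 by (subst emeasure_mu_product) (auto intro: mult_right_mono)
  also have "\<dots> \<le> emeasure mu (base_half_ball R)"
  proof (rule emeasure_mono)
    have "Nbox (1/2) \<times> ?I \<subseteq> Nbox (1/2) \<times> {5/2 * exp (- R)<..<1/2}" using e6 by (intro Sigma_mono) auto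
    then show "Nbox (1/2) \<times> ?I \<subseteq> base_half_ball R" using large_box_subset_base_half_ball[of R] R by auto
    show "base_half_ball R \<in> sets mu" by (intro borel_imp_sets_mu base_half_ball_subset_S) (simp add: open_base_half_ball)
  qed
  also have "emeasure lborel (Nbox (1/2)) = ennreal ((1/2) ^ DIM('n) * Nbox1_volume)" by (rule emeasure_Nbox) simp
  finally have "ennreal (1/2 * 3 powr (- nu - 1) * exp (nu * R)) * ennreal ((1/2) ^ DIM('n) * Nbox1_volume) \<le> emeasure mu (base_half_ball R)" .
  moreover have "ennreal (1/2 * 3 powr (- nu - 1) * exp (nu * R)) * ennreal ((1/2) ^ DIM('n) * Nbox1_volume)
      = ennreal (1/2 * 3 powr (- nu - 1) * ((1/2) ^ DIM('n) * Nbox1_volume) * exp (nu * R))"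
    using Nbox1_volume(2) by (simp only: ennreal_mult'[symmetric] mult_ac zero_le_mult_iff) (simp add: ennreal_mult[symmetric] mult_ac)
  ultimately show ?thesis by simp
qed

lemma vmax_slice_measurable:
  fixes g :: "'n \<times> real \<Rightarrow> real"
  assumes g: "g \<in> borel_measurable borel"
  shows "(\<lambda>p. vmax (\<lambda>r. ennreal (g (fst p, r))) (snd p)) \<in> borel_measurable borel"
proof -
  have [measurable]: "g \<in> borel_measurable (borel \<Otimes>\<^sub>M borel)" using g by (simp add: borel_prod)
  have "(\<lambda>p :: 'n \<times> real. vmax (\<lambda>r. ennreal (g (fst p, r))) (snd p)) \<in> borel_measurable (borel \<Otimes>\<^sub>M borel)"
    unfolding vmax_def tail_integral_def by measurable
  then show ?thesis by (simp add: borel_prod)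
qed

lemma slice_measurable:
  fixes g :: "'n \<times> real \<Rightarrow> 'b::topological_space"
  assumes g: "g \<in> borel_measurable borel"
  shows "(\<lambda>r. g (w, r)) \<in> borel_measurable borel" "(\<lambda>w. g (w, s)) \<in> borel_measurable borel"
proof -
  have [measurable]: "g \<in> borel_measurable (borel \<Otimes>\<^sub>M borel)" using g by (simp add: borel_prod)
  show "(\<lambda>r. g (w, r)) \<in> borel_measurable borel" "(\<lambda>w. g (w, s)) \<in> borel_measurable borel" by measurable
qed

definition large_const :: real where
  "large_const = 1/2 * 3 powr (- nu - 1) * ((1/2) ^ DIM('n) * Nbox1_volume)"

lemma large_const_pos: "large_const > 0"
  using Nbox1_volume(2) by (simp add: large_const_def)

text \<open>Ratio of the constants in the measures of a large half ball and of its shadow on the nilpotent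
factor; the factor \<open>2\<^sup>-\<^sup>\<nu>\<close> is lost by rounding the lowest height to a power of two.\<close>

definition base_const :: real where
  "base_const = large_const * 2 powr (- nu) / (2 ^ DIM('n) * Nbox1_volume)"

lemma base_const_pos: "base_const > 0"
  using Nbox1_volume(2) large_const_pos by (simp add: base_const_def)

text \<open>Enlarge the half ball to the product of its shadow and the ray above the dyadic number just
below its lowest height \<open>s0 exp (-R)\<close>. The ray contains the height \<open>s\<close> of the given point, so its average is
one of those in \<open>vmax\<close>.\<close>

lemma large_half_ball_base:
  fixes g :: "'n \<times> real \<Rightarrow> real"
  assumes g[measurable]: "g \<in> borel_measurable borel" and a: "a > 0"
    and R: "R \<ge> 2" and s0: "s0 > 0"
    and avg: "ennreal a * emeasure mu (half_ball (w0, s0) R) \<le> (\<integral>\<^sup>+y\<in>half_ball (w0, s0) R. ennreal (g y) \<partial>mu)"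
    and p: "(w, s) \<in> half_ball (w0, s0) R"
  shows "w \<in> Nball w0 s0"
    and "ennreal (a * base_const) * emeasure lborel (Nball w0 s0) \<le> (\<integral>\<^sup>+v\<in>Nball w0 s0. vmax (\<lambda>r. ennreal (g (v, r))) s \<partial>lborel)"
proof -
  have in_prod: "v \<in> Nball w0 s0 \<and> r > s0 * exp (- R)" if "(v, r) \<in> half_ball (w0, s0) R" for v r
  proof -
    have R0: "R > 0" using R by simp
    obtain q where q: "(v, r) = mult (w0, s0) q" "q \<in> base_half_ball R"
      using \<open>(v, r) \<in> half_ball (w0, s0) R\<close> unfolding half_ball_eq[OF R0] by (rule imageE)
    obtain k \<sigma> where ks: "q = (k, \<sigma>)" by fastforce
    have "v = aff w0 s0 k" "r = s0 * \<sigma>" using q(1) unfolding ks mult_aff by simp_all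
    with q(2) ks have k: "(k, \<sigma>) \<in> base_half_ball R" "v = aff w0 s0 k" "r = s0 * \<sigma>" by simp_all
    have "k \<in> Nbox 2" "exp (- R) < \<sigma>" using base_half_ball_crude[OF k(1)] R by auto
    then show ?thesis using k(2,3) s0 by (auto simp: Nball_def)
  qed
  then show "w \<in> Nball w0 s0" using p by blast
  (* The dyadic number below the lowest height of the half ball. *)
  define k where "k = \<lfloor>log 2 (s0 * exp (- R))\<rfloor>"
  let ?h = "2 powr real_of_int k"
  have se: "s0 * exp (- R) > 0" using s0 by simp
  have h1: "?h \<le> s0 * exp (- R)"
  proof -
    have "?h \<le> 2 powr (log 2 (s0 * exp (- R)))" unfolding k_def by (intro powr_mono) auto
    then show ?thesis using se by simp
  qed
  have h2: "s0 * exp (- R) \<le> 2 * ?h"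
  proof -
    have "log 2 (s0 * exp (- R)) \<le> real_of_int k + 1" unfolding k_def by linarith
    then have "2 powr (log 2 (s0 * exp (- R))) \<le> 2 powr (real_of_int k + 1)" by (intro powr_mono) auto
    then show ?thesis using se by (simp add: powr_add)
  qed
  have hs: "?h < s" using in_prod[OF p] h1 by linarith
  have NB[measurable]: "Nball w0 s0 \<in> sets borel" using open_Nball[OF s0] by simp
  have gm: "(\<lambda>p. ennreal (g p) * (indicator (Nball w0 s0) (fst p) * indicator {?h<..} (snd p))) \<in> borel_measurable borel"
  proof -
    have [measurable]: "g \<in> borel_measurable (borel \<Otimes>\<^sub>M borel)" using g by (simp add: borel_prod)
    have "(\<lambda>p :: 'n \<times> real. ennreal (g p) * (indicator (Nball w0 s0) (fst p) * indicator {?h<..} (snd p))) \<in> borel_measurable (borel \<Otimes>\<^sub>M borel)"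
      by measurable
    then show ?thesis by (simp add: borel_prod)
  qed
  have x: "(w0, s0) \<in> S" using s0 by simp
  have "ennreal a * ennreal (large_const * exp (nu * R)) \<le> ennreal a * emeasure mu (half_ball (w0, s0) R)"
    using emeasure_base_half_ball_large_ge[OF R] x R by (intro mult_left_mono) (auto simp: large_const_def emeasure_half_ball)
  also have "\<dots> \<le> (\<integral>\<^sup>+y\<in>half_ball (w0, s0) R. ennreal (g y) \<partial>mu)" by (rule avg)
  also have "\<dots> \<le> (\<integral>\<^sup>+p. ennreal (g p) * (indicator (Nball w0 s0) (fst p) * indicator {?h<..} (snd p)) \<partial>mu)"
  proof (rule nn_integral_mono)
    fix p :: "'n \<times> real"
    obtain v r where vr: "p = (v, r)" by fastforce
    show "ennreal (g p) * indicator (half_ball (w0, s0) R) p \<le> ennreal (g p) * (indicator (Nball w0 s0) (fst p) * indicator {?h<..} (snd p))"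
    proof (cases "p \<in> half_ball (w0, s0) R")
      case True
      then have "v \<in> Nball w0 s0" "r > ?h" using in_prod[of v r] h1 vr by auto
      then show ?thesis using True by (simp add: vr)
    qed simp
  qed
  also have "\<dots> = (\<integral>\<^sup>+v. (\<integral>\<^sup>+r. rho r * (ennreal (g (v, r)) * (indicator (Nball w0 s0) v * indicator {?h<..} r)) \<partial>lborel) \<partial>lborel)"
    using nn_integral_mu(2)[OF gm] by simp
  also have "\<dots> = (\<integral>\<^sup>+v\<in>Nball w0 s0. tail_integral (\<lambda>r. ennreal (g (v, r))) k \<partial>lborel)"
    by (rule nn_integral_cong) (simp add: tail_integral_def indicator_def mult.assoc)
  finally have 1: "ennreal a * ennreal (large_const * exp (nu * R)) \<le> (\<integral>\<^sup>+v\<in>Nball w0 s0. tail_integral (\<lambda>r. ennreal (g (v, r))) k \<partial>lborel)" .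
  have tm: "(\<lambda>v. tail_integral (\<lambda>r. ennreal (g (v, r))) k) \<in> borel_measurable borel"
  proof -
    have [measurable]: "g \<in> borel_measurable (borel \<Otimes>\<^sub>M borel)" using g by (simp add: borel_prod)
    show ?thesis unfolding tail_integral_def by measurable
  qed
  have "a * base_const * (s0 powr nu * (2 ^ DIM('n) * Nbox1_volume)) = a * large_const * (2 powr (- nu) * s0 powr nu)"
    using Nbox1_volume(2) by (simp add: base_const_def)
  also have "\<dots> \<le> a * large_const * (?h powr nu * exp (nu * R))"
  proof (rule mult_left_mono)
    have "s0 = s0 * exp (- R) * exp R" by (simp add: exp_minus)
    also have "\<dots> \<le> 2 * ?h * exp R" using h2 by (intro mult_right_mono) auto
    finally have "s0 powr nu \<le> (2 * ?h * exp R) powr nu" using s0 nu_pos by (intro powr_mono2) auto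
    also have "\<dots> = 2 powr nu * (?h powr nu * exp (nu * R))" by (simp add: powr_mult powr_def[of "exp R"])
    finally have "2 powr (- nu) * s0 powr nu \<le> 2 powr (- nu) * (2 powr nu * (?h powr nu * exp (nu * R)))" by (intro mult_left_mono) auto
    also have "\<dots> = (2 powr (- nu) * 2 powr nu) * (?h powr nu * exp (nu * R))" by (simp only: mult.assoc)
    also have "2 powr (- nu) * 2 powr nu = (1::real)" by (simp only: powr_add[symmetric]) simp
    finally show "2 powr (- nu) * s0 powr nu \<le> ?h powr nu * exp (nu * R)" by simp
  qed (use a large_const_pos in simp)
  also have "\<dots> = ?h powr nu * (a * (large_const * exp (nu * R)))" by simp
  finally have 2: "ennreal (a * base_const * (s0 powr nu * (2 ^ DIM('n) * Nbox1_volume))) \<le> ennreal (?h powr nu * (a * (large_const * exp (nu * R))))"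
    by (rule ennreal_leI)
  have "ennreal (a * base_const) * emeasure lborel (Nball w0 s0) = ennreal (a * base_const * (s0 powr nu * (2 ^ DIM('n) * Nbox1_volume)))"
    using a base_const_pos Nbox1_volume(2) by (simp add: emeasure_Nball[OF s0] ennreal_mult[symmetric])
  also note 2
  also have "ennreal (?h powr nu * (a * (large_const * exp (nu * R)))) = ennreal (?h powr nu) * (ennreal a * ennreal (large_const * exp (nu * R)))"
    using a large_const_pos by (simp add: ennreal_mult)
  also have "\<dots> \<le> ennreal (?h powr nu) * (\<integral>\<^sup>+v\<in>Nball w0 s0. tail_integral (\<lambda>r. ennreal (g (v, r))) k \<partial>lborel)"
    using 1 by (intro mult_left_mono) auto
  also have "\<dots> = (\<integral>\<^sup>+v. ennreal (?h powr nu) * (tail_integral (\<lambda>r. ennreal (g (v, r))) k * indicator (Nball w0 s0) v) \<partial>lborel)"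
    using tm by (intro nn_integral_cmult[symmetric]) auto
  also have "\<dots> \<le> (\<integral>\<^sup>+v\<in>Nball w0 s0. vmax (\<lambda>r. ennreal (g (v, r))) s \<partial>lborel)"
    using vmax_ge[OF hs] by (intro nn_integral_mono) (auto simp: indicator_def)
  finally show "ennreal (a * base_const) * emeasure lborel (Nball w0 s0) \<le> (\<integral>\<^sup>+v\<in>Nball w0 s0. vmax (\<lambda>r. ennreal (g (v, r))) s \<partial>lborel)" .
qed

text \<open>On each horizontal slice apply the weak type estimate on \<open>N\<close> to the part of \<open>vmax\<close> above half
the level, then integrate over the heights by \<open>vmax_LlogL\<close>.\<close>

lemma large_half_balls_LlogL:
  "\<exists>C>0. \<forall>g :: 'n \<times> real \<Rightarrow> real. g \<in> borel_measurable borel \<longrightarrow> (\<forall>p. g p \<ge> 0) \<longrightarrow> (\<forall>a>0.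
     emeasure mu (\<Union>(x, R)\<in>{(x, R). x \<in> S \<and> 2 \<le> R \<and>
        ennreal a * emeasure mu (half_ball x R) \<le> (\<integral>\<^sup>+y\<in>half_ball x R. ennreal (g y) \<partial>mu)}. half_ball x R)
     \<le> ennreal C * (\<integral>\<^sup>+y. ennreal (Phi (g y / a)) \<partial>mu))"
proof -
  (* Half of the constant is spent on removing the values of vmax below the level b. *)
  define c where "c = base_const / 2"
  have c: "c > 0" using base_const_pos by (simp add: c_def)
  define A where "A = max 1 (2 / (nu * c))"
  have A: "A \<ge> 1" by (simp add: A_def)
  define D where "D = 1 + ln A / ln 2"
  have D: "D > 0" using A by (simp add: D_def add_pos_nonneg)
  define C where "C = 13 ^ DIM('n) / c * (2 / nu) * D"
  have C: "C > 0" using c D nu_pos by (simp add: C_def)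
  show ?thesis
  proof (intro exI conjI allI impI)
    show "C > 0" by (rule C)
    fix g :: "'n \<times> real \<Rightarrow> real" and a :: real
    assume g: "g \<in> borel_measurable borel" and g0: "\<forall>p. g p \<ge> 0" and a: "a > 0"
    define I where "I = {(x, R). x \<in> S \<and> 2 \<le> R \<and>
        ennreal a * emeasure mu (half_ball x R) \<le> (\<integral>\<^sup>+y\<in>half_ball x R. ennreal (g y) \<partial>mu)}"
    define U where "U = (\<Union>(x, R)\<in>I. half_ball x R)"
    define b where "b = a * c"
    have b: "b > 0" using a c by (simp add: b_def)
    define H where "H p = vmax (\<lambda>r. ennreal (g (fst p, r))) (snd p) - ennreal b" for p :: "'n \<times> real"
    have Hm: "H \<in> borel_measurable borel"
      unfolding H_def[abs_def] using vmax_slice_measurable[OF g] by measurable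
    have oU: "open U" unfolding U_def by (intro open_UN) (auto simp: I_def intro!: open_half_ball)
    have US: "U \<subseteq> S"
    proof
      fix p assume "p \<in> U"
      then obtain x R where xR: "(x, R) \<in> I" "p \<in> half_ball x R" by (auto simp: U_def)
      then have "x \<in> S" "R > 0" by (auto simp: I_def)
      then show "p \<in> S" using half_ball_subset_S xR(2) by blast
    qed
    have slice: "ennreal b * emeasure lborel {w. (w, s) \<in> U} \<le> ennreal (13 ^ DIM('n)) * (\<integral>\<^sup>+w. H (w, s) \<partial>lborel)" for s
    proof -
      have Hs: "(\<lambda>w. H (w, s)) \<in> borel_measurable lborel" using slice_measurable(2)[OF Hm] by simp
      let ?K = "{(w0, s0). 0 < s0 \<and> ennreal b * emeasure lborel (Nball w0 s0) \<le> (\<integral>\<^sup>+y\<in>Nball w0 s0. H (y, s) \<partial>lborel)}"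
      have "{w. (w, s) \<in> U} \<subseteq> (\<Union>(w0, s0)\<in>?K. Nball w0 s0)"
      proof
        fix w assume "w \<in> {w. (w, s) \<in> U}"
        then obtain x R where xR: "(x, R) \<in> I" "(w, s) \<in> half_ball x R" by (auto simp: U_def)
        obtain w0 s0 where x: "x = (w0, s0)" "s0 > 0" using xR(1) by (cases x) (auto simp: I_def)
        have avg: "ennreal a * emeasure mu (half_ball (w0, s0) R) \<le> (\<integral>\<^sup>+y\<in>half_ball (w0, s0) R. ennreal (g y) \<partial>mu)" and R: "R \<ge> 2"
          using xR(1) x by (auto simp: I_def)
        note L = large_half_ball_base[OF g a R x(2) avg xR(2)[unfolded x(1)]]
        have NB: "Nball w0 s0 \<in> sets lborel" using open_Nball[OF x(2)] by simp
        have fin: "emeasure lborel (Nball w0 s0) \<noteq> \<infinity>" by (simp add: emeasure_Nball[OF x(2)])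
        have "ennreal b * emeasure lborel (Nball w0 s0) + ennreal b * emeasure lborel (Nball w0 s0)
            = ennreal (a * base_const) * emeasure lborel (Nball w0 s0)"
        proof -
          have "a * base_const = b + b" by (simp add: b_def c_def)
          then have "ennreal (a * base_const) = ennreal b + ennreal b" using b by (simp only: ennreal_plus less_imp_le)
          then show ?thesis by (simp only: distrib_right)
        qed
        also note L(2)
        also have "(\<integral>\<^sup>+v\<in>Nball w0 s0. vmax (\<lambda>r. ennreal (g (v, r))) s \<partial>lborel)
           \<le> (\<integral>\<^sup>+v. H (v, s) * indicator (Nball w0 s0) v + ennreal b * indicator (Nball w0 s0) v \<partial>lborel)"
        proof (rule nn_integral_mono)
          fix v
          have "x \<le> (x - y) + y" if "y \<noteq> \<infinity>" for x y :: ennreal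
          proof (cases "y \<le> x")
            case False
            then have "x \<le> y" by simp
            also have "y \<le> (x - y) + y" by (simp add: add_increasing)
            finally show ?thesis .
          qed (simp add: diff_add_cancel_ennreal)
          from this[of "ennreal b" "vmax (\<lambda>r. ennreal (g (v, r))) s"]
          have "vmax (\<lambda>r. ennreal (g (v, r))) s \<le> H (v, s) + ennreal b" by (simp add: H_def)
          then show "vmax (\<lambda>r. ennreal (g (v, r))) s * indicator (Nball w0 s0) v
            \<le> H (v, s) * indicator (Nball w0 s0) v + ennreal b * indicator (Nball w0 s0) v"
            by (simp add: indicator_def)
        qed
        also have "\<dots> = (\<integral>\<^sup>+v\<in>Nball w0 s0. H (v, s) \<partial>lborel) + ennreal b * emeasure lborel (Nball w0 s0)"
          using Hs NB by (subst nn_integral_add) (auto simp: nn_integral_cmult_indicator)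
        finally have le: "ennreal b * emeasure lborel (Nball w0 s0) + ennreal b * emeasure lborel (Nball w0 s0)
          \<le> ennreal b * emeasure lborel (Nball w0 s0) + (\<integral>\<^sup>+v\<in>Nball w0 s0. H (v, s) \<partial>lborel)"
          by (simp only: add.commute)
        have "ennreal b * emeasure lborel (Nball w0 s0) \<noteq> \<infinity>"
          using fin by (simp add: ennreal_mult_eq_top_iff)
        with le have "ennreal b * emeasure lborel (Nball w0 s0) \<le> (\<integral>\<^sup>+v\<in>Nball w0 s0. H (v, s) \<partial>lborel)"
          by (simp only: ennreal_add_left_cancel_le) simp
        then show "w \<in> (\<Union>(w0, s0)\<in>?K. Nball w0 s0)" using L(1) x(2) by blast
      qed
      then have "emeasure lborel {w. (w, s) \<in> U} \<le> emeasure lborel (\<Union>(w0, s0)\<in>?K. Nball w0 s0)"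
      proof (rule emeasure_mono)
        have "open (\<Union>(w0, s0)\<in>?K. Nball w0 s0)" by (intro open_UN) (auto intro!: open_Nball)
        then show "(\<Union>(w0, s0)\<in>?K. Nball w0 s0) \<in> sets lborel" by simp
      qed
      then have "ennreal b * emeasure lborel {w. (w, s) \<in> U} \<le> ennreal b * emeasure lborel (\<Union>(w0, s0)\<in>?K. Nball w0 s0)"
        by (rule mult_left_mono) simp
      also have "\<dots> \<le> ennreal (13 ^ DIM('n)) * (\<integral>\<^sup>+w. H (w, s) \<partial>lborel)"
        by (rule Nball_weak_type[OF Hs])
      finally show ?thesis .
    qed
    have Ub: "U \<in> sets borel" using oU by simp
    have Um: "(\<lambda>s. emeasure lborel {w. (w, s) \<in> U}) \<in> borel_measurable borel"
    proof -
      have "U \<in> sets (lborel \<Otimes>\<^sub>M lborel)" unfolding lborel_prod using Ub by simp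
      from lborel_pair.measurable_emeasure_Pair2[OF this] show ?thesis by (simp add: vimage_def)
    qed
    have "ennreal b * emeasure mu U = (\<integral>\<^sup>+s. ennreal b * (rho s * emeasure lborel {w. (w, s) \<in> U}) \<partial>lborel)"
      unfolding emeasure_mu[OF Ub US] using Um by (intro nn_integral_cmult[symmetric]) auto
    also have "\<dots> = (\<integral>\<^sup>+s. rho s * (ennreal b * emeasure lborel {w. (w, s) \<in> U}) \<partial>lborel)"
      by (simp add: mult_ac)
    also have "\<dots> \<le> (\<integral>\<^sup>+s. rho s * (ennreal (13 ^ DIM('n)) * (\<integral>\<^sup>+w. H (w, s) \<partial>lborel)) \<partial>lborel)"
      by (intro nn_integral_mono mult_left_mono slice) simp
    also have "\<dots> = (\<integral>\<^sup>+s. ennreal (13 ^ DIM('n)) * (rho s * (\<integral>\<^sup>+w. H (w, s) \<partial>lborel)) \<partial>lborel)"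
      by (simp add: mult_ac)
    also have "\<dots> = ennreal (13 ^ DIM('n)) * (\<integral>\<^sup>+s. rho s * (\<integral>\<^sup>+w. H (w, s) \<partial>lborel) \<partial>lborel)"
    proof (rule nn_integral_cmult)
      have [measurable]: "H \<in> borel_measurable (lborel \<Otimes>\<^sub>M lborel)" unfolding lborel_prod using Hm by simp
      show "(\<lambda>s. rho s * (\<integral>\<^sup>+w. H (w, s) \<partial>lborel)) \<in> borel_measurable lborel" by measurable
    qed
    also have "(\<integral>\<^sup>+s. rho s * (\<integral>\<^sup>+w. H (w, s) \<partial>lborel) \<partial>lborel) = (\<integral>\<^sup>+w. (\<integral>\<^sup>+s. rho s * H (w, s) \<partial>lborel) \<partial>lborel)"
      using nn_integral_mu[OF Hm] by simp
    also have "\<dots> \<le> (\<integral>\<^sup>+w. (\<integral>\<^sup>+s. rho s * (ennreal (2 / nu * D * a) * ennreal (Phi (g (w, s) / a))) \<partial>lborel) \<partial>lborel)"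
    proof (rule nn_integral_mono)
      fix w
      have gw[measurable]: "(\<lambda>s. g (w, s)) \<in> borel_measurable borel" by (rule slice_measurable[OF g])
      have "(\<integral>\<^sup>+s. rho s * H (w, s) \<partial>lborel) = (\<integral>\<^sup>+s. H (w, s) \<partial>mrho)"
        by (rule nn_integral_mrho[symmetric]) (rule slice_measurable[OF Hm])
      also have "\<dots> \<le> (\<integral>\<^sup>+s. ennreal (2 / nu * g (w, s) * ln (max 1 (2 / (nu * b) * g (w, s)))) \<partial>mrho)"
        unfolding H_def fst_conv snd_conv using g0 b by (intro vmax_LlogL gw) auto
      also have "\<dots> \<le> (\<integral>\<^sup>+s. ennreal (2 / nu * D * a) * ennreal (Phi (g (w, s) / a)) \<partial>mrho)"
      proof (rule nn_integral_mono)
        fix s :: real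
        let ?t = "g (w, s) / a"
        have t: "?t \<ge> 0" using g0 a by simp
        have "2 / (nu * b) * g (w, s) = 2 / (nu * c) * ?t" using a by (simp add: b_def)
        also have "\<dots> \<le> A * ?t" using t by (intro mult_right_mono) (auto simp: A_def)
        finally have "ln (max 1 (2 / (nu * b) * g (w, s))) \<le> ln (max 1 (A * ?t))" by (subst ln_le_cancel_iff) auto
        also have "\<dots> \<le> D * ln (2 + ?t)" unfolding D_def by (rule ln_max_le[OF A t])
        finally have "2 / nu * g (w, s) * ln (max 1 (2 / (nu * b) * g (w, s))) \<le> 2 / nu * g (w, s) * (D * ln (2 + ?t))"
          using g0 nu_pos by (intro mult_left_mono) auto
        also have "\<dots> = 2 / nu * D * a * Phi ?t" using a by (simp add: Phi_def)
        finally have "ennreal (2 / nu * g (w, s) * ln (max 1 (2 / (nu * b) * g (w, s)))) \<le> ennreal (2 / nu * D * a * Phi ?t)"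
          by (rule ennreal_leI)
        also have "\<dots> = ennreal (2 / nu * D * a) * ennreal (Phi ?t)"
        proof (rule ennreal_mult)
          show "0 \<le> Phi ?t" unfolding Phi_def using t by (intro mult_nonneg_nonneg) auto
        qed (use nu_pos D a in simp)
        finally show "ennreal (2 / nu * g (w, s) * ln (max 1 (2 / (nu * b) * g (w, s)))) \<le> ennreal (2 / nu * D * a) * ennreal (Phi ?t)" .
      qed
      also have "\<dots> = (\<integral>\<^sup>+s. rho s * (ennreal (2 / nu * D * a) * ennreal (Phi (g (w, s) / a))) \<partial>lborel)"
        by (rule nn_integral_mrho) (simp add: Phi_def)
      finally show "(\<integral>\<^sup>+s. rho s * H (w, s) \<partial>lborel) \<le> (\<integral>\<^sup>+s. rho s * (ennreal (2 / nu * D * a) * ennreal (Phi (g (w, s) / a))) \<partial>lborel)" .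
    qed
    also have "\<dots> = (\<integral>\<^sup>+p. ennreal (2 / nu * D * a) * ennreal (Phi (g p / a)) \<partial>mu)"
      using g by (intro nn_integral_mu(2)[symmetric]) (simp add: Phi_def)
    also have "\<dots> = ennreal (2 / nu * D * a) * (\<integral>\<^sup>+p. ennreal (Phi (g p / a)) \<partial>mu)"
      using g by (intro nn_integral_cmult borel_measurable_mu) (simp add: Phi_def)
    finally have "ennreal b * emeasure mu U \<le> ennreal (13 ^ DIM('n)) * (ennreal (2 / nu * D * a) * (\<integral>\<^sup>+p. ennreal (Phi (g p / a)) \<partial>mu))"
      by (simp add: mult_left_mono)
    then have "ennreal (1 / b) * (ennreal b * emeasure mu U) \<le> ennreal (1 / b) * (ennreal (13 ^ DIM('n)) * (ennreal (2 / nu * D * a) * (\<integral>\<^sup>+p. ennreal (Phi (g p / a)) \<partial>mu)))"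
      by (rule mult_left_mono) simp
    moreover have "ennreal (1 / b) * (ennreal b * emeasure mu U) = emeasure mu U"
    proof -
      have "ennreal (1 / b) * ennreal b = 1" using b by (simp add: ennreal_mult[symmetric])
      then show ?thesis by (simp only: mult.assoc[symmetric] mult_1_left)
    qed
    moreover have "ennreal (1 / b) * (ennreal (13 ^ DIM('n)) * (ennreal (2 / nu * D * a) * X)) = ennreal C * X" for X
    proof -
      have "1 / b * (13 ^ DIM('n) * (2 / nu * D * a)) = C" using a by (simp add: C_def b_def)
      then have "ennreal (1 / b) * (ennreal (13 ^ DIM('n)) * ennreal (2 / nu * D * a)) = ennreal C"
      proof -
        have "ennreal A * (ennreal B * ennreal E) = ennreal (A * (B * E))" if "A \<ge> 0" "B \<ge> 0" "E \<ge> 0" for A B E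
          using that by (simp add: ennreal_mult)
        from this[of "1 / b" "13 ^ DIM('n)" "2 / nu * D * a"] show ?thesis
          using b nu_pos D a \<open>1 / b * _ = C\<close> by simp
      qed
      then show ?thesis by (simp only: mult.assoc[symmetric])
    qed
    ultimately show "emeasure mu (\<Union>(x, R)\<in>{(x, R). x \<in> S \<and> 2 \<le> R \<and>
        ennreal a * emeasure mu (half_ball x R) \<le> (\<integral>\<^sup>+y\<in>half_ball x R. ennreal (g y) \<partial>mu)}. half_ball x R)
      \<le> ennreal C * (\<integral>\<^sup>+y. ennreal (Phi (g y / a)) \<partial>mu)"
      unfolding I_def[symmetric] U_def[symmetric] by simp
  qed
qed

end

section \<open>The L log L estimate\<close>

lemma nn_integral_powr_Icc:
  assumes "a > -1" "c \<ge> 0"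
  shows "(\<integral>\<^sup>+x. ennreal (x powr a) * indicator {0..c} x \<partial>lborel) = ennreal (c powr (a + 1) / (a + 1))"
proof -
  have "((\<lambda>x. x powr a) has_integral (c powr (a + 1) / (a + 1))) {0..c}"
    using assms by (rule has_integral_powr_from_0)
  then show ?thesis by (rule nn_integral_has_integral_lebesgue'[rotated]) simp
qed

text \<open>The layer cake formula for a power; an inequality suffices and holds for infinite \<open>x\<close> as well.\<close>

lemma ennreal_powr_le_layer:
  assumes p: "p > 1"
  shows "ennreal_powr x p \<le> (\<integral>\<^sup>+b. ennreal (p * b powr (p - 1)) * indicator {0..} b * indicator {b. ennreal b < x} b \<partial>lborel)"
proof -
  have lay: "ennreal (r powr p) \<le> (\<integral>\<^sup>+b. ennreal (p * b powr (p - 1)) * indicator {0..} b * indicator {b. ennreal b < x} b \<partial>lborel)"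
    if r: "r \<ge> 0" "ennreal r \<le> x" for r
  proof -
    have "ennreal (r powr p) = ennreal p * ennreal (r powr (p - 1 + 1) / (p - 1 + 1))"
      using p r by (simp add: ennreal_mult[symmetric])
    also have "\<dots> = (\<integral>\<^sup>+b. ennreal p * (ennreal (b powr (p - 1)) * indicator {0..r} b) \<partial>lborel)"
      using p r by (simp add: nn_integral_cmult nn_integral_powr_Icc)
    also have "\<dots> \<le> (\<integral>\<^sup>+b. ennreal (p * b powr (p - 1)) * indicator {0..} b * indicator {b. ennreal b < x} b \<partial>lborel)"
    proof (rule nn_integral_mono_AE)
      have "AE b in lborel. b \<noteq> r" by (rule AE_lborel_singleton)
      then show "AE b in lborel. ennreal p * (ennreal (b powr (p - 1)) * indicator {0..r} b)
        \<le> ennreal (p * b powr (p - 1)) * indicator {0..} b * indicator {b. ennreal b < x} b"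
      proof eventually_elim
        case (elim b)
        show ?case
        proof (cases "b \<in> {0..r}")
          case True
          then have "ennreal b < ennreal r" using elim by (simp add: ennreal_less_iff)
          then have "ennreal b < x" using r(2) by (rule less_le_trans)
          then show ?thesis using True p by (simp add: ennreal_mult)
        qed simp
      qed
    qed
    finally show ?thesis .
  qed
  show ?thesis
  proof (cases x)
    case (real r)
    then show ?thesis using lay[of r] by (simp add: ennreal_powr_def)
  next
    case top
    let ?I = "(\<integral>\<^sup>+b. ennreal (p * b powr (p - 1)) * indicator {0..} b * indicator {b. ennreal b < x} b \<partial>lborel)"
    have le_I: "of_nat n \<le> ?I" for n :: nat
    proof -
      have "real n powr 1 \<le> real n powr p" if "n \<ge> 1" using that p by (intro powr_mono) auto
      then have "real n \<le> real n powr p" by (cases "n = 0") auto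
      then have "ennreal (real n) \<le> ennreal (real n powr p)" by (rule ennreal_leI)
      also have "\<dots> \<le> ?I" by (rule lay) (simp_all add: top)
      finally show ?thesis by (simp add: ennreal_of_nat_eq_real_of_nat)
    qed
    have "?I = \<infinity>"
    proof (rule ccontr)
      assume "?I \<noteq> \<infinity>"
      then have "?I < top" by (simp add: less_top)
      then obtain n :: nat where "?I < of_nat n" using ennreal_Ex_less_of_nat by blast
      then show False using le_I[of n] by (meson not_le)
    qed
    then show ?thesis by simp
  qed
qed

lemma ennreal_powr_mono: "a > 0 \<Longrightarrow> x \<le> y \<Longrightarrow> ennreal_powr x a \<le> ennreal_powr y a"
  by (cases x; cases y) (auto simp: ennreal_powr_def top_unique intro!: ennreal_leI powr_mono2)

lemma ennreal_powr_mult: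
  assumes "a > 0" "c > 0"
  shows "ennreal_powr (ennreal c * x) a = ennreal (c powr a) * ennreal_powr x a"
proof (cases x)
  case (real r)
  then show ?thesis using assms by (simp add: ennreal_powr_def ennreal_mult[symmetric] powr_mult)
next
  case top
  then show ?thesis using assms by (simp add: ennreal_powr_def ennreal_mult_top)
qed

lemma Phi_nonneg: "t \<ge> 0 \<Longrightarrow> Phi t \<ge> 0"
  by (simp add: Phi_def)

text \<open>A logarithm is dominated by any positive power, with constant blowing up as the power tends to
0.\<close>

lemma Phi_le_powr:
  assumes a: "a > 0" and t: "t \<ge> 1"
  shows "Phi t \<le> 3 powr a / a * t powr (1 + a)"
proof -
  have "ln (2 + t) \<le> (2 + t) powr a / a" using a t by (intro ln_powr_bound) auto
  also have "\<dots> \<le> (3 * t) powr a / a" using a t by (intro divide_right_mono powr_mono2) auto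
  finally have "t * ln (2 + t) \<le> t * ((3 * t) powr a / a)" using t by (intro mult_left_mono) auto
  also have "\<dots> = 3 powr a / a * (t powr 1 * t powr a)" using t by (simp add: powr_mult)
  also have "t powr 1 * t powr a = t powr (1 + a)" by (rule powr_add[symmetric])
  finally show ?thesis by (simp add: Phi_def)
qed

lemma ennreal_less_divideD:
  assumes "ennreal a < x / y" shows "ennreal a * y \<le> x"
proof (cases "y = 0 \<or> y = \<infinity>")
  case True
  then show ?thesis using assms by auto
next
  case False
  have "ennreal a * y \<le> x / y * y" using assms by (intro mult_right_mono) auto
  also have "x / y * y = x * (y / y)" by (rule ennreal_divide_times)
  also have "y / y = 1" by (rule ennreal_divide_self) (use False in \<open>auto simp: less_top\<close>)
  also have "x * 1 = x" by simp
  finally show ?thesis .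
qed

context damek_ricci
begin

text \<open>The slices of a Lebesgue measurable function need not be measurable, so a Borel version is used
wherever the horizontal and the vertical variable are separated.\<close>

lemma measurable_mu_borel_version:
  fixes f :: "'n \<times> real \<Rightarrow> real"
  assumes f: "f \<in> borel_measurable mu"
  obtains g where "g \<in> borel_measurable borel" "\<And>p. g p \<ge> 0" "AE p in mu. \<bar>f p\<bar> = g p"
proof -
  have "f \<in> borel_measurable (lebesgue_on S)" using f by (simp add: measurable_cong_sets[OF sets_mu refl])
  then have "(\<lambda>p. indicator S p *\<^sub>R f p) \<in> borel_measurable lebesgue"
    by (subst (asm) borel_measurable_restrict_space_iff) auto
  then obtain g where g: "g \<in> borel_measurable lborel" "AE p in lborel. indicator S p *\<^sub>R f p = g p"
    using completion_ex_borel_measurable_real by blast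
  have "AE p in mu. \<bar>f p\<bar> = \<bar>g p\<bar>"
  proof -
    have "AE p in lebesgue. indicator S p *\<^sub>R f p = g p" using g(2) by (rule AE_completion)
    then have "AE p in lebesgue_on S. \<bar>f p\<bar> = \<bar>g p\<bar>"
      by (subst AE_restrict_space_iff) (auto elim!: eventually_mono)
    then show ?thesis unfolding mu_def
    proof (subst AE_density)
      have "(\<lambda>(w :: 'n, s). ennreal (s powr (- nu - 1))) \<in> borel_measurable borel"
        unfolding borel_prod[symmetric] by measurable
      then have "(\<lambda>(w :: 'n, s). ennreal (s powr (- nu - 1))) \<in> borel_measurable lborel" by simp
      from measurable_restrict_space1[OF measurable_completion[OF this]]
      show "(\<lambda>(w :: 'n, s). ennreal (s powr (- nu - 1))) \<in> borel_measurable (lebesgue_on S)" .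
    qed (auto elim!: eventually_mono)
  qed
  then show ?thesis using g(1) by (intro that[of "\<lambda>p. \<bar>g p\<bar>"]) auto
qed

lemma sigma_finite_mu: "sigma_finite_measure mu"
proof
  show "\<exists>A. countable A \<and> A \<subseteq> sets mu \<and> \<Union> A = space mu \<and> (\<forall>a\<in>A. emeasure mu a \<noteq> \<infinity>)"
  proof (intro exI conjI ballI)
    let ?A = "range (\<lambda>n. Ebox (real (Suc n)) (real (Suc n)))"
    show "countable ?A" by simp
    show "?A \<subseteq> sets mu" using Ebox_in_S by (auto intro!: borel_imp_sets_mu simp: open_Ebox)
    show "\<Union> ?A = space mu"
    proof
      show "\<Union> ?A \<subseteq> space mu" using Ebox_in_S by auto
      show "space mu \<subseteq> \<Union> ?A"
      proof
        fix p assume p: "p \<in> space mu"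
        obtain w s where ws: "p = (w, s)" by fastforce
        have s: "s > 0" using p ws by simp
        obtain n :: nat where n: "norm w + \<bar>ln s\<bar> < real n" using reals_Archimedean2 by blast
        have "norm (V_part w) < real (Suc n)" "norm (Z_part w) < real (Suc n)"
          using n norm_part_le[of w] by (auto intro: order_le_less_trans)
        moreover have "- real (Suc n) < ln s" "ln s < real (Suc n)" using n norm_ge_zero[of w] abs_ge_self[of "ln s"] abs_ge_minus_self[of "ln s"] unfolding of_nat_Suc by linarith+
        then have "exp (- real (Suc n)) < exp (ln s)" "exp (ln s) < exp (real (Suc n))" by (simp_all only: exp_less_cancel_iff)
        ultimately have "p \<in> Ebox (real (Suc n)) (real (Suc n))" using s by (simp add: ws Ebox_def Nbox_def)
        then show "p \<in> \<Union> ?A" by blast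
      qed
    qed
    fix a assume "a \<in> ?A"
    then obtain n where a: "a = Nbox (real (Suc n)) \<times> {exp (- real (Suc n))<..<exp (real (Suc n))}" by (auto simp: Ebox_def)
    have "emeasure mu a = (\<integral>\<^sup>+s. rho s * indicator {exp (- real (Suc n))<..<exp (real (Suc n))} s \<partial>lborel) * ennreal (real (Suc n) ^ DIM('n) * Nbox1_volume)"
      unfolding a by (subst emeasure_mu_product) (auto simp: emeasure_Nbox simp del: of_nat_Suc intro: order_less_trans[OF exp_gt_zero])
    also have "\<dots> \<le> ennreal ((exp (real (Suc n)) - exp (- real (Suc n))) * exp (- real (Suc n)) powr (- nu - 1)) * ennreal (real (Suc n) ^ DIM('n) * Nbox1_volume)"
      by (intro mult_right_mono rho_interval_le) auto
    also have "\<dots> < \<infinity>" by (simp add: ennreal_mult_less_top)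
    finally show "emeasure mu a \<noteq> \<infinity>" by simp
  qed
qed

abbreviation hlmax :: "('n \<times> real \<Rightarrow> real) \<Rightarrow> 'n \<times> real \<Rightarrow> ennreal" where
  "hlmax \<equiv> maximal_op mu half_balls"

lemma half_balls_open: "F \<in> half_balls \<Longrightarrow> open F" and half_balls_sets: "F \<in> half_balls \<Longrightarrow> F \<in> sets mu"
  and half_balls_subset: "F \<in> half_balls \<Longrightarrow> F \<subseteq> S"
proof -
  assume "F \<in> half_balls"
  then obtain x R where F: "F = half_ball x R" "x \<in> S" "R > 0" by (auto simp: half_balls_def)
  show 1: "open F" using F open_half_ball by simp
  show 2: "F \<subseteq> S" using F half_ball_subset_S by simp
  show "F \<in> sets mu" using 1 2 by (intro borel_imp_sets_mu) simp_all
qed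

text \<open>Half balls are open, so superlevel sets are open; this is where the measurability of the maximal
function comes from.\<close>

lemma superlevel_eq:
  "{x \<in> space mu. c < hlmax f x} = \<Union>{F \<in> half_balls. c < (\<integral>\<^sup>+y\<in>F. ennreal \<bar>f y\<bar> \<partial>mu) / emeasure mu F}"
  unfolding maximal_op_def less_SUP_iff using half_balls_subset by auto

lemma open_superlevel: "open {x \<in> space mu. c < hlmax f x}"
  unfolding superlevel_eq by (rule open_Union) (auto simp: half_balls_open)

lemma superlevel_sets: "{x \<in> space mu. c < hlmax f x} \<in> sets mu"
  by (rule borel_imp_sets_mu) (use open_superlevel in auto)

lemma hlmax_measurable: "hlmax f \<in> borel_measurable mu"
  by (rule borel_measurableI_greater) (rule superlevel_sets)

text \<open>A half ball contains one of radius at most 2, and with it a small box.\<close>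

lemma emeasure_half_ball_pos: "x \<in> S \<Longrightarrow> R > 0 \<Longrightarrow> emeasure mu (half_ball x R) > 0"
proof -
  assume x: "x \<in> S" "R > 0"
  let ?R = "min R 2"
  have R: "?R > 0" "?R \<le> 2" using x by auto
  have "0 < ennreal ((1/32) ^ DIM('n) * Nbox1_volume / 16 * ?R ^ Suc DIM('n))" using R Nbox1_volume(2) by simp
  also have "\<dots> \<le> emeasure mu (base_half_ball ?R)" by (rule emeasure_base_half_ball_small_ge[OF R])
  also have "\<dots> \<le> emeasure mu (base_half_ball R)"
    using base_half_ball_mono[of ?R R] R by (intro emeasure_mono borel_imp_sets_mu base_half_ball_subset_S) (auto simp: open_base_half_ball)
  finally show ?thesis using x by (simp add: emeasure_half_ball)
qed

lemma emeasure_base_half_ball_le: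
  assumes R: "R > 0"
  shows "emeasure mu (base_half_ball R) \<le> ennreal (2 ^ DIM('n) * Nbox1_volume / nu * exp (nu * R))"
proof -
  have "base_half_ball R \<subseteq> Nbox 2 \<times> {exp (- R)<..}" using base_half_ball_crude R by auto
  moreover have "Nbox 2 \<times> {exp (- R)<..} \<in> sets mu"
  proof (rule borel_imp_sets_mu)
    show "Nbox 2 \<times> {exp (- R)<..} \<in> sets borel" unfolding borel_prod[symmetric] by simp
    show "Nbox 2 \<times> {exp (- R)<..} \<subseteq> S" by (auto intro: order_less_trans[OF exp_gt_zero])
  qed
  ultimately have "emeasure mu (base_half_ball R) \<le> emeasure mu (Nbox 2 \<times> {exp (- R)<..})" by (rule emeasure_mono)
  also have "\<dots> = ennreal (exp (- R) powr (- nu) / nu) * ennreal (2 ^ DIM('n) * Nbox1_volume)"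
    by (subst emeasure_mu_product) (auto simp: rho_tail emeasure_Nbox intro: order_less_trans[OF exp_gt_zero])
  also have "exp (- R) powr (- nu) = exp (nu * R)" by (simp add: powr_def)
  also have "ennreal (exp (nu * R) / nu) * ennreal (2 ^ DIM('n) * Nbox1_volume) = ennreal (2 ^ DIM('n) * Nbox1_volume / nu * exp (nu * R))"
    using nu_pos Nbox1_volume(2) by (simp add: ennreal_mult[symmetric] mult_ac)
  finally show ?thesis .
qed

lemma emeasure_half_ball_finite: "x \<in> S \<Longrightarrow> R > 0 \<Longrightarrow> emeasure mu (half_ball x R) < \<infinity>"
  using emeasure_base_half_ball_le[of R] by (simp add: emeasure_half_ball less_top le_less_trans)

text \<open>Every half ball is small or large, and \<open>t ln 2 \<le> \<Phi>(t)\<close> absorbs the weak type (1,1) estimate of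
the small ones.\<close>

lemma LlogL_estimate:
  "\<exists>C>0. \<forall>a>0. \<forall>f\<in>borel_measurable mu.
     emeasure mu {x \<in> space mu. hlmax f x > ennreal a} \<le> ennreal C * (\<integral>\<^sup>+x. ennreal (Phi (\<bar>f x\<bar> / a)) \<partial>mu)"
proof -
  obtain C1 where C1: "C1 > 0" and small: "\<And>g a. g \<in> borel_measurable mu \<Longrightarrow> a > 0 \<Longrightarrow>
     ennreal a * emeasure mu (\<Union>(x, R)\<in>{(x, R). x \<in> S \<and> 0 < R \<and> R \<le> 2 \<and>
        ennreal a * emeasure mu (half_ball x R) \<le> (\<integral>\<^sup>+y\<in>half_ball x R. g y \<partial>mu)}. half_ball x R)
     \<le> ennreal C1 * (\<integral>\<^sup>+y. g y \<partial>mu)"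
    using small_half_balls_weak_type by blast
  obtain C2 where C2: "C2 > 0" and large: "\<And>g a. g \<in> borel_measurable borel \<Longrightarrow> (\<And>p. g p \<ge> 0) \<Longrightarrow> a > 0 \<Longrightarrow>
     emeasure mu (\<Union>(x, R)\<in>{(x, R). x \<in> S \<and> 2 \<le> R \<and>
        ennreal a * emeasure mu (half_ball x R) \<le> (\<integral>\<^sup>+y\<in>half_ball x R. ennreal (g y) \<partial>mu)}. half_ball x R)
     \<le> ennreal C2 * (\<integral>\<^sup>+y. ennreal (Phi (g y / a)) \<partial>mu)"
    using large_half_balls_LlogL by blast
  define C where "C = C1 / ln 2 + C2"
  show ?thesis
  proof (intro exI conjI allI impI ballI)
    show "C > 0" using C1 C2 by (simp add: C_def add_pos_pos)
    fix a :: real and f :: "'n \<times> real \<Rightarrow> real" assume a: "a > 0" and f: "f \<in> borel_measurable mu"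
    obtain g where g: "g \<in> borel_measurable borel" "\<And>p. g p \<ge> 0" "AE p in mu. \<bar>f p\<bar> = g p"
      using measurable_mu_borel_version[OF f] by blast
    have gm: "(\<lambda>y. ennreal (g y)) \<in> borel_measurable mu" using g(1) by (intro borel_measurable_mu) simp
    (* Averages do not see the difference between f and its Borel version. *)
    have int: "(\<integral>\<^sup>+y\<in>F. ennreal \<bar>f y\<bar> \<partial>mu) = (\<integral>\<^sup>+y\<in>F. ennreal (g y) \<partial>mu)" for F
      by (rule nn_integral_cong_AE) (use g(3) in \<open>auto elim!: eventually_mono\<close>)
    let ?P = "\<lambda>x R. ennreal a * emeasure mu (half_ball x R) \<le> (\<integral>\<^sup>+y\<in>half_ball x R. ennreal (g y) \<partial>mu)"
    define A where "A = (\<Union>(x, R)\<in>{(x, R). x \<in> S \<and> 0 < R \<and> R \<le> 2 \<and> ?P x R}. half_ball x R)"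
    define B where "B = (\<Union>(x, R)\<in>{(x, R). x \<in> S \<and> 2 \<le> R \<and> ?P x R}. half_ball x R)"
    have AS: "A \<in> sets mu" "B \<in> sets mu"
    proof -
      have "open A" "open B" unfolding A_def B_def by (intro open_UN; auto intro!: open_half_ball)+
      moreover have sub: "(\<Union>(x, R)\<in>K. half_ball x R) \<subseteq> S" if K: "\<And>x R. (x, R) \<in> K \<Longrightarrow> x \<in> S \<and> R > 0" for K
      proof
        fix p assume "p \<in> (\<Union>(x, R)\<in>K. half_ball x R)"
        then obtain x R where "(x, R) \<in> K" "p \<in> half_ball x R" by auto
        then show "p \<in> S" using half_ball_subset_S[of x R] K[of x R] by blast
      qed
      have "A \<subseteq> S" "B \<subseteq> S" unfolding A_def B_def by (rule sub, simp)+
      ultimately show "A \<in> sets mu" "B \<in> sets mu" by (simp_all add: borel_imp_sets_mu)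
    qed
    have "{x \<in> space mu. hlmax f x > ennreal a} \<subseteq> A \<union> B"
    proof
      fix x assume "x \<in> {x \<in> space mu. hlmax f x > ennreal a}"
      then obtain F where F: "F \<in> half_balls" "x \<in> F" "ennreal a < (\<integral>\<^sup>+y\<in>F. ennreal \<bar>f y\<bar> \<partial>mu) / emeasure mu F"
        unfolding superlevel_eq by blast
      obtain x0 R where xR: "F = half_ball x0 R" "x0 \<in> S" "R > 0" using F(1) by (auto simp: half_balls_def)
      have P: "?P x0 R" using ennreal_less_divideD[OF F(3)] unfolding int xR(1) .
      show "x \<in> A \<union> B"
      proof (cases "R \<le> 2")
        case True
        then have "x \<in> A" unfolding A_def using xR P F(2) by blast
        then show ?thesis by simp
      next
        case False
        then have "2 \<le> R" by simp
        then have "x \<in> B" unfolding B_def using xR P F(2) by blast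
        then show ?thesis by simp
      qed
    qed
    then have "emeasure mu {x \<in> space mu. hlmax f x > ennreal a} \<le> emeasure mu (A \<union> B)"
      using AS by (intro emeasure_mono) auto
    also have "\<dots> \<le> emeasure mu A + emeasure mu B" using AS by (rule emeasure_subadditive)
    also have "emeasure mu A = ennreal (1 / a) * (ennreal a * emeasure mu A)"
    proof -
      have "ennreal (1 / a) * ennreal a = 1" using a by (simp add: ennreal_mult[symmetric])
      then show ?thesis by (simp only: mult.assoc[symmetric] mult_1_left)
    qed
    also have "\<dots> \<le> ennreal (1 / a) * (ennreal C1 * (\<integral>\<^sup>+y. ennreal (g y) \<partial>mu))"
      unfolding A_def by (intro mult_left_mono small gm a) simp
    also have "\<dots> = (\<integral>\<^sup>+y. ennreal (C1 / a) * ennreal (g y) \<partial>mu)"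
    proof -
      have "ennreal (1 / a) * ennreal C1 = ennreal (C1 / a)" using a C1 by (simp add: ennreal_mult[symmetric])
      then show ?thesis using gm by (simp add: nn_integral_cmult mult.assoc[symmetric])
    qed
    also have "\<dots> \<le> (\<integral>\<^sup>+y. ennreal (C1 / ln 2) * ennreal (Phi (g y / a)) \<partial>mu)"
    proof (rule nn_integral_mono)
      fix y
      have t: "g y / a \<ge> 0" using g(2) a by simp
      then have "ln 2 \<le> ln (2 + g y / a)" by simp
      then have "g y / a * ln 2 \<le> Phi (g y / a)" unfolding Phi_def using t by (rule mult_left_mono)
      then have "C1 / ln 2 * (g y / a * ln 2) \<le> C1 / ln 2 * Phi (g y / a)" using C1 by (intro mult_left_mono) auto
      then have "C1 / a * g y \<le> C1 / ln 2 * Phi (g y / a)" by simp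
      then have "ennreal (C1 / a * g y) \<le> ennreal (C1 / ln 2 * Phi (g y / a))" by (rule ennreal_leI)
      then show "ennreal (C1 / a) * ennreal (g y) \<le> ennreal (C1 / ln 2) * ennreal (Phi (g y / a))"
        using C1 a g(2) Phi_nonneg[OF t] by (subst (1 2) ennreal_mult''[symmetric]) auto
    qed
    also have "\<dots> = ennreal (C1 / ln 2) * (\<integral>\<^sup>+y. ennreal (Phi (g y / a)) \<partial>mu)"
      using g(1) by (intro nn_integral_cmult borel_measurable_mu) (simp add: Phi_def)
    also have "emeasure mu B \<le> ennreal C2 * (\<integral>\<^sup>+y. ennreal (Phi (g y / a)) \<partial>mu)"
      unfolding B_def by (rule large[OF g(1,2) a])
    finally have "emeasure mu {x \<in> space mu. hlmax f x > ennreal a}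
      \<le> ennreal (C1 / ln 2) * (\<integral>\<^sup>+y. ennreal (Phi (g y / a)) \<partial>mu) + ennreal C2 * (\<integral>\<^sup>+y. ennreal (Phi (g y / a)) \<partial>mu)"
      by (simp only: add_left_mono add_right_mono)
    also have "\<dots> = ennreal C * (\<integral>\<^sup>+y. ennreal (Phi (g y / a)) \<partial>mu)"
      using C1 C2 by (simp add: C_def distrib_right)
    also have "(\<integral>\<^sup>+y. ennreal (Phi (g y / a)) \<partial>mu) = (\<integral>\<^sup>+x. ennreal (Phi (\<bar>f x\<bar> / a)) \<partial>mu)"
      by (rule nn_integral_cong_AE) (use g(3) in \<open>auto elim!: eventually_mono\<close>)
    finally show "emeasure mu {x \<in> space mu. hlmax f x > ennreal a} \<le> ennreal C * (\<integral>\<^sup>+x. ennreal (Phi (\<bar>f x\<bar> / a)) \<partial>mu)" .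
  qed
qed

end

section \<open>Strong type estimates\<close>

context damek_ricci
begin

lemma half_ballsE:
  assumes "F \<in> half_balls"
  obtains "0 < emeasure mu F" "emeasure mu F < \<infinity>" "F \<in> sets mu"
proof -
  obtain x R where F: "F = half_ball x R" "x \<in> S" "R > 0" using assms by (auto simp: half_balls_def)
  show ?thesis
    using that emeasure_half_ball_pos[OF F(2,3)] emeasure_half_ball_finite[OF F(2,3)] half_balls_sets[OF assms] F(1) by simp
qed

text \<open>The maximal operator is sublinear and does not increase constants.\<close>

lemma hlmax_le_bounded_part:
  fixes f f1 :: "'n \<times> real \<Rightarrow> real"
  assumes f: "f \<in> borel_measurable mu" and f1: "f1 \<in> borel_measurable mu"
    and le: "AE x in mu. ennreal \<bar>f x\<bar> \<le> ennreal \<bar>f1 x\<bar> + c"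
  shows "hlmax f x \<le> hlmax f1 x + c"
  unfolding maximal_op_def[of mu half_balls f]
proof (rule SUP_least)
  fix F assume F: "F \<in> {F \<in> half_balls. x \<in> F}"
  then have "F \<in> half_balls" by simp
  then obtain m: "0 < emeasure mu F" "emeasure mu F < \<infinity>" "F \<in> sets mu" by (rule half_ballsE)
  have "(\<integral>\<^sup>+y\<in>F. ennreal \<bar>f y\<bar> \<partial>mu) \<le> (\<integral>\<^sup>+y. ennreal \<bar>f1 y\<bar> * indicator F y + c * indicator F y \<partial>mu)"
  proof (rule nn_integral_mono_AE)
    show "AE y in mu. ennreal \<bar>f y\<bar> * indicator F y \<le> ennreal \<bar>f1 y\<bar> * indicator F y + c * indicator F y"
      using le by eventually_elim (auto simp: indicator_def)
  qed
  also have "\<dots> = (\<integral>\<^sup>+y\<in>F. ennreal \<bar>f1 y\<bar> \<partial>mu) + c * emeasure mu F"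
    using f1 m(3) by (subst nn_integral_add) (auto simp: nn_integral_cmult_indicator)
  finally have "(\<integral>\<^sup>+y\<in>F. ennreal \<bar>f y\<bar> \<partial>mu) / emeasure mu F \<le> ((\<integral>\<^sup>+y\<in>F. ennreal \<bar>f1 y\<bar> \<partial>mu) + c * emeasure mu F) / emeasure mu F"
    by (rule divide_right_mono_ennreal)
  also have "\<dots> = (\<integral>\<^sup>+y\<in>F. ennreal \<bar>f1 y\<bar> \<partial>mu) / emeasure mu F + c * emeasure mu F / emeasure mu F"
    by (rule add_divide_distrib_ennreal)
  also have "c * emeasure mu F / emeasure mu F = c"
    using m by (intro mult_divide_eq_ennreal) auto
  also have "(\<integral>\<^sup>+y\<in>F. ennreal \<bar>f1 y\<bar> \<partial>mu) / emeasure mu F + c \<le> hlmax f1 x + c"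
    unfolding maximal_op_def by (intro add_right_mono SUP_upper F)
  finally show "(\<integral>\<^sup>+y\<in>F. ennreal \<bar>f y\<bar> \<partial>mu) / emeasure mu F \<le> hlmax f1 x + c" .
qed

text \<open>At level \<open>b\<close> apply the L log L estimate to the part of \<open>f\<close> above \<open>b / 2\<close>, and replace \<open>\<Phi>\<close> by a
power \<open>q\<close> strictly between 1 and \<open>p\<close>. The integral over the levels then converges at 0, as \<open>q < p\<close>, and is
cut off at \<open>2 |f|\<close>.\<close>

lemma strong_type:
  fixes p :: real
  assumes p: "p > 1"
  shows "\<exists>C>0. \<forall>f\<in>borel_measurable mu.
    (\<integral>\<^sup>+x. ennreal_powr (hlmax f x) p \<partial>mu) \<le> ennreal C * (\<integral>\<^sup>+x. ennreal (\<bar>f x\<bar> powr p) \<partial>mu)"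
proof -
  obtain C0 where C0: "C0 > 0" and est: "\<And>a f. a > 0 \<Longrightarrow> f \<in> borel_measurable mu \<Longrightarrow>
     emeasure mu {x \<in> space mu. hlmax f x > ennreal a} \<le> ennreal C0 * (\<integral>\<^sup>+x. ennreal (Phi (\<bar>f x\<bar> / a)) \<partial>mu)"
    using LlogL_estimate by blast
  (* The exponent q lies half way between 1 and p. *)
  define a where "a = (p - 1) / 2"
  define q where "q = 1 + a"
  have a: "a > 0" "q > 0" "p - q = a" "p - 1 - q > -1" using p by (auto simp: a_def q_def field_simps)
  define K where "K = 3 powr a / a"
  have K: "K > 0" using a by (simp add: K_def)
  define C where "C = C0 * (p * K / a * 2 powr p)"
  show ?thesis
  proof (intro exI conjI ballI)
    show "C > 0" using C0 K p a by (simp add: C_def)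
    fix f :: "'n \<times> real \<Rightarrow> real" assume f[measurable]: "f \<in> borel_measurable mu"
    interpret m: sigma_finite_measure mu by (rule sigma_finite_mu)
    interpret P: pair_sigma_finite mu lborel by unfold_locales
    define w where "w b = ennreal (p * b powr (p - 1)) * indicator {0..} b" for b :: real
    have [measurable]: "w \<in> borel_measurable borel" unfolding w_def[abs_def] by measurable
    define k where "k x b = ennreal (K * (2 * \<bar>f x\<bar> / b) powr q) * (if \<bar>f x\<bar> > b / 2 then 1 else 0)" for x b
    have [measurable]: "(\<lambda>(x, b). w b * k x b) \<in> borel_measurable (mu \<Otimes>\<^sub>M lborel)" unfolding k_def by measurable
    have km[measurable]: "(\<lambda>x. k x b) \<in> borel_measurable mu" for b unfolding k_def by measurable
    have "(\<integral>\<^sup>+x. ennreal_powr (hlmax f x) p \<partial>mu) \<le> (\<integral>\<^sup>+x. (\<integral>\<^sup>+b. w b * indicator {b. ennreal b < hlmax f x} b \<partial>lborel) \<partial>mu)"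
      unfolding w_def by (intro nn_integral_mono ennreal_powr_le_layer p)
    also have "\<dots> = (\<integral>\<^sup>+b. w b * emeasure mu {x \<in> space mu. hlmax f x > ennreal b} \<partial>lborel)"
      by (rule nn_integral_layer_cake[OF sigma_finite_mu hlmax_measurable]) measurable
    also have "\<dots> \<le> (\<integral>\<^sup>+b. w b * (ennreal C0 * (\<integral>\<^sup>+x. k x b \<partial>mu)) \<partial>lborel)"
    proof (rule nn_integral_mono)
      fix b :: real
      show "w b * emeasure mu {x \<in> space mu. hlmax f x > ennreal b} \<le> w b * (ennreal C0 * (\<integral>\<^sup>+x. k x b \<partial>mu))"
      proof (cases "b > 0")
        case False
        then have "w b = 0" by (cases "b = 0") (auto simp: w_def)
        then show ?thesis by simp
      next
        case b: True
        define f1 where "f1 x = (if \<bar>f x\<bar> > b / 2 then f x else 0)" for x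
        have f1[measurable]: "f1 \<in> borel_measurable mu" unfolding f1_def[abs_def] by measurable
        have "ennreal \<bar>f x\<bar> \<le> ennreal \<bar>f1 x\<bar> + ennreal (b / 2)" for x
          by (auto simp: f1_def ennreal_leI add_increasing2)
        then have hl: "hlmax f x \<le> hlmax f1 x + ennreal (b / 2)" for x
          by (intro hlmax_le_bounded_part f f1) simp
        have "{x \<in> space mu. hlmax f x > ennreal b} \<subseteq> {x \<in> space mu. hlmax f1 x > ennreal (b / 2)}"
        proof
          fix x assume x: "x \<in> {x \<in> space mu. hlmax f x > ennreal b}"
          have "ennreal b = ennreal (b / 2) + ennreal (b / 2)" using b by (simp add: ennreal_plus[symmetric] del: ennreal_plus)
          moreover have "ennreal b < hlmax f x" using x by simp
          ultimately have "ennreal (b / 2) + ennreal (b / 2) < hlmax f1 x + ennreal (b / 2)"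
            using hl[of x] by (metis less_le_trans)
          then have "ennreal (b / 2) < hlmax f1 x" by (meson add_right_mono leD not_le_imp_less)
          then show "x \<in> {x \<in> space mu. hlmax f1 x > ennreal (b / 2)}" using x by simp
        qed
        then have "emeasure mu {x \<in> space mu. hlmax f x > ennreal b} \<le> emeasure mu {x \<in> space mu. hlmax f1 x > ennreal (b / 2)}"
          by (intro emeasure_mono superlevel_sets)
        also have "\<dots> \<le> ennreal C0 * (\<integral>\<^sup>+x. ennreal (Phi (\<bar>f1 x\<bar> / (b / 2))) \<partial>mu)"
          using b by (intro est f1) auto
        also have "\<dots> \<le> ennreal C0 * (\<integral>\<^sup>+x. k x b \<partial>mu)"
        proof (intro mult_left_mono nn_integral_mono)
          fix x
          show "ennreal (Phi (\<bar>f1 x\<bar> / (b / 2))) \<le> k x b"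
          proof (cases "\<bar>f x\<bar> > b / 2")
            case True
            then have t: "2 * \<bar>f x\<bar> / b \<ge> 1" using b by (simp add: field_simps)
            have "Phi (2 * \<bar>f x\<bar> / b) \<le> K * (2 * \<bar>f x\<bar> / b) powr q"
              unfolding K_def q_def by (rule Phi_le_powr[OF a(1) t])
            moreover have "\<bar>f1 x\<bar> / (b / 2) = 2 * \<bar>f x\<bar> / b" using True by (simp add: f1_def)
            ultimately have "Phi (\<bar>f1 x\<bar> / (b / 2)) \<le> K * (2 * \<bar>f x\<bar> / b) powr q" by (simp only:)
            moreover have "k x b = ennreal (K * (2 * \<bar>f x\<bar> / b) powr q)" using True unfolding k_def by simp
            ultimately show ?thesis by (simp only: ennreal_leI)
          next
            case False
            then show ?thesis by (simp add: f1_def Phi_def)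
          qed
        qed simp
        finally show ?thesis by (rule mult_left_mono) simp
      qed
    qed
    also have "\<dots> = (\<integral>\<^sup>+b. (\<integral>\<^sup>+x. ennreal C0 * (w b * k x b) \<partial>mu) \<partial>lborel)"
      by (simp add: nn_integral_cmult mult_ac)
    also have "\<dots> = (\<integral>\<^sup>+x. (\<integral>\<^sup>+b. ennreal C0 * (w b * k x b) \<partial>lborel) \<partial>mu)"
      by (rule P.Fubini') measurable
    also have "\<dots> \<le> (\<integral>\<^sup>+x. ennreal C * ennreal (\<bar>f x\<bar> powr p) \<partial>mu)"
    proof (rule nn_integral_mono)
      fix x
      let ?B = "2 * \<bar>f x\<bar>"
      have "(\<integral>\<^sup>+b. ennreal C0 * (w b * k x b) \<partial>lborel)
         \<le> (\<integral>\<^sup>+b. ennreal (C0 * p * K * ?B powr q) * (ennreal (b powr (p - 1 - q)) * indicator {0..?B} b) \<partial>lborel)"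
      proof (rule nn_integral_mono)
        fix b :: real
        show "ennreal C0 * (w b * k x b) \<le> ennreal (C0 * p * K * ?B powr q) * (ennreal (b powr (p - 1 - q)) * indicator {0..?B} b)"
        proof (cases "b > 0 \<and> \<bar>f x\<bar> > b / 2")
          case True
          then have b: "b > 0" "b \<le> ?B" by auto
          have "C0 * (p * b powr (p - 1) * (K * (?B / b) powr q)) = C0 * p * K * ?B powr q * (b powr (p - 1) / b powr q)"
            using b by (simp add: powr_divide)
          also have "b powr (p - 1) / b powr q = b powr (p - 1 - q)" by (rule powr_diff[symmetric])
          finally have eq: "C0 * (p * b powr (p - 1) * (K * (?B / b) powr q)) = C0 * p * K * ?B powr q * b powr (p - 1 - q)" .
          have "ennreal C0 * (w b * k x b) = ennreal (C0 * (p * b powr (p - 1) * (K * (?B / b) powr q)))"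
            using True C0 K p by (simp add: w_def k_def ennreal_mult)
          also have "\<dots> = ennreal (C0 * p * K * ?B powr q) * (ennreal (b powr (p - 1 - q)) * indicator {0..?B} b)"
            unfolding eq using b C0 K p by (simp add: ennreal_mult)
          finally show ?thesis by simp
        next
          case False
          then have "w b * k x b = 0" by (cases "b = 0") (auto simp: w_def k_def)
          then have "ennreal C0 * (w b * k x b) = 0" by (simp only: mult_zero_right)
          then show ?thesis by (simp only: zero_le)
        qed
      qed
      also have "\<dots> = ennreal (C0 * p * K * ?B powr q) * ennreal (?B powr (p - 1 - q + 1) / (p - 1 - q + 1))"
        using a by (subst nn_integral_cmult) (auto simp: nn_integral_powr_Icc)
      also have "\<dots> = ennreal (C0 * p * K * ?B powr q * (?B powr a / a))"
      proof -
        have "p - 1 - q + 1 = a" using a by simp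
        then show ?thesis using C0 p K a by (simp only:, intro ennreal_mult[symmetric]) simp_all
      qed
      also have "C0 * p * K * ?B powr q * (?B powr a / a) = C0 * p * K / a * (?B powr q * ?B powr a)" by simp
      also have "?B powr q * ?B powr a = ?B powr p"
      proof -
        have "q + a = p" using a by simp
        then show ?thesis by (simp add: powr_add[symmetric])
      qed
      also have "?B powr p = 2 powr p * \<bar>f x\<bar> powr p" by (simp add: powr_mult)
      also have "C0 * p * K / a * (2 powr p * \<bar>f x\<bar> powr p) = C * \<bar>f x\<bar> powr p" by (simp add: C_def)
      also have "ennreal (C * \<bar>f x\<bar> powr p) = ennreal C * ennreal (\<bar>f x\<bar> powr p)"
        using C0 K p a by (intro ennreal_mult) (auto simp: C_def)
      finally show "(\<integral>\<^sup>+b. ennreal C0 * (w b * k x b) \<partial>lborel) \<le> ennreal C * ennreal (\<bar>f x\<bar> powr p)" .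
    qed
    also have "\<dots> = ennreal C * (\<integral>\<^sup>+x. ennreal (\<bar>f x\<bar> powr p) \<partial>mu)"
      by (rule nn_integral_cmult) measurable
    finally show "(\<integral>\<^sup>+x. ennreal_powr (hlmax f x) p \<partial>mu) \<le> ennreal C * (\<integral>\<^sup>+x. ennreal (\<bar>f x\<bar> powr p) \<partial>mu)" .
  qed
qed

lemma hlmax_bounded_on_Lp:
  assumes p: "p > 1" shows "bounded_on_Lp mu p hlmax"
proof (cases p)
  case top
  show ?thesis unfolding bounded_on_Lp_def
  proof (intro exI conjI ballI impI)
    show "(1::real) > 0" by simp
    fix f :: "'n \<times> real \<Rightarrow> real" assume f: "f \<in> borel_measurable mu"
    show "hlmax f \<in> borel_measurable mu" by (rule hlmax_measurable)
    have "hlmax f x \<le> esssup mu (\<lambda>x. ennreal \<bar>f x\<bar>)" for x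
    proof -
      have "AE x in mu. ennreal \<bar>f x\<bar> \<le> ennreal \<bar>0\<bar> + esssup mu (\<lambda>x. ennreal \<bar>f x\<bar>)"
        using esssup_AE[of "\<lambda>x. ennreal \<bar>f x\<bar>" mu] by simp
      then have "hlmax f x \<le> hlmax (\<lambda>_. 0) x + esssup mu (\<lambda>x. ennreal \<bar>f x\<bar>)"
        by (intro hlmax_le_bounded_part f) auto
      moreover have "hlmax (\<lambda>_. 0) x = 0" unfolding maximal_op_def by (simp add: SUP_eq_const bot_ennreal) (auto intro!: antisym SUP_least)
      ultimately show ?thesis by simp
    qed
    then have "esssup mu (hlmax f) \<le> esssup mu (\<lambda>x. ennreal \<bar>f x\<bar>)"
      by (intro esssup_I hlmax_measurable) simp
    then show "Lp_norm mu p (hlmax f) \<le> ennreal 1 * Lp_norm mu p (\<lambda>x. ennreal \<bar>f x\<bar>)"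
      by (simp add: Lp_norm_def top)
  qed
next
  case (real r)
  then have r: "r > 1" using p ennreal_less_iff[of 1 r] by simp
  obtain C where C: "C > 0" and est: "\<And>f. f \<in> borel_measurable mu \<Longrightarrow>
    (\<integral>\<^sup>+x. ennreal_powr (hlmax f x) r \<partial>mu) \<le> ennreal C * (\<integral>\<^sup>+x. ennreal (\<bar>f x\<bar> powr r) \<partial>mu)"
    using strong_type[OF r] by blast
  have pinf: "p \<noteq> \<infinity>" "enn2real p = r" using real by simp_all
  show ?thesis unfolding bounded_on_Lp_def
  proof (intro exI conjI ballI impI)
    show "C powr (1 / r) > 0" using C by simp
    fix f :: "'n \<times> real \<Rightarrow> real" assume f: "f \<in> borel_measurable mu"
    show "hlmax f \<in> borel_measurable mu" by (rule hlmax_measurable)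
    have r1: "1 / r > 0" using r by simp
    have eq: "ennreal_powr (ennreal \<bar>f x\<bar>) r = ennreal (\<bar>f x\<bar> powr r)" for x
      by (simp add: ennreal_powr_def)
    have "ennreal_powr (\<integral>\<^sup>+x. ennreal_powr (hlmax f x) r \<partial>mu) (1 / r)
       \<le> ennreal_powr (ennreal C * (\<integral>\<^sup>+x. ennreal (\<bar>f x\<bar> powr r) \<partial>mu)) (1 / r)"
      by (rule ennreal_powr_mono[OF r1 est[OF f]])
    also have "\<dots> = ennreal (C powr (1 / r)) * ennreal_powr (\<integral>\<^sup>+x. ennreal (\<bar>f x\<bar> powr r) \<partial>mu) (1 / r)"
      by (rule ennreal_powr_mult[OF r1 C])
    finally show "Lp_norm mu p (hlmax f) \<le> ennreal (C powr (1 / r)) * Lp_norm mu p (\<lambda>x. ennreal \<bar>f x\<bar>)"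
      unfolding Lp_norm_def using pinf by (simp add: eq)
  qed
qed

section \<open>Sharpness of the L log L estimate\<close>

text \<open>Any set of positive measure near the identity would do that all the half balls below contain; it
lies at heights between 1 and 2, under centres of height at least 4.\<close>

definition lower_set :: "('n \<times> real) set" where
  "lower_set = Nbox (1/2) \<times> {1<..<2}"

lemma lower_set_sets: "lower_set \<in> sets mu" "lower_set \<subseteq> S"
proof -
  show 1: "lower_set \<subseteq> S" by (auto simp: lower_set_def)
  show "lower_set \<in> sets mu"
  proof (rule borel_imp_sets_mu[OF _ 1])
    show "lower_set \<in> sets borel" unfolding lower_set_def borel_prod[symmetric] by simp
  qed
qed

lemma lower_set_measure:
  obtains mE where "emeasure mu lower_set = ennreal mE" "mE > 0"
proof -
  have e: "emeasure mu lower_set = (\<integral>\<^sup>+s. rho s * indicator {1<..<2} s \<partial>lborel) * ennreal ((1/2) ^ DIM('n) * Nbox1_volume)"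
    unfolding lower_set_def by (subst emeasure_mu_product) (auto simp: emeasure_Nbox)
  have "0 < ennreal ((2 - 1) * 2 powr (- nu - 1))" by simp
  also have "\<dots> \<le> (\<integral>\<^sup>+s. rho s * indicator {1<..<2} s \<partial>lborel)" by (rule rho_interval_ge) auto
  finally have pos: "emeasure mu lower_set > 0" unfolding e using Nbox1_volume(2) by (simp add: ennreal_zero_less_mult_iff)
  have "emeasure mu lower_set \<le> ennreal ((2 - 1) * 1 powr (- nu - 1)) * ennreal ((1/2) ^ DIM('n) * Nbox1_volume)"
    unfolding e by (intro mult_right_mono rho_interval_le) auto
  also have "\<dots> < \<infinity>" by (simp add: ennreal_mult_less_top)
  finally have "emeasure mu lower_set < \<infinity>" .
  then have "emeasure mu lower_set = ennreal (measure mu lower_set)" by (intro emeasure_eq_ennreal_measure) auto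
  moreover from this have "measure mu lower_set > 0" using pos by (simp add: zero_less_measure_iff)
  ultimately show ?thesis by (rule that)
qed

lemma Nbox_dil: "0 < s \<Longrightarrow> s \<le> 1 \<Longrightarrow> w \<in> Nbox a \<Longrightarrow> dil s w \<in> Nbox a"
proof -
  assume s: "0 < s" "s \<le> 1" and w: "w \<in> Nbox a"
  have "norm (V_part (dil s w)) = sqrt s * norm (V_part w)" "norm (Z_part (dil s w)) = s * norm (Z_part w)"
    using s by (simp_all add: dil_def part_linear)
  moreover have "sqrt s * norm (V_part w) \<le> 1 * norm (V_part w)" "s * norm (Z_part w) \<le> 1 * norm (Z_part w)"
    using s by (intro mult_right_mono; simp)+
  ultimately show ?thesis using w by (simp add: Nbox_def)
qed

text \<open>All half balls have the same radius \<open>ln T\<close>, so \<open>ht\<close> is chosen to make the average of the test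
function exceed 1 over each of them. The centres \<open>4 * 2 ^ j\<close> start at 4 so that the heights of \<open>lower_set\<close>
are below half of each, and \<open>T = 10 * 2 ^ m\<close> is \<open>5/2\<close> times the largest of them. The bottom layers, of
relative heights between \<open>5/2 / T\<close> and \<open>5 / T\<close>, span a factor 2 and are therefore disjoint for different \<open>j\<close>.\<close>

lemma superlevel_lower_bound:
  assumes mE: "emeasure mu lower_set = ennreal mE" "mE > 0"
  defines "C3 \<equiv> 2 ^ DIM('n) * Nbox1_volume / nu" and "c3 \<equiv> 5/2 * 5 powr (- nu - 1) * ((1/2) ^ DIM('n) * Nbox1_volume)"
  fixes m :: nat
  defines "T \<equiv> 10 * 2 ^ m"
  defines "ht \<equiv> 2 * C3 * T powr nu / mE"
  shows "ennreal (real (Suc m) * (c3 * T powr nu)) \<le> emeasure mu {x \<in> space mu. hlmax (\<lambda>x. ht * indicator lower_set x) x > ennreal 1}"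
proof -
  have T: "T \<ge> 10" by (simp add: T_def)
  define R where "R = ln T"
  have eR: "exp R = T" "exp (- R) = 1 / T" using T by (simp_all add: R_def exp_minus field_simps)
  have R: "R > 0" using T by (simp add: R_def)
  have C3: "C3 > 0" using Nbox1_volume(2) nu_pos by (simp add: C3_def)
  have c3: "c3 > 0" using Nbox1_volume(2) by (simp add: c3_def)
  have Tn: "exp (nu * R) = T powr nu" using T by (simp add: R_def powr_def)
  have lam: "ht > 0" using C3 mE(2) T by (simp add: ht_def)
  define s where "s j = (4 * 2 ^ j :: real)" for j :: nat
  have s: "s j \<ge> 4" "s j > 0" for j by (simp_all add: s_def)
  let ?f = "\<lambda>x. ht * indicator lower_set x :: real"
  let ?I = "{5/2 / T<..<5 / T}"
  let ?B = "Nbox (1/2) \<times> ?I"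
  define L where "L j = mult (0, s j) ` ?B" for j
  have mult0: "mult (0, s0) (w, r) = (dil s0 w, s0 * r)" for s0 w r by (simp add: mult_aff aff_eq)
  have bs: "Nbox (1/2) \<times> {5/2 / T<..<1/2} \<subseteq> base_half_ball R"
    using large_box_subset_base_half_ball[OF R] by (simp add: eR)
  have x: "(0, s j) \<in> S" for j using s by simp
  have BS: "?B \<subseteq> S" "open ?B"
  proof -
    have "0 < 5/2 / T" using T by simp
    then show "?B \<subseteq> S" by (auto intro: order_less_trans)
    show "open ?B" by (intro open_Times open_Nbox) auto
  qed
  have LF: "L j \<subseteq> half_ball (0, s j) R" for j
  proof -
    have "5 / T \<le> 1/2" using T by (simp add: field_simps)
    then have "?B \<subseteq> Nbox (1/2) \<times> {5/2 / T<..<1/2}" by (intro Sigma_mono) auto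
    then show ?thesis unfolding L_def half_ball_eq[OF R] using bs by (intro image_mono) blast
  qed
  have EF: "lower_set \<subseteq> half_ball (0, s j) R" if j: "j \<le> m" for j
  proof
    fix p assume p: "p \<in> lower_set"
    then obtain w r where wr: "p = (w, r)" "w \<in> Nbox (1/2)" "1 < r" "r < 2" by (auto simp: lower_set_def)
    have sT: "5/2 * s j \<le> T"
    proof -
      have "(2::real) ^ j \<le> 2 ^ m" using j by (intro power_increasing) auto
      then show ?thesis by (simp add: s_def T_def)
    qed
    have "dil (1 / s j) w \<in> Nbox (1/2)" using s[of j] wr(2) by (intro Nbox_dil) auto
    moreover have "5/2 / T < r / s j"
    proof -
      have "5/2 * s j < r * T" using sT wr(3) T mult_strict_right_mono[of 1 r T] by linarith
      then show ?thesis using T s[of j] by (simp add: field_simps)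
    qed
    moreover have "r / s j < 1/2" using s[of j] wr(4) by (simp add: field_simps)
    ultimately have "(dil (1 / s j) w, r / s j) \<in> base_half_ball R" using bs by auto
    moreover have "p = mult (0, s j) (dil (1 / s j) w, r / s j)"
      using s[of j] V_Z_decomp[of w] by (simp add: mult0 wr(1) dil_def part_linear real_sqrt_divide)
    ultimately show "p \<in> half_ball (0, s j) R" unfolding half_ball_eq[OF R] by blast
  qed
  have sup: "half_ball (0, s j) R \<subseteq> {x \<in> space mu. hlmax ?f x > ennreal 1}" if j: "j \<le> m" for j
  proof -
    let ?F = "half_ball (0, s j) R"
    have Fh: "?F \<in> half_balls" using x R by (auto simp: half_balls_def)
    then obtain mF: "0 < emeasure mu ?F" "emeasure mu ?F < \<infinity>" by (rule half_ballsE)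
    have "(\<integral>\<^sup>+y\<in>?F. ennreal \<bar>?f y\<bar> \<partial>mu) = (\<integral>\<^sup>+y. ennreal ht * indicator lower_set y \<partial>mu)"
      by (rule nn_integral_cong) (use EF[OF j] lam in \<open>auto simp: indicator_def\<close>)
    also have "\<dots> = ennreal ht * ennreal mE"
      using lower_set_sets by (simp add: nn_integral_cmult_indicator mE)
    also have "\<dots> = ennreal (2 * (C3 * T powr nu))"
      using lam mE(2) by (simp add: ennreal_mult[symmetric] ht_def mult.assoc)
    finally have num: "(\<integral>\<^sup>+y\<in>?F. ennreal \<bar>?f y\<bar> \<partial>mu) = ennreal (2 * (C3 * T powr nu))" .
    have pos: "C3 * T powr nu > 0" using C3 T by simp
    have "emeasure mu ?F \<le> ennreal (C3 * T powr nu)"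
      using emeasure_base_half_ball_le[OF R] emeasure_half_ball[OF x R, of j] unfolding C3_def Tn by simp
    then obtain F where F: "emeasure mu ?F = ennreal F" "F > 0" "F \<le> C3 * T powr nu"
      using mF pos by (cases "emeasure mu ?F") (auto simp: ennreal_le_iff)
    have "1 < 2 * (C3 * T powr nu) / F" using F pos by (simp add: field_simps)
    then have "ennreal 1 < ennreal (2 * (C3 * T powr nu) / F)" by (simp only: ennreal_less_iff zero_le_one)
    also have "\<dots> = (\<integral>\<^sup>+y\<in>?F. ennreal \<bar>?f y\<bar> \<partial>mu) / emeasure mu ?F"
      unfolding num F(1) using F(2) pos by (simp add: divide_ennreal)
    finally show ?thesis unfolding superlevel_eq using Fh by blast
  qed
  have LB: "L j \<in> sets mu" for j
  proof (rule borel_imp_sets_mu)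
    show "L j \<in> sets borel" unfolding L_def using BS x by (intro mult_image_borel) auto
    show "L j \<subseteq> S" using LF half_ball_subset_S[OF x R] by blast
  qed
  have disj: "disjoint_family_on L {..m}"
  proof -
    have "L i \<inter> L j = {}" if ij: "i < j" for i j
    proof (rule equals0I)
      fix p assume p: "p \<in> L i \<inter> L j"
      have hl: "snd p < s i * (5 / T)" "s j * (5/2 / T) < snd p"
      proof -
        obtain a b a' b' where ab: "p = (dil (s i) a, s i * b)" "b < 5 / T" "p = (dil (s j) a', s j * b')" "5/2 / T < b'"
        proof -
          from p obtain u v where uv: "u \<in> ?B" "p = mult (0, s i) u" "v \<in> ?B" "p = mult (0, s j) v"
            unfolding L_def by blast
          show ?thesis by (rule that[of "fst u" "snd u" "fst v" "snd v"])
            (use uv mult0[of "s i" "fst u" "snd u"] mult0[of "s j" "fst v" "snd v"] in \<open>simp_all add: mem_Times_iff\<close>)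
        qed
        show "snd p < s i * (5 / T)" using ab(1,2) mult_strict_left_mono[OF ab(2) s(2)[of i]] by simp
        show "s j * (5/2 / T) < snd p" using ab(3,4) mult_strict_left_mono[OF ab(4) s(2)[of j]] by simp
      qed
      have "(2::real) ^ Suc i \<le> 2 ^ j" using ij by (intro power_increasing) auto
      then have "s i * 2 \<le> s j" by (simp add: s_def)
      then have "s i * 2 * (5/2 / T) \<le> s j * (5/2 / T)" using T by (intro mult_right_mono) auto
      then show False using hl by simp
    qed
    then show ?thesis unfolding disjoint_family_on_def by (metis Int_commute linorder_neqE_nat)
  qed
  have mL: "ennreal (c3 * T powr nu) \<le> emeasure mu (L j)" for j
  proof -
    have "emeasure mu (L j) = emeasure mu ?B" unfolding L_def using BS x by (intro emeasure_mult_image) auto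
    also have "\<dots> = (\<integral>\<^sup>+s. rho s * indicator ?I s \<partial>lborel) * ennreal ((1/2) ^ DIM('n) * Nbox1_volume)"
    proof (subst emeasure_mu_product)
      have "0 < 5/2 / T" using T by simp
      then show "?I \<subseteq> {0<..}" by (auto intro: order_less_trans)
    qed (auto simp: emeasure_Nbox)
    finally have e: "emeasure mu (L j) = (\<integral>\<^sup>+s. rho s * indicator ?I s \<partial>lborel) * ennreal ((1/2) ^ DIM('n) * Nbox1_volume)" .
    have "(5 / T - 5/2 / T) * (5 / T) powr (- nu - 1) = 5/2 * 5 powr (- nu - 1) * T powr nu"
    proof -
      have "(5 / T) powr (- nu - 1) = 5 powr (- nu - 1) / T powr (- nu - 1)" by (rule powr_divide)
      also have "T powr (- nu - 1) = 1 / (T powr nu * T)"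
        using T powr_minus_divide[of T "nu + 1"] by (simp add: powr_add)
      finally have "(5 / T) powr (- nu - 1) = 5 powr (- nu - 1) * (T powr nu * T)" by simp
      moreover have "5 / T - 5/2 / T = 5/2 / T" by simp
      ultimately show ?thesis using T by simp
    qed
    moreover have "0 \<le> 5/2 / T" "5/2 / T < 5 / T" using T by (simp_all add: field_simps)
    note rho_interval_ge[OF this]
    ultimately have "ennreal (5/2 * 5 powr (- nu - 1) * T powr nu) \<le> (\<integral>\<^sup>+s. rho s * indicator ?I s \<partial>lborel)"
      by (simp only:)
    then have "ennreal (5/2 * 5 powr (- nu - 1) * T powr nu) * ennreal ((1/2) ^ DIM('n) * Nbox1_volume) \<le> emeasure mu (L j)"
      unfolding e by (rule mult_right_mono) simp
    moreover have "ennreal (5/2 * 5 powr (- nu - 1) * T powr nu) * ennreal ((1/2) ^ DIM('n) * Nbox1_volume) = ennreal (c3 * T powr nu)"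
    proof -
      have eq: "c3 * T powr nu = 5/2 * 5 powr (- nu - 1) * T powr nu * ((1/2) ^ DIM('n) * Nbox1_volume)" by (simp add: c3_def)
      show ?thesis unfolding eq using Nbox1_volume(2) by (subst ennreal_mult''[symmetric]) auto
    qed
    ultimately show ?thesis by simp
  qed
  have "ennreal (real (Suc m) * (c3 * T powr nu)) = (\<Sum>j\<le>m. ennreal (c3 * T powr nu))"
    using c3 by (simp add: ennreal_mult ennreal_of_nat_eq_real_of_nat del: of_nat_Suc)
  also have "\<dots> \<le> (\<Sum>j\<le>m. emeasure mu (L j))" by (intro sum_mono mL)
  also have "\<dots> = emeasure mu (\<Union>j\<le>m. L j)"
    using LB disj by (intro sum_emeasure) auto
  also have "\<dots> \<le> emeasure mu {x \<in> space mu. hlmax ?f x > ennreal 1}"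
    using LF sup by (intro emeasure_mono superlevel_sets) blast
  finally show ?thesis .
qed

text \<open>The test functions have height \<open>ht m\<close> growing like \<open>2\<^sup>m\<^sup>\<nu>\<close>, so the number \<open>m + 1\<close> of layers is
comparable with \<open>ln (ht m)\<close>, while \<open>\<Psi>(ht m)\<close> is eventually smaller than any given multiple of \<open>ht m ln (2 +
ht m)\<close>.\<close>

lemma LlogL_sharp:
  assumes \<Psi>: "young_function \<Psi>" and lim: "((\<lambda>t. \<Psi> t / Phi t) \<longlongrightarrow> 0) at_top" and C: "C > 0"
    and est: "\<forall>\<alpha>>0. \<forall>f\<in>borel_measurable mu. (\<integral>\<^sup>+x. ennreal (\<Psi> (\<bar>f x\<bar> / \<alpha>)) \<partial>mu) < \<infinity> \<longrightarrow>
       emeasure mu {x \<in> space mu. hlmax f x > ennreal \<alpha>} \<le> ennreal C * (\<integral>\<^sup>+x. ennreal (\<Psi> (\<bar>f x\<bar> / \<alpha>)) \<partial>mu)"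
  shows False
proof -
  obtain mE where mE: "emeasure mu lower_set = ennreal mE" "mE > 0" by (rule lower_set_measure)
  define C3 where "C3 = 2 ^ DIM('n) * Nbox1_volume / nu"
  define c3 where "c3 = 5/2 * 5 powr (- nu - 1) * ((1/2) ^ DIM('n) * Nbox1_volume)"
  define T where "T m = (10 * 2 ^ m :: real)" for m :: nat
  define ht where "ht m = 2 * C3 * T m powr nu / mE" for m
  have C3: "C3 > 0" using Nbox1_volume(2) nu_pos by (simp add: C3_def)
  have c3: "c3 > 0" using Nbox1_volume(2) by (simp add: c3_def)
  have T: "T m > 0" for m by (simp add: T_def)
  have lam: "ht m > 0" for m using C3 mE(2) T[of m] by (simp add: ht_def)
  have \<Psi>0: "\<Psi> 0 = 0" "\<And>t. t \<ge> 0 \<Longrightarrow> \<Psi> t \<ge> 0" using \<Psi> by (auto simp: young_function_def)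
  have key: "real (Suc m) * (c3 * T m powr nu) \<le> C * (\<Psi> (ht m) * mE)" for m
  proof -
    let ?f = "\<lambda>x. ht m * indicator lower_set x :: real"
    have fm: "?f \<in> borel_measurable mu" using lower_set_sets by measurable
    have int: "(\<integral>\<^sup>+x. ennreal (\<Psi> (\<bar>?f x\<bar> / 1)) \<partial>mu) = ennreal (\<Psi> (ht m) * mE)"
    proof -
      have "(\<integral>\<^sup>+x. ennreal (\<Psi> (\<bar>?f x\<bar> / 1)) \<partial>mu) = (\<integral>\<^sup>+x. ennreal (\<Psi> (ht m)) * indicator lower_set x \<partial>mu)"
        by (rule nn_integral_cong) (use lam[of m] \<Psi>0(1) in \<open>auto simp: indicator_def\<close>)
      also have "\<dots> = ennreal (\<Psi> (ht m)) * ennreal mE"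
        using lower_set_sets by (simp add: nn_integral_cmult_indicator mE)
      also have "\<dots> = ennreal (\<Psi> (ht m) * mE)" using \<Psi>0(2)[of "ht m"] lam[of m] mE(2) by (simp add: ennreal_mult)
      finally show ?thesis .
    qed
    have "ennreal (real (Suc m) * (c3 * T m powr nu)) \<le> emeasure mu {x \<in> space mu. hlmax ?f x > ennreal 1}"
      using superlevel_lower_bound[OF mE, of m] unfolding C3_def[symmetric] c3_def[symmetric] T_def[symmetric] ht_def[symmetric] .
    also have "\<dots> \<le> ennreal C * (\<integral>\<^sup>+x. ennreal (\<Psi> (\<bar>?f x\<bar> / 1)) \<partial>mu)"
      using est[rule_format, of 1 ?f] fm int by simp
    also have "\<dots> = ennreal (C * (\<Psi> (ht m) * mE))"
      unfolding int using C \<Psi>0(2)[of "ht m"] lam[of m] mE(2) by (simp add: ennreal_mult)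
    finally show ?thesis using C \<Psi>0(2)[of "ht m"] lam[of m] mE(2) by (subst (asm) ennreal_le_iff) auto
  qed
  define b where "b = 2 powr nu"
  have b: "b > 1" using nu_pos by (simp add: b_def)
  define L1 where "L1 = 2 * C3 / mE * 10 powr nu"
  have L1: "L1 > 0" using C3 mE(2) by (simp add: L1_def)
  have lam_eq: "ht m = L1 * b ^ m" for m
  proof -
    have "T m powr nu = 10 powr nu * (2 ^ m) powr nu" unfolding T_def by (rule powr_mult)
    also have "(2 ^ m :: real) powr nu = b ^ m"
      by (simp add: b_def powr_realpow[symmetric] powr_powr mult.commute)
    finally show ?thesis by (simp add: ht_def L1_def)
  qed
  define D where "D = ln (2 + L1) + ln b"
  have D: "D > 0" using L1 b by (simp add: D_def add_pos_pos)
  have lnl: "ln (2 + ht m) \<le> D * real (Suc m)" for m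
  proof -
    have "1 \<le> b ^ m" using b by (simp add: one_le_power)
    then have "2 + ht m \<le> (2 + L1) * b ^ m" unfolding lam_eq by (simp add: distrib_right)
    then have "ln (2 + ht m) \<le> ln ((2 + L1) * b ^ m)" using lam[of m] L1 b by (subst ln_le_cancel_iff) (auto simp: add_pos_pos)
    also have "\<dots> = ln (2 + L1) + real m * ln b" using L1 b by (simp add: ln_mult ln_realpow)
    also have "\<dots> \<le> D * real (Suc m)"
    proof -
      have "0 \<le> ln (2 + L1) * real m" "0 \<le> ln b" using L1 b by simp_all
      then show ?thesis by (simp add: D_def algebra_simps)
    qed
    finally show ?thesis .
  qed
  (* Small enough that the upper bound is half of the lower bound. *)
  define \<epsilon> where "\<epsilon> = c3 / (4 * C * C3 * D)"
  have \<epsilon>: "\<epsilon> > 0" using c3 C C3 D by (simp add: \<epsilon>_def)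
  have "eventually (\<lambda>t. dist (\<Psi> t / Phi t) 0 < \<epsilon>) at_top" using lim \<epsilon> by (rule tendstoD)
  then obtain t0 where t0: "\<And>t. t \<ge> t0 \<Longrightarrow> \<bar>\<Psi> t / Phi t\<bar> < \<epsilon>" by (auto simp: eventually_at_top_linorder)
  obtain m where m: "t0 / L1 < b ^ m" using real_arch_pow[OF b] by blast
  then have "ht m \<ge> t0" unfolding lam_eq using L1 by (simp add: field_simps)
  from t0[OF this] have "\<bar>\<Psi> (ht m) / Phi (ht m)\<bar> < \<epsilon>" .
  moreover have "Phi (ht m) > 0" using lam[of m] by (simp add: Phi_def)
  ultimately have "\<Psi> (ht m) \<le> \<epsilon> * Phi (ht m)" by (simp add: abs_less_iff field_simps)
  also have "\<dots> \<le> \<epsilon> * (ht m * (D * real (Suc m)))"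
    unfolding Phi_def using \<epsilon> lam[of m] lnl[of m] by (intro mult_left_mono) auto
  finally have "C * (\<Psi> (ht m) * mE) \<le> C * (\<epsilon> * (ht m * (D * real (Suc m))) * mE)"
    using C mE(2) by (intro mult_left_mono mult_right_mono) auto
  also have "\<dots> = (c3 * T m powr nu) * real (Suc m) / 2"
    using C C3 D mE(2) by (simp add: \<epsilon>_def ht_def del: of_nat_Suc)
  finally have "real (Suc m) * (c3 * T m powr nu) \<le> (c3 * T m powr nu) * real (Suc m) / 2" using key[of m] by linarith
  moreover have "(c3 * T m powr nu) * real (Suc m) > 0" using c3 T[of m] by simp
  ultimately show False by (simp only: mult.commute[of "real (Suc m)"])
qed

lemma id_over_Phi: "((\<lambda>t. t / Phi t) \<longlongrightarrow> 0) at_top"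
proof -
  have "filterlim (\<lambda>t::real. 2 + t) at_top at_top"
    by (intro filterlim_tendsto_add_at_top[OF tendsto_const] filterlim_ident)
  then have "filterlim (\<lambda>t::real. ln (2 + t)) at_top at_top" by (rule filterlim_compose[OF ln_at_top])
  then have "((\<lambda>t::real. inverse (ln (2 + t))) \<longlongrightarrow> 0) at_top" by (rule tendsto_inverse_0_at_top)
  moreover have "eventually (\<lambda>t::real. inverse (ln (2 + t)) = t / Phi t) at_top"
    using eventually_gt_at_top[of 0] by eventually_elim (simp add: Phi_def field_simps)
  ultimately show ?thesis by (rule Lim_transform_eventually)
qed

lemma young_id: "young_function (\<lambda>t. t)"
  by (auto simp: young_function_def convex_on_def mono_on_def intro: exI[of _ 1])

text \<open>Weak type (1,1) would be the estimate for the Young function \<open>t\<close>.\<close>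

lemma not_weak_type: "\<not> weak_type_1_1 mu hlmax"
proof
  assume "weak_type_1_1 mu hlmax"
  then obtain C where C: "C > 0" and w: "\<And>\<alpha> f. \<alpha> > 0 \<Longrightarrow> f \<in> borel_measurable mu \<Longrightarrow> (\<integral>\<^sup>+x. ennreal \<bar>f x\<bar> \<partial>mu) < \<infinity> \<Longrightarrow>
     emeasure mu {x \<in> space mu. hlmax f x > ennreal \<alpha>} \<le> ennreal (C / \<alpha>) * (\<integral>\<^sup>+x. ennreal \<bar>f x\<bar> \<partial>mu)"
    unfolding weak_type_1_1_def by blast
  show False
  proof (rule LlogL_sharp[OF young_id id_over_Phi C], intro allI impI ballI)
    fix \<alpha> :: real and f :: "'n \<times> real \<Rightarrow> real"
    assume \<alpha>: "\<alpha> > 0" and f: "f \<in> borel_measurable mu" and fin: "(\<integral>\<^sup>+x. ennreal (\<bar>f x\<bar> / \<alpha>) \<partial>mu) < \<infinity>"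
    have eq: "(\<integral>\<^sup>+x. ennreal \<bar>f x\<bar> \<partial>mu) = ennreal \<alpha> * (\<integral>\<^sup>+x. ennreal (\<bar>f x\<bar> / \<alpha>) \<partial>mu)"
    proof -
      have "(\<integral>\<^sup>+x. ennreal \<bar>f x\<bar> \<partial>mu) = (\<integral>\<^sup>+x. ennreal \<alpha> * ennreal (\<bar>f x\<bar> / \<alpha>) \<partial>mu)"
        using \<alpha> by (simp add: ennreal_mult[symmetric])
      then show ?thesis using f by (simp add: nn_integral_cmult)
    qed
    have "emeasure mu {x \<in> space mu. hlmax f x > ennreal \<alpha>} \<le> ennreal (C / \<alpha>) * (\<integral>\<^sup>+x. ennreal \<bar>f x\<bar> \<partial>mu)"
      using fin eq by (intro w \<alpha> f) (simp add: ennreal_mult_less_top)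
    also have "\<dots> = ennreal C * (\<integral>\<^sup>+x. ennreal (\<bar>f x\<bar> / \<alpha>) \<partial>mu)"
    proof -
      have "ennreal (C / \<alpha>) * ennreal \<alpha> = ennreal C" using C \<alpha> by (simp add: ennreal_mult[symmetric])
      then show ?thesis unfolding eq by (simp only: mult.assoc[symmetric])
    qed
    finally show "emeasure mu {x \<in> space mu. hlmax f x > ennreal \<alpha>} \<le> ennreal C * (\<integral>\<^sup>+x. ennreal (\<bar>f x\<bar> / \<alpha>) \<partial>mu)" .
  qed
qed

end

theorem theorem1p1:
  fixes V Z :: "'n::euclidean_space set" and br :: "'n \<Rightarrow> 'n \<Rightarrow> 'n"
  assumes "damek_ricci V Z br"
  shows
    "let \<mu> = damek_ricci.mu V Z;
         N = maximal_op \<mu> (damek_ricci.half_balls V Z br)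
     in
       (\<exists>C>0. \<forall>\<alpha>>0. \<forall>f\<in>borel_measurable \<mu>.
          (\<integral>\<^sup>+x. ennreal (Phi (\<bar>f x\<bar> / \<alpha>)) \<partial>\<mu>) < \<infinity> \<longrightarrow>
          {x \<in> space \<mu>. N f x > ennreal \<alpha>} \<in> sets \<mu> \<and>
          emeasure \<mu> {x \<in> space \<mu>. N f x > ennreal \<alpha>}
            \<le> ennreal C * (\<integral>\<^sup>+x. ennreal (Phi (\<bar>f x\<bar> / \<alpha>)) \<partial>\<mu>))
     \<and> (\<forall>p>1. bounded_on_Lp \<mu> p N)
     \<and> (\<forall>\<Psi>. young_function \<Psi> \<and> ((\<lambda>t. \<Psi> t / Phi t) \<longlongrightarrow> 0) at_top \<longrightarrow>
          \<not> (\<exists>C>0. \<forall>\<alpha>>0. \<forall>f\<in>borel_measurable \<mu>.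
               (\<integral>\<^sup>+x. ennreal (\<Psi> (\<bar>f x\<bar> / \<alpha>)) \<partial>\<mu>) < \<infinity> \<longrightarrow>
               emeasure \<mu> {x \<in> space \<mu>. N f x > ennreal \<alpha>}
                 \<le> ennreal C * (\<integral>\<^sup>+x. ennreal (\<Psi> (\<bar>f x\<bar> / \<alpha>)) \<partial>\<mu>)))
     \<and> \<not> weak_type_1_1 \<mu> N"
proof -
  interpret damek_ricci V Z br by fact
  have "\<exists>C>0. \<forall>\<alpha>>0. \<forall>f\<in>borel_measurable mu.
          (\<integral>\<^sup>+x. ennreal (Phi (\<bar>f x\<bar> / \<alpha>)) \<partial>mu) < \<infinity> \<longrightarrow>
          {x \<in> space mu. hlmax f x > ennreal \<alpha>} \<in> sets mu \<and>
          emeasure mu {x \<in> space mu. hlmax f x > ennreal \<alpha>}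
            \<le> ennreal C * (\<integral>\<^sup>+x. ennreal (Phi (\<bar>f x\<bar> / \<alpha>)) \<partial>mu)"
    using LlogL_estimate superlevel_sets by blast
  moreover have "\<forall>p>1. bounded_on_Lp mu p hlmax" using hlmax_bounded_on_Lp by blast
  moreover have "\<forall>\<Psi>. young_function \<Psi> \<and> ((\<lambda>t. \<Psi> t / Phi t) \<longlongrightarrow> 0) at_top \<longrightarrow>
          \<not> (\<exists>C>0. \<forall>\<alpha>>0. \<forall>f\<in>borel_measurable mu.
               (\<integral>\<^sup>+x. ennreal (\<Psi> (\<bar>f x\<bar> / \<alpha>)) \<partial>mu) < \<infinity> \<longrightarrow>
               emeasure mu {x \<in> space mu. hlmax f x > ennreal \<alpha>}
                 \<le> ennreal C * (\<integral>\<^sup>+x. ennreal (\<Psi> (\<bar>f x\<bar> / \<alpha>)) \<partial>mu))"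
  proof (intro allI impI notI)
    fix \<Psi> :: "real \<Rightarrow> real"
    assume \<Psi>: "young_function \<Psi> \<and> ((\<lambda>t. \<Psi> t / Phi t) \<longlongrightarrow> 0) at_top"
    assume "\<exists>C>0. \<forall>\<alpha>>0. \<forall>f\<in>borel_measurable mu.
               (\<integral>\<^sup>+x. ennreal (\<Psi> (\<bar>f x\<bar> / \<alpha>)) \<partial>mu) < \<infinity> \<longrightarrow>
               emeasure mu {x \<in> space mu. hlmax f x > ennreal \<alpha>}
                 \<le> ennreal C * (\<integral>\<^sup>+x. ennreal (\<Psi> (\<bar>f x\<bar> / \<alpha>)) \<partial>mu)"
    then obtain C where "C > 0" "\<forall>\<alpha>>0. \<forall>f\<in>borel_measurable mu.
               (\<integral>\<^sup>+x. ennreal (\<Psi> (\<bar>f x\<bar> / \<alpha>)) \<partial>mu) < \<infinity> \<longrightarrow>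
               emeasure mu {x \<in> space mu. hlmax f x > ennreal \<alpha>}
                 \<le> ennreal C * (\<integral>\<^sup>+x. ennreal (\<Psi> (\<bar>f x\<bar> / \<alpha>)) \<partial>mu)" by blast
    then show False using LlogL_sharp \<Psi> by blast
  qed
  ultimately show ?thesis unfolding Let_def using not_weak_type by blast
qed

end
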